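(* Assume condition (A): there exist $C_A,\gamma_A>0$ and, for all $x,y\in E$, a Markovian coupling $\mathbb{P}_{(x,y)}$ between $\mathbb{P}_x$ and $\mathbb{P}_y$ such that for all $t\in I$, $\mathbb{E}_{(x,y)}[G^X_t\, d(X_t,Y_t)]\le C_A e^{-\gamma_A t}d(x,y)$. Let $\alpha,\kappa,\beta,C_0$ be the constants and $\eta,\lambda_0,\nu_{QS}$ the objects defined in the context. Then the following hold. (i) (Existence of the $Q$-process.) There exists a family $(\mathbb{Q}_x)_{x\in E}$ of probability measures on $\Omega$ such that, for some constant $C$, $$\left|\frac{\mathbb{E}_x(\mathbf 1_AZ_t)}{\mathbb{E}_xZ_t}-\mathbb{Q}_x(A)\right|\le Ce^{-\alpha(t-s)}$$ for all $x\in E$, all $s\le t\in I$ and all $\mathcal F_s$-measurable sets $A$. The process $(\Omega,(\mathcal F_t)_{t\in I},(X_t)_{t\in I},(\mathbb{Q}_x)_{x\in E})$ is an $E$-valued homogeneous Markov process. In addition, if $(X_t)_{t\in I}$ is a strong Markov process under $(\mathbb{P}_x)_{x\in E}$, then so is $(X_t)_{t\in I}$ under $(\mathbb{Q}_x)_{x\in E}$. (ii) (Transition semigroup.) The semigroup $(\widetilde P_t)_{t\in I}$ of the Markov process $(X_t)_{t\in I}$ under $(\mathbb{Q}_x)_{x\in E}$ is given by $$\widetilde P_t\varphi(x)=\frac{e^{\lambda_0t}}{\eta(x)}P_t(\eta\varphi)(x)$$ for all bounded measurable $\varphi$, $x\in E$ and $t\in I$. (iii) (Exponential ergodicity in Wasserstein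 distance.) The probability measure $\nu_Q$ on $E$ defined by $\nu_Q(dx)=\eta(x)\nu_{QS}(dx)$ is the unique invariant distribution of $(X_t)_{t\in I}$ under $(\mathbb{Q}_x)_{x\in E}$. In addition, for any probability measures $\mu,\nu$ on $E$ and all $t\in I$, $$\mathcal{W}_d\left(\mathbb{Q}_\mu(X_t\in\cdot),\mathbb{Q}_\nu(X_t\in\cdot)\right)\le\frac{C_0\,(1\vee(\kappa\bar d))}{\beta}\,e^{-\alpha t}\,\mathcal{W}_d(\mu,\nu),$$ where $\mathbb{Q}_\mu=\int_E\mathbb{Q}_x\,\mu(dx)$.
   Context: Setting. $(E,d)$ is a Polish space whose distance satisfies $d\le\bar d$ on $E\times E$ for a finite constant $\bar d$. $\mathcal{W}_d(\mu,\nu)=\inf_{\pi}\iint d(x,y)\,\pi(dx,dy)$ (infimum over couplings $\pi$ of $\mu,\nu$). The time set $I$ is either $[0,+\infty)$ or $\mathbb{Z}_+$. $(\Omega,(\mathcal F_t)_{t\in I},(\mathbb{P}_x)_{x\in E},(X_t)_{t\in I})$ is a time-homogeneous Markov process in $E$ with $\mathbb{P}_x(X_0=x)=1$; $\mathbb{E}_x$ is the expectation under $\mathbb{P}_x$. The function $\rho:E\to\mathbb{R}_+$ is $d$-Lipschitz. The penalization is $Z_t=Z_t(X)=e^{-\int_0^t\rho(X_s)ds}$ if $I=[0,+\infty)$ (the integral being assumed well defined), and $Z_t=Z_t(X)=p(X_0)p(X_1)\cdots p(X_{t-1})$ with $p=e^{-\rho}$ (and $Z_0=1$) if $I=\mathbb{Z}_+$.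 The penalized semigroup is $P_tf(x)=\mathbb{E}_x[Z_tf(X_t)]$ for bounded measurable $f$, and $\mu P_tf=\int_E P_tf(x)\,\mu(dx)$. Couplings. A coupling measure between $\mathbb{P}_x$ and $\mathbb{P}_y$ is a probability measure $\mathbb{P}_{(x,y)}$ on a space carrying $(X_t,Y_t)_{t\in I}$ such that $(X_t)$ has the law of $X$ under $\mathbb{P}_x$ and $(Y_t)$ the law of $X$ under $\mathbb{P}_y$. It is Markovian if $(X_t,Y_t)_{t\in I}$ is Markov with respect to its natural filtration; the couplings are understood as a family $(\mathbb{P}_{(x,y)})_{x,y\in E}$ of laws of a time-homogeneous Markov process on $E\times E$ started from $(x,y)$ (conditionally on the past up to time $t$, the process shifted by $t$ has law $\mathbb{P}_{(X_t,Y_t)}$). Write $Z^X_t=Z_t(X)$, $Z^Y_t=Z_t(Y)$, $G^X_t=Z^X_t/\mathbb{E}_xZ_t$, $G^Y_t=Z^Y_t/\mathbb{E}_yZ_t$. Quasi-stationary objects. A quasi-stationary distribution is a probability measure $\nu$ with $\frac{\nu P_t}{\nu P_t\mathbf 1}=\nu$ for all $t\in I$; its absorption rate is the number $\lambda_0\ge0$ with $\nu P_t=e^{-\lambda_0t}\nu$ for all $t\in I$. Under (A) there is a unique quasi-stationary distribution $\nu_{QS}$; $\lambda_0$ denotes its absorption rate, and $\eta(x)=\lim_{t\to\infty}e^{\lambda_0t}\mathbb{E}_xZ_t$ (the limit exists, uniformly in $x$, and $\eta$ is $d$-Lipschitz, bounded away from $0$, with $\nu_{QS}(\eta)=1$ and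 $P_t\eta=e^{-\lambda_0t}\eta$). Constants. Under (A), there exist constants $C_B>0$ and $C_C>1$ such that the couplings of (A) also satisfy, for all $x,y\in E$ and $t\in I$, $\mathbb{E}_{(x,y)}|Z^X_t-Z^Y_t|\le C_B\,d(x,y)\,\mathbb{E}_xZ_t$ and $\mathbb{E}_{(x,y)}[G^X_t\wedge G^Y_t]\ge1/C_C$. Fix such constants and set $\gamma(t)=C_Ae^{-\gamma_At}$, $\beta=1-\frac1{2C_C}$, $\kappa=\frac{C_B}{\beta-1/2}$. Let $t_1$ be the smallest element of $I$ such that $\gamma(t)\le\frac1{2(1+C_B\bar d)}$ for all $t\ge t_1$, let $t_2$ be the smallest element of $I$ such that $\gamma(t)\le\frac1{2\kappa(1+C_B\bar d)\bar d\,C_C}$ for all $t\ge t_2$, and set $t_0=t_1\vee t_2$, $\alpha=\frac{\log(1/\beta)}{t_0}$, and $$C_0=\left(\tfrac12\left(1-\tfrac1{C_C}\right)+(1+C_B\bar d)\,C_A\right)\vee\left(1-\tfrac1{C_C}+\frac{2C_B\bar d\,(1+C_B\bar d)}{1-1/C_C}\,C_A\right).$$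
   Formalization: Adds the assumption that every consistent family of probability measures on the F_t extends to the sigma-algebra generated by all F_t (true on canonical path spaces); without it the measures Q_x in (i) may fail to exist on Ω. *)

theory Defs
  imports "HOL-Probability.Probability"
begin

section \<open>Filtered spaces and Markov processes indexed by a time set of reals\<close>

text \<open>The time set \<open>I\<close> is a set of reals, either \<open>{0..}\<close> or \<open>\<nat>\<close>. Filtrations and processes
  are functions of a real time, of which only the values at times in \<open>I\<close> matter.
  A \<open>\<sigma>\<close>-algebra is represented by a measure of which only the space and the measurable sets
  matter.\<close>

definition filtration_on :: "real set \<Rightarrow> 'w set \<Rightarrow> (real \<Rightarrow> 'w measure) \<Rightarrow> bool" where
  "filtration_on I \<Omega> F \<longleftrightarrow>
     (\<forall>t\<in>I. space (F t) = \<Omega>) \<and>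
     (\<forall>s\<in>I. \<forall>t\<in>I. s \<le> t \<longrightarrow> sets (F s) \<subseteq> sets (F t))"

definition filtration_sup :: "real set \<Rightarrow> 'w set \<Rightarrow> (real \<Rightarrow> 'w measure) \<Rightarrow> 'w measure" where
  "filtration_sup I \<Omega> F = sigma \<Omega> (\<Union>t\<in>I. sets (F t))"

definition natural_filtration ::
    "real set \<Rightarrow> 'w set \<Rightarrow> (real \<Rightarrow> 'w \<Rightarrow> 'e::topological_space) \<Rightarrow> real \<Rightarrow> 'w measure" where
  "natural_filtration I \<Omega> X t =
     sigma \<Omega> {X s -` B \<inter> \<Omega> | s B. s \<in> I \<and> s \<le> t \<and> B \<in> sets borel}"

text \<open>The probability measures \<open>P x\<close> live on the \<open>\<sigma>\<close>-algebra generated by the whole filtration.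
  The last clause is the Markov property: given the past up to time \<open>s\<close>, the process shifted
  by \<open>s\<close> has law \<open>P (X s)\<close>, as a random element of the product space over \<open>I\<close>.\<close>

definition markov_process ::
    "real set \<Rightarrow> 'w set \<Rightarrow> (real \<Rightarrow> 'w measure) \<Rightarrow> (real \<Rightarrow> 'w \<Rightarrow> 'e::topological_space) \<Rightarrow>
     ('e \<Rightarrow> 'w measure) \<Rightarrow> bool" where
  "markov_process I \<Omega> F X P \<longleftrightarrow>
     filtration_on I \<Omega> F \<and>
     (\<forall>t\<in>I. X t \<in> F t \<rightarrow>\<^sub>M borel) \<and>
     P \<in> borel \<rightarrow>\<^sub>M prob_algebra (filtration_sup I \<Omega> F) \<and>
     (\<forall>x. AE \<omega> in P x. X 0 \<omega> = x) \<and>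
     (\<forall>x. \<forall>s\<in>I. \<forall>B\<in>sets (PiM I (\<lambda>_. borel)). AE \<omega> in P x.
        real_cond_exp (P x) (F s) (indicator {\<omega>\<in>\<Omega>. (\<lambda>u\<in>I. X (s + u) \<omega>) \<in> B}) \<omega> =
        measure (P (X s \<omega>)) {\<omega>'\<in>\<Omega>. (\<lambda>u\<in>I. X u \<omega>') \<in> B})"

definition progressively_measurable ::
    "real set \<Rightarrow> (real \<Rightarrow> 'w measure) \<Rightarrow> (real \<Rightarrow> 'w \<Rightarrow> 'e::topological_space) \<Rightarrow> bool" where
  "progressively_measurable I F Y \<longleftrightarrow>
     (\<forall>t\<in>I. (\<lambda>(s, \<omega>). Y s \<omega>) \<in> restrict_space borel (I \<inter> {..t}) \<Otimes>\<^sub>M F t \<rightarrow>\<^sub>M borel)"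

definition stopping_time_on ::
    "real set \<Rightarrow> 'w set \<Rightarrow> (real \<Rightarrow> 'w measure) \<Rightarrow> ('w \<Rightarrow> ereal) \<Rightarrow> bool" where
  "stopping_time_on I \<Omega> F \<tau> \<longleftrightarrow>
     (\<forall>\<omega>\<in>\<Omega>. \<tau> \<omega> \<in> ereal ` I \<union> {\<infinity>}) \<and>
     (\<forall>t\<in>I. {\<omega>\<in>\<Omega>. \<tau> \<omega> \<le> ereal t} \<in> sets (F t))"

definition stopped_sigma ::
    "real set \<Rightarrow> 'w set \<Rightarrow> (real \<Rightarrow> 'w measure) \<Rightarrow> ('w \<Rightarrow> ereal) \<Rightarrow> 'w measure" where
  "stopped_sigma I \<Omega> F \<tau> =
     sigma \<Omega> {A \<in> sets (filtration_sup I \<Omega> F). \<forall>t\<in>I. A \<inter> {\<omega>\<in>\<Omega>. \<tau> \<omega> \<le> ereal t} \<in> sets (F t)}"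

text \<open>Progressive measurability is part of the definition of a strong Markov process: it makes the
  position at a finite stopping time measurable. In discrete time it follows from adaptedness.\<close>

definition strong_markov_process ::
    "real set \<Rightarrow> 'w set \<Rightarrow> (real \<Rightarrow> 'w measure) \<Rightarrow> (real \<Rightarrow> 'w \<Rightarrow> 'e::topological_space) \<Rightarrow>
     ('e \<Rightarrow> 'w measure) \<Rightarrow> bool" where
  "strong_markov_process I \<Omega> F X P \<longleftrightarrow>
     markov_process I \<Omega> F X P \<and>
     progressively_measurable I F X \<and>
     (\<forall>x \<tau>. stopping_time_on I \<Omega> F \<tau> \<longrightarrow>
        (\<forall>B\<in>sets (PiM I (\<lambda>_. borel)). AE \<omega> in P x. \<tau> \<omega> < \<infinity> \<longrightarrow>
           real_cond_exp (P x) (stopped_sigma I \<Omega> F \<tau>)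
             (indicator {\<omega>\<in>\<Omega>. \<tau> \<omega> < \<infinity> \<and> (\<lambda>u\<in>I. X (real_of_ereal (\<tau> \<omega>) + u) \<omega>) \<in> B}) \<omega> =
           measure (P (X (real_of_ereal (\<tau> \<omega>)) \<omega>)) {\<omega>'\<in>\<Omega>. (\<lambda>u\<in>I. X u \<omega>') \<in> B}))"

text \<open>A property of the filtered space alone: a projective family of probability measures on the
  \<open>\<sigma>\<close>-algebras \<open>F t\<close> has a projective limit. It holds for the canonical path spaces with their
  natural filtrations (sequences, continuous paths, or right-continuous paths with left limits, in
  a Polish space). It is what allows a law to be defined on \<open>\<Omega>\<close> by a change of measure on each
  \<open>F t\<close>, and it fails, for instance, once a tail event that has probability zero under the
  original laws but not under the new ones is removed from the space of sequences.\<close>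

definition projective_limits_exist ::
    "real set \<Rightarrow> 'w set \<Rightarrow> (real \<Rightarrow> 'w measure) \<Rightarrow> bool" where
  "projective_limits_exist I \<Omega> F \<longleftrightarrow>
     (\<forall>R :: real \<Rightarrow> 'w measure.
        (\<forall>t\<in>I. prob_space (R t) \<and> sets (R t) = sets (F t)) \<and>
        (\<forall>s\<in>I. \<forall>t\<in>I. s \<le> t \<longrightarrow> (\<forall>A\<in>sets (F s). emeasure (R t) A = emeasure (R s) A)) \<longrightarrow>
        (\<exists>Q. prob_space Q \<and> sets Q = sets (filtration_sup I \<Omega> F) \<and>
             (\<forall>t\<in>I. \<forall>A\<in>sets (F t). emeasure Q A = emeasure (R t) A)))"

text \<open>Markovian couplings: \<open>PP (x, y)\<close> is the law, on an auxiliary space \<open>\<Omega>'\<close>, of the homogeneous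
  Markov process \<open>(X', Y')\<close> started from \<open>(x, y)\<close>, for its natural filtration.\<close>

definition markovian_coupling ::
    "real set \<Rightarrow> (real \<Rightarrow> 'w \<Rightarrow> 'e::topological_space) \<Rightarrow> ('e \<Rightarrow> 'w measure) \<Rightarrow>
     'v set \<Rightarrow> (real \<Rightarrow> 'v \<Rightarrow> 'e) \<Rightarrow> (real \<Rightarrow> 'v \<Rightarrow> 'e) \<Rightarrow> ('e \<times> 'e \<Rightarrow> 'v measure) \<Rightarrow> bool" where
  "markovian_coupling I X P \<Omega>' X' Y' PP \<longleftrightarrow>
     markov_process I \<Omega>' (natural_filtration I \<Omega>' (\<lambda>t \<omega>. (X' t \<omega>, Y' t \<omega>)))
       (\<lambda>t \<omega>. (X' t \<omega>, Y' t \<omega>)) PP \<and>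
     (\<forall>x y.
        distr (PP (x, y)) (PiM I (\<lambda>_. borel)) (\<lambda>\<omega>. \<lambda>t\<in>I. X' t \<omega>) =
        distr (P x) (PiM I (\<lambda>_. borel)) (\<lambda>\<omega>. \<lambda>t\<in>I. X t \<omega>) \<and>
        distr (PP (x, y)) (PiM I (\<lambda>_. borel)) (\<lambda>\<omega>. \<lambda>t\<in>I. Y' t \<omega>) =
        distr (P y) (PiM I (\<lambda>_. borel)) (\<lambda>\<omega>. \<lambda>t\<in>I. X t \<omega>))"

section \<open>Penalization\<close>

definition penal ::
    "real set \<Rightarrow> ('e \<Rightarrow> real) \<Rightarrow> (real \<Rightarrow> 'w \<Rightarrow> 'e) \<Rightarrow> real \<Rightarrow> 'w \<Rightarrow> real" where
  "penal I \<rho> X t \<omega> =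
     (if I = {0..} then exp (- (LINT s:{0..t}|lborel. \<rho> (X s \<omega>)))
      else (\<Prod>k<nat \<lfloor>t\<rfloor>. exp (- \<rho> (X (real k) \<omega>))))"

definition penal_mean ::
    "real set \<Rightarrow> ('e \<Rightarrow> real) \<Rightarrow> (real \<Rightarrow> 'w \<Rightarrow> 'e) \<Rightarrow> ('e \<Rightarrow> 'w measure) \<Rightarrow> real \<Rightarrow> 'e \<Rightarrow> real" where
  "penal_mean I \<rho> X P t x = (\<integral>\<omega>. penal I \<rho> X t \<omega> \<partial>P x)"

definition penal_semigroup ::
    "real set \<Rightarrow> ('e \<Rightarrow> real) \<Rightarrow> (real \<Rightarrow> 'w \<Rightarrow> 'e) \<Rightarrow> ('e \<Rightarrow> 'w measure) \<Rightarrow>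
     real \<Rightarrow> ('e \<Rightarrow> real) \<Rightarrow> 'e \<Rightarrow> real" where
  "penal_semigroup I \<rho> X P t f x = (\<integral>\<omega>. penal I \<rho> X t \<omega> * f (X t \<omega>) \<partial>P x)"

definition bounded_measurable :: "('e::topological_space \<Rightarrow> real) \<Rightarrow> bool" where
  "bounded_measurable f \<longleftrightarrow> f \<in> borel_measurable borel \<and> bounded (range f)"

definition prob_on_borel :: "'e::topological_space measure \<Rightarrow> bool" where
  "prob_on_borel \<mu> \<longleftrightarrow> prob_space \<mu> \<and> sets \<mu> = sets borel"

text \<open>Identities between finite measures are expressed by testing bounded measurable functions.\<close>

definition quasi_stationary ::
    "real set \<Rightarrow> ('e::topological_space \<Rightarrow> real) \<Rightarrow> (real \<Rightarrow> 'w \<Rightarrow> 'e) \<Rightarrow> ('e \<Rightarrow> 'w measure) \<Rightarrow>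
     'e measure \<Rightarrow> bool" where
  "quasi_stationary I \<rho> X P \<nu> \<longleftrightarrow>
     prob_on_borel \<nu> \<and>
     (\<forall>t\<in>I. \<forall>f. bounded_measurable f \<longrightarrow>
        (\<integral>x. penal_semigroup I \<rho> X P t f x \<partial>\<nu>) /
          (\<integral>x. penal_semigroup I \<rho> X P t (\<lambda>_. 1) x \<partial>\<nu>) = (\<integral>x. f x \<partial>\<nu>))"

definition absorption_rate ::
    "real set \<Rightarrow> ('e::topological_space \<Rightarrow> real) \<Rightarrow> (real \<Rightarrow> 'w \<Rightarrow> 'e) \<Rightarrow> ('e \<Rightarrow> 'w measure) \<Rightarrow>
     'e measure \<Rightarrow> real \<Rightarrow> bool" where
  "absorption_rate I \<rho> X P \<nu> l \<longleftrightarrow>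
     0 \<le> l \<and>
     (\<forall>t\<in>I. \<forall>f. bounded_measurable f \<longrightarrow>
        (\<integral>x. penal_semigroup I \<rho> X P t f x \<partial>\<nu>) = exp (- l * t) * (\<integral>x. f x \<partial>\<nu>))"

section \<open>Wasserstein distance and invariant distributions\<close>

definition couplings :: "'e::topological_space measure \<Rightarrow> 'e measure \<Rightarrow> ('e \<times> 'e) measure set" where
  "couplings \<mu> \<nu> = {\<pi>. sets \<pi> = sets (borel \<Otimes>\<^sub>M borel) \<and> distr \<pi> borel fst = \<mu> \<and> distr \<pi> borel snd = \<nu>}"

definition wasserstein :: "'e::metric_space measure \<Rightarrow> 'e measure \<Rightarrow> real" where
  "wasserstein \<mu> \<nu> = (INF \<pi>\<in>couplings \<mu> \<nu>. (\<integral>z. dist (fst z) (snd z) \<partial>\<pi>))"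

definition law_at ::
    "(real \<Rightarrow> 'w \<Rightarrow> 'e::topological_space) \<Rightarrow> ('e \<Rightarrow> 'w measure) \<Rightarrow> 'e measure \<Rightarrow> real \<Rightarrow> 'e measure" where
  "law_at X Q \<mu> t = distr (\<mu> \<bind> Q) borel (X t)"

definition invariant_distribution ::
    "real set \<Rightarrow> (real \<Rightarrow> 'w \<Rightarrow> 'e::topological_space) \<Rightarrow> ('e \<Rightarrow> 'w measure) \<Rightarrow> 'e measure \<Rightarrow> bool" where
  "invariant_distribution I X Q \<mu> \<longleftrightarrow> prob_on_borel \<mu> \<and> (\<forall>t\<in>I. law_at X Q \<mu> t = \<mu>)"

section \<open>Constants\<close>

definition decay :: "real \<Rightarrow> real \<Rightarrow> real \<Rightarrow> real" where
  "decay CA gA t = CA * exp (- gA * t)"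

definition first_time_below :: "real set \<Rightarrow> (real \<Rightarrow> real) \<Rightarrow> real \<Rightarrow> real" where
  "first_time_below I g c = (LEAST s. s \<in> I \<and> (\<forall>t\<in>I. s \<le> t \<longrightarrow> g t \<le> c))"

definition const_beta :: "real \<Rightarrow> real" where
  "const_beta CC = 1 - 1 / (2 * CC)"

definition const_kappa :: "real \<Rightarrow> real \<Rightarrow> real" where
  "const_kappa CB CC = CB / (const_beta CC - 1/2)"

text \<open>If the bound \<open>D\<close> is \<open>0\<close>, then \<open>E\<close> is a single point and the second threshold
  below, which should be infinite, is \<open>0\<close> by the convention for division by zero. The rate
  is irrelevant in this case.\<close>

definition const_t0 :: "real set \<Rightarrow> real \<Rightarrow> real \<Rightarrow> real \<Rightarrow> real \<Rightarrow> real \<Rightarrow> real" where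
  "const_t0 I D CA gA CB CC =
     max (first_time_below I (decay CA gA) (1 / (2 * (1 + CB * D))))
         (first_time_below I (decay CA gA) (1 / (2 * const_kappa CB CC * (1 + CB * D) * D * CC)))"

definition const_alpha :: "real set \<Rightarrow> real \<Rightarrow> real \<Rightarrow> real \<Rightarrow> real \<Rightarrow> real \<Rightarrow> real" where
  "const_alpha I D CA gA CB CC = ln (1 / const_beta CC) / const_t0 I D CA gA CB CC"

definition const_C0 :: "real \<Rightarrow> real \<Rightarrow> real \<Rightarrow> real \<Rightarrow> real" where
  "const_C0 D CA CB CC =
     max (1/2 * (1 - 1 / CC) + (1 + CB * D) * CA)
         (1 - 1 / CC + 2 * CB * D * (1 + CB * D) / (1 - 1 / CC) * CA)"

end

theory Submission
  imports Defs
begin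

text \<open>The penalized expectations \<open>E\<^sub>x Z\<^sub>t\<close> are comparable for all starting points, because the coupling gives
  \<open>\<bar>E\<^sub>x Z\<^sub>t - E\<^sub>y Z\<^sub>t\<bar> \<le> CB d(x, y) E\<^sub>x Z\<^sub>t\<close>. Averaged against the quasi-stationary distribution, this
  bounds \<open>exp (l0 t) E\<^sub>x Z\<^sub>t\<close> between \<open>1 / (1 + CB D)\<close> and \<open>1 + CB D\<close>, and the bounds pass to its limit \<open>\<eta>\<close>,
  which is an eigenfunction of the penalized semigroup. The process \<open>exp (l0 t) Z\<^sub>t \<eta> (X\<^sub>t) / \<eta> x\<close> is then
  a martingale with expectation one under \<open>P x\<close>, and \<open>Q x\<close> is the law that has it as density on the
  events before each time \<open>t\<close>; the consistent family of these laws has a projective limit.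

  \<^bold>\<open>The Markov property.\<close> The Markov property of \<open>P\<close> speaks of the product \<open>\<sigma>\<close>-algebra on the paths, and
  in continuous time the penalization is not measurable with respect to it. However, it depends on the path
  through the integral of the bounded function \<open>\<rho>\<close>. The moments of this integral are, by Fubini, integrals of
  finite-dimensional expectations, and the moments of a bounded variable determine its Laplace transform.
  Therefore two processes with the same law of paths also have the same penalized law
  (\<open>penalized_path_law_eq\<close>), the penalized law regenerates at the same times as \<open>P\<close> (\<open>penalized_markov\<close>), and
  \<open>Q\<close> is Markov (\<open>Q_markov\<close>).

  \<^bold>\<open>The strong Markov property.\<close> The paths have no regularity, so a stopping time cannot be approximated by
  discrete ones in order to stop the density martingale. Instead, the martingale is integrated over a window of
  time of length \<open>L\<close>. The expectation of the integral over a window that starts at the bounded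
  stopping time and over one that starts at a deterministic later time are both linear in \<open>L\<close>, and their
  difference stays bounded, so their slopes agree (\<open>Q_stopped_regeneration\<close>).

  \<^bold>\<open>Contraction.\<close> The penalized coupling carries two densities, those of \<open>Q x\<close> and \<open>Q y\<close> with respect to the
  two marginals. A coupling of \<open>Q x\<close> and \<open>Q y\<close> at time \<open>t\<close> keeps the pair with the minimum of the
  densities and makes the remaining masses independent (\<open>overlap_coupling\<close>). The minimum has mass at least
  \<open>max (1 / CC) (1 - CB d(x, y))\<close>: this holds for the densities \<open>Z\<^sub>T / E Z\<^sub>T\<close> at a finite horizon \<open>T\<close>,
  taking conditional expectations given the past up to \<open>t\<close> only increases the mass of the minimum, and
  \<open>T\<close> tends to infinity (\<open>overlap_projected\<close>, \<open>overlap_limit\<close>). Condition (A) makes the distance on the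
  common part small. Hence one step multiplies the mean distance by at most \<open>C0\<close> (\<open>bounded_step\<close>),
  while a step of length \<open>t0\<close> multiplies the mean of the truncated distance \<open>min 1 (\<kappa> d)\<close> by at most
  \<open>\<beta>\<close> (\<open>contracting_step\<close>): points at distance less than \<open>1 / \<kappa>\<close> profit from the overlap close to one and distant
  points from the overlap \<open>1 / CC\<close>. The two kinds of steps together give \<open>wasserstein_contraction\<close>.

  \<^bold>\<open>Consequences.\<close> The semigroup of \<open>Q\<close> reduces the oscillation of Lipschitz functions exponentially fast. For the
  function \<open>1 / \<eta>\<close>, whose image under the semigroup is \<open>exp (l0 u) E\<^sub>x Z\<^sub>u / \<eta> x\<close>, this says that the
  conditioned laws converge to \<open>Q x\<close> (\<open>conditioned_law_convergence\<close>). For bounded Lipschitz functions in general,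
  it says that two invariant distributions agree (\<open>invariant_unique\<close>).\<close>

section \<open>The clock that drives the penalization\<close>

text \<open>The measure against which the penalization integrates \<open>\<rho>\<close>: with it, \<open>Z\<close> is the exponential of
  \<open>- \<integral> \<rho>\<close> over \<open>{..<t}\<close> for both kinds of time.\<close>

definition clock :: "real set \<Rightarrow> real measure" where
  "clock I = (if I = {0..} then restrict_space lborel {0..} else count_space I)"

lemma Nats_neq_atLeast: "(\<nat> :: real set) \<noteq> {0..}"
proof
  assume eq: "(\<nat> :: real set) = {0..}"
  have "(1/2 :: real) \<in> \<nat>" unfolding eq by simp
  then obtain n :: nat where "(1/2 :: real) = real n" by (rule Nats_cases)
  then have "real (2 * n) = real 1" by linarith
  then have "2 * n = 1" by (simp only: of_nat_eq_iff)
  then show False by presburger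
qed

lemma Nats_real_eq: "(\<nat> :: real set) = range real"
  by (auto simp: Nats_def)

lemma clock_Nats: "clock \<nat> = count_space \<nat>"
  using Nats_neq_atLeast by (simp add: clock_def)

lemma clock_atLeast: "clock {0..} = restrict_space lborel {0..}"
  by (simp add: clock_def)

lemma countable_Nats_real: "countable (\<nat> :: real set)"
  by (simp add: Nats_def)

locale time_set =
  fixes I :: "real set"
  assumes time: "I = {0..} \<or> I = \<nat>"
begin

lemma time_cases [consumes 0, case_names continuous discrete]:
  assumes "I = {0..} \<Longrightarrow> thesis" "I = \<nat> \<Longrightarrow> thesis" shows thesis
  using time assms by blast

lemma zero_in_time [simp]: "0 \<in> I"
  and one_in_time [simp]: "1 \<in> I"
  and time_nonneg: "t \<in> I \<Longrightarrow> 0 \<le> t"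
  and time_real [simp]: "real n \<in> I"
  using time by (auto simp: Nats_def)

lemma time_add [simp]: "s \<in> I \<Longrightarrow> t \<in> I \<Longrightarrow> s + t \<in> I"
  using time by auto

lemma time_diff [simp]:
  assumes "s \<in> I" "t \<in> I" "s \<le> t" shows "t - s \<in> I"
proof (cases rule: time_cases)
  case discrete
  then obtain m n where "s = real m" "t = real n" using assms by (auto simp: Nats_real_eq)
  with assms(3) have "t - s = real (n - m)" by simp
  then show ?thesis using discrete by (metis of_nat_in_Nats)
qed (use assms in auto)

lemma time_max [simp]: "s \<in> I \<Longrightarrow> t \<in> I \<Longrightarrow> max s t \<in> I"
  and time_min [simp]: "s \<in> I \<Longrightarrow> t \<in> I \<Longrightarrow> min s t \<in> I"
  by (auto simp: max_def min_def)

lemma time_mult [simp]: "t \<in> I \<Longrightarrow> real n * t \<in> I"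
  by (induction n) (auto simp: algebra_simps)

lemma sets_time_borel [measurable, simp]: "I \<in> sets borel"
  using time countable_Nats_real by (auto intro: sets.countable)

lemma space_clock [simp]: "space (clock I) = I"
  using time by (auto simp: clock_Nats clock_atLeast space_restrict_space)

lemma sets_clock [measurable_cong]: "sets (clock I) = sets (restrict_space borel I)"
proof (cases rule: time_cases)
  case continuous
  then show ?thesis by (simp add: clock_atLeast sets_restrict_space)
next
  case discrete
  have "A \<in> sets borel" if "A \<subseteq> \<nat>" for A :: "real set"
  proof (rule sets.countable)
    show "countable A" using that countable_Nats_real by (rule countable_subset)
  qed simp
  then have "Pow \<nat> = (\<inter>) \<nat> ` sets (borel :: real measure)"
    by (auto simp: image_iff)
  then show ?thesis using discrete by (simp add: clock_Nats sets_restrict_space)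
qed

lemma sigma_finite_clock: "sigma_finite_measure (clock I)"
  using time
  by (auto simp: clock_Nats clock_atLeast sigma_finite_measure_count_space_countable
      countable_Nats_real intro!: sigma_finite_measure_restrict_space sigma_finite_lborel)

text \<open>Both clocks are invariant under translation by an element of the time set.\<close>

lemma nn_integral_clock_shift:
  assumes s: "s \<in> I" and f: "f \<in> borel_measurable (clock I)"
  shows "(\<integral>\<^sup>+r. f r * indicator {s..} r \<partial>clock I) = (\<integral>\<^sup>+r. f (s + r) \<partial>clock I)"
proof (cases rule: time_cases)
  case continuous
  have m: "(\<lambda>x. f x * indicator {s..} x * indicator {0..} x) \<in> borel_measurable borel"
  proof -
    have "f \<in> borel_measurable (restrict_space borel {0..})"
      using f continuous sets_clock by (simp cong: measurable_cong_sets)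
    then have [measurable]: "(\<lambda>x. f x * indicator {0..} x) \<in> borel_measurable borel"
      by (subst (asm) borel_measurable_restrict_space_iff_ennreal) auto
    have "(\<lambda>x. (f x * indicator {0..} x) * indicator {s..} x) \<in> borel_measurable borel"
      by measurable
    then show ?thesis by (simp add: ac_simps)
  qed
  have "(\<integral>\<^sup>+r. f r * indicator {s..} r \<partial>clock I)
      = (\<integral>\<^sup>+r. f r * indicator {s..} r * indicator {0..} r \<partial>lborel)"
    using continuous by (simp add: clock_atLeast nn_integral_restrict_space)
  also have "\<dots> = (\<integral>\<^sup>+r. f (s + r) * indicator {s..} (s + r) * indicator {0..} (s + r) \<partial>lborel)"
    using m by (subst nn_integral_real_affine[where c = 1 and t = s]) auto
  also have "\<dots> = (\<integral>\<^sup>+r. f (s + r) * indicator {0..} r \<partial>lborel)"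
    using time_nonneg[OF s] by (intro nn_integral_cong) (auto simp: indicator_def)
  also have "\<dots> = (\<integral>\<^sup>+r. f (s + r) \<partial>clock I)"
    using continuous by (simp add: clock_atLeast nn_integral_restrict_space)
  finally show ?thesis .
next
  case discrete
  have bij: "bij_betw ((+) s) \<nat> (\<nat> \<inter> {s..})"
  proof (rule bij_betwI[where g = "\<lambda>r. r - s"])
    show "(\<lambda>r. r - s) \<in> \<nat> \<inter> {s..} \<rightarrow> \<nat>"
      using s discrete time_diff[OF s] by auto
  qed (use s discrete time_nonneg in auto)
  have "(\<integral>\<^sup>+r. f r * indicator {s..} r \<partial>clock I) = (\<integral>\<^sup>+r. f r \<partial>count_space (\<nat> \<inter> {s..}))"
    unfolding discrete clock_Nats
    by (subst (1 2) nn_integral_count_space_indicator)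
      (auto intro!: nn_integral_cong simp: indicator_def)
  also have "\<dots> = (\<integral>\<^sup>+r. f (s + r) \<partial>count_space \<nat>)"
    using nn_integral_bij_count_space[OF bij, of f] by simp
  finally show ?thesis by (simp add: discrete clock_Nats)
qed

lemma emeasure_clock_lessThan:
  assumes "t \<in> I" shows "emeasure (clock I) (I \<inter> {..<t}) = ennreal t"
proof (cases rule: time_cases)
  case continuous
  have "{0..} \<inter> {..<t} = {0..<t}" by auto
  then show ?thesis
    using continuous time_nonneg[OF assms] by (subst clock_atLeast[folded continuous], subst emeasure_restrict_space) auto
next
  case discrete
  then obtain n where n: "t = real n" using assms by (auto simp: Nats_def)
  have "\<nat> \<inter> {..<t} = real ` {..<n}" by (auto simp: n Nats_def)
  moreover have "real ` {..<n} \<subseteq> \<nat>" by auto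
  ultimately show ?thesis
    using discrete by (simp add: clock_Nats n emeasure_count_space_finite card_image ennreal_of_nat_eq_real_of_nat)
qed

lemma clock_lessThan_sets [measurable, simp]: "I \<inter> {..<t} \<in> sets (clock I)"
  by (simp add: sets_clock sets_restrict_space)

lemma finite_clock_upto: "t \<in> I \<Longrightarrow> finite_measure (restrict_space (clock I) {..<t})"
  by (intro finite_measureI)
    (simp add: space_restrict_space emeasure_restrict_space Int_commute emeasure_clock_lessThan)

lemma sets_clock_upto:
  "sets (restrict_space (clock I) {..<t}) = sets (restrict_space borel (I \<inter> {..<t}))"
  by (simp add: sets_restrict_space_cong[OF sets_clock] restrict_restrict_space)

lemma penal_clock:
  assumes t: "t \<in> I"
  shows "penal I \<rho> X t \<omega> = exp (- (\<integral>r. \<rho> (X r \<omega>) \<partial>restrict_space (clock I) {..<t}))"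
proof (cases rule: time_cases)
  case continuous
  have "(\<integral>r. \<rho> (X r \<omega>) \<partial>restrict_space (clock I) {..<t}) = (LINT s:{0..<t}|lborel. \<rho> (X s \<omega>))"
    using continuous by (simp add: clock_atLeast restrict_restrict_space integral_restrict_space
        set_lebesgue_integral_def atLeastLessThan_def)
  also have "\<dots> = (LINT s:{0..t}|lborel. \<rho> (X s \<omega>))"
    by (rule set_integral_discrete_difference[where X = "{t}"]) auto
  finally show ?thesis using continuous by (simp add: penal_def)
next
  case discrete
  then obtain n where n: "t = real n" using t by (auto simp: Nats_def)
  have "{..<t} \<inter> \<nat> = real ` {..<n}" by (auto simp: n Nats_def)
  then have "(\<integral>r. \<rho> (X r \<omega>) \<partial>restrict_space (clock I) {..<t}) = (\<Sum>k<n. \<rho> (X (real k) \<omega>))"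
    using discrete
    by (simp add: clock_Nats restrict_count_space lebesgue_integral_count_space_finite
        sum.reindex)
  then show ?thesis
    using discrete Nats_neq_atLeast by (simp add: penal_def n exp_sum sum_negf[symmetric])
qed

end

section \<open>The penalization depends only on the finite-dimensional distributions\<close>

text \<open>The \<open>n\<close>-th power of an integral over time is an integral over \<open>n\<close> times, so by Fubini its expectation
  involves only \<open>n\<close>-dimensional distributions.\<close>

lemma moments_time_integral_eq:
  fixes a1 :: "'r \<Rightarrow> 'a \<Rightarrow> ennreal" and a2 :: "'r \<Rightarrow> 'b \<Rightarrow> ennreal"
  assumes m: "sigma_finite_measure m" and M1: "sigma_finite_measure M1" and M2: "sigma_finite_measure M2"
    and a1[measurable]: "(\<lambda>(r, \<omega>). a1 r \<omega>) \<in> borel_measurable (m \<Otimes>\<^sub>M M1)"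
    and a2[measurable]: "(\<lambda>(r, \<omega>). a2 r \<omega>) \<in> borel_measurable (m \<Otimes>\<^sub>M M2)"
    and fdd: "\<And>(n::nat) r. r \<in> {..<n} \<rightarrow> space m \<Longrightarrow>
      (\<integral>\<^sup>+\<omega>. (\<Prod>i<n. a1 (r i) \<omega>) \<partial>M1) = (\<integral>\<^sup>+\<omega>. (\<Prod>i<n. a2 (r i) \<omega>) \<partial>M2)"
  shows "(\<integral>\<^sup>+\<omega>. (\<integral>\<^sup>+r. a1 r \<omega> \<partial>m) ^ n \<partial>M1) = (\<integral>\<^sup>+\<omega>. (\<integral>\<^sup>+r. a2 r \<omega> \<partial>m) ^ n \<partial>M2)"
proof -
  have *: "(\<integral>\<^sup>+\<omega>. (\<integral>\<^sup>+r. a r \<omega> \<partial>m) ^ n \<partial>M) =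
      (\<integral>\<^sup>+r. (\<integral>\<^sup>+\<omega>. (\<Prod>i<n. a (r i) \<omega>) \<partial>M) \<partial>PiM {..<n} (\<lambda>_. m))"
    if M: "sigma_finite_measure M" and a: "(\<lambda>(r, \<omega>). a r \<omega>) \<in> borel_measurable (m \<Otimes>\<^sub>M M)"
    for M :: "'x measure" and a :: "'r \<Rightarrow> 'x \<Rightarrow> ennreal"
  proof -
    interpret P0: product_sigma_finite "\<lambda>_. m"
      by (rule product_sigma_finite.intro) (rule m)
    interpret P: finite_product_sigma_finite "\<lambda>_. m" "{..<n}"
      by standard simp
    interpret pair_sigma_finite "PiM {..<n} (\<lambda>_. m)" M
      by (rule pair_sigma_finite.intro) (rule P.sigma_finite_measure_axioms, rule M)
    have sec: "(\<lambda>r. a r \<omega>) \<in> borel_measurable m" if "\<omega> \<in> space M" for \<omega>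
      using measurable_compose[OF measurable_Pair2'[OF that] a] by simp
    have "(\<integral>\<^sup>+\<omega>. (\<integral>\<^sup>+r. a r \<omega> \<partial>m) ^ n \<partial>M) =
        (\<integral>\<^sup>+\<omega>. (\<integral>\<^sup>+r. (\<Prod>i<n. a (r i) \<omega>) \<partial>PiM {..<n} (\<lambda>_. m)) \<partial>M)"
      by (intro nn_integral_cong, subst P0.product_nn_integral_prod) (auto simp: sec)
    also have "\<dots> = (\<integral>\<^sup>+r. (\<integral>\<^sup>+\<omega>. (\<Prod>i<n. a (r i) \<omega>) \<partial>M) \<partial>PiM {..<n} (\<lambda>_. m))"
    proof (rule Fubini')
      have "(\<lambda>p. a (fst p i) (snd p)) \<in> borel_measurable (PiM {..<n} (\<lambda>_. m) \<Otimes>\<^sub>M M)" if "i < n" for i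
      proof -
        have "(\<lambda>p. (fst p i, snd p)) \<in> PiM {..<n} (\<lambda>_. m) \<Otimes>\<^sub>M M \<rightarrow>\<^sub>M m \<Otimes>\<^sub>M M"
          by (intro measurable_Pair measurable_compose[OF measurable_fst measurable_component_singleton]
              measurable_snd) (use that in simp)
        from measurable_compose[OF this a] show ?thesis by simp
      qed
      then show "(\<lambda>(r, \<omega>). \<Prod>i<n. a (r i) \<omega>) \<in> borel_measurable (PiM {..<n} (\<lambda>_. m) \<Otimes>\<^sub>M M)"
        unfolding case_prod_beta' by (intro borel_measurable_prod_ennreal) simp
    qed
    finally show ?thesis .
  qed
  show ?thesis
    unfolding *[OF M1 a1] *[OF M2 a2]
    by (intro nn_integral_cong fdd) (auto simp: space_PiM)
qed

text \<open>The terms of the exponential series of a bounded variable are bounded by those of a convergent series of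
  constants, so the series can be integrated term by term.\<close>

lemma nn_integral_exp_neg_eq_of_moments:
  fixes J1 :: "'a \<Rightarrow> real" and J2 :: "'b \<Rightarrow> real"
  assumes M1: "finite_measure M1" and M2: "finite_measure M2"
    and J1: "J1 \<in> borel_measurable M1" "\<And>\<omega>. \<omega> \<in> space M1 \<Longrightarrow> 0 \<le> J1 \<omega> \<and> J1 \<omega> \<le> C"
    and J2: "J2 \<in> borel_measurable M2" "\<And>\<omega>. \<omega> \<in> space M2 \<Longrightarrow> 0 \<le> J2 \<omega> \<and> J2 \<omega> \<le> C"
    and mom: "\<And>n. (\<integral>\<^sup>+\<omega>. ennreal (J1 \<omega>) ^ n \<partial>M1) = (\<integral>\<^sup>+\<omega>. ennreal (J2 \<omega>) ^ n \<partial>M2)"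
  shows "(\<integral>\<^sup>+\<omega>. ennreal (exp (- J1 \<omega>)) \<partial>M1) = (\<integral>\<^sup>+\<omega>. ennreal (exp (- J2 \<omega>)) \<partial>M2)"
proof -
  define c :: "nat \<Rightarrow> real" where "c n = (-1) ^ n / fact n" for n
  have abs_c: "\<bar>c n\<bar> = inverse (fact n)" for n
    by (simp add: c_def abs_mult power_abs divide_inverse)
  have c_exp: "c n * x ^ n = (- x) ^ n /\<^sub>R fact n" for n x
    unfolding c_def power_minus[of x] by (simp add: divide_inverse)
  have series: "(\<lambda>n. c n * (\<integral>\<omega>. J \<omega> ^ n \<partial>M)) sums (\<integral>\<omega>. exp (- J \<omega>) \<partial>M)"
    and moment: "(\<integral>\<omega>. J \<omega> ^ k \<partial>M) = enn2real (\<integral>\<^sup>+\<omega>. ennreal (J \<omega>) ^ k \<partial>M)"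
    and exp_int: "(\<integral>\<^sup>+\<omega>. ennreal (exp (- J \<omega>)) \<partial>M) = ennreal (\<integral>\<omega>. exp (- J \<omega>) \<partial>M)"
    if M: "finite_measure M" and Jm[measurable]: "J \<in> borel_measurable M"
      and J: "\<And>\<omega>. \<omega> \<in> space M \<Longrightarrow> 0 \<le> J \<omega> \<and> J \<omega> \<le> C"
    for M :: "'x measure" and J k
  proof -
    interpret finite_measure M by fact
    have pow0: "0 \<le> J \<omega> ^ n" if "\<omega> \<in> space M" for \<omega> n
      using J[OF that] by (intro zero_le_power) simp
    have powle: "J \<omega> ^ n \<le> \<bar>C\<bar> ^ n" if "\<omega> \<in> space M" for \<omega> n
      using J[OF that] by (intro power_mono) linarith+
    have int: "integrable M (\<lambda>\<omega>. J \<omega> ^ n)" for n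
    proof (rule integrable_const_bound)
      show "AE \<omega> in M. norm (J \<omega> ^ n) \<le> \<bar>C\<bar> ^ n"
        using powle pow0 by (intro AE_I2) simp
    qed measurable
    have "(\<lambda>n. \<integral>\<omega>. c n * J \<omega> ^ n \<partial>M) sums (\<integral>\<omega>. (\<Sum>n. c n * J \<omega> ^ n) \<partial>M)"
    proof (rule sums_integral[where f = "\<lambda>n \<omega>. c n * J \<omega> ^ n" and M = M])
      show "integrable M (\<lambda>\<omega>. c n * J \<omega> ^ n)" for n
        by (rule integrable_mult_right) (rule int)
      show "AE \<omega> in M. summable (\<lambda>n. norm (c n * J \<omega> ^ n))"
      proof (rule AE_I2)
        show "summable (\<lambda>n. norm (c n * J \<omega> ^ n))" for \<omega>
          using summable_norm_exp[of "- J \<omega>"] by (simp only: c_exp)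
      qed
      show "summable (\<lambda>n. \<integral>\<omega>. norm (c n * J \<omega> ^ n) \<partial>M)"
      proof (rule summable_comparison_test')
        show "summable (\<lambda>n. (\<bar>C\<bar> ^ n /\<^sub>R fact n) * measure M (space M))"
          by (intro summable_mult2 summable_exp_generic)
        fix n :: nat
        have "(\<integral>\<omega>. norm (c n * J \<omega> ^ n) \<partial>M) \<le> (\<integral>\<omega>. \<bar>C\<bar> ^ n /\<^sub>R fact n \<partial>M)"
        proof (rule integral_mono)
          show "norm (c n * J \<omega> ^ n) \<le> \<bar>C\<bar> ^ n /\<^sub>R fact n" if "\<omega> \<in> space M" for \<omega>
            using powle[OF that, of n] pow0[OF that, of n]
            by (simp add: abs_mult abs_c mult_left_mono del: zero_le_power_eq)
          show "integrable M (\<lambda>\<omega>. norm (c n * J \<omega> ^ n))"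
            by (intro integrable_norm integrable_mult_right int)
        qed simp
        then show "norm (\<integral>\<omega>. norm (c n * J \<omega> ^ n) \<partial>M) \<le> (\<bar>C\<bar> ^ n /\<^sub>R fact n) * measure M (space M)"
          by (simp add: mult.commute; (linarith | simp only: mult.commute mult.left_commute | metis mult.commute mult.left_commute mult.assoc))
      qed
    qed
    moreover have "(\<Sum>n. c n * J \<omega> ^ n) = exp (- J \<omega>)" for \<omega>
      unfolding c_exp by (simp add: exp_def)
    ultimately show "(\<lambda>n. c n * (\<integral>\<omega>. J \<omega> ^ n \<partial>M)) sums (\<integral>\<omega>. exp (- J \<omega>) \<partial>M)"
      by simp
    have "(\<integral>\<^sup>+\<omega>. ennreal (J \<omega>) ^ k \<partial>M) = (\<integral>\<^sup>+\<omega>. ennreal (J \<omega> ^ k) \<partial>M)"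
      using J by (intro nn_integral_cong) (simp add: ennreal_power)
    then show "(\<integral>\<omega>. J \<omega> ^ k \<partial>M) = enn2real (\<integral>\<^sup>+\<omega>. ennreal (J \<omega>) ^ k \<partial>M)"
      using pow0 by (subst integral_eq_nn_integral) auto
    show "(\<integral>\<^sup>+\<omega>. ennreal (exp (- J \<omega>)) \<partial>M) = ennreal (\<integral>\<omega>. exp (- J \<omega>) \<partial>M)"
      using J by (intro nn_integral_eq_integral integrable_const_bound[where B = 1]) auto
  qed
  have "(\<integral>\<omega>. exp (- J1 \<omega>) \<partial>M1) = (\<integral>\<omega>. exp (- J2 \<omega>) \<partial>M2)"
    using series[OF M1 J1] series[OF M2 J2] mom
    by (simp add: moment[OF M1 J1] moment[OF M2 J2] sums_unique2)
  then show ?thesis by (simp add: exp_int[OF M1 J1] exp_int[OF M2 J2])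
qed

abbreviation path :: "real set \<Rightarrow> (real \<Rightarrow> 'w \<Rightarrow> 'e) \<Rightarrow> 'w \<Rightarrow> real \<Rightarrow> 'e" where
  "path I W \<omega> \<equiv> (\<lambda>u\<in>I. W u \<omega>)"

lemma measurable_pair_restrict_borel_mono:
  assumes f: "f \<in> restrict_space borel A \<Otimes>\<^sub>M M \<rightarrow>\<^sub>M N" and "B \<subseteq> A"
  shows "f \<in> restrict_space borel B \<Otimes>\<^sub>M M \<rightarrow>\<^sub>M N"
proof -
  have "(\<lambda>p. (fst p, snd p)) \<in> restrict_space borel B \<Otimes>\<^sub>M M \<rightarrow>\<^sub>M restrict_space borel A \<Otimes>\<^sub>M M"
  proof (rule measurable_Pair)
    have "(\<lambda>r. r) \<in> restrict_space borel B \<rightarrow>\<^sub>M restrict_space borel A"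
      using \<open>B \<subseteq> A\<close> by (intro measurable_restrict_space2 measurable_restrict_space1)
        (auto simp: space_restrict_space)
    then show "fst \<in> restrict_space borel B \<Otimes>\<^sub>M M \<rightarrow>\<^sub>M restrict_space borel A"
      by (rule measurable_compose[OF measurable_fst])
  qed (rule measurable_snd)
  from measurable_compose[OF this f] show ?thesis by simp
qed

locale penalization = time_set +
  fixes \<rho> :: "'e::topological_space \<Rightarrow> real" and K :: real
  assumes rho_measurable [measurable]: "\<rho> \<in> borel_measurable borel"
    and rho_nonneg [simp]: "\<And>x. 0 \<le> \<rho> x"
    and rho_le: "\<And>x. \<rho> x \<le> K"
begin

abbreviation Z :: "(real \<Rightarrow> 'w \<Rightarrow> 'e) \<Rightarrow> real \<Rightarrow> 'w \<Rightarrow> real" where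
  "Z W t \<omega> \<equiv> penal I \<rho> W t \<omega>"

abbreviation penalizable :: "'w measure \<Rightarrow> (real \<Rightarrow> 'w \<Rightarrow> 'e) \<Rightarrow> real \<Rightarrow> bool" where
  "penalizable M W t \<equiv>
     (\<lambda>(r, \<omega>). \<rho> (W r \<omega>)) \<in> borel_measurable (restrict_space borel (I \<inter> {..t}) \<Otimes>\<^sub>M M)"

lemma penal_pos [simp]: "t \<in> I \<Longrightarrow> 0 < Z W t \<omega>"
  and penal_nonneg [simp]: "t \<in> I \<Longrightarrow> 0 \<le> Z W t \<omega>"
  and penal_le_one [simp]: "t \<in> I \<Longrightarrow> Z W t \<omega> \<le> 1"
  by (simp_all add: penal_clock)

lemma penal_zero [simp]: "Z W 0 \<omega> = 1"
proof -
  have "space (restrict_space (clock I) {..<0}) = {}"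
    using time_nonneg by (fastforce simp: space_restrict_space)
  then show ?thesis by (simp add: penal_clock Bochner_Integration.integral_empty)
qed

lemma penalizable_clock:
  assumes "penalizable M W t"
  shows "(\<lambda>(r, \<omega>). \<rho> (W r \<omega>)) \<in> borel_measurable (restrict_space (clock I) {..<t} \<Otimes>\<^sub>M M)"
proof -
  have "(\<lambda>(r, \<omega>). \<rho> (W r \<omega>)) \<in> borel_measurable (restrict_space borel (I \<inter> {..<t}) \<Otimes>\<^sub>M M)"
    by (rule measurable_pair_restrict_borel_mono[OF assms]) auto
  then show ?thesis
    by (simp cong: measurable_cong_sets add: sets_pair_measure_cong[OF sets_clock_upto refl])
qed

lemma penalizable_mono_sets:
  assumes "penalizable M W t" "space M = space N" "sets M \<subseteq> sets N"
  shows "penalizable N W t"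
proof -
  have "(\<lambda>p. (fst p, snd p)) \<in> restrict_space borel (I \<inter> {..t}) \<Otimes>\<^sub>M N \<rightarrow>\<^sub>M restrict_space borel (I \<inter> {..t}) \<Otimes>\<^sub>M M"
  proof (rule measurable_Pair)
    have "(\<lambda>\<omega>. \<omega>) \<in> N \<rightarrow>\<^sub>M M" using assms by (auto simp: measurable_def)
    then show "snd \<in> restrict_space borel (I \<inter> {..t}) \<Otimes>\<^sub>M N \<rightarrow>\<^sub>M M"
      by (rule measurable_compose[OF measurable_snd])
  qed (rule measurable_fst)
  from measurable_compose[OF this assms(1)] show ?thesis by simp
qed

lemma penalizable_mono: "penalizable M W t \<Longrightarrow> s \<le> t \<Longrightarrow> penalizable M W s"
  by (erule measurable_pair_restrict_borel_mono) auto

lemma rho_section_measurable: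
  assumes "penalizable M W t" "\<omega> \<in> space M"
  shows "(\<lambda>r. \<rho> (W r \<omega>)) \<in> borel_measurable (restrict_space (clock I) {..<t})"
  using measurable_compose[OF measurable_Pair2'[OF assms(2)] penalizable_clock[OF assms(1)]] by simp

lemma rho_integrable:
  assumes "penalizable M W t" "\<omega> \<in> space M" and t: "t \<in> I"
  shows "integrable (restrict_space (clock I) {..<t}) (\<lambda>r. \<rho> (W r \<omega>))"
proof -
  interpret finite_measure "restrict_space (clock I) {..<t}" by (rule finite_clock_upto[OF t])
  show ?thesis
    by (rule integrable_const_bound[where B = K])
      (auto simp: rho_section_measurable[OF assms(1,2)] rho_le)
qed

lemma time_integral_measurable:
  assumes p: "penalizable M W t" and t: "t \<in> I"
  shows "(\<lambda>\<omega>. \<integral>r. \<rho> (W r \<omega>) \<partial>restrict_space (clock I) {..<t}) \<in> borel_measurable M"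
proof -
  interpret finite_measure "restrict_space (clock I) {..<t}" by (rule finite_clock_upto[OF t])
  have "(\<lambda>(\<omega>, r). \<rho> (W r \<omega>)) \<in> borel_measurable (M \<Otimes>\<^sub>M restrict_space (clock I) {..<t})"
    using measurable_compose[OF measurable_pair_swap' penalizable_clock[OF p]]
    by (simp add: case_prod_beta')
  then show ?thesis by (rule borel_measurable_lebesgue_integral)
qed

lemma penal_measurable:
  assumes "penalizable M W t" and t: "t \<in> I" shows "Z W t \<in> borel_measurable M"
proof -
  have "(\<lambda>\<omega>. exp (- (\<integral>r. \<rho> (W r \<omega>) \<partial>restrict_space (clock I) {..<t}))) \<in> borel_measurable M"
    using time_integral_measurable[OF assms] by measurable
  then show ?thesis by (simp add: penal_clock[OF t, abs_def])
qed

lemma measurable_path: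
  assumes "\<forall>u\<in>I. W u \<in> M \<rightarrow>\<^sub>M borel"
  shows "path I W \<in> M \<rightarrow>\<^sub>M PiM I (\<lambda>_. borel)"
  using assms by (intro measurable_restrict) simp

text \<open>The moments of the integral of \<open>\<rho>\<close> along a path are integrals over time of
  finite-dimensional expectations, and they determine the expectation of the penalization because
  the integral is bounded. This is how the law of the path on the product \<open>\<sigma>\<close>-algebra, for which the
  penalization itself is not measurable in continuous time, determines the penalized law.\<close>

lemma penalized_mass_eq:
  fixes W1 :: "real \<Rightarrow> 'a \<Rightarrow> 'e" and W2 :: "real \<Rightarrow> 'b \<Rightarrow> 'e"
  assumes t: "t \<in> I" and M1: "finite_measure M1" and M2: "finite_measure M2"
    and W1: "\<forall>u\<in>I. W1 u \<in> M1 \<rightarrow>\<^sub>M borel" and W2: "\<forall>u\<in>I. W2 u \<in> M2 \<rightarrow>\<^sub>M borel"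
    and p1: "penalizable M1 W1 t" and p2: "penalizable M2 W2 t"
    and law: "distr M1 (PiM I (\<lambda>_. borel)) (path I W1) = distr M2 (PiM I (\<lambda>_. borel)) (path I W2)"
  shows "(\<integral>\<^sup>+\<omega>. ennreal (Z W1 t \<omega>) \<partial>M1) = (\<integral>\<^sup>+\<omega>. ennreal (Z W2 t \<omega>) \<partial>M2)"
proof -
  let ?m = "restrict_space (clock I) {..<t}"
  interpret m: finite_measure ?m by (rule finite_clock_upto[OF t])
  have bound: "0 \<le> (\<integral>r. \<rho> (W r \<omega>) \<partial>?m) \<and> (\<integral>r. \<rho> (W r \<omega>) \<partial>?m) \<le> K * measure ?m (space ?m)"
    if "penalizable M W t" "\<omega> \<in> space M" for M :: "'x measure" and W \<omega>
  proof -
    have "(\<integral>r. \<rho> (W r \<omega>) \<partial>?m) \<le> (\<integral>r. K \<partial>?m)"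
      by (intro integral_mono rho_integrable[OF that t]) (auto simp: rho_le)
    then show ?thesis by (simp add: mult.commute)
  qed
  have ennreal_J: "ennreal (\<integral>r. \<rho> (W r \<omega>) \<partial>?m) = (\<integral>\<^sup>+r. ennreal (\<rho> (W r \<omega>)) \<partial>?m)"
    if "penalizable M W t" "\<omega> \<in> space M" for M :: "'x measure" and W \<omega>
    using rho_integrable[OF that t] by (simp add: nn_integral_eq_integral)
  have fdd: "(\<integral>\<^sup>+\<omega>. (\<Prod>i<n. ennreal (\<rho> (W (r i) \<omega>))) \<partial>M) =
      (\<integral>\<^sup>+q. (\<Prod>i<n. ennreal (\<rho> (q (r i)))) \<partial>distr M (PiM I (\<lambda>_. borel)) (path I W))"
    if W: "\<forall>u\<in>I. W u \<in> M \<rightarrow>\<^sub>M borel" and r: "r \<in> {..<n} \<rightarrow> space ?m"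
    for M :: "'x measure" and W and n :: nat and r
  proof -
    have r: "i < n \<Longrightarrow> r i \<in> I" for i using r by (auto simp: space_restrict_space)
    have [measurable]: "(\<lambda>q. \<rho> (q (r i))) \<in> borel_measurable (PiM I (\<lambda>_. borel))" if "i < n" for i
      using r[OF that] by measurable
    have "(\<lambda>q. \<Prod>i<n. ennreal (\<rho> (q (r i)))) \<in> borel_measurable (PiM I (\<lambda>_. borel))"
      by (intro borel_measurable_prod_ennreal) simp
    then show ?thesis
      by (subst nn_integral_distr[OF measurable_path[OF W]])
        (auto intro!: nn_integral_cong prod.cong simp: r)
  qed
  have meas: "(\<lambda>(r, \<omega>). ennreal (\<rho> (W r \<omega>))) \<in> borel_measurable (?m \<Otimes>\<^sub>M M)"
    if "penalizable M W t" for M :: "'x measure" and W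
    using measurable_compose[OF penalizable_clock[OF that] measurable_ennreal] by (simp add: case_prod_beta')
  have mom: "(\<integral>\<^sup>+\<omega>. (\<integral>\<^sup>+r. ennreal (\<rho> (W1 r \<omega>)) \<partial>?m) ^ n \<partial>M1) =
      (\<integral>\<^sup>+\<omega>. (\<integral>\<^sup>+r. ennreal (\<rho> (W2 r \<omega>)) \<partial>?m) ^ n \<partial>M2)" for n
  proof (rule moments_time_integral_eq[OF m.sigma_finite_measure_axioms
        finite_measure.axioms(1)[OF M1] finite_measure.axioms(1)[OF M2] meas[OF p1] meas[OF p2]])
    fix k :: nat and r assume r0: "r \<in> {..<k} \<rightarrow> space ?m"
    show "(\<integral>\<^sup>+\<omega>. (\<Prod>i<k. ennreal (\<rho> (W1 (r i) \<omega>))) \<partial>M1) =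
        (\<integral>\<^sup>+\<omega>. (\<Prod>i<k. ennreal (\<rho> (W2 (r i) \<omega>))) \<partial>M2)"
      using fdd[OF W1 r0] fdd[OF W2 r0] by (simp add: law)
  qed
  show ?thesis
    unfolding penal_clock[OF t]
  proof (rule nn_integral_exp_neg_eq_of_moments[OF M1 M2 time_integral_measurable[OF p1 t]
        bound[OF p1] time_integral_measurable[OF p2 t] bound[OF p2]])
    show "(\<integral>\<^sup>+\<omega>. ennreal (\<integral>r. \<rho> (W1 r \<omega>) \<partial>?m) ^ n \<partial>M1) =
        (\<integral>\<^sup>+\<omega>. ennreal (\<integral>r. \<rho> (W2 r \<omega>) \<partial>?m) ^ n \<partial>M2)" for n
      using mom[of n] by (simp add: ennreal_J[OF p1] ennreal_J[OF p2] cong: nn_integral_cong)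
  qed
qed

text \<open>Two processes with the same law of paths still have the same law of paths once they are restricted to the
  paths in a measurable set \<open>B\<close>. Hence the laws of the paths weighted by \<open>Z\<close> agree on every \<open>B\<close>.\<close>

lemma penalized_path_law_eq:
  fixes W1 :: "real \<Rightarrow> 'a \<Rightarrow> 'e" and W2 :: "real \<Rightarrow> 'b \<Rightarrow> 'e"
  assumes t: "t \<in> I" and M1: "finite_measure M1" and M2: "finite_measure M2"
    and W1: "\<forall>u\<in>I. W1 u \<in> M1 \<rightarrow>\<^sub>M borel" and W2: "\<forall>u\<in>I. W2 u \<in> M2 \<rightarrow>\<^sub>M borel"
    and p1: "penalizable M1 W1 t" and p2: "penalizable M2 W2 t"
    and law: "distr M1 (PiM I (\<lambda>_. borel)) (path I W1) = distr M2 (PiM I (\<lambda>_. borel)) (path I W2)"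
    and h: "h \<in> borel_measurable (PiM I (\<lambda>_. borel))"
  shows "(\<integral>\<^sup>+\<omega>. ennreal (Z W1 t \<omega>) * h (path I W1 \<omega>) \<partial>M1) =
    (\<integral>\<^sup>+\<omega>. ennreal (Z W2 t \<omega>) * h (path I W2 \<omega>) \<partial>M2)"
proof -
  let ?S = "PiM I (\<lambda>_. borel :: 'e measure)"
  let ?N = "\<lambda>M W. distr (density M (\<lambda>\<omega>. ennreal (Z W t \<omega>))) ?S (path I W)"
  have N: "emeasure (?N M W) B = (\<integral>\<^sup>+\<omega>. ennreal (Z W t \<omega>) \<partial>density M (\<lambda>\<omega>. indicator B (path I W \<omega>)))"
    if W: "\<forall>u\<in>I. W u \<in> M \<rightarrow>\<^sub>M borel" and p: "penalizable M W t" and B: "B \<in> sets ?S"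
    for M :: "'x measure" and W B
  proof -
    note [measurable] = measurable_path[OF W] penal_measurable[OF p t] B
    have "emeasure (?N M W) B = (\<integral>\<^sup>+\<omega>. ennreal (Z W t \<omega>) * indicator (path I W -` B \<inter> space M) \<omega> \<partial>M)"
      by (simp add: emeasure_distr emeasure_density)
    also have "\<dots> = (\<integral>\<^sup>+\<omega>. indicator B (path I W \<omega>) * ennreal (Z W t \<omega>) \<partial>M)"
      by (intro nn_integral_cong) (auto simp: indicator_def)
    finally show ?thesis by (simp add: nn_integral_density)
  qed
  have restr: "distr (density M (\<lambda>\<omega>. indicator B (path I W \<omega>))) ?S (path I W) =
      density (distr M ?S (path I W)) (indicator B)"
    if W: "\<forall>u\<in>I. W u \<in> M \<rightarrow>\<^sub>M borel" and B[measurable]: "B \<in> sets ?S" for M :: "'x measure" and W B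
    by (subst density_distr) (auto intro!: measurable_path W)
  have fin: "finite_measure (density M (\<lambda>\<omega>. indicator B (path I W \<omega>)))"
    if W: "\<forall>u\<in>I. W u \<in> M \<rightarrow>\<^sub>M borel" and B: "B \<in> sets ?S" and M: "finite_measure M"
    for M :: "'x measure" and W B
  proof -
    note [measurable] = measurable_path[OF W] B
    interpret finite_measure M by fact
    have "(\<integral>\<^sup>+\<omega>. indicator B (path I W \<omega>) \<partial>M) \<le> (\<integral>\<^sup>+\<omega>. 1 \<partial>M)"
      by (intro nn_integral_mono) (auto simp: indicator_def)
    also have "\<dots> < \<infinity>" by (simp add: less_top[symmetric])
    finally show ?thesis
      by (intro finite_measureI) (auto simp: emeasure_density cong: nn_integral_cong)
  qed
  have eq: "?N M1 W1 = ?N M2 W2"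
  proof (rule measure_eqI)
    fix B assume "B \<in> sets (?N M1 W1)"
    then have B: "B \<in> sets ?S" by simp
    show "emeasure (?N M1 W1) B = emeasure (?N M2 W2) B"
      unfolding N[OF W1 p1 B] N[OF W2 p2 B]
      by (rule penalized_mass_eq[OF t fin[OF W1 B M1] fin[OF W2 B M2]])
        (use W1 W2 p1 p2 in \<open>simp_all add: restr[OF W1 B] restr[OF W2 B] law
          penalizable_mono_sets[where M = M1] penalizable_mono_sets[where M = M2]\<close>)
  qed simp
  have "(\<integral>\<^sup>+\<omega>. ennreal (Z W t \<omega>) * h (path I W \<omega>) \<partial>M) = (\<integral>\<^sup>+q. h q \<partial>?N M W)"
    if W: "\<forall>u\<in>I. W u \<in> M \<rightarrow>\<^sub>M borel" and p: "penalizable M W t" for M :: "'x measure" and W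
    using h measurable_path[OF W] penal_measurable[OF p t]
    by (simp add: nn_integral_distr nn_integral_density)
  from this[OF W1 p1] this[OF W2 p2] show ?thesis by (simp only: eq)
qed

text \<open>The multiplicative functional property.\<close>

lemma penal_add:
  assumes p: "penalizable M W (s + t)" and \<omega>: "\<omega> \<in> space M" and st: "s \<in> I" "t \<in> I"
  shows "Z W (s + t) \<omega> = Z W s \<omega> * Z (\<lambda>r. W (s + r)) t \<omega>"
proof -
  have nn: "ennreal (\<integral>r. \<rho> (W r \<omega>) \<partial>restrict_space (clock I) {..<u}) =
      (\<integral>\<^sup>+r. ennreal (\<rho> (W r \<omega>)) * indicator {..<u} r \<partial>clock I)" if "u \<in> I" "u \<le> s + t" for u
    using rho_integrable[OF penalizable_mono[OF p that(2)] \<omega> that(1)]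
    by (simp add: nn_integral_eq_integral[symmetric] nn_integral_restrict_space Int_commute)
  have f: "(\<lambda>r. ennreal (\<rho> (W r \<omega>)) * indicator {..<s + t} r) \<in> borel_measurable (clock I)"
    using measurable_compose[OF rho_section_measurable[OF p \<omega>] measurable_ennreal]
    by (subst (asm) borel_measurable_restrict_space_iff_ennreal) (auto simp: Int_commute)
  have ind: "indicator A \<in> borel_measurable (clock I)" if "A \<in> sets borel" for A :: "real set"
    using that by (intro measurable_cong_sets[OF sets_clock refl, THEN equalityD2, THEN subsetD]
        measurable_restrict_space1 borel_measurable_indicator)
  have m: "(\<lambda>r. \<rho> (W (s + r) \<omega>)) \<in> borel_measurable (restrict_space (clock I) {..<t})"
  proof -
    have "(\<lambda>r. s + r) \<in> restrict_space (clock I) {..<t} \<rightarrow>\<^sub>M restrict_space (clock I) {..<s + t}"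
      unfolding measurable_cong_sets[OF sets_clock_upto sets_clock_upto]
      by (intro measurable_restrict_space2 measurable_restrict_space1)
        (use st in \<open>auto simp: space_restrict_space\<close>)
    from measurable_compose[OF this rho_section_measurable[OF p \<omega>]] show ?thesis .
  qed
  interpret mt: finite_measure "restrict_space (clock I) {..<t}" by (rule finite_clock_upto[OF st(2)])
  have i: "integrable (restrict_space (clock I) {..<t}) (\<lambda>r. \<rho> (W (s + r) \<omega>))"
    by (rule mt.integrable_const_bound[where B = K]) (auto simp: m rho_le)
  have "ennreal (\<integral>r. \<rho> (W r \<omega>) \<partial>restrict_space (clock I) {..<s + t}) =
      (\<integral>\<^sup>+r. ennreal (\<rho> (W r \<omega>)) * indicator {..<s} r +
        (ennreal (\<rho> (W r \<omega>)) * indicator {..<s + t} r) * indicator {s..} r \<partial>clock I)"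
    unfolding nn[OF time_add[OF st] order.refl]
    by (intro nn_integral_cong) (use time_nonneg[OF st(2)] in \<open>auto simp: indicator_def\<close>)
  also have "\<dots> = (\<integral>\<^sup>+r. ennreal (\<rho> (W r \<omega>)) * indicator {..<s} r \<partial>clock I) +
      (\<integral>\<^sup>+r. (ennreal (\<rho> (W r \<omega>)) * indicator {..<s + t} r) * indicator {s..} r \<partial>clock I)"
  proof (rule nn_integral_add)
    have "(\<lambda>r. (ennreal (\<rho> (W r \<omega>)) * indicator {..<s + t} r) * indicator {..<s} r) \<in> borel_measurable (clock I)"
      using borel_measurable_times_ennreal[OF f ind] by simp
    also have "(\<lambda>r. (ennreal (\<rho> (W r \<omega>)) * indicator {..<s + t} r) * indicator {..<s} r) =
        (\<lambda>r. ennreal (\<rho> (W r \<omega>)) * indicator {..<s} r)"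
      using time_nonneg[OF st(2)] by (auto simp: indicator_def fun_eq_iff)
    finally show "(\<lambda>r. ennreal (\<rho> (W r \<omega>)) * indicator {..<s} r) \<in> borel_measurable (clock I)" .
    show "(\<lambda>r. (ennreal (\<rho> (W r \<omega>)) * indicator {..<s + t} r) * indicator {s..} r) \<in> borel_measurable (clock I)"
      using borel_measurable_times_ennreal[OF f ind] by simp
  qed
  also have "(\<integral>\<^sup>+r. (ennreal (\<rho> (W r \<omega>)) * indicator {..<s + t} r) * indicator {s..} r \<partial>clock I) =
      (\<integral>\<^sup>+r. ennreal (\<rho> (W (s + r) \<omega>)) * indicator {..<t} r \<partial>clock I)"
    by (subst nn_integral_clock_shift[OF st(1) f]) (auto intro!: nn_integral_cong simp: indicator_def)
  also have "\<dots> = ennreal (\<integral>r. \<rho> (W (s + r) \<omega>) \<partial>restrict_space (clock I) {..<t})"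
    using i by (simp add: nn_integral_eq_integral[symmetric] nn_integral_restrict_space Int_commute)
  finally have "ennreal (\<integral>r. \<rho> (W r \<omega>) \<partial>restrict_space (clock I) {..<s + t}) =
      ennreal ((\<integral>r. \<rho> (W r \<omega>) \<partial>restrict_space (clock I) {..<s}) +
        (\<integral>r. \<rho> (W (s + r) \<omega>) \<partial>restrict_space (clock I) {..<t}))"
    using nn[OF st(1)] time_nonneg[OF st(2)] by (simp add: ennreal_plus)
  then have "(\<integral>r. \<rho> (W r \<omega>) \<partial>restrict_space (clock I) {..<s + t}) =
      (\<integral>r. \<rho> (W r \<omega>) \<partial>restrict_space (clock I) {..<s}) +
        (\<integral>r. \<rho> (W (s + r) \<omega>) \<partial>restrict_space (clock I) {..<t})"
    by (subst (asm) ennreal_inj) (auto intro!: add_nonneg_nonneg)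
  then show ?thesis using st by (simp add: penal_clock exp_add[symmetric])
qed

end

text \<open>The conditional expectation of an indicator, integrated against a nonnegative weight that is
  measurable with respect to the smaller \<open>\<sigma>\<close>-algebra; the identification of the conditional
  expectation is needed only where the weight does not vanish.\<close>

lemma nn_integral_weight_cond_exp_indicator:
  assumes M: "prob_space M" and G: "subalgebra M G" and E: "E \<in> sets M" and S: "S \<in> sets G"
    and g: "g \<in> borel_measurable M" "\<And>\<omega>. 0 \<le> g \<omega>"
    and ce: "AE \<omega> in M. \<omega> \<in> S \<longrightarrow> real_cond_exp M G (indicator E) \<omega> = g \<omega>"
    and V: "V \<in> borel_measurable G" "\<And>\<omega>. \<omega> \<in> space M \<Longrightarrow> \<omega> \<notin> S \<Longrightarrow> V \<omega> = 0"
  shows "(\<integral>\<^sup>+\<omega>. V \<omega> * indicator E \<omega> \<partial>M) = (\<integral>\<^sup>+\<omega>. V \<omega> * ennreal (g \<omega>) \<partial>M)"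
proof -
  interpret M: prob_space M by fact
  interpret finite_measure_subalgebra M G
    by (intro finite_measure_subalgebra.intro M.finite_measure_axioms finite_measure_subalgebra_axioms.intro G)
  note [measurable] = g(1) E
  have GM: "A \<in> sets M" if "A \<in> sets G" for A using that G by (auto simp: subalgebra_def)
  have SM[measurable]: "S \<in> sets M" by (rule GM[OF S])
  have VM[measurable]: "V \<in> borel_measurable M" by (rule measurable_from_subalg[OF G V(1)])
  let ?N1 = "density M (indicator (E \<inter> S))" and ?N2 = "density M (\<lambda>\<omega>. ennreal (g \<omega>) * indicator S \<omega>)"
  have int_ind: "integrable M (indicator E :: _ \<Rightarrow> real)"
    using E M.emeasure_finite[of E] by (intro integrable_real_indicator) (auto simp: less_top[symmetric])
  have eqA: "emeasure ?N1 A = emeasure ?N2 A" if A: "A \<in> sets G" for A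
  proof -
    have AM[measurable]: "A \<in> sets M" by (rule GM[OF A])
    have AS: "A \<inter> S \<in> sets G" using A S by blast
    have i1: "integrable M (\<lambda>\<omega>. indicator (A \<inter> S) \<omega> * real_cond_exp M G (indicator E) \<omega>)"
      using integrable_mult_indicator[OF GM[OF AS] real_cond_exp_int(1)[OF int_ind]] by simp
    have ae: "AE \<omega> in M. indicator (A \<inter> S) \<omega> * real_cond_exp M G (indicator E) \<omega> = indicator (A \<inter> S) \<omega> * g \<omega>"
      using ce by eventually_elim (auto simp: indicator_def)
    have i2: "integrable M (\<lambda>\<omega>. indicator (A \<inter> S) \<omega> * g \<omega>)"
      by (rule integrable_cong_AE_imp[OF i1 _ ae]) measurable
    have "(\<integral>\<omega>. indicator (A \<inter> S) \<omega> * indicator E \<omega> \<partial>M) = (\<integral>\<omega>. indicator (A \<inter> S) \<omega> * g \<omega> \<partial>M)"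
      using real_cond_exp_intA[OF int_ind AS] integral_cong_AE[OF _ _ ae]
      by (simp add: set_lebesgue_integral_def)
    moreover have "(\<integral>\<^sup>+\<omega>. ennreal (indicator (A \<inter> S) \<omega> * g \<omega>) \<partial>M) = ennreal (\<integral>\<omega>. indicator (A \<inter> S) \<omega> * g \<omega> \<partial>M)"
      using i2 g(2) by (intro nn_integral_eq_integral) auto
    moreover have "(\<integral>\<^sup>+\<omega>. ennreal (indicator (A \<inter> S) \<omega> * indicator E \<omega>) \<partial>M) = ennreal (\<integral>\<omega>. indicator (A \<inter> S) \<omega> * indicator E \<omega> \<partial>M)"
      using integrable_mult_indicator[OF GM[OF AS] int_ind]
      by (intro nn_integral_eq_integral) auto
    ultimately have "(\<integral>\<^sup>+\<omega>. ennreal (indicator (A \<inter> S) \<omega> * indicator E \<omega>) \<partial>M) =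
        (\<integral>\<^sup>+\<omega>. ennreal (indicator (A \<inter> S) \<omega> * g \<omega>) \<partial>M)" by simp
    moreover have "emeasure ?N1 A = (\<integral>\<^sup>+\<omega>. ennreal (indicator (A \<inter> S) \<omega> * indicator E \<omega>) \<partial>M)"
      by (simp add: emeasure_density) (intro nn_integral_cong, auto simp: indicator_def)
    moreover have "emeasure ?N2 A = (\<integral>\<^sup>+\<omega>. ennreal (indicator (A \<inter> S) \<omega> * g \<omega>) \<partial>M)"
      by (simp add: emeasure_density) (intro nn_integral_cong, auto simp: indicator_def)
    ultimately show ?thesis by simp
  qed
  have G1: "subalgebra ?N1 G" and G2: "subalgebra ?N2 G"
    using G by (auto simp: subalgebra_def)
  have "restr_to_subalg ?N1 G = restr_to_subalg ?N2 G"
    using eqA by (intro measure_eqI)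
      (auto simp: sets_restr_to_subalg[OF G1] sets_restr_to_subalg[OF G2]
        emeasure_restr_to_subalg[OF G1] emeasure_restr_to_subalg[OF G2])
  then have "(\<integral>\<^sup>+\<omega>. V \<omega> \<partial>?N1) = (\<integral>\<^sup>+\<omega>. V \<omega> \<partial>?N2)"
    using nn_integral_subalgebra2[OF G1 V(1)] nn_integral_subalgebra2[OF G2 V(1)] by simp
  then have "(\<integral>\<^sup>+\<omega>. indicator (E \<inter> S) \<omega> * V \<omega> \<partial>M) = (\<integral>\<^sup>+\<omega>. (ennreal (g \<omega>) * indicator S \<omega>) * V \<omega> \<partial>M)"
    by (simp add: nn_integral_density)
  moreover have "(\<integral>\<^sup>+\<omega>. indicator (E \<inter> S) \<omega> * V \<omega> \<partial>M) = (\<integral>\<^sup>+\<omega>. V \<omega> * indicator E \<omega> \<partial>M)"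
    using V(2) by (intro nn_integral_cong) (auto simp: indicator_def)
  moreover have "(\<integral>\<^sup>+\<omega>. (ennreal (g \<omega>) * indicator S \<omega>) * V \<omega> \<partial>M) = (\<integral>\<^sup>+\<omega>. V \<omega> * ennreal (g \<omega>) \<partial>M)"
    using V(2) by (intro nn_integral_cong) (auto simp: indicator_def mult.commute)
  ultimately show ?thesis by simp
qed

locale penalized_markov = penalization I \<rho> K for I and \<rho> :: "'e::topological_space \<Rightarrow> real" and K +
  fixes \<Omega> :: "'w set" and F :: "real \<Rightarrow> 'w measure"
    and X :: "real \<Rightarrow> 'w \<Rightarrow> 'e" and P :: "'e \<Rightarrow> 'w measure"
  assumes markov: "markov_process I \<Omega> F X P"
    and progressive: "progressively_measurable I F (\<lambda>t \<omega>. \<rho> (X t \<omega>))"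
begin

abbreviation Finf :: "'w measure" where "Finf \<equiv> filtration_sup I \<Omega> F"
abbreviation paths :: "(real \<Rightarrow> 'e) measure" where "paths \<equiv> PiM I (\<lambda>_. borel)"

lemma space_F [simp]: "t \<in> I \<Longrightarrow> space (F t) = \<Omega>"
  using markov by (simp add: markov_process_def filtration_on_def)

lemma sets_F_mono: "s \<in> I \<Longrightarrow> t \<in> I \<Longrightarrow> s \<le> t \<Longrightarrow> sets (F s) \<subseteq> sets (F t)"
  using markov by (simp add: markov_process_def filtration_on_def)

lemma sets_F_Pow: "(\<Union>t\<in>I. sets (F t)) \<subseteq> Pow \<Omega>"
  using sets.sets_into_space by fastforce

lemma space_Finf [simp]: "space Finf = \<Omega>"
  unfolding filtration_sup_def using sets_F_Pow by (rule space_measure_of)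

lemma sets_Finf: "sets Finf = sigma_sets \<Omega> (\<Union>t\<in>I. sets (F t))"
  unfolding filtration_sup_def using sets_F_Pow by (rule sets_measure_of)

lemma sets_F_Finf: "t \<in> I \<Longrightarrow> sets (F t) \<subseteq> sets Finf"
  unfolding sets_Finf by (auto intro: sigma_sets.Basic)

lemma measurable_F_mono:
  "f \<in> F s \<rightarrow>\<^sub>M N \<Longrightarrow> s \<in> I \<Longrightarrow> t \<in> I \<Longrightarrow> s \<le> t \<Longrightarrow> f \<in> F t \<rightarrow>\<^sub>M N"
  using sets_F_mono[of s t] by (auto simp: measurable_def)

lemma measurable_F_Finf: "f \<in> F s \<rightarrow>\<^sub>M N \<Longrightarrow> s \<in> I \<Longrightarrow> f \<in> Finf \<rightarrow>\<^sub>M N"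
  using sets_F_Finf[of s] by (auto simp: measurable_def)

lemma X_F: "t \<in> I \<Longrightarrow> X t \<in> F t \<rightarrow>\<^sub>M borel"
  using markov by (simp add: markov_process_def)

lemma X_F_le: "s \<in> I \<Longrightarrow> t \<in> I \<Longrightarrow> s \<le> t \<Longrightarrow> X s \<in> F t \<rightarrow>\<^sub>M borel"
  by (rule measurable_F_mono[OF X_F])

lemma X_Finf [measurable]: "t \<in> I \<Longrightarrow> X t \<in> Finf \<rightarrow>\<^sub>M borel"
  by (rule measurable_F_Finf[OF X_F])

lemma P_kernel [measurable]: "P \<in> borel \<rightarrow>\<^sub>M prob_algebra Finf"
  using markov by (simp add: markov_process_def)

lemma kernel_prob: "R \<in> borel \<rightarrow>\<^sub>M prob_algebra Finf \<Longrightarrow> prob_space (R (x :: 'e))"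
  and kernel_sets: "R \<in> borel \<rightarrow>\<^sub>M prob_algebra Finf \<Longrightarrow> sets (R (x :: 'e)) = sets Finf"
  using measurable_space[of R borel "prob_algebra Finf" x] by (auto simp: space_prob_algebra)

lemma prob_P [simp]: "prob_space (P x)"
  and sets_P [simp, measurable_cong]: "sets (P x) = sets Finf"
  by (rule kernel_prob[OF P_kernel], rule kernel_sets[OF P_kernel])

lemma space_P [simp]: "space (P x) = \<Omega>"
  using sets_eq_imp_space_eq[OF sets_P] by simp

lemma Omega_nonempty: "\<Omega> \<noteq> {}"
  using prob_space.not_empty[OF prob_P] by simp

lemma subalgebra_F: "sets M = sets Finf \<Longrightarrow> t \<in> I \<Longrightarrow> subalgebra M (F t)"
  using sets_eq_imp_space_eq[of M Finf] sets_F_Finf[of t] by (simp add: subalgebra_def)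

lemma X_zero: "AE \<omega> in P x. X 0 \<omega> = x"
  using markov by (simp add: markov_process_def)

lemma penalizable_F: "t \<in> I \<Longrightarrow> penalizable (F t) X t"
  using progressive by (simp add: progressively_measurable_def)

lemma penalizable_Finf: "t \<in> I \<Longrightarrow> penalizable Finf X t"
  by (rule penalizable_mono_sets[OF penalizable_F]) (auto simp: sets_F_Finf)

lemma Z_F: "t \<in> I \<Longrightarrow> Z X t \<in> borel_measurable (F t)"
  by (rule penal_measurable[OF penalizable_F])

lemma Z_Finf [measurable]: "t \<in> I \<Longrightarrow> Z X t \<in> borel_measurable Finf"
  by (rule penal_measurable[OF penalizable_Finf])

lemma path_Finf [measurable]: "path I X \<in> Finf \<rightarrow>\<^sub>M paths"
  by (rule measurable_path) simp

lemma Finf_preimage: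
  assumes "f \<in> Finf \<rightarrow>\<^sub>M N" "B \<in> sets N" shows "{\<omega>\<in>\<Omega>. f \<omega> \<in> B} \<in> sets Finf"
  using measurable_sets[OF assms] by (simp add: vimage_def Int_def conj_commute)

lemma kernel_subprob: "R \<in> borel \<rightarrow>\<^sub>M prob_algebra Finf \<Longrightarrow> R \<in> borel \<rightarrow>\<^sub>M subprob_algebra Finf"
  by (rule measurable_prob_algebraD)

lemma kernel_nn_integral_measurable:
  assumes "R \<in> borel \<rightarrow>\<^sub>M prob_algebra Finf" "f \<in> borel_measurable Finf"
  shows "(\<lambda>x. \<integral>\<^sup>+\<omega>. f \<omega> \<partial>R x) \<in> borel_measurable borel"
  by (rule measurable_compose[OF kernel_subprob[OF assms(1)] nn_integral_measurable_subprob_algebra[OF assms(2)]])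

text \<open>A law on the paths that regenerates at the random time \<open>T\<close>, in the sense that the path after
  \<open>T\<close> weighted by \<open>V\<close> is a mixture of the laws \<open>P (X T)\<close>, regenerates also with the penalization.\<close>

lemma penalized_regeneration:
  assumes V[measurable]: "V \<in> borel_measurable Finf" and Vfin: "(\<integral>\<^sup>+\<omega>. V \<omega> \<partial>P x) < \<infinity>"
    and XT: "\<forall>r\<in>I. (\<lambda>\<omega>. X (T \<omega> + r) \<omega>) \<in> Finf \<rightarrow>\<^sub>M borel"
    and w: "w \<in> I" and pen: "penalizable Finf (\<lambda>r \<omega>. X (T \<omega> + r) \<omega>) w"
    and regen: "\<And>B. B \<in> sets paths \<Longrightarrow>
      (\<integral>\<^sup>+\<omega>. V \<omega> * indicator {\<omega>\<in>\<Omega>. path I (\<lambda>r \<omega>. X (T \<omega> + r) \<omega>) \<omega> \<in> B} \<omega> \<partial>P x) =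
      (\<integral>\<^sup>+\<omega>. V \<omega> * emeasure (P (X (T \<omega>) \<omega>)) {\<omega>'\<in>\<Omega>. path I X \<omega>' \<in> B} \<partial>P x)"
    and h[measurable]: "h \<in> borel_measurable paths"
  shows "(\<integral>\<^sup>+\<omega>. V \<omega> * (ennreal (Z (\<lambda>r \<omega>. X (T \<omega> + r) \<omega>) w \<omega>) * h (path I (\<lambda>r \<omega>. X (T \<omega> + r) \<omega>) \<omega>)) \<partial>P x) =
    (\<integral>\<^sup>+\<omega>. V \<omega> * (\<integral>\<^sup>+\<omega>'. ennreal (Z X w \<omega>') * h (path I X \<omega>') \<partial>P (X (T \<omega>) \<omega>)) \<partial>P x)"
proof -
  let ?Y = "\<lambda>r \<omega>. X (T \<omega> + r) \<omega>"
  have [measurable]: "(\<lambda>\<omega>. X (T \<omega>) \<omega>) \<in> Finf \<rightarrow>\<^sub>M borel"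
    using bspec[OF XT zero_in_time] by simp
  have pY[measurable]: "path I ?Y \<in> Finf \<rightarrow>\<^sub>M paths" by (rule measurable_path) (use XT in simp)
  define M1 where "M1 = density (P x) V"
  have sM1 [simp, measurable_cong]: "sets M1 = sets Finf" by (simp add: M1_def)
  have spM1 [simp]: "space M1 = \<Omega>" by (simp add: M1_def)
  have nnM1: "(\<integral>\<^sup>+\<omega>. f \<omega> \<partial>M1) = (\<integral>\<^sup>+\<omega>. V \<omega> * f \<omega> \<partial>P x)" if "f \<in> borel_measurable Finf" for f
    unfolding M1_def using that by (simp add: nn_integral_density)
  have kern: "(\<lambda>\<omega>. P (X (T \<omega>) \<omega>)) \<in> M1 \<rightarrow>\<^sub>M prob_algebra Finf" by measurable
  note kern' = measurable_prob_algebraD[OF kern]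
  define M2 where "M2 = M1 \<bind> (\<lambda>\<omega>. P (X (T \<omega>) \<omega>))"
  have sM2 [simp, measurable_cong]: "sets M2 = sets Finf"
    unfolding M2_def by (rule sets_bind) (auto simp: Omega_nonempty)
  have spM2 [simp]: "space M2 = \<Omega>" using sets_eq_imp_space_eq[OF sM2] by simp
  have nnM2: "(\<integral>\<^sup>+\<omega>. f \<omega> \<partial>M2) = (\<integral>\<^sup>+\<omega>. V \<omega> * (\<integral>\<^sup>+\<omega>'. f \<omega>' \<partial>P (X (T \<omega>) \<omega>)) \<partial>P x)"
    if f: "f \<in> borel_measurable Finf" for f
    unfolding M2_def nn_integral_bind[OF f kern']
    by (rule nnM1, rule measurable_compose[OF _ kernel_nn_integral_measurable[OF P_kernel f]]) measurable
  have "emeasure M1 \<Omega> = (\<integral>\<^sup>+\<omega>. V \<omega> \<partial>P x)"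
    using nnM1[of "\<lambda>_. 1"] by simp
  then have fin1: "finite_measure M1" using Vfin by (intro finite_measureI) simp
  have "emeasure M2 \<Omega> = (\<integral>\<^sup>+\<omega>. 1 \<partial>M2)" by simp
  also have "\<dots> = (\<integral>\<^sup>+\<omega>. V \<omega> \<partial>P x)"
    by (subst nnM2) (auto simp: prob_space.emeasure_space_1[OF prob_P, simplified])
  finally have fin2: "finite_measure M2" using Vfin by (intro finite_measureI) simp
  have law: "distr M1 paths (path I ?Y) = distr M2 paths (path I X)"
  proof (rule measure_eqI)
    fix B assume "B \<in> sets (distr M1 paths (path I ?Y))"
    then have B[measurable]: "B \<in> sets paths" by simp
    have E1: "{\<omega>\<in>\<Omega>. path I ?Y \<omega> \<in> B} \<in> sets Finf" and E2: "{\<omega>\<in>\<Omega>. path I X \<omega> \<in> B} \<in> sets Finf"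
      by (rule Finf_preimage[OF pY B], rule Finf_preimage[OF path_Finf B])
    have "emeasure (distr M1 paths (path I ?Y)) B = (\<integral>\<^sup>+\<omega>. indicator {\<omega>\<in>\<Omega>. path I ?Y \<omega> \<in> B} \<omega> \<partial>M1)"
      using E1 by (subst emeasure_distr) (auto intro!: arg_cong[where f = "emeasure M1"])
    also have "\<dots> = (\<integral>\<^sup>+\<omega>. V \<omega> * indicator {\<omega>\<in>\<Omega>. path I ?Y \<omega> \<in> B} \<omega> \<partial>P x)"
      using E1 by (intro nnM1) simp
    also have "\<dots> = (\<integral>\<^sup>+\<omega>. indicator {\<omega>\<in>\<Omega>. path I X \<omega> \<in> B} \<omega> \<partial>M2)"
      using E2 by (subst nnM2) (simp_all add: regen[OF B])
    also have "\<dots> = emeasure (distr M2 paths (path I X)) B"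
      using E2 by (subst emeasure_distr) (auto intro!: arg_cong[where f = "emeasure M2"])
    finally show "emeasure (distr M1 paths (path I ?Y)) B = emeasure (distr M2 paths (path I X)) B" .
  qed simp
  have penM1: "penalizable M1 ?Y w" by (rule penalizable_mono_sets[OF pen]) auto
  have penM2: "penalizable M2 X w" by (rule penalizable_mono_sets[OF penalizable_Finf[OF w]]) auto
  have [measurable]: "(\<lambda>\<omega>. Z ?Y w \<omega>) \<in> borel_measurable Finf" using penal_measurable[OF pen w] .
  have "(\<integral>\<^sup>+\<omega>. ennreal (Z ?Y w \<omega>) * h (path I ?Y \<omega>) \<partial>M1) = (\<integral>\<^sup>+\<omega>. ennreal (Z X w \<omega>) * h (path I X \<omega>) \<partial>M2)"
    by (rule penalized_path_law_eq[OF w fin1 fin2 _ _ penM1 penM2 law h]) (use XT in auto)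
  then show ?thesis
    using w by (subst (asm) nnM1) (auto simp: nnM2)
qed

text \<open>The Markov property, freed from conditional expectations.\<close>

lemma markov_regeneration:
  assumes s: "s \<in> I" and V: "V \<in> borel_measurable (F s)" and B[measurable]: "B \<in> sets paths"
  shows "(\<integral>\<^sup>+\<omega>. V \<omega> * indicator {\<omega>\<in>\<Omega>. path I (\<lambda>r \<omega>. X (s + r) \<omega>) \<omega> \<in> B} \<omega> \<partial>P x) =
      (\<integral>\<^sup>+\<omega>. V \<omega> * emeasure (P (X s \<omega>)) {\<omega>'\<in>\<Omega>. path I X \<omega>' \<in> B} \<partial>P x)"
proof -
  have pY[measurable]: "path I (\<lambda>r \<omega>. X (s + r) \<omega>) \<in> Finf \<rightarrow>\<^sub>M paths"
    by (rule measurable_path) (use s in simp)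
  note [measurable] = X_Finf[OF s]
  have E1: "{\<omega>\<in>\<Omega>. path I (\<lambda>r \<omega>. X (s + r) \<omega>) \<omega> \<in> B} \<in> sets Finf" and E2: "{\<omega>\<in>\<Omega>. path I X \<omega> \<in> B} \<in> sets Finf"
    by (rule Finf_preimage[OF pY B], rule Finf_preimage[OF path_Finf B])
  have em: "emeasure (P y) {\<omega>'\<in>\<Omega>. path I X \<omega>' \<in> B} = ennreal (measure (P y) {\<omega>'\<in>\<Omega>. path I X \<omega>' \<in> B})" for y
  proof -
    interpret prob_space "P y" by simp
    show ?thesis by (rule emeasure_eq_measure)
  qed
  have "(\<lambda>y. measure (P y) {\<omega>'\<in>\<Omega>. path I X \<omega>' \<in> B}) \<in> borel_measurable borel"
    by (rule measurable_compose[OF kernel_subprob[OF P_kernel] measurable_measure_subprob_algebra[OF E2]])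
  then have g: "(\<lambda>\<omega>. measure (P (X s \<omega>)) {\<omega>'\<in>\<Omega>. path I X \<omega>' \<in> B}) \<in> borel_measurable (P x)"
    by measurable
  have ce: "AE \<omega> in P x. real_cond_exp (P x) (F s) (indicator {\<omega>\<in>\<Omega>. path I (\<lambda>r \<omega>. X (s + r) \<omega>) \<omega> \<in> B}) \<omega> =
      measure (P (X s \<omega>)) {\<omega>'\<in>\<Omega>. path I X \<omega>' \<in> B}"
    using markov s B by (simp add: markov_process_def)
  show ?thesis
    unfolding em
    by (rule nn_integral_weight_cond_exp_indicator[OF prob_P subalgebra_F[OF sets_P s] _ sets.top g _ _ V])
      (use ce E1 s in auto)
qed

text \<open>The penalization after time \<open>s\<close> is the penalization of the shifted path, which regenerates with that path.\<close>

lemma penalized_markov: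
  assumes s: "s \<in> I" and w: "w \<in> I" and V: "V \<in> borel_measurable (F s)" and Vfin: "(\<integral>\<^sup>+\<omega>. V \<omega> \<partial>P x) < \<infinity>"
    and h[measurable]: "h \<in> borel_measurable paths"
  shows "(\<integral>\<^sup>+\<omega>. V \<omega> * (ennreal (Z X (s + w) \<omega>) * h (path I (\<lambda>r \<omega>. X (s + r) \<omega>) \<omega>)) \<partial>P x) =
    (\<integral>\<^sup>+\<omega>. V \<omega> * (ennreal (Z X s \<omega>) * (\<integral>\<^sup>+\<omega>'. ennreal (Z X w \<omega>') * h (path I X \<omega>') \<partial>P (X s \<omega>))) \<partial>P x)"
proof -
  let ?Y = "\<lambda>r \<omega>. X (s + r) \<omega>"
  let ?V = "\<lambda>\<omega>. V \<omega> * ennreal (Z X s \<omega>)"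
  have V': "?V \<in> borel_measurable (F s)"
    using V Z_F[OF s] by measurable
  have pen: "penalizable Finf ?Y w"
  proof -
    have "(\<lambda>p. (s + fst p, snd p)) \<in> restrict_space borel (I \<inter> {..w}) \<Otimes>\<^sub>M Finf \<rightarrow>\<^sub>M restrict_space borel (I \<inter> {..s + w}) \<Otimes>\<^sub>M Finf"
    proof (rule measurable_Pair)
      have "(\<lambda>r. s + r) \<in> restrict_space borel (I \<inter> {..w}) \<rightarrow>\<^sub>M restrict_space borel (I \<inter> {..s + w})"
        using s by (intro measurable_restrict_space2 measurable_restrict_space1) (auto simp: space_restrict_space)
      then show "(\<lambda>p. s + fst p) \<in> restrict_space borel (I \<inter> {..w}) \<Otimes>\<^sub>M Finf \<rightarrow>\<^sub>M restrict_space borel (I \<inter> {..s + w})"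
        by (rule measurable_compose[OF measurable_fst])
    qed (rule measurable_snd)
    from measurable_compose[OF this penalizable_Finf[OF time_add[OF s w]]] show ?thesis
      by (simp add: case_prod_beta')
  qed
  have "(\<integral>\<^sup>+\<omega>. V \<omega> * (ennreal (Z X (s + w) \<omega>) * h (path I ?Y \<omega>)) \<partial>P x) =
      (\<integral>\<^sup>+\<omega>. ?V \<omega> * (ennreal (Z ?Y w \<omega>) * h (path I ?Y \<omega>)) \<partial>P x)"
    using s w by (intro nn_integral_cong)
      (simp add: penal_add[OF penalizable_Finf] ennreal_mult ac_simps)
  also have "\<dots> = (\<integral>\<^sup>+\<omega>. ?V \<omega> * (\<integral>\<^sup>+\<omega>'. ennreal (Z X w \<omega>') * h (path I X \<omega>') \<partial>P (X s \<omega>)) \<partial>P x)"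
  proof (rule penalized_regeneration[where T = "\<lambda>_. s", OF _ _ _ w pen markov_regeneration[OF s V'] h])
    show "?V \<in> borel_measurable Finf" by (rule measurable_F_Finf[OF V' s])
    have "(\<integral>\<^sup>+\<omega>. ?V \<omega> \<partial>P x) \<le> (\<integral>\<^sup>+\<omega>. V \<omega> * 1 \<partial>P x)"
      using s by (intro nn_integral_mono mult_left_mono) (auto simp: ennreal_le_1)
    then show "(\<integral>\<^sup>+\<omega>. ?V \<omega> \<partial>P x) < \<infinity>" using Vfin by (simp add: order.strict_trans1)
  qed (use s in auto)
  finally show ?thesis by (simp add: ac_simps)
qed

end

lemma real_cond_exp_indicator_eqI:
  assumes M: "prob_space M" and G: "subalgebra M G" and E: "E \<in> sets M"
    and g: "g \<in> borel_measurable G" "\<And>\<omega>. 0 \<le> g \<omega>" "\<And>\<omega>. g \<omega> \<le> 1"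
    and eq: "\<And>A. A \<in> sets G \<Longrightarrow>
      (\<integral>\<^sup>+\<omega>. indicator A \<omega> * indicator E \<omega> \<partial>M) = (\<integral>\<^sup>+\<omega>. indicator A \<omega> * ennreal (g \<omega>) \<partial>M)"
  shows "AE \<omega> in M. real_cond_exp M G (indicator E) \<omega> = g \<omega>"
proof -
  interpret M: prob_space M by fact
  interpret finite_measure_subalgebra M G
    by (intro finite_measure_subalgebra.intro M.finite_measure_axioms finite_measure_subalgebra_axioms.intro G)
  have gM: "g \<in> borel_measurable M" by (rule measurable_from_subalg[OF G g(1)])
  have i1: "integrable M (indicator E :: _ \<Rightarrow> real)"
    using E M.emeasure_finite[of E] by (intro integrable_real_indicator) (auto simp: less_top[symmetric])
  have i2: "integrable M g"
    using gM g by (intro M.integrable_const_bound[where B = 1]) auto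
  show ?thesis
  proof (rule real_cond_exp_charact[OF _ i1 i2 g(1)])
    fix A assume A: "A \<in> sets G"
    then have AM: "A \<in> sets M" using G by (auto simp: subalgebra_def)
    have j1: "integrable M (\<lambda>\<omega>. indicator A \<omega> * indicator E \<omega> :: real)"
      and j2: "integrable M (\<lambda>\<omega>. indicator A \<omega> * g \<omega>)"
      using integrable_mult_indicator[OF AM i1] integrable_mult_indicator[OF AM i2] by auto
    have "ennreal (\<integral>\<omega>. indicator A \<omega> * indicator E \<omega> \<partial>M) = (\<integral>\<^sup>+\<omega>. indicator A \<omega> * indicator E \<omega> \<partial>M)"
      using j1 by (subst nn_integral_eq_integral[symmetric]) (auto intro!: nn_integral_cong simp: indicator_def)
    also have "\<dots> = (\<integral>\<^sup>+\<omega>. indicator A \<omega> * ennreal (g \<omega>) \<partial>M)" by (rule eq[OF A])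
    also have "\<dots> = ennreal (\<integral>\<omega>. indicator A \<omega> * g \<omega> \<partial>M)"
      using j2 g by (subst nn_integral_eq_integral[symmetric]) (auto intro!: nn_integral_cong simp: indicator_def)
    finally have "(\<integral>\<omega>. indicator A \<omega> * indicator E \<omega> \<partial>M) = (\<integral>\<omega>. indicator A \<omega> * g \<omega> \<partial>M)"
      by (subst (asm) ennreal_inj) (auto intro!: integral_nonneg_AE simp: g)
    then show "(\<integral>\<omega>\<in>A. indicator E \<omega> \<partial>M) = (\<integral>\<omega>\<in>A. g \<omega> \<partial>M)"
      by (simp add: set_lebesgue_integral_def)
  qed
qed

context penalized_markov
begin

text \<open>A mixture of the laws of a kernel, started from the position \<open>Y\<close> drawn under \<open>M\<close>.\<close>

lemma
  fixes Y :: "'w \<Rightarrow> 'e"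
  assumes M: "sets M = sets Finf" and R: "R \<in> borel \<rightarrow>\<^sub>M prob_algebra Finf"
    and Y[measurable]: "Y \<in> Finf \<rightarrow>\<^sub>M borel"
  shows sets_mixture: "sets (M \<bind> (\<lambda>\<omega>. R (Y \<omega>))) = sets Finf"
    and nn_integral_mixture: "f \<in> borel_measurable Finf \<Longrightarrow>
      (\<integral>\<^sup>+\<omega>. f \<omega> \<partial>(M \<bind> (\<lambda>\<omega>. R (Y \<omega>)))) = (\<integral>\<^sup>+\<omega>. (\<integral>\<^sup>+\<omega>'. f \<omega>' \<partial>R (Y \<omega>)) \<partial>M)"
proof -
  have k: "(\<lambda>\<omega>. R (Y \<omega>)) \<in> M \<rightarrow>\<^sub>M subprob_algebra Finf"
    using measurable_compose[OF Y kernel_subprob[OF R]] M by (simp cong: measurable_cong_sets)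
  have sp: "space M = \<Omega>" using sets_eq_imp_space_eq[OF M] by simp
  show "sets (M \<bind> (\<lambda>\<omega>. R (Y \<omega>))) = sets Finf"
    by (rule sets_bind) (use kernel_sets[OF R] sp Omega_nonempty in auto)
  show "(\<integral>\<^sup>+\<omega>. f \<omega> \<partial>(M \<bind> (\<lambda>\<omega>. R (Y \<omega>)))) = (\<integral>\<^sup>+\<omega>. (\<integral>\<^sup>+\<omega>'. f \<omega>' \<partial>R (Y \<omega>)) \<partial>M)"
    if "f \<in> borel_measurable Finf"
    by (rule nn_integral_bind[OF that k])
qed

definition cylinder :: "real set \<Rightarrow> (real \<Rightarrow> 'e set) \<Rightarrow> (real \<Rightarrow> 'e) set" where
  "cylinder J B = prod_emb I (\<lambda>_. borel) J (Pi\<^sub>E J B)"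

lemma path_in_cylinder:
  "J \<subseteq> I \<Longrightarrow> path I Y \<omega> \<in> cylinder J B \<longleftrightarrow> (\<forall>j\<in>J. Y j \<omega> \<in> B j)"
  by (auto simp: cylinder_def prod_emb_def PiE_iff)

lemma cylinder_sets:
  "finite J \<Longrightarrow> J \<subseteq> I \<Longrightarrow> (\<And>j. j \<in> J \<Longrightarrow> B j \<in> sets borel) \<Longrightarrow> cylinder J B \<in> sets paths"
  unfolding cylinder_def by (intro sets_PiM_I) auto

lemma cylinder_preimage:
  assumes "finite J" "J \<subseteq> I" "\<And>j. j \<in> J \<Longrightarrow> B j \<in> sets borel"
    and Y: "\<And>j. j \<in> J \<Longrightarrow> Y j \<in> G \<rightarrow>\<^sub>M borel" and "space G = \<Omega>"
  shows "{\<omega>\<in>\<Omega>. path I Y \<omega> \<in> cylinder J B} \<in> sets G"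
proof -
  have "{\<omega>\<in>space G. \<forall>j\<in>J. Y j \<omega> \<in> B j} \<in> sets G"
    using assms by (intro sets.sets_Collect_finite_All measurable_sets_borel
        measurable_sets[OF Y, unfolded vimage_def Int_def, simplified conj_commute mem_Collect_eq]) auto
  then show ?thesis using assms by (simp add: path_in_cylinder)
qed

text \<open>Regeneration needs to be checked only on cylinders.\<close>

lemma regeneration_of_cylinders:
  assumes R: "R \<in> borel \<rightarrow>\<^sub>M prob_algebra Finf" and A: "A \<in> sets Finf"
    and Y: "\<forall>r\<in>I. Y r \<in> Finf \<rightarrow>\<^sub>M borel"
    and cyl: "\<And>J B. finite J \<Longrightarrow> J \<subseteq> I \<Longrightarrow> (\<And>j. j \<in> J \<Longrightarrow> B j \<in> sets borel) \<Longrightarrow>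
      (\<integral>\<^sup>+\<omega>. indicator A \<omega> * indicator {\<omega>\<in>\<Omega>. path I Y \<omega> \<in> cylinder J B} \<omega> \<partial>R x) =
      (\<integral>\<^sup>+\<omega>. indicator A \<omega> * emeasure (R (Y 0 \<omega>)) {\<omega>'\<in>\<Omega>. path I X \<omega>' \<in> cylinder J B} \<partial>R x)"
    and B: "B \<in> sets paths"
  shows "(\<integral>\<^sup>+\<omega>. indicator A \<omega> * indicator {\<omega>\<in>\<Omega>. path I Y \<omega> \<in> B} \<omega> \<partial>R x) =
      (\<integral>\<^sup>+\<omega>. indicator A \<omega> * emeasure (R (Y 0 \<omega>)) {\<omega>'\<in>\<Omega>. path I X \<omega>' \<in> B} \<partial>R x)"
proof -
  interpret R: prob_space "R x" by (rule kernel_prob[OF R])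
  have sR [simp, measurable_cong]: "sets (R y) = sets Finf" for y by (rule kernel_sets[OF R])
  have spR [simp]: "space (R y) = \<Omega>" for y using sets_eq_imp_space_eq[OF sR] by simp
  note [measurable] = A
  have Y0[measurable]: "Y 0 \<in> Finf \<rightarrow>\<^sub>M borel" using Y by simp
  have pY[measurable]: "path I Y \<in> Finf \<rightarrow>\<^sub>M paths" by (rule measurable_path[OF Y])
  let ?M = "density (R x) (indicator A)"
  let ?N = "?M \<bind> (\<lambda>\<omega>. R (Y 0 \<omega>))"
  have sM [measurable_cong]: "sets ?M = sets Finf" by simp
  have sN [measurable_cong]: "sets ?N = sets Finf" by (rule sets_mixture[OF sM R Y0])
  have 1: "emeasure (distr ?M paths (path I Y)) B =
      (\<integral>\<^sup>+\<omega>. indicator A \<omega> * indicator {\<omega>\<in>\<Omega>. path I Y \<omega> \<in> B} \<omega> \<partial>R x)" if B: "B \<in> sets paths" for B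
  proof -
    note E = Finf_preimage[OF pY B]
    have "emeasure (distr ?M paths (path I Y)) B = emeasure ?M {\<omega>\<in>\<Omega>. path I Y \<omega> \<in> B}"
      using B by (subst emeasure_distr) (auto intro!: arg_cong[where f = "emeasure ?M"])
    then show ?thesis using E by (simp add: emeasure_density)
  qed
  have 2: "emeasure (distr ?N paths (path I X)) B =
      (\<integral>\<^sup>+\<omega>. indicator A \<omega> * emeasure (R (Y 0 \<omega>)) {\<omega>'\<in>\<Omega>. path I X \<omega>' \<in> B} \<partial>R x)" if B: "B \<in> sets paths" for B
  proof -
    note E = Finf_preimage[OF path_Finf B]
    have k: "(\<lambda>\<omega>. emeasure (R (Y 0 \<omega>)) {\<omega>'\<in>\<Omega>. path I X \<omega>' \<in> B}) \<in> borel_measurable Finf"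
      by (rule measurable_compose[OF measurable_compose[OF Y0 kernel_subprob[OF R]]
            measurable_emeasure_subprob_algebra[OF E]])
    have "emeasure (distr ?N paths (path I X)) B = emeasure ?N {\<omega>\<in>\<Omega>. path I X \<omega> \<in> B}"
      using B sets_eq_imp_space_eq[OF sN]
      by (subst emeasure_distr) (auto intro!: arg_cong[where f = "emeasure ?N"])
    also have "\<dots> = (\<integral>\<^sup>+\<omega>. indicator {\<omega>\<in>\<Omega>. path I X \<omega> \<in> B} \<omega> \<partial>?N)"
      using E sN by simp
    also have "\<dots> = (\<integral>\<^sup>+\<omega>. emeasure (R (Y 0 \<omega>)) {\<omega>'\<in>\<Omega>. path I X \<omega>' \<in> B} \<partial>?M)"
      using E by (subst nn_integral_mixture[OF sM R Y0]) simp_all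
    also have "\<dots> = (\<integral>\<^sup>+\<omega>. indicator A \<omega> * emeasure (R (Y 0 \<omega>)) {\<omega>'\<in>\<Omega>. path I X \<omega>' \<in> B} \<partial>R x)"
      using k by (subst nn_integral_density) auto
    finally show ?thesis .
  qed
  have "distr ?M paths (path I Y) = distr ?N paths (path I X)"
  proof (rule measure_eqI_PiM_infinite)
    fix B J assume J: "finite J" "J \<subseteq> I" "\<And>i. i \<in> J \<Longrightarrow> B i \<in> sets (borel :: 'e measure)"
    show "emeasure (distr ?M paths (path I Y)) (prod_emb I (\<lambda>_. borel) J (Pi\<^sub>E J B)) =
        emeasure (distr ?N paths (path I X)) (prod_emb I (\<lambda>_. borel) J (Pi\<^sub>E J B))"
      using cyl[OF J] 1[OF cylinder_sets[OF J]] 2[OF cylinder_sets[OF J]] by (simp add: cylinder_def)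
  next
    have "emeasure ?M \<Omega> = emeasure (R x) A"
      using nn_integral_density[of "indicator A" "R x" "\<lambda>_. 1"] A by simp
    then have "emeasure ?M \<Omega> \<noteq> \<infinity>" by (simp add: R.emeasure_finite)
    then show "finite_measure (distr ?M paths (path I Y))"
      by (intro finite_measure.finite_measure_distr finite_measureI) auto
  qed auto
  then show ?thesis using 1[OF B] 2[OF B] by simp
qed

end

section \<open>The h-transform of a penalized Markov process\<close>

locale penalized_h_transform = penalized_markov I \<rho> K \<Omega> F X P
  for I and \<rho> :: "'e::t1_space \<Rightarrow> real" and K \<Omega> F and X :: "real \<Rightarrow> 'w \<Rightarrow> 'e" and P +
  fixes \<eta> :: "'e \<Rightarrow> real" and l0 :: real
  assumes eta_measurable [measurable]: "\<eta> \<in> borel_measurable borel"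
    and eta_pos [simp]: "\<And>x. 0 < \<eta> x"
    and eta_eigen: "\<And>t x. t \<in> I \<Longrightarrow>
      (\<integral>\<^sup>+\<omega>. ennreal (Z X t \<omega>) * ennreal (\<eta> (X t \<omega>)) \<partial>P x) = ennreal (exp (- l0 * t) * \<eta> x)"
    and proj_limits: "projective_limits_exist I \<Omega> F"
begin

lemma eta_nonneg [simp]: "0 \<le> \<eta> x" by (rule less_imp_le) (rule eta_pos)

definition mart :: "real \<Rightarrow> 'w \<Rightarrow> ennreal" where
  "mart t \<omega> = ennreal (exp (l0 * t)) * (ennreal (Z X t \<omega>) * ennreal (\<eta> (X t \<omega>)))"

lemma mart_F: "t \<in> I \<Longrightarrow> mart t \<in> borel_measurable (F t)"
  unfolding mart_def using Z_F[of t] X_F[of t] by measurable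

lemma mart_Finf [measurable]: "t \<in> I \<Longrightarrow> mart t \<in> borel_measurable Finf"
  by (rule measurable_F_Finf[OF mart_F])

lemma nn_integral_eigen:
  assumes t: "t \<in> I"
  shows "(\<integral>\<^sup>+\<omega>. a * (ennreal (Z X t \<omega>) * ennreal (\<eta> (X t \<omega>))) \<partial>P x) = a * ennreal (exp (- l0 * t) * \<eta> x)"
proof -
  have "(\<lambda>\<omega>. ennreal (Z X t \<omega>) * ennreal (\<eta> (X t \<omega>))) \<in> borel_measurable (P x)"
    using t by measurable
  then show ?thesis by (simp only: nn_integral_cmult eta_eigen[OF t])
qed

lemma nn_integral_mart: "t \<in> I \<Longrightarrow> (\<integral>\<^sup>+\<omega>. mart t \<omega> \<partial>P x) = ennreal (\<eta> x)"
  unfolding mart_def nn_integral_eigen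
  by (simp add: ennreal_mult[symmetric] mult.assoc[symmetric] exp_add[symmetric])

text \<open>By the Markov property and the eigenfunction equation.\<close>

lemma mart_martingale:
  assumes s: "s \<in> I" and t: "t \<in> I" and st: "s \<le> t" and A: "A \<in> sets (F s)"
  shows "(\<integral>\<^sup>+\<omega>. indicator A \<omega> * mart t \<omega> \<partial>P x) = (\<integral>\<^sup>+\<omega>. indicator A \<omega> * mart s \<omega> \<partial>P x)"
proof -
  define w where "w = t - s"
  have w: "w \<in> I" and t_eq: "t = s + w" using s t st by (auto simp: w_def)
  interpret prob_space "P x" by simp
  have AM: "A \<in> sets Finf" using A sets_F_Finf[OF s] by auto
  have fin: "(\<integral>\<^sup>+\<omega>. indicator A \<omega> \<partial>P x) < \<infinity>"
    using AM by (simp add: less_top[symmetric])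
  have h: "(\<lambda>q. ennreal (exp (l0 * t) * \<eta> (q w))) \<in> borel_measurable paths"
    using w by measurable
  have "(\<integral>\<^sup>+\<omega>. indicator A \<omega> * mart t \<omega> \<partial>P x) =
      (\<integral>\<^sup>+\<omega>. indicator A \<omega> * (ennreal (Z X (s + w) \<omega>) * ennreal (exp (l0 * t) * \<eta> (path I (\<lambda>r \<omega>. X (s + r) \<omega>) \<omega> w))) \<partial>P x)"
    using w by (intro nn_integral_cong) (simp add: mart_def t_eq ennreal_mult ac_simps)
  also have "\<dots> = (\<integral>\<^sup>+\<omega>. indicator A \<omega> * (ennreal (Z X s \<omega>) *
      (\<integral>\<^sup>+\<omega>'. ennreal (Z X w \<omega>') * ennreal (exp (l0 * t) * \<eta> (path I X \<omega>' w)) \<partial>P (X s \<omega>))) \<partial>P x)"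
    using A by (intro penalized_markov[OF s w _ fin h]) simp
  also have "\<dots> = (\<integral>\<^sup>+\<omega>. indicator A \<omega> * mart s \<omega> \<partial>P x)"
  proof (rule nn_integral_cong)
    fix \<omega>
    have "(\<integral>\<^sup>+\<omega>'. ennreal (Z X w \<omega>') * ennreal (exp (l0 * t) * \<eta> (path I X \<omega>' w)) \<partial>P (X s \<omega>)) =
        (\<integral>\<^sup>+\<omega>'. ennreal (exp (l0 * t)) * (ennreal (Z X w \<omega>') * ennreal (\<eta> (X w \<omega>'))) \<partial>P (X s \<omega>))"
      using w by (intro nn_integral_cong) (simp add: ennreal_mult ac_simps)
    also have "\<dots> = ennreal (exp (l0 * t)) * ennreal (exp (- l0 * w) * \<eta> (X s \<omega>))"
      by (rule nn_integral_eigen[OF w])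
    also have "\<dots> = ennreal (exp (l0 * s)) * ennreal (\<eta> (X s \<omega>))"
      by (simp add: ennreal_mult[symmetric] t_eq exp_add[symmetric] distrib_left algebra_simps
          flip: mult.assoc)
    finally show "indicator A \<omega> * (ennreal (Z X s \<omega>) *
        (\<integral>\<^sup>+\<omega>'. ennreal (Z X w \<omega>') * ennreal (exp (l0 * t) * \<eta> (path I X \<omega>' w)) \<partial>P (X s \<omega>))) =
        indicator A \<omega> * mart s \<omega>"
      by (simp add: mart_def ac_simps)
  qed
  finally show ?thesis .
qed

lemma Q_exists:
  "\<exists>Q. prob_space Q \<and> sets Q = sets Finf \<and>
    (\<forall>t\<in>I. \<forall>A\<in>sets (F t). ennreal (\<eta> x) * emeasure Q A = (\<integral>\<^sup>+\<omega>. indicator A \<omega> * mart t \<omega> \<partial>P x))"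
proof -
  define R where "R t = density (restr_to_subalg (P x) (F t)) (\<lambda>\<omega>. ennreal (1 / \<eta> x) * mart t \<omega>)" for t
  have sR: "sets (R t) = sets (F t)" if "t \<in> I" for t
    unfolding R_def by (simp add: sets_restr_to_subalg[OF subalgebra_F[OF sets_P that]])
  have eR: "emeasure (R t) A = ennreal (1 / \<eta> x) * (\<integral>\<^sup>+\<omega>. indicator A \<omega> * mart t \<omega> \<partial>P x)"
    if t: "t \<in> I" and A: "A \<in> sets (F t)" for t A
  proof -
    note sub = subalgebra_F[OF sets_P t]
    have m: "(\<lambda>\<omega>. ennreal (1 / \<eta> x) * mart t \<omega> * indicator A \<omega>) \<in> borel_measurable (F t)"
      using mart_F[OF t] A by measurable
    have AM[measurable]: "A \<in> sets Finf" using A sets_F_Finf[OF t] by auto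
    have "emeasure (R t) A = (\<integral>\<^sup>+\<omega>. ennreal (1 / \<eta> x) * mart t \<omega> * indicator A \<omega> \<partial>restr_to_subalg (P x) (F t))"
      unfolding R_def using mart_F[OF t] A
      by (intro emeasure_density)
        (simp_all add: sets_restr_to_subalg[OF sub] measurable_cong_sets[OF sets_restr_to_subalg[OF sub] refl])
    also have "\<dots> = (\<integral>\<^sup>+\<omega>. ennreal (1 / \<eta> x) * (indicator A \<omega> * mart t \<omega>) \<partial>P x)"
      by (subst nn_integral_subalgebra2[OF sub m]) (auto intro!: nn_integral_cong simp: ac_simps)
    also have "\<dots> = ennreal (1 / \<eta> x) * (\<integral>\<^sup>+\<omega>. indicator A \<omega> * mart t \<omega> \<partial>P x)"
      by (rule nn_integral_cmult) (use t in measurable)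
    finally show ?thesis .
  qed
  have pR: "prob_space (R t)" if t: "t \<in> I" for t
  proof (rule prob_spaceI)
    have sp: "space (R t) = \<Omega>" using sets_eq_imp_space_eq[OF sR[OF t]] t by simp
    have "emeasure (R t) \<Omega> = ennreal (1 / \<eta> x) * (\<integral>\<^sup>+\<omega>. mart t \<omega> \<partial>P x)"
      using t sets.top[of "F t"] by (subst eR) (auto intro!: arg_cong[where f = "(*) _"] nn_integral_cong)
    then show "emeasure (R t) (space (R t)) = 1"
      using eta_pos[of x] t by (simp add: sp nn_integral_mart ennreal_mult[symmetric] del: eta_pos)
  qed
  have cR: "emeasure (R t) A = emeasure (R s) A" if "s \<in> I" "t \<in> I" "s \<le> t" "A \<in> sets (F s)" for s t A
    using that sets_F_mono[of s t] by (simp add: eR subset_iff mart_martingale[OF that])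
  have R_family: "(\<forall>t\<in>I. prob_space (R t) \<and> sets (R t) = sets (F t)) \<and>
      (\<forall>s\<in>I. \<forall>t\<in>I. s \<le> t \<longrightarrow> (\<forall>A\<in>sets (F s). emeasure (R t) A = emeasure (R s) A))"
    using pR sR cR by blast
  obtain Q where Q: "prob_space Q \<and> sets Q = sets Finf \<and>
      (\<forall>t\<in>I. \<forall>A\<in>sets (F t). emeasure Q A = emeasure (R t) A)"
    using mp[OF spec[OF proj_limits[unfolded projective_limits_exist_def], of R] R_family] ..
  have "ennreal (\<eta> x) * emeasure Q A = (\<integral>\<^sup>+\<omega>. indicator A \<omega> * mart t \<omega> \<partial>P x)"
    if "t \<in> I" "A \<in> sets (F t)" for t A
    using eta_pos[of x] that Q
    by (simp add: eR ennreal_mult[symmetric] mult.assoc[symmetric] del: eta_pos)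
  then show ?thesis using Q by blast
qed

definition Q :: "'e \<Rightarrow> 'w measure" where
  "Q x = (SOME Q. prob_space Q \<and> sets Q = sets Finf \<and>
    (\<forall>t\<in>I. \<forall>A\<in>sets (F t). ennreal (\<eta> x) * emeasure Q A = (\<integral>\<^sup>+\<omega>. indicator A \<omega> * mart t \<omega> \<partial>P x)))"

lemma prob_Q [simp]: "prob_space (Q x)"
  and sets_Q [simp, measurable_cong]: "sets (Q x) = sets Finf"
  and emeasure_Q: "t \<in> I \<Longrightarrow> A \<in> sets (F t) \<Longrightarrow>
    ennreal (\<eta> x) * emeasure (Q x) A = (\<integral>\<^sup>+\<omega>. indicator A \<omega> * mart t \<omega> \<partial>P x)"
  using someI_ex[OF Q_exists[of x]] unfolding Q_def[symmetric] by blast+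

lemma space_Q [simp]: "space (Q x) = \<Omega>"
  using sets_eq_imp_space_eq[OF sets_Q] by simp

lemma eta_cancel: "ennreal (\<eta> x) * a = ennreal (\<eta> x) * b \<longleftrightarrow> a = b"
  using eta_pos[of x] by (intro ennreal_mult_cancel_left[THEN trans]) (auto simp del: eta_pos)

lemma nn_integral_Q:
  assumes t: "t \<in> I" and f: "f \<in> borel_measurable (F t)"
  shows "ennreal (\<eta> x) * (\<integral>\<^sup>+\<omega>. f \<omega> \<partial>Q x) = (\<integral>\<^sup>+\<omega>. f \<omega> * mart t \<omega> \<partial>P x)"
proof -
  let ?M = "density (Q x) (\<lambda>_. ennreal (\<eta> x))" and ?N = "density (P x) (mart t)"
  have M: "subalgebra ?M (F t)" and N: "subalgebra ?N (F t)"
    using t by (auto intro!: subalgebra_F)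
  have "restr_to_subalg ?M (F t) = restr_to_subalg ?N (F t)"
  proof (rule measure_eqI)
    fix A assume "A \<in> sets (restr_to_subalg ?M (F t))"
    then have A: "A \<in> sets (F t)" by (simp add: sets_restr_to_subalg[OF M])
    then have AM[measurable]: "A \<in> sets Finf" using sets_F_Finf[OF t] by auto
    have "emeasure ?M A = ennreal (\<eta> x) * emeasure (Q x) A"
      by (simp add: emeasure_density nn_integral_cmult)
    also have "\<dots> = emeasure ?N A"
      using t by (simp add: emeasure_density emeasure_Q[OF t A] mult.commute)
    finally show "emeasure (restr_to_subalg ?M (F t)) A = emeasure (restr_to_subalg ?N (F t)) A"
      by (simp add: emeasure_restr_to_subalg[OF M A] emeasure_restr_to_subalg[OF N A])
  qed (simp add: sets_restr_to_subalg[OF M] sets_restr_to_subalg[OF N])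
  then have "(\<integral>\<^sup>+\<omega>. f \<omega> \<partial>?M) = (\<integral>\<^sup>+\<omega>. f \<omega> \<partial>?N)"
    using nn_integral_subalgebra2[OF M f] nn_integral_subalgebra2[OF N f] by simp
  then show ?thesis
    using t measurable_F_Finf[OF f t]
    by (simp add: nn_integral_density nn_integral_cmult mult.commute[of _ "mart t _"])
qed

lemma Q_kernel [measurable]: "Q \<in> borel \<rightarrow>\<^sub>M prob_algebra Finf"
proof (rule measurable_prob_algebra_generated[OF sets_Finf _ sets_F_Pow])
  show "Int_stable (\<Union>t\<in>I. sets (F t))"
  proof (rule Int_stableI)
    fix A B assume "A \<in> (\<Union>t\<in>I. sets (F t))" "B \<in> (\<Union>t\<in>I. sets (F t))"
    then obtain s t where st: "s \<in> I" "t \<in> I" "A \<in> sets (F s)" "B \<in> sets (F t)" by auto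
    then have "A \<in> sets (F (max s t))" "B \<in> sets (F (max s t))"
      using sets_F_mono[of s "max s t"] sets_F_mono[of t "max s t"] by auto
    then show "A \<inter> B \<in> (\<Union>t\<in>I. sets (F t))" using time_max[OF st(1,2)] by blast
  qed
  fix A assume "A \<in> (\<Union>t\<in>I. sets (F t))"
  then obtain t where t: "t \<in> I" and A: "A \<in> sets (F t)" by auto
  have AM[measurable]: "A \<in> sets Finf" using A sets_F_Finf[OF t] by auto
  have e: "emeasure (Q x) A = ennreal (1 / \<eta> x) * (\<integral>\<^sup>+\<omega>. indicator A \<omega> * mart t \<omega> \<partial>P x)" for x
    unfolding emeasure_Q[OF t A, symmetric] using eta_pos[of x]
    by (simp add: mult.assoc[symmetric] ennreal_mult[symmetric] del: eta_pos)
  have "(\<lambda>x. \<integral>\<^sup>+\<omega>. indicator A \<omega> * mart t \<omega> \<partial>P x) \<in> borel_measurable borel"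
    using t by (intro kernel_nn_integral_measurable[OF P_kernel]) measurable
  then show "(\<lambda>x. emeasure (Q x) A) \<in> borel_measurable borel"
    unfolding e by measurable
qed simp_all

lemma Q_X_zero: "AE \<omega> in Q x. X 0 \<omega> = x"
proof -
  have [measurable]: "{x} \<in> sets borel" by simp
  have A: "{\<omega>\<in>\<Omega>. X 0 \<omega> \<noteq> x} \<in> sets (F 0)"
  proof -
    have "X 0 -` (- {x}) \<inter> space (F 0) \<in> sets (F 0)"
      by (rule measurable_sets[OF X_F]) auto
    then show ?thesis by (simp add: vimage_def Int_def conj_commute)
  qed
  have "(\<integral>\<^sup>+\<omega>. indicator {\<omega>\<in>\<Omega>. X 0 \<omega> \<noteq> x} \<omega> * mart 0 \<omega> \<partial>P x) = (\<integral>\<^sup>+\<omega>. 0 \<partial>P x)"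
    using X_zero[of x] by (intro nn_integral_cong_AE) (auto elim!: eventually_mono)
  then have "ennreal (\<eta> x) * emeasure (Q x) {\<omega>\<in>\<Omega>. X 0 \<omega> \<noteq> x} = 0"
    by (simp add: emeasure_Q[OF zero_in_time A])
  then have "emeasure (Q x) {\<omega>\<in>\<Omega>. X 0 \<omega> \<noteq> x} = 0" using eta_pos[of x] by (simp del: eta_pos)
  then show ?thesis
    using A sets_F_Finf[OF zero_in_time] by (subst AE_iff_measurable[OF _ refl]) auto
qed

text \<open>Under the penalized law, the weighted regeneration becomes the regeneration with the
  h-transformed kernel.\<close>

lemma penalized_to_Q:
  assumes w: "w \<in> I" and h[measurable]: "h \<in> borel_measurable paths"
    and hF: "(\<lambda>\<omega>. h (path I X \<omega>)) \<in> borel_measurable (F w)"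
  shows "(\<integral>\<^sup>+\<omega>'. ennreal (Z X w \<omega>') * (ennreal (exp (l0 * w) * \<eta> (path I X \<omega>' w)) * h (path I X \<omega>')) \<partial>P y) =
    ennreal (\<eta> y) * (\<integral>\<^sup>+\<omega>'. h (path I X \<omega>') \<partial>Q y)"
  unfolding nn_integral_Q[OF w hF]
  using w by (intro nn_integral_cong) (simp add: mart_def ennreal_mult ac_simps)

text \<open>The density at time \<open>s + w\<close> is the product of the density at time \<open>s\<close> and the density at time \<open>w\<close> of the
  shifted path, so the change of measure can be undone in two steps. This needs \<open>h\<close> to depend on the path before a fixed
  time only.\<close>

lemma Q_markov_cylinder:
  assumes s: "s \<in> I" and w: "w \<in> I" and A: "A \<in> sets (F s)" and h: "h \<in> borel_measurable paths"
    and hF: "(\<lambda>\<omega>. h (path I X \<omega>)) \<in> borel_measurable (F w)"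
    and hsF: "(\<lambda>\<omega>. h (path I (\<lambda>r \<omega>. X (s + r) \<omega>) \<omega>)) \<in> borel_measurable (F (s + w))"
  shows "(\<integral>\<^sup>+\<omega>. indicator A \<omega> * h (path I (\<lambda>r \<omega>. X (s + r) \<omega>) \<omega>) \<partial>Q x) =
    (\<integral>\<^sup>+\<omega>. indicator A \<omega> * (\<integral>\<^sup>+\<omega>'. h (path I X \<omega>') \<partial>Q (X s \<omega>)) \<partial>Q x)"
proof -
  let ?Y = "\<lambda>r \<omega>. X (s + r) \<omega>"
  interpret prob_space "P x" by simp
  have AM: "A \<in> sets Finf" using A sets_F_Finf[OF s] by auto
  have A': "A \<in> sets (F (s + w))" using A sets_F_mono[of s "s + w"] s w time_nonneg by auto
  have h': "(\<lambda>q. ennreal (exp (l0 * w) * \<eta> (q w)) * h q) \<in> borel_measurable paths"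
    using w h by measurable
  have V: "(\<lambda>\<omega>. indicator A \<omega> * ennreal (exp (l0 * s))) \<in> borel_measurable (F s)" using A by measurable
  have Vfin: "(\<integral>\<^sup>+\<omega>. indicator A \<omega> * ennreal (exp (l0 * s)) \<partial>P x) < \<infinity>"
    using AM by (subst nn_integral_multc) (simp_all add: less_top[symmetric] ennreal_mult_eq_top_iff emeasure_finite)
  have inner: "(\<lambda>\<omega>. \<integral>\<^sup>+\<omega>'. h (path I X \<omega>') \<partial>Q (X s \<omega>)) \<in> borel_measurable (F s)"
    by (rule measurable_compose[OF X_F[OF s] kernel_nn_integral_measurable[OF Q_kernel measurable_F_Finf[OF hF w]]])
  have "ennreal (\<eta> x) * (\<integral>\<^sup>+\<omega>. indicator A \<omega> * h (path I ?Y \<omega>) \<partial>Q x) =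
      (\<integral>\<^sup>+\<omega>. indicator A \<omega> * h (path I ?Y \<omega>) * mart (s + w) \<omega> \<partial>P x)"
    using A' hsF s w by (intro nn_integral_Q) (auto intro!: borel_measurable_times_ennreal)
  also have "\<dots> = (\<integral>\<^sup>+\<omega>. (indicator A \<omega> * ennreal (exp (l0 * s))) * (ennreal (Z X (s + w) \<omega>) *
      (ennreal (exp (l0 * w) * \<eta> (path I ?Y \<omega> w)) * h (path I ?Y \<omega>))) \<partial>P x)"
    using s w by (intro nn_integral_cong) (simp add: mart_def ennreal_mult exp_add distrib_left ac_simps)
  also have "\<dots> = (\<integral>\<^sup>+\<omega>. (indicator A \<omega> * ennreal (exp (l0 * s))) * (ennreal (Z X s \<omega>) *
      (\<integral>\<^sup>+\<omega>'. ennreal (Z X w \<omega>') * (ennreal (exp (l0 * w) * \<eta> (path I X \<omega>' w)) * h (path I X \<omega>')) \<partial>P (X s \<omega>))) \<partial>P x)"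
    by (rule penalized_markov[OF s w V Vfin h'])
  also have "\<dots> = (\<integral>\<^sup>+\<omega>. indicator A \<omega> * (\<integral>\<^sup>+\<omega>'. h (path I X \<omega>') \<partial>Q (X s \<omega>)) * mart s \<omega> \<partial>P x)"
    unfolding penalized_to_Q[OF w h hF] by (intro nn_integral_cong) (simp add: mart_def ac_simps)
  also have "\<dots> = ennreal (\<eta> x) * (\<integral>\<^sup>+\<omega>. indicator A \<omega> * (\<integral>\<^sup>+\<omega>'. h (path I X \<omega>') \<partial>Q (X s \<omega>)) \<partial>Q x)"
    using A inner by (intro nn_integral_Q[OF s, symmetric]) (auto intro!: borel_measurable_times_ennreal)
  finally show ?thesis by (simp only: eta_cancel)
qed

lemma horizon: "finite J \<Longrightarrow> J \<subseteq> I \<Longrightarrow> \<exists>u\<in>I. \<forall>j\<in>J. j \<le> u"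
proof (induction J rule: finite_induct)
  case (insert j J)
  then obtain u where "u \<in> I" "\<forall>i\<in>J. i \<le> u" by auto
  then show ?case using insert.prems by (intro bexI[of _ "max j u"]) (auto simp: le_max_iff_disj)
qed (auto intro: zero_in_time)

lemma Q_markov: "markov_process I \<Omega> F X Q"
proof -
  have "AE \<omega> in Q x. real_cond_exp (Q x) (F s) (indicator {\<omega>\<in>\<Omega>. path I (\<lambda>r \<omega>. X (s + r) \<omega>) \<omega> \<in> B}) \<omega> =
      measure (Q (X s \<omega>)) {\<omega>'\<in>\<Omega>. path I X \<omega>' \<in> B}"
    if s: "s \<in> I" and B: "B \<in> sets paths" for x s B
  proof (rule real_cond_exp_indicator_eqI[OF prob_Q subalgebra_F[OF sets_Q s]])
    let ?Y = "\<lambda>r \<omega>. X (s + r) \<omega>"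
    have Y: "\<forall>r\<in>I. ?Y r \<in> Finf \<rightarrow>\<^sub>M borel" using s by simp
    show "{\<omega>\<in>\<Omega>. path I ?Y \<omega> \<in> B} \<in> sets (Q x)"
      using Finf_preimage[OF measurable_path[OF Y] B] by simp
    show "(\<lambda>\<omega>. measure (Q (X s \<omega>)) {\<omega>'\<in>\<Omega>. path I X \<omega>' \<in> B}) \<in> borel_measurable (F s)"
      by (rule measurable_compose[OF measurable_compose[OF X_F[OF s] kernel_subprob[OF Q_kernel]]
            measurable_measure_subprob_algebra[OF Finf_preimage[OF path_Finf B]]])
    show "measure (Q (X s \<omega>)) {\<omega>'\<in>\<Omega>. path I X \<omega>' \<in> B} \<le> 1" for \<omega>
      by (rule prob_space.prob_le_1[OF prob_Q])
    fix A assume A: "A \<in> sets (F s)"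
    have AM: "A \<in> sets Finf" using A sets_F_Finf[OF s] by auto
    have "(\<integral>\<^sup>+\<omega>. indicator A \<omega> * indicator {\<omega>\<in>\<Omega>. path I ?Y \<omega> \<in> B} \<omega> \<partial>Q x) =
        (\<integral>\<^sup>+\<omega>. indicator A \<omega> * emeasure (Q (?Y 0 \<omega>)) {\<omega>'\<in>\<Omega>. path I X \<omega>' \<in> B} \<partial>Q x)"
    proof (rule regeneration_of_cylinders[OF Q_kernel AM Y _ B])
      fix J B assume J: "finite J" "J \<subseteq> I" "\<And>j. j \<in> J \<Longrightarrow> B j \<in> sets (borel :: 'e measure)"
      obtain u where u: "u \<in> I" "\<forall>j\<in>J. j \<le> u" using horizon[OF J(1,2)] by auto
      have m1: "{\<omega>\<in>\<Omega>. path I X \<omega> \<in> cylinder J B} \<in> sets (F u)"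
        using J u by (intro cylinder_preimage X_F_le) auto
      have m2: "{\<omega>\<in>\<Omega>. path I ?Y \<omega> \<in> cylinder J B} \<in> sets (F (s + u))"
        using J u s by (intro cylinder_preimage X_F_le) auto
      have e: "(\<integral>\<^sup>+\<omega>'. indicator (cylinder J B) (path I X \<omega>') \<partial>Q y) = emeasure (Q y) {\<omega>'\<in>\<Omega>. path I X \<omega>' \<in> cylinder J B}" for y
      proof -
        have "(\<integral>\<^sup>+\<omega>'. indicator (cylinder J B) (path I X \<omega>') \<partial>Q y) = (\<integral>\<^sup>+\<omega>'. indicator {\<omega>'\<in>\<Omega>. path I X \<omega>' \<in> cylinder J B} \<omega>' \<partial>Q y)"
          by (intro nn_integral_cong) (auto simp: indicator_def)
        then show ?thesis using m1 sets_F_Finf[OF u(1)] by auto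
      qed
      have "(\<integral>\<^sup>+\<omega>. indicator A \<omega> * indicator {\<omega>\<in>\<Omega>. path I ?Y \<omega> \<in> cylinder J B} \<omega> \<partial>Q x) =
          (\<integral>\<^sup>+\<omega>. indicator A \<omega> * indicator (cylinder J B) (path I ?Y \<omega>) \<partial>Q x)"
        by (intro nn_integral_cong) (auto simp: indicator_def)
      also have "\<dots> = (\<integral>\<^sup>+\<omega>. indicator A \<omega> * (\<integral>\<^sup>+\<omega>'. indicator (cylinder J B) (path I X \<omega>') \<partial>Q (X s \<omega>)) \<partial>Q x)"
      proof (rule Q_markov_cylinder[OF s u(1) A])
        show "(\<lambda>\<omega>. indicator (cylinder J B) (path I X \<omega>) :: ennreal) \<in> borel_measurable (F u)"
          by (rule borel_measurable_indicator') (use m1 u in simp)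
        show "(\<lambda>\<omega>. indicator (cylinder J B) (path I ?Y \<omega>) :: ennreal) \<in> borel_measurable (F (s + u))"
          by (rule borel_measurable_indicator') (use m2 u s in simp)
      qed (use cylinder_sets[OF J] in simp)
      finally show "(\<integral>\<^sup>+\<omega>. indicator A \<omega> * indicator {\<omega>\<in>\<Omega>. path I ?Y \<omega> \<in> cylinder J B} \<omega> \<partial>Q x) =
          (\<integral>\<^sup>+\<omega>. indicator A \<omega> * emeasure (Q (?Y 0 \<omega>)) {\<omega>'\<in>\<Omega>. path I X \<omega>' \<in> cylinder J B} \<partial>Q x)"
        by (simp add: e)
    qed
    then show "(\<integral>\<^sup>+\<omega>. indicator A \<omega> * indicator {\<omega>\<in>\<Omega>. path I ?Y \<omega> \<in> B} \<omega> \<partial>Q x) =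
        (\<integral>\<^sup>+\<omega>. indicator A \<omega> * ennreal (measure (Q (X s \<omega>)) {\<omega>'\<in>\<Omega>. path I X \<omega>' \<in> B}) \<partial>Q x)"
      using finite_measure.emeasure_eq_measure[OF prob_space.finite_measure[OF prob_Q]] by simp
  qed simp
  then show ?thesis
    using markov Q_X_zero by (simp add: markov_process_def)
qed

end

lemma ennreal_le_of_linear_growth:
  fixes c d k :: ennreal
  assumes le: "\<And>m :: nat. c * of_nat m \<le> d * of_nat m + k" and d: "d < \<infinity>" and k: "k < \<infinity>"
  shows "c \<le> d"
proof -
  have "c \<le> d + k" using le[of 1] by simp
  then have "c < \<infinity>" using d k by (simp add: order.strict_trans1)
  then obtain c' where c': "c = ennreal c'" "0 \<le> c'" by (cases c) auto
  obtain d' where d': "d = ennreal d'" "0 \<le> d'" using d by (cases d) auto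
  obtain k' where k': "k = ennreal k'" "0 \<le> k'" using k by (cases k) auto
  have lin: "(c' - d') * real m \<le> k'" for m
  proof -
    have "ennreal (c' * real m) \<le> ennreal (d' * real m + k')"
      using le[of m] c' d' k'
      by (simp add: ennreal_mult[symmetric] ennreal_of_nat_eq_real_of_nat ennreal_plus[symmetric] del: ennreal_plus)
    then have "c' * real m \<le> d' * real m + k'"
      using d' k' by (subst (asm) ennreal_le_iff) auto
    then show ?thesis by (simp add: algebra_simps)
  qed
  have "\<not> d' < c'"
  proof
    assume "d' < c'"
    then obtain m :: nat where "k' < real m * (c' - d')"
      using reals_Archimedean3[of "c' - d'"] by auto
    then show False using lin[of m] by (simp add: mult.commute)
  qed
  then show ?thesis using c' d' by simp
qed

context time_set
begin

lemma indicator_clock_measurable: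
  "A \<in> sets borel \<Longrightarrow> (indicator A :: real \<Rightarrow> ennreal) \<in> borel_measurable (clock I)"
  unfolding measurable_cong_sets[OF sets_clock refl]
  by (intro measurable_restrict_space1 borel_measurable_indicator)

lemma time_floor:
  assumes "0 \<le> c" obtains c' where "c' \<in> I" "c' \<le> c" "\<And>t. t \<in> I \<Longrightarrow> t \<le> c \<Longrightarrow> t \<le> c'"
proof (cases rule: time_cases)
  case continuous
  then show ?thesis using assms by (intro that[of c]) auto
next
  case discrete
  show ?thesis
  proof (rule that[OF time_real])
    show "real (nat \<lfloor>c\<rfloor>) \<le> c" using assms by simp
    fix t assume "t \<in> I" "t \<le> c"
    then obtain n where n: "t = real n" using discrete by (auto simp: Nats_def)
    then have "int n \<le> \<lfloor>c\<rfloor>" using \<open>t \<le> c\<close> by (simp add: le_floor_iff)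
    then show "t \<le> real (nat \<lfloor>c\<rfloor>)" using n by simp
  qed
qed

end

context penalized_markov
begin

lemma measurable_shift_time:
  assumes T: "T \<in> G \<rightarrow>\<^sub>M borel" and sp: "space G = \<Omega>"
    and T_I: "\<And>\<omega>. \<omega> \<in> \<Omega> \<Longrightarrow> T \<omega> \<in> I" and T_le: "\<And>\<omega>. \<omega> \<in> \<Omega> \<Longrightarrow> T \<omega> \<le> N"
  shows "(\<lambda>p. (T (snd p) + fst p, snd p)) \<in>
    restrict_space borel (I \<inter> {..w}) \<Otimes>\<^sub>M G \<rightarrow>\<^sub>M restrict_space borel (I \<inter> {..N + w}) \<Otimes>\<^sub>M G"
proof (rule measurable_Pair)
  have f: "fst \<in> restrict_space borel (I \<inter> {..w}) \<Otimes>\<^sub>M G \<rightarrow>\<^sub>M borel"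
    by (rule measurable_compose[OF measurable_fst]) (intro measurable_restrict_space1 measurable_ident_sets refl)
  show "(\<lambda>p. T (snd p) + fst p) \<in> restrict_space borel (I \<inter> {..w}) \<Otimes>\<^sub>M G \<rightarrow>\<^sub>M restrict_space borel (I \<inter> {..N + w})"
    using T_I T_le sp
    by (intro measurable_restrict_space2 borel_measurable_add f measurable_compose[OF measurable_snd T])
      (auto simp: space_pair_measure space_restrict_space intro!: add_mono)
qed (rule measurable_snd)

lemma Z_joint:
  assumes t: "t \<in> I"
  shows "(\<lambda>(r, \<omega>). Z X r \<omega>) \<in> borel_measurable (restrict_space borel (I \<inter> {..t}) \<Otimes>\<^sub>M F t)"
proof -
  let ?B = "restrict_space borel (I \<inter> {..t}) \<Otimes>\<^sub>M F t" and ?m = "restrict_space (clock I) {..<t}"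
  interpret m: finite_measure ?m by (rule finite_clock_upto[OF t])
  have b1: "(\<lambda>p. fst (fst p)) \<in> borel_measurable (?B \<Otimes>\<^sub>M ?m)"
    by (rule measurable_compose[OF measurable_compose[OF measurable_fst measurable_fst]])
      (intro measurable_restrict_space1 measurable_ident_sets refl)
  have mB: "(\<lambda>r. r) \<in> borel_measurable ?m"
    unfolding measurable_cong_sets[OF sets_clock_upto refl]
    by (intro measurable_restrict_space1 measurable_ident_sets refl)
  have b2: "(\<lambda>p. snd p) \<in> borel_measurable (?B \<Otimes>\<^sub>M ?m)"
    by (rule measurable_compose[OF measurable_snd mB])
  have "(\<lambda>p. (snd p, snd (fst p))) \<in> ?B \<Otimes>\<^sub>M ?m \<rightarrow>\<^sub>M ?m \<Otimes>\<^sub>M F t"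
    by (intro measurable_Pair measurable_snd measurable_compose[OF measurable_fst measurable_snd])
  from measurable_compose[OF this penalizable_clock[OF penalizable_F[OF t]]]
  have b3: "(\<lambda>p. \<rho> (X (snd p) (snd (fst p)))) \<in> borel_measurable (?B \<Otimes>\<^sub>M ?m)" by simp
  have "(\<lambda>p. indicator {p. snd p < fst (fst p)} p * \<rho> (X (snd p) (snd (fst p)))) \<in> borel_measurable (?B \<Otimes>\<^sub>M ?m)"
    by (intro borel_measurable_times b3 borel_measurable_indicator' borel_measurable_less[OF b2 b1, simplified])
      (use borel_measurable_less[OF b2 b1] in simp)
  then have "(\<lambda>(p, q). indicator {..<fst p} q * \<rho> (X q (snd p))) \<in> borel_measurable (?B \<Otimes>\<^sub>M ?m)"
    by (rule measurable_cong[THEN iffD1, rotated]) (auto simp: indicator_def)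
  then have "(\<lambda>p. exp (- (\<integral>q. indicator {..<fst p} q * \<rho> (X q (snd p)) \<partial>?m))) \<in> borel_measurable ?B"
    by (intro borel_measurable_exp[THEN measurable_compose[rotated]] borel_measurable_uminus
        m.borel_measurable_lebesgue_integral)
  then show ?thesis
  proof (rule measurable_cong[THEN iffD1, rotated])
    fix p assume "p \<in> space ?B"
    then have p: "fst p \<in> I" "fst p \<le> t" by (auto simp: space_pair_measure space_restrict_space)
    have s: "{..<fst p} \<inter> space ?m \<in> sets ?m"
      unfolding sets_clock_upto
      by (auto simp: sets_restrict_space space_restrict_space intro!: image_eqI[of _ _ "{..<fst p}"])
    have "restrict_space ?m {..<fst p} = restrict_space (clock I) {..<fst p}"
      using p by (subst restrict_restrict_space) (auto simp: Int_commute intro!: arg_cong[where f = "restrict_space _"])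
    then have "(\<integral>q. \<rho> (X q (snd p)) \<partial>restrict_space (clock I) {..<fst p}) =
        (\<integral>q. indicator {..<fst p} q * \<rho> (X q (snd p)) \<partial>?m)"
      using integral_restrict_space[OF s, of "\<lambda>q. \<rho> (X q (snd p))"] by simp
    then show "exp (- (\<integral>q. indicator {..<fst p} q * \<rho> (X q (snd p)) \<partial>?m)) = (case p of (r, \<omega>) \<Rightarrow> Z X r \<omega>)"
      using p by (simp add: penal_clock case_prod_beta')
  qed
qed

end

section \<open>The strong Markov property of the h-transform\<close>

context penalized_h_transform
begin

context
  assumes prog: "progressively_measurable I F X"
begin

lemma X_joint: "t \<in> I \<Longrightarrow> (\<lambda>(r, \<omega>). X r \<omega>) \<in> restrict_space borel (I \<inter> {..t}) \<Otimes>\<^sub>M F t \<rightarrow>\<^sub>M borel"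
  using prog by (simp add: progressively_measurable_def)

lemma mart_joint:
  assumes t: "t \<in> I"
  shows "(\<lambda>(r, \<omega>). mart r \<omega>) \<in> borel_measurable (restrict_space borel (I \<inter> {..t}) \<Otimes>\<^sub>M Finf)"
proof -
  let ?B = "restrict_space borel (I \<inter> {..t}) \<Otimes>\<^sub>M F t"
  have "fst \<in> borel_measurable ?B"
    by (rule measurable_compose[OF measurable_fst]) (intro measurable_restrict_space1 measurable_ident_sets refl)
  then have "(\<lambda>p. ennreal (exp (l0 * fst p)) * (ennreal (Z X (fst p) (snd p)) * ennreal (\<eta> (X (fst p) (snd p))))) \<in> borel_measurable ?B"
    using Z_joint[OF t] X_joint[OF t] unfolding case_prod_beta' by measurable
  then have F: "(\<lambda>(r, \<omega>). mart r \<omega>) \<in> borel_measurable ?B"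
    by (simp add: mart_def case_prod_beta')
  have "(\<lambda>p. (fst p, snd p)) \<in> restrict_space borel (I \<inter> {..t}) \<Otimes>\<^sub>M Finf \<rightarrow>\<^sub>M ?B"
    using t sets_F_Finf[OF t]
    by (intro measurable_Pair measurable_fst measurable_compose[OF measurable_snd])
      (auto simp: measurable_def)
  from measurable_compose[OF this F] show ?thesis by simp
qed

text \<open>The time integral of the martingale over a window of length \<open>L\<close> that starts at the random time
  \<open>S\<close>.\<close>

definition window :: "('w \<Rightarrow> real) \<Rightarrow> real \<Rightarrow> 'w \<Rightarrow> ennreal" where
  "window S L \<omega> = (\<integral>\<^sup>+r. mart (S \<omega> + r) \<omega> \<partial>restrict_space (clock I) {..<L})"

lemma mart_section:
  assumes b: "b \<in> I" and \<omega>: "\<omega> \<in> \<Omega>"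
  shows "(\<lambda>r. mart r \<omega> * indicator {..<b} r) \<in> borel_measurable (clock I)"
proof -
  have "(\<lambda>r. mart r \<omega>) \<in> borel_measurable (restrict_space borel (I \<inter> {..b}))"
    using measurable_compose[OF measurable_Pair2'[of \<omega> Finf] mart_joint[OF b]] \<omega> by simp
  then have "(\<lambda>r. mart r \<omega>) \<in> borel_measurable (restrict_space (clock I) {..<b})"
    unfolding measurable_cong_sets[OF sets_clock_upto refl]
    by (rule measurable_compose[rotated]) (intro measurable_restrict_space2 measurable_restrict_space1 measurable_ident_sets refl, auto simp: space_restrict_space)
  then show ?thesis
    by (subst (asm) borel_measurable_restrict_space_iff_ennreal) (auto simp: Int_commute)
qed

context
  fixes S :: "'w \<Rightarrow> real" and N L :: real
  assumes S: "S \<in> borel_measurable Finf" and S_I: "\<And>\<omega>. \<omega> \<in> \<Omega> \<Longrightarrow> S \<omega> \<in> I"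
    and S_le: "\<And>\<omega>. \<omega> \<in> \<Omega> \<Longrightarrow> S \<omega> \<le> N" and N: "N \<in> I" and L: "L \<in> I"
begin

lemma window_joint:
  "(\<lambda>(\<omega>, r). mart (S \<omega> + r) \<omega>) \<in> borel_measurable (Finf \<Otimes>\<^sub>M restrict_space (clock I) {..<L})"
proof -
  have "(\<lambda>(r, \<omega>). mart (S \<omega> + r) \<omega>) \<in> borel_measurable (restrict_space borel (I \<inter> {..L}) \<Otimes>\<^sub>M Finf)"
    using measurable_compose[OF measurable_shift_time[OF S space_Finf S_I S_le] mart_joint[OF time_add[OF N L]]]
    by (simp add: case_prod_beta')
  then have "(\<lambda>(r, \<omega>). mart (S \<omega> + r) \<omega>) \<in> borel_measurable (restrict_space borel (I \<inter> {..<L}) \<Otimes>\<^sub>M Finf)"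
    by (rule measurable_pair_restrict_borel_mono) auto
  then have "(\<lambda>(r, \<omega>). mart (S \<omega> + r) \<omega>) \<in> borel_measurable (restrict_space (clock I) {..<L} \<Otimes>\<^sub>M Finf)"
    by (simp cong: measurable_cong_sets add: sets_pair_measure_cong[OF sets_clock_upto refl])
  from measurable_compose[OF measurable_pair_swap' this] show ?thesis
    by (simp add: case_prod_beta')
qed

lemma window_measurable: "window S L \<in> borel_measurable Finf"
proof -
  interpret finite_measure "restrict_space (clock I) {..<L}" by (rule finite_clock_upto[OF L])
  show ?thesis unfolding window_def[abs_def] by (rule borel_measurable_nn_integral[OF window_joint])
qed

lemma window_eq:
  assumes \<omega>: "\<omega> \<in> \<Omega>"
  shows "window S L \<omega> = (\<integral>\<^sup>+r. mart r \<omega> * indicator {S \<omega>..<S \<omega> + L} r \<partial>clock I)"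
proof -
  have "(\<integral>\<^sup>+r. mart r \<omega> * indicator {S \<omega>..<S \<omega> + L} r \<partial>clock I) =
      (\<integral>\<^sup>+r. (mart r \<omega> * indicator {..<S \<omega> + L} r) * indicator {S \<omega>..} r \<partial>clock I)"
    by (intro nn_integral_cong) (auto simp: indicator_def)
  also have "\<dots> = (\<integral>\<^sup>+r. mart (S \<omega> + r) \<omega> * indicator {..<S \<omega> + L} (S \<omega> + r) \<partial>clock I)"
    by (rule nn_integral_clock_shift[OF S_I[OF \<omega>] mart_section[OF time_add[OF S_I[OF \<omega>] L] \<omega>]])
  also have "\<dots> = (\<integral>\<^sup>+r. mart (S \<omega> + r) \<omega> * indicator {..<L} r \<partial>clock I)"
    by (intro nn_integral_cong) (auto simp: indicator_def)
  also have "\<dots> = window S L \<omega>"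
    unfolding window_def by (subst nn_integral_restrict_space) (auto simp: Int_commute)
  finally show ?thesis ..
qed

lemma nn_integral_window:
  assumes W: "W \<in> borel_measurable Finf"
    and c: "\<And>w. w \<in> I \<Longrightarrow> (\<integral>\<^sup>+\<omega>. W \<omega> * mart (S \<omega> + w) \<omega> \<partial>P x) = c"
  shows "(\<integral>\<^sup>+\<omega>. W \<omega> * window S L \<omega> \<partial>P x) = c * ennreal L"
proof -
  let ?m = "restrict_space (clock I) {..<L}"
  interpret m: finite_measure ?m by (rule finite_clock_upto[OF L])
  interpret prob_space "P x" by simp
  interpret pair_sigma_finite ?m "P x" ..
  have sec: "(\<lambda>r. mart (S \<omega> + r) \<omega>) \<in> borel_measurable ?m" if "\<omega> \<in> \<Omega>" for \<omega>
    using measurable_compose[OF measurable_Pair1'[of \<omega> Finf] window_joint] that by simp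
  have "(\<lambda>(\<omega>, r). W \<omega> * mart (S \<omega> + r) \<omega>) \<in> borel_measurable (Finf \<Otimes>\<^sub>M ?m)"
    using borel_measurable_times_ennreal[OF measurable_compose[OF measurable_fst W] window_joint]
    by (simp add: case_prod_beta')
  from measurable_compose[OF measurable_pair_swap' this]
  have joint: "(\<lambda>(r, \<omega>). W \<omega> * mart (S \<omega> + r) \<omega>) \<in> borel_measurable (?m \<Otimes>\<^sub>M P x)"
    by (simp add: case_prod_beta' cong: measurable_cong_sets sets_pair_measure_cong)
  have "(\<integral>\<^sup>+\<omega>. W \<omega> * window S L \<omega> \<partial>P x) = (\<integral>\<^sup>+\<omega>. (\<integral>\<^sup>+r. W \<omega> * mart (S \<omega> + r) \<omega> \<partial>?m) \<partial>P x)"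
    unfolding window_def by (intro nn_integral_cong, subst nn_integral_cmult) (auto simp: sec)
  also have "\<dots> = (\<integral>\<^sup>+r. (\<integral>\<^sup>+\<omega>. W \<omega> * mart (S \<omega> + r) \<omega> \<partial>P x) \<partial>?m)"
    by (rule Fubini'[OF joint])
  also have "\<dots> = (\<integral>\<^sup>+r. c \<partial>?m)"
    by (intro nn_integral_cong c) (auto simp: space_restrict_space)
  also have "\<dots> = c * ennreal L"
    by (simp add: space_restrict_space emeasure_restrict_space Int_commute emeasure_clock_lessThan[OF L])
  finally show ?thesis .
qed

end

end

end

context penalized_h_transform
begin

context
  fixes T :: "'w \<Rightarrow> real" and N :: real and A :: "'w set" and x :: 'e
  assumes prog: "progressively_measurable I F X"
    and N: "N \<in> I" and T: "T \<in> borel_measurable (F N)"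
    and T_I: "\<And>\<omega>. \<omega> \<in> \<Omega> \<Longrightarrow> T \<omega> \<in> I" and T_le: "\<And>\<omega>. \<omega> \<in> \<Omega> \<Longrightarrow> T \<omega> \<le> N"
    and A: "A \<in> sets (F N)"
    and regen: "\<And>B. B \<in> sets paths \<Longrightarrow>
      (\<integral>\<^sup>+\<omega>. (indicator A \<omega> * ennreal (exp (l0 * T \<omega>) * Z X (T \<omega>) \<omega>)) *
        indicator {\<omega>\<in>\<Omega>. path I (\<lambda>r \<omega>. X (T \<omega> + r) \<omega>) \<omega> \<in> B} \<omega> \<partial>P x) =
      (\<integral>\<^sup>+\<omega>. (indicator A \<omega> * ennreal (exp (l0 * T \<omega>) * Z X (T \<omega>) \<omega>)) *
        emeasure (P (X (T \<omega>) \<omega>)) {\<omega>'\<in>\<Omega>. path I X \<omega>' \<in> B} \<partial>P x)"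
begin

abbreviation "Y \<equiv> (\<lambda>r \<omega>. X (T \<omega> + r) \<omega>)"
abbreviation "V \<equiv> (\<lambda>\<omega>. indicator A \<omega> * ennreal (exp (l0 * T \<omega>) * Z X (T \<omega>) \<omega>))"

lemma TF: "u \<in> I \<Longrightarrow> N \<le> u \<Longrightarrow> T \<in> borel_measurable (F u)"
  by (rule measurable_F_mono[OF T N])

lemma TFinf: "T \<in> borel_measurable Finf"
  by (rule measurable_F_Finf[OF T N])

lemma compose_T:
  assumes r: "r \<in> I" and f: "(\<lambda>(r, \<omega>). f r \<omega>) \<in> restrict_space borel (I \<inter> {..N + r}) \<Otimes>\<^sub>M F (N + r) \<rightarrow>\<^sub>M M"
  shows "(\<lambda>\<omega>. f (T \<omega> + r) \<omega>) \<in> F (N + r) \<rightarrow>\<^sub>M M"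
proof -
  have Nr: "N + r \<in> I" "N \<le> N + r" using N r time_nonneg by auto
  have "r \<in> space (restrict_space borel (I \<inter> {..r}))" using r by (simp add: space_restrict_space)
  from measurable_compose[OF measurable_Pair1'[OF this] measurable_compose[OF
      measurable_shift_time[OF TF[OF Nr] space_F[OF Nr(1)] T_I T_le, where w = r] f]]
  show ?thesis by (simp add: case_prod_beta')
qed

lemma Y_F: "r \<in> I \<Longrightarrow> Y r \<in> F (N + r) \<rightarrow>\<^sub>M borel"
  by (rule compose_T, assumption, rule X_joint[OF prog]) (use N in simp)

lemma Y_Finf: "\<forall>r\<in>I. Y r \<in> Finf \<rightarrow>\<^sub>M borel"
  using measurable_F_Finf[OF Y_F] N by simp

lemma ZT_F: "(\<lambda>\<omega>. Z X (T \<omega>) \<omega>) \<in> borel_measurable (F N)"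
  using compose_T[OF zero_in_time, of "\<lambda>r \<omega>. Z X r \<omega>" borel] Z_joint[of N] N by simp

lemma Y_penalizable: "w \<in> I \<Longrightarrow> penalizable Finf Y w"
  using measurable_compose[OF measurable_shift_time[OF TFinf space_Finf T_I T_le] penalizable_Finf[OF time_add[OF N]]]
  by (simp add: case_prod_beta')

lemma V_F: "V \<in> borel_measurable (F N)"
  using A T ZT_F by measurable

lemma V_finite: "(\<integral>\<^sup>+\<omega>. V \<omega> \<partial>P x) < \<infinity>"
proof -
  interpret prob_space "P x" by simp
  have "(\<integral>\<^sup>+\<omega>. V \<omega> \<partial>P x) \<le> (\<integral>\<^sup>+\<omega>. ennreal (exp (\<bar>l0\<bar> * N)) \<partial>P x)"
  proof (rule nn_integral_mono)
    fix \<omega> assume "\<omega> \<in> space (P x)"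
    then have T: "T \<omega> \<in> I" "0 \<le> T \<omega>" "T \<omega> \<le> N" using T_I T_le time_nonneg by auto
    have "l0 * T \<omega> \<le> \<bar>l0\<bar> * T \<omega>" using T by (intro mult_right_mono) auto
    also have "\<dots> \<le> \<bar>l0\<bar> * N" using T by (intro mult_left_mono) auto
    finally have "exp (l0 * T \<omega>) * Z X (T \<omega>) \<omega> \<le> exp (\<bar>l0\<bar> * N) * 1"
      using T by (intro mult_mono) auto
    then show "V \<omega> \<le> ennreal (exp (\<bar>l0\<bar> * N))" by (simp add: indicator_def ennreal_leI)
  qed
  also have "\<dots> < \<infinity>" by (simp add: emeasure_space_1[simplified])
  finally show ?thesis .
qed

lemma mart_after_T:
  assumes \<omega>: "\<omega> \<in> \<Omega>" and w: "w \<in> I"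
  shows "indicator A \<omega> * mart (T \<omega> + w) \<omega> =
    V \<omega> * (ennreal (Z Y w \<omega>) * ennreal (exp (l0 * w) * \<eta> (path I Y \<omega> w)))"
proof -
  have "Z X (T \<omega> + w) \<omega> = Z X (T \<omega>) \<omega> * Z Y w \<omega>"
    using penal_add[OF penalizable_Finf, of "T \<omega>" w \<omega>] T_I[OF \<omega>] \<omega> w
    by (simp add: penal_clock)
  then show ?thesis
    using T_I[OF \<omega>] w by (simp add: mart_def ennreal_mult exp_add distrib_left ac_simps)
qed

text \<open>Optional stopping without any regularity of the paths. The martingale after the stopping time
  has a constant expectation \<open>c\<close> at the times \<open>T + w\<close> by the strong Markov property, and a constant
  expectation \<open>c'\<close> at the deterministic times after \<open>N + u\<close>. Its integrals over the windows of
  length \<open>L\<close> that start at \<open>T + u\<close> and at \<open>N + u\<close> are \<open>c L\<close> and \<open>c' L\<close>, and they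
  differ by an amount that is bounded in \<open>L\<close>, since the two windows overlap up to sets of length at
  most \<open>N + u\<close>.\<close>

lemma Q_stopped_regeneration:
  assumes u: "u \<in> I" and h: "h \<in> borel_measurable paths" and h1: "\<And>q. h q \<le> 1"
    and hX: "(\<lambda>\<omega>. h (path I X \<omega>)) \<in> borel_measurable (F u)"
    and hY: "(\<lambda>\<omega>. h (path I Y \<omega>)) \<in> borel_measurable (F (N + u))"
  shows "ennreal (\<eta> x) * (\<integral>\<^sup>+\<omega>. indicator A \<omega> * h (path I Y \<omega>) \<partial>Q x) =
    (\<integral>\<^sup>+\<omega>. V \<omega> * (ennreal (\<eta> (X (T \<omega>) \<omega>)) * (\<integral>\<^sup>+\<omega>'. h (path I X \<omega>') \<partial>Q (X (T \<omega>) \<omega>))) \<partial>P x)"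
    (is "?l = ?r")
proof -
  define W where "W \<omega> = indicator A \<omega> * h (path I Y \<omega>)" for \<omega>
  have Nu: "N + u \<in> I" "0 \<le> N" "0 \<le> u" using N u time_nonneg by auto
  have A': "A \<in> sets (F (N + u))" using A sets_F_mono[of N "N + u"] N Nu by auto
  have WF: "W \<in> borel_measurable (F (N + u))"
    unfolding W_def using A' hY by measurable
  have WFinf: "W \<in> borel_measurable Finf" by (rule measurable_F_Finf[OF WF Nu(1)])
  have W1: "W \<omega> \<le> 1" for \<omega> using h1 by (simp add: W_def indicator_def)
  have c: "(\<integral>\<^sup>+\<omega>. W \<omega> * mart ((T \<omega> + u) + w) \<omega> \<partial>P x) = ?r" if w: "w \<in> I" for w
  proof -
    have uw: "u + w \<in> I" "u \<le> u + w" using u w time_nonneg by auto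
    have hX': "(\<lambda>\<omega>. h (path I X \<omega>)) \<in> borel_measurable (F (u + w))"
      by (rule measurable_F_mono[OF hX u uw])
    have h': "(\<lambda>q. ennreal (exp (l0 * (u + w)) * \<eta> (q (u + w))) * h q) \<in> borel_measurable paths"
      using uw(1) h by measurable
    have "(\<integral>\<^sup>+\<omega>. W \<omega> * mart ((T \<omega> + u) + w) \<omega> \<partial>P x) =
        (\<integral>\<^sup>+\<omega>. V \<omega> * (ennreal (Z Y (u + w) \<omega>) *
          (ennreal (exp (l0 * (u + w)) * \<eta> (path I Y \<omega> (u + w))) * h (path I Y \<omega>))) \<partial>P x)"
    proof (rule nn_integral_cong)
      fix \<omega> assume "\<omega> \<in> space (P x)"
      then have "\<omega> \<in> \<Omega>" by simp
      have "W \<omega> * mart ((T \<omega> + u) + w) \<omega> = h (path I Y \<omega>) * (indicator A \<omega> * mart (T \<omega> + (u + w)) \<omega>)"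
        by (simp add: W_def ac_simps)
      also have "\<dots> = h (path I Y \<omega>) * (V \<omega> * (ennreal (Z Y (u + w) \<omega>) *
          ennreal (exp (l0 * (u + w)) * \<eta> (path I Y \<omega> (u + w)))))"
        by (simp only: mart_after_T[OF \<open>\<omega> \<in> \<Omega>\<close> uw(1)])
      finally show "W \<omega> * mart ((T \<omega> + u) + w) \<omega> = V \<omega> * (ennreal (Z Y (u + w) \<omega>) *
          (ennreal (exp (l0 * (u + w)) * \<eta> (path I Y \<omega> (u + w))) * h (path I Y \<omega>)))"
        by (simp only: mult.assoc mult.commute mult.left_commute)
    qed
    also have "\<dots> = (\<integral>\<^sup>+\<omega>. V \<omega> * (\<integral>\<^sup>+\<omega>'. ennreal (Z X (u + w) \<omega>') *
        (ennreal (exp (l0 * (u + w)) * \<eta> (path I X \<omega>' (u + w))) * h (path I X \<omega>')) \<partial>P (X (T \<omega>) \<omega>)) \<partial>P x)"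
      by (rule penalized_regeneration[OF measurable_F_Finf[OF V_F N] V_finite Y_Finf uw(1) Y_penalizable[OF uw(1)] regen h'])
    finally show ?thesis unfolding penalized_to_Q[OF uw(1) h hX'] .
  qed
  have c': "(\<integral>\<^sup>+\<omega>. W \<omega> * mart ((N + u) + w) \<omega> \<partial>P x) = ?l" if w: "w \<in> I" for w
  proof -
    have "W \<in> borel_measurable (F ((N + u) + w))"
      using Nu w time_nonneg[OF w] by (intro measurable_F_mono[OF WF Nu(1)]) auto
    from nn_integral_Q[OF time_add[OF Nu(1) w] this, of x] show ?thesis
      by (simp add: W_def)
  qed
  have one: "(\<integral>\<^sup>+\<omega>. 1 * mart (a + w) \<omega> \<partial>P x) = ennreal (\<eta> x)" if "a \<in> I" "w \<in> I" for a w
    using that by (simp add: nn_integral_mart)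
  have TuS: "(\<lambda>\<omega>. T \<omega> + u) \<in> borel_measurable Finf" using TFinf by measurable
  note win = window_eq[OF prog] nn_integral_window[OF prog] window_measurable[OF prog]
  let ?k = "ennreal (\<eta> x) * ennreal (N + u)"
  have bounds: "?r * of_nat m \<le> ?l * of_nat m + ?k" "?l * of_nat m \<le> ?r * of_nat m + ?k" for m
  proof -
    let ?L = "real m"
    have m: "of_nat m = ennreal ?L" by (simp add: ennreal_of_nat_eq_real_of_nat)
    let ?w1 = "window (\<lambda>\<omega>. T \<omega> + u) ?L" and ?w2 = "window (\<lambda>_. N + u) ?L"
      and ?w3 = "window (\<lambda>_. 0) (N + u)" and ?w4 = "window (\<lambda>_. ?L) (N + u)"
    have T1: "T \<omega> + u \<in> I" "T \<omega> + u \<le> N + u" "0 \<le> T \<omega>" if "\<omega> \<in> \<Omega>" for \<omega>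
      using T_I[OF that] T_le[OF that] time_nonneg u by auto
    have i1: "(\<integral>\<^sup>+\<omega>. W \<omega> * ?w1 \<omega> \<partial>P x) = ?r * ennreal ?L"
      by (rule win(2)[OF TuS T1(1) T1(2) Nu(1) time_real WFinf c])
    have i2: "(\<integral>\<^sup>+\<omega>. W \<omega> * ?w2 \<omega> \<partial>P x) = ?l * ennreal ?L"
      by (rule win(2)[OF measurable_const Nu(1) order.refl Nu(1) time_real WFinf c']) auto
    have i3: "(\<integral>\<^sup>+\<omega>. 1 * ?w3 \<omega> \<partial>P x) = ?k"
      by (rule win(2)[OF measurable_const zero_in_time order.refl zero_in_time Nu(1) measurable_const one[OF zero_in_time]]) auto
    have i4: "(\<integral>\<^sup>+\<omega>. 1 * ?w4 \<omega> \<partial>P x) = ?k"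
      by (rule win(2)[OF measurable_const time_real order.refl time_real Nu(1) measurable_const one[OF time_real]]) auto
    have m2: "?w2 \<in> borel_measurable Finf"
      by (rule win(3)[OF measurable_const Nu(1) order.refl Nu(1) time_real]) auto
    have m1: "?w1 \<in> borel_measurable Finf"
      by (rule win(3)[OF TuS T1(1) T1(2) Nu(1) time_real])
    have m3: "?w3 \<in> borel_measurable Finf"
      by (rule win(3)[OF measurable_const zero_in_time order.refl zero_in_time Nu(1)]) auto
    have m4: "?w4 \<in> borel_measurable Finf"
      by (rule win(3)[OF measurable_const time_real order.refl time_real Nu(1)]) auto
    have e1: "?w1 \<omega> = (\<integral>\<^sup>+r. mart r \<omega> * indicator {T \<omega> + u..<T \<omega> + u + ?L} r \<partial>clock I)" if "\<omega> \<in> \<Omega>" for \<omega>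
      by (rule win(1)[OF TuS T1(1) T1(2) Nu(1) time_real that])
    have e2: "?w2 \<omega> = (\<integral>\<^sup>+r. mart r \<omega> * indicator {N + u..<N + u + ?L} r \<partial>clock I)" if "\<omega> \<in> \<Omega>" for \<omega>
      by (rule win(1)[OF measurable_const Nu(1) order.refl Nu(1) time_real that]) auto
    have e3: "?w3 \<omega> = (\<integral>\<^sup>+r. mart r \<omega> * indicator {0..<0 + (N + u)} r \<partial>clock I)" if "\<omega> \<in> \<Omega>" for \<omega>
      by (rule win(1)[OF measurable_const zero_in_time order.refl zero_in_time Nu(1) that]) auto
    have e4: "?w4 \<omega> = (\<integral>\<^sup>+r. mart r \<omega> * indicator {?L..<?L + (N + u)} r \<partial>clock I)" if "\<omega> \<in> \<Omega>" for \<omega>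
      by (rule win(1)[OF measurable_const time_real order.refl time_real Nu(1) that]) auto
    have sec: "(\<lambda>r. mart r \<omega> * indicator {a..<b} r) \<in> borel_measurable (clock I)"
      if "b \<in> I" "\<omega> \<in> \<Omega>" for a b \<omega>
    proof -
      have "(\<lambda>r. (mart r \<omega> * indicator {..<b} r) * indicator {a..} r) \<in> borel_measurable (clock I)"
        by (rule borel_measurable_times_ennreal[OF mart_section[OF prog that] indicator_clock_measurable]) auto
      also have "(\<lambda>r. (mart r \<omega> * indicator {..<b} r) * indicator {a..} r) = (\<lambda>r. mart r \<omega> * indicator {a..<b} r)"
        by (auto simp: indicator_def fun_eq_iff)
      finally show ?thesis .
    qed
    have p1: "?w1 \<omega> \<le> ?w2 \<omega> + ?w3 \<omega>" if "\<omega> \<in> \<Omega>" for \<omega>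
    proof -
      have "(\<integral>\<^sup>+r. mart r \<omega> * indicator {T \<omega> + u..<T \<omega> + u + ?L} r \<partial>clock I) \<le>
          (\<integral>\<^sup>+r. mart r \<omega> * indicator {N + u..<N + u + ?L} r + mart r \<omega> * indicator {0..<0 + (N + u)} r \<partial>clock I)"
        using T1[OF that] Nu by (intro nn_integral_mono) (auto simp: indicator_def)
      also have "\<dots> = ?w2 \<omega> + ?w3 \<omega>"
        unfolding e2[OF that] e3[OF that] using Nu that by (intro nn_integral_add sec) auto
      finally show ?thesis unfolding e1[OF that] .
    qed
    have p2: "?w2 \<omega> \<le> ?w1 \<omega> + ?w4 \<omega>" if "\<omega> \<in> \<Omega>" for \<omega>
    proof -
      have "(\<integral>\<^sup>+r. mart r \<omega> * indicator {N + u..<N + u + ?L} r \<partial>clock I) \<le>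
          (\<integral>\<^sup>+r. mart r \<omega> * indicator {T \<omega> + u..<T \<omega> + u + ?L} r + mart r \<omega> * indicator {?L..<?L + (N + u)} r \<partial>clock I)"
        using T1[OF that] Nu by (intro nn_integral_mono) (auto simp: indicator_def)
      also have "\<dots> = ?w1 \<omega> + ?w4 \<omega>"
        unfolding e1[OF that] e4[OF that] using Nu that T1[OF that] by (intro nn_integral_add sec) auto
      finally show ?thesis unfolding e2[OF that] .
    qed
    have sum: "(\<integral>\<^sup>+\<omega>. W \<omega> * a \<omega> \<partial>P x) \<le> (\<integral>\<^sup>+\<omega>. W \<omega> * b \<omega> \<partial>P x) + (\<integral>\<^sup>+\<omega>. 1 * d \<omega> \<partial>P x)"
      if b: "b \<in> borel_measurable Finf" and d: "d \<in> borel_measurable Finf"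
        and le: "\<And>\<omega>. \<omega> \<in> \<Omega> \<Longrightarrow> a \<omega> \<le> b \<omega> + d \<omega>" for a b d
    proof -
      have "(\<integral>\<^sup>+\<omega>. W \<omega> * a \<omega> \<partial>P x) \<le> (\<integral>\<^sup>+\<omega>. W \<omega> * b \<omega> + 1 * d \<omega> \<partial>P x)"
      proof (rule nn_integral_mono)
        fix \<omega> assume "\<omega> \<in> space (P x)"
        then have "W \<omega> * a \<omega> \<le> W \<omega> * (b \<omega> + d \<omega>)" using le by (intro mult_left_mono) auto
        also have "\<dots> \<le> W \<omega> * b \<omega> + 1 * d \<omega>"
          unfolding distrib_left by (intro add_mono mult_right_mono W1) auto
        finally show "W \<omega> * a \<omega> \<le> W \<omega> * b \<omega> + 1 * d \<omega>" .
      qed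
      also have "\<dots> = (\<integral>\<^sup>+\<omega>. W \<omega> * b \<omega> \<partial>P x) + (\<integral>\<^sup>+\<omega>. 1 * d \<omega> \<partial>P x)"
        using b d WFinf by (intro nn_integral_add) simp_all
      finally show ?thesis .
    qed
    show "?r * of_nat m \<le> ?l * of_nat m + ?k"
      using sum[OF m2 m3 p1] unfolding i1 i2 i3 m .
    show "?l * of_nat m \<le> ?r * of_nat m + ?k"
      using sum[OF m1 m4 p2] unfolding i1 i2 i4 m .
  qed
  have k: "?k < \<infinity>" by (simp add: ennreal_mult_less_top del: ennreal_plus)
  have lfin: "?l < \<infinity>"
  proof -
    have "?l \<le> ennreal (\<eta> x) * (\<integral>\<^sup>+\<omega>. 1 \<partial>Q x)"
      using W1 by (intro mult_left_mono nn_integral_mono) (auto simp: W_def)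
    also have "\<dots> < \<infinity>" by (simp add: prob_space.emeasure_space_1[OF prob_Q, simplified])
    finally show ?thesis .
  qed
  have "?r \<le> ?l" by (rule ennreal_le_of_linear_growth[OF bounds(1) lfin k])
  moreover have "?l \<le> ?r"
    by (rule ennreal_le_of_linear_growth[OF bounds(2) _ k]) (use \<open>?r \<le> ?l\<close> lfin in \<open>simp add: order.strict_trans1\<close>)
  ultimately show ?thesis by simp
qed

lemma Q_regeneration:
  assumes B: "B \<in> sets paths"
  shows "(\<integral>\<^sup>+\<omega>. indicator A \<omega> * indicator {\<omega>\<in>\<Omega>. path I Y \<omega> \<in> B} \<omega> \<partial>Q x) =
    (\<integral>\<^sup>+\<omega>. indicator A \<omega> * emeasure (Q (X (T \<omega>) \<omega>)) {\<omega>'\<in>\<Omega>. path I X \<omega>' \<in> B} \<partial>Q x)"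
proof -
  have AM: "A \<in> sets Finf" using A sets_F_Finf[OF N] by auto
  have "(\<integral>\<^sup>+\<omega>. indicator A \<omega> * indicator {\<omega>\<in>\<Omega>. path I Y \<omega> \<in> B} \<omega> \<partial>Q x) =
    (\<integral>\<^sup>+\<omega>. indicator A \<omega> * emeasure (Q (Y 0 \<omega>)) {\<omega>'\<in>\<Omega>. path I X \<omega>' \<in> B} \<partial>Q x)"
  proof (rule regeneration_of_cylinders[OF Q_kernel AM Y_Finf _ B])
    fix J B assume J: "finite J" "J \<subseteq> I" "\<And>j. j \<in> J \<Longrightarrow> B j \<in> sets (borel :: 'e measure)"
    obtain u where u: "u \<in> I" "\<forall>j\<in>J. j \<le> u" using horizon[OF J(1,2)] by auto
    let ?C = "cylinder J B"
    define g where "g y = emeasure (Q y) {\<omega>'\<in>\<Omega>. path I X \<omega>' \<in> ?C}" for y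
    have m1: "{\<omega>\<in>\<Omega>. path I X \<omega> \<in> ?C} \<in> sets (F u)"
      using J u by (intro cylinder_preimage X_F_le) auto
    have m2: "{\<omega>\<in>\<Omega>. path I Y \<omega> \<in> ?C} \<in> sets (F (N + u))"
      using J u N by (intro cylinder_preimage measurable_F_mono[OF Y_F]) auto
    have gm: "g \<in> borel_measurable borel"
      unfolding g_def[abs_def]
      by (rule measurable_compose[OF kernel_subprob[OF Q_kernel]
            measurable_emeasure_subprob_algebra[OF Finf_preimage[OF path_Finf cylinder_sets[OF J]]]])
    have g1: "g y \<le> 1" for y
      unfolding g_def by (rule prob_space.emeasure_le_1[OF prob_Q])
    have e1: "(\<integral>\<^sup>+\<omega>'. indicator ?C (path I X \<omega>') \<partial>Q y) = g y" for y
    proof -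
      have "(\<integral>\<^sup>+\<omega>'. indicator ?C (path I X \<omega>') \<partial>Q y) = (\<integral>\<^sup>+\<omega>'. indicator {\<omega>'\<in>\<Omega>. path I X \<omega>' \<in> ?C} \<omega>' \<partial>Q y)"
        by (intro nn_integral_cong) (auto simp: indicator_def)
      then show ?thesis using m1 sets_F_Finf[OF u(1)] by (auto simp: g_def)
    qed
    have e2: "(\<integral>\<^sup>+\<omega>'. g (path I X \<omega>' 0) \<partial>Q y) = g y" for y
    proof -
      have "(\<integral>\<^sup>+\<omega>'. g (path I X \<omega>' 0) \<partial>Q y) = (\<integral>\<^sup>+\<omega>'. g y \<partial>Q y)"
        using Q_X_zero[of y] by (intro nn_integral_cong_AE) (auto elim!: eventually_mono)
      then show ?thesis by (simp add: prob_space.emeasure_space_1[OF prob_Q, simplified])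
    qed
    have "ennreal (\<eta> x) * (\<integral>\<^sup>+\<omega>. indicator A \<omega> * indicator ?C (path I Y \<omega>) \<partial>Q x) =
        (\<integral>\<^sup>+\<omega>. V \<omega> * (ennreal (\<eta> (X (T \<omega>) \<omega>)) * g (X (T \<omega>) \<omega>)) \<partial>P x)"
      unfolding e1[symmetric]
    proof (rule Q_stopped_regeneration[OF u(1)])
      show "(\<lambda>\<omega>. indicator ?C (path I X \<omega>) :: ennreal) \<in> borel_measurable (F u)"
        by (rule borel_measurable_indicator') (use m1 u in simp)
      show "(\<lambda>\<omega>. indicator ?C (path I Y \<omega>) :: ennreal) \<in> borel_measurable (F (N + u))"
        by (rule borel_measurable_indicator') (use m2 u N in simp)
    qed (use cylinder_sets[OF J] in \<open>auto simp: indicator_def\<close>)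
    also have "\<dots> = ennreal (\<eta> x) * (\<integral>\<^sup>+\<omega>. indicator A \<omega> * g (path I Y \<omega> 0) \<partial>Q x)"
    proof -
      have "ennreal (\<eta> x) * (\<integral>\<^sup>+\<omega>. indicator A \<omega> * g (path I Y \<omega> 0) \<partial>Q x) =
        (\<integral>\<^sup>+\<omega>. V \<omega> * (ennreal (\<eta> (X (T \<omega>) \<omega>)) * (\<integral>\<^sup>+\<omega>'. g (path I X \<omega>' 0) \<partial>Q (X (T \<omega>) \<omega>))) \<partial>P x)"
      proof (rule Q_stopped_regeneration[OF zero_in_time, where h = "\<lambda>q. g (q 0)"])
        show "(\<lambda>q. g (q 0)) \<in> borel_measurable paths"
          by (rule measurable_compose[OF measurable_component_singleton[OF zero_in_time] gm])
        show "(\<lambda>\<omega>. g (path I X \<omega> 0)) \<in> borel_measurable (F 0)"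
          using measurable_compose[OF X_F[OF zero_in_time] gm] by simp
        show "(\<lambda>\<omega>. g (path I Y \<omega> 0)) \<in> borel_measurable (F (N + 0))"
          using measurable_compose[OF Y_F[OF zero_in_time] gm] by simp
      qed (rule g1)
      then show ?thesis by (simp only: e2)
    qed
    finally have "(\<integral>\<^sup>+\<omega>. indicator A \<omega> * indicator ?C (path I Y \<omega>) \<partial>Q x) =
        (\<integral>\<^sup>+\<omega>. indicator A \<omega> * g (path I Y \<omega> 0) \<partial>Q x)"
      by (simp only: eta_cancel)
    moreover have "(\<integral>\<^sup>+\<omega>. indicator A \<omega> * indicator {\<omega>\<in>\<Omega>. path I Y \<omega> \<in> ?C} \<omega> \<partial>Q x) =
        (\<integral>\<^sup>+\<omega>. indicator A \<omega> * indicator ?C (path I Y \<omega>) \<partial>Q x)"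
      by (intro nn_integral_cong) (auto simp: indicator_def)
    ultimately show "(\<integral>\<^sup>+\<omega>. indicator A \<omega> * indicator {\<omega>\<in>\<Omega>. path I Y \<omega> \<in> ?C} \<omega> \<partial>Q x) =
        (\<integral>\<^sup>+\<omega>. indicator A \<omega> * emeasure (Q (Y 0 \<omega>)) {\<omega>'\<in>\<Omega>. path I X \<omega>' \<in> ?C} \<partial>Q x)"
      by (simp add: g_def)
  qed
  then show ?thesis by simp
qed

end

end

context penalized_markov
begin

context
  fixes \<tau> :: "'w \<Rightarrow> ereal"
  assumes stop: "stopping_time_on I \<Omega> F \<tau>"
begin

abbreviation "Fstop \<equiv> stopped_sigma I \<Omega> F \<tau>"

lemma stop_values: "\<omega> \<in> \<Omega> \<Longrightarrow> \<tau> \<omega> \<in> ereal ` I \<union> {\<infinity>}"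
  and stop_sets: "t \<in> I \<Longrightarrow> {\<omega>\<in>\<Omega>. \<tau> \<omega> \<le> ereal t} \<in> sets (F t)"
  using stop by (simp_all add: stopping_time_on_def)

lemma stop_cases:
  assumes "\<omega> \<in> \<Omega>" obtains s where "s \<in> I" "\<tau> \<omega> = ereal s" | "\<tau> \<omega> = \<infinity>"
  using stop_values[OF assms] by auto

lemma Fstop_Pow: "{A \<in> sets Finf. \<forall>t\<in>I. A \<inter> {\<omega>\<in>\<Omega>. \<tau> \<omega> \<le> ereal t} \<in> sets (F t)} \<subseteq> Pow \<Omega>"
  using sets.sets_into_space[of _ Finf] by auto

lemma space_Fstop [simp]: "space Fstop = \<Omega>"
  unfolding stopped_sigma_def using Fstop_Pow by (rule space_measure_of)

lemma sets_Fstop: "sets Fstop = {A \<in> sets Finf. \<forall>t\<in>I. A \<inter> {\<omega>\<in>\<Omega>. \<tau> \<omega> \<le> ereal t} \<in> sets (F t)}"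
proof -
  let ?G = "{A \<in> sets Finf. \<forall>t\<in>I. A \<inter> {\<omega>\<in>\<Omega>. \<tau> \<omega> \<le> ereal t} \<in> sets (F t)}"
  have *: "A \<in> ?G" if "A \<in> sigma_sets \<Omega> ?G" for A
    using that
  proof induction
    case (Compl A)
    then have A: "A \<in> sets Finf" "\<forall>t\<in>I. A \<inter> {\<omega>\<in>\<Omega>. \<tau> \<omega> \<le> ereal t} \<in> sets (F t)" by auto
    have "(\<Omega> - A) \<inter> {\<omega>\<in>\<Omega>. \<tau> \<omega> \<le> ereal t} = {\<omega>\<in>\<Omega>. \<tau> \<omega> \<le> ereal t} - A \<inter> {\<omega>\<in>\<Omega>. \<tau> \<omega> \<le> ereal t}" for t
      by auto
    moreover have "\<Omega> - A \<in> sets Finf" using sets.compl_sets[OF A(1)] by simp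
    ultimately show ?case using A(2) stop_sets by (simp add: sets.Diff)
  next
    case (Union a)
    have "(\<Union>i. a i) \<inter> {\<omega>\<in>\<Omega>. \<tau> \<omega> \<le> ereal t} \<in> sets (F t)" if "t \<in> I" for t
      unfolding Int_UN_distrib2[of a UNIV, symmetric] UN_simps(4)[symmetric]
      using Union.IH that by (intro sets.countable_UN) auto
    then show ?case using Union.IH by auto
  qed auto
  have "sigma_sets \<Omega> ?G = ?G"
    by (rule equalityI; rule subsetI) (erule *, erule sigma_sets.Basic)
  then show ?thesis
    unfolding stopped_sigma_def sets_measure_of[OF Fstop_Pow] .
qed

lemma subalgebra_Fstop: "sets M = sets Finf \<Longrightarrow> subalgebra M Fstop"
  using sets_eq_imp_space_eq[of M Finf] by (auto simp: subalgebra_def sets_Fstop)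

lemma stop_finite_eq: "{\<omega>\<in>\<Omega>. \<tau> \<omega> < \<infinity>} = (\<Union>n. {\<omega>\<in>\<Omega>. \<tau> \<omega> \<le> ereal (real n)})"
proof -
  have "\<exists>n. \<tau> \<omega> \<le> ereal (real n)" if "\<omega> \<in> \<Omega>" "\<tau> \<omega> \<noteq> \<infinity>" for \<omega>
    using stop_cases[OF that(1)] that(2) by (metis ereal_less_eq(3) real_arch_simple)
  then show ?thesis by auto
qed

lemma stop_le_Finf: "{\<omega>\<in>\<Omega>. \<tau> \<omega> \<le> ereal (real n)} \<in> sets Finf"
  using stop_sets[OF time_real] sets_F_Finf[OF time_real] by auto

text \<open>The measurability of a stopped process is checked before each deterministic time.\<close>

lemma measurable_FstopI:
  fixes f :: "'w \<Rightarrow> 'b::{topological_space, zero}"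
  assumes f: "\<And>t. t \<in> I \<Longrightarrow> (\<lambda>\<omega>. if \<tau> \<omega> \<le> ereal t then f \<omega> else 0) \<in> F t \<rightarrow>\<^sub>M borel"
    and f0: "\<And>\<omega>. \<omega> \<in> \<Omega> \<Longrightarrow> \<tau> \<omega> = \<infinity> \<Longrightarrow> f \<omega> = 0"
  shows "f \<in> Fstop \<rightarrow>\<^sub>M borel"
proof (rule measurableI)
  fix C :: "'b set" assume C: "C \<in> sets borel"
  have t: "(f -` C \<inter> \<Omega>) \<inter> {\<omega>\<in>\<Omega>. \<tau> \<omega> \<le> ereal t} \<in> sets (F t)" if "t \<in> I" for t
  proof -
    have "(\<lambda>\<omega>. if \<tau> \<omega> \<le> ereal t then f \<omega> else 0) -` C \<inter> space (F t) \<in> sets (F t)"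
      by (rule measurable_sets[OF f[OF that] C])
    then have "((\<lambda>\<omega>. if \<tau> \<omega> \<le> ereal t then f \<omega> else 0) -` C \<inter> \<Omega>) \<inter> {\<omega>\<in>\<Omega>. \<tau> \<omega> \<le> ereal t} \<in> sets (F t)"
      unfolding space_F[OF that] by (rule sets.Int) (rule stop_sets[OF that])
    also have "((\<lambda>\<omega>. if \<tau> \<omega> \<le> ereal t then f \<omega> else 0) -` C \<inter> \<Omega>) \<inter> {\<omega>\<in>\<Omega>. \<tau> \<omega> \<le> ereal t} =
        (f -` C \<inter> \<Omega>) \<inter> {\<omega>\<in>\<Omega>. \<tau> \<omega> \<le> ereal t}" by auto
    finally show ?thesis .
  qed
  have "f -` C \<inter> \<Omega> = (\<Union>n. (f -` C \<inter> \<Omega>) \<inter> {\<omega>\<in>\<Omega>. \<tau> \<omega> \<le> ereal (real n)}) \<union>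
      (if 0 \<in> C then \<Omega> - (\<Union>n. {\<omega>\<in>\<Omega>. \<tau> \<omega> \<le> ereal (real n)}) else {})"
    using f0 stop_finite_eq by (auto simp: set_eq_iff)
  also have "\<dots> \<in> sets Finf"
  proof (rule sets.Un)
    show "(\<Union>n. (f -` C \<inter> \<Omega>) \<inter> {\<omega>\<in>\<Omega>. \<tau> \<omega> \<le> ereal (real n)}) \<in> sets Finf"
      using t[OF time_real] sets_F_Finf[OF time_real] by (intro sets.countable_UN) auto
    have "\<Omega> - (\<Union>n. {\<omega>\<in>\<Omega>. \<tau> \<omega> \<le> ereal (real n)}) \<in> sets Finf"
      using stop_le_Finf sets.top[of Finf] by (intro sets.Diff sets.countable_UN) auto
    then show "(if 0 \<in> C then \<Omega> - (\<Union>n. {\<omega>\<in>\<Omega>. \<tau> \<omega> \<le> ereal (real n)}) else {}) \<in> sets Finf"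
      by simp
  qed
  finally show "f -` C \<inter> space Fstop \<in> sets Fstop"
    using t by (simp add: sets_Fstop)
qed simp

definition stop_min :: "real \<Rightarrow> 'w \<Rightarrow> real" where
  "stop_min t \<omega> = (if \<tau> \<omega> \<le> ereal t then real_of_ereal (\<tau> \<omega>) else t)"

lemma stop_min_time: "t \<in> I \<Longrightarrow> \<omega> \<in> \<Omega> \<Longrightarrow> stop_min t \<omega> \<in> I"
  and stop_min_le: "\<omega> \<in> \<Omega> \<Longrightarrow> stop_min t \<omega> \<le> t"
  by (auto simp: stop_min_def elim!: stop_cases)

lemma stop_min_measurable:
  assumes t: "t \<in> I" shows "stop_min t \<in> borel_measurable (F t)"
proof (rule borel_measurableI_le)
  fix c :: real
  show "{\<omega>\<in>space (F t). stop_min t \<omega> \<le> c} \<in> sets (F t)"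
  proof (cases "c < 0 \<or> t \<le> c")
    case True
    then show ?thesis
    proof
      assume "c < 0"
      then have "{\<omega>\<in>space (F t). stop_min t \<omega> \<le> c} = {}"
        using stop_min_time[OF t] time_nonneg t by fastforce
      then show ?thesis by (simp only: sets.empty_sets)
    next
      assume "t \<le> c"
      then have "{\<omega>\<in>space (F t). stop_min t \<omega> \<le> c} = space (F t)"
        using stop_min_le t order.trans by fastforce
      then show ?thesis by simp
    qed
  next
    case False
    then obtain c' where c': "c' \<in> I" "c' \<le> c" "\<And>s. s \<in> I \<Longrightarrow> s \<le> c \<Longrightarrow> s \<le> c'"
      using time_floor[of c] by auto
    have "stop_min t \<omega> \<le> c \<longleftrightarrow> \<tau> \<omega> \<le> ereal c'" if "\<omega> \<in> \<Omega>" for \<omega>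
      using that False c' by (cases rule: stop_cases[OF that]) (auto simp: stop_min_def intro: order.trans)
    then have "{\<omega>\<in>space (F t). stop_min t \<omega> \<le> c} = {\<omega>\<in>\<Omega>. \<tau> \<omega> \<le> ereal c'}" using t by auto
    also have "\<dots> \<in> sets (F t)"
      using stop_sets[OF c'(1)] sets_F_mono[OF c'(1) t] c' False by auto
    finally show ?thesis .
  qed
qed

lemma compose_stop_min:
  assumes t: "t \<in> I" and f: "(\<lambda>(r, \<omega>). f r \<omega>) \<in> restrict_space borel (I \<inter> {..t}) \<Otimes>\<^sub>M F t \<rightarrow>\<^sub>M M"
  shows "(\<lambda>\<omega>. f (stop_min t \<omega>) \<omega>) \<in> F t \<rightarrow>\<^sub>M M"
proof -
  have z: "0 \<in> space (restrict_space borel (I \<inter> {..0}))" by (simp add: space_restrict_space)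
  have "(\<lambda>p. (stop_min t (snd p) + fst p, snd p)) \<in>
      restrict_space borel (I \<inter> {..0}) \<Otimes>\<^sub>M F t \<rightarrow>\<^sub>M restrict_space borel (I \<inter> {..t + 0}) \<Otimes>\<^sub>M F t"
    by (rule measurable_shift_time[OF stop_min_measurable[OF t] space_F[OF t] stop_min_time[OF t] stop_min_le])
  then have "(\<lambda>p. (stop_min t (snd p) + fst p, snd p)) \<in>
      restrict_space borel (I \<inter> {..0}) \<Otimes>\<^sub>M F t \<rightarrow>\<^sub>M restrict_space borel (I \<inter> {..t}) \<Otimes>\<^sub>M F t"
    by simp
  from measurable_compose[OF measurable_Pair1'[OF z] measurable_compose[OF this f]]
  show ?thesis by (simp add: case_prod_beta')
qed

end

end

context penalized_h_transform
begin

theorem Q_strong_markov: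
  assumes strong: "strong_markov_process I \<Omega> F X P"
  shows "strong_markov_process I \<Omega> F X Q"
proof -
  have prog: "progressively_measurable I F X"
    using strong by (simp add: strong_markov_process_def)
  have "AE \<omega> in Q x. \<tau> \<omega> < \<infinity> \<longrightarrow>
      real_cond_exp (Q x) (stopped_sigma I \<Omega> F \<tau>)
        (indicator {\<omega>\<in>\<Omega>. \<tau> \<omega> < \<infinity> \<and> path I (\<lambda>u \<omega>. X (real_of_ereal (\<tau> \<omega>) + u) \<omega>) \<omega> \<in> B}) \<omega> =
      measure (Q (X (real_of_ereal (\<tau> \<omega>)) \<omega>)) {\<omega>'\<in>\<Omega>. path I X \<omega>' \<in> B}"
    if stop: "stopping_time_on I \<Omega> F \<tau>" and B: "B \<in> sets paths" for x \<tau> B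
  proof -
    let ?G = "stopped_sigma I \<Omega> F \<tau>"
    let ?E = "\<lambda>B. {\<omega>\<in>\<Omega>. \<tau> \<omega> < \<infinity> \<and> path I (\<lambda>u \<omega>. X (real_of_ereal (\<tau> \<omega>) + u) \<omega>) \<omega> \<in> B}"
    let ?T = "\<lambda>n. stop_min \<tau> (real n)"
    let ?S = "\<lambda>n. {\<omega>\<in>\<Omega>. \<tau> \<omega> \<le> ereal (real n)}"
    note T = stop_min_measurable[OF stop] stop_min_time[OF stop] stop_min_le[OF stop]
    have T_eq: "stop_min \<tau> t \<omega> = real_of_ereal (\<tau> \<omega>)" if "\<tau> \<omega> \<le> ereal t" for t \<omega>
      using that by (simp add: stop_min_def[OF stop])
    have EY: "path I (\<lambda>u \<omega>. X (real_of_ereal (\<tau> \<omega>) + u) \<omega>) \<omega> = path I (\<lambda>u \<omega>. X (?T n \<omega> + u) \<omega>) \<omega>"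
      if "\<omega> \<in> ?S n" for \<omega> n
      using that by (simp add: T_eq)
    have finite_S: "\<omega> \<in> \<Omega> \<Longrightarrow> \<tau> \<omega> < \<infinity> \<longleftrightarrow> (\<exists>n. \<omega> \<in> ?S n)" for \<omega>
      using stop_finite_eq[OF stop] by blast
    have EB_S: "\<omega> \<in> ?E B \<longleftrightarrow> path I (\<lambda>u \<omega>. X (?T n \<omega> + u) \<omega>) \<omega> \<in> B" if "\<omega> \<in> ?S n" for \<omega> n B
      using that finite_S[of \<omega>] EY[OF that] by auto
    have ind_E: "indicator (A \<inter> ?S n) \<omega> * (a * indicator {\<omega>\<in>\<Omega>. path I (\<lambda>u \<omega>. X (?T n \<omega> + u) \<omega>) \<omega> \<in> B} \<omega>) =
        indicator (A \<inter> ?S n) \<omega> * (a * (indicator (?E B) \<omega> :: ennreal))" for A B n a \<omega>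
    proof (cases "\<omega> \<in> ?S n")
      case True
      then show ?thesis using EB_S[OF True, of B] by (simp add: indicator_def)
    next
      case False
      then have "indicator (A \<inter> ?S n) \<omega> = (0 :: ennreal)" by simp
      then show ?thesis by simp
    qed
    have YF: "(\<lambda>\<omega>. X (?T n \<omega> + u) \<omega>) \<in> F (real n + u) \<rightarrow>\<^sub>M borel" if "u \<in> I" for n u
      using Y_F[OF prog time_real T(1)[OF time_real] T(2)[OF time_real] T(3)] that by simp
    have YFinf: "\<forall>u\<in>I. (\<lambda>\<omega>. X (?T n \<omega> + u) \<omega>) \<in> Finf \<rightarrow>\<^sub>M borel" for n
      using measurable_F_Finf[OF YF] by simp
    have pT: "{\<omega>\<in>\<Omega>. path I (\<lambda>u \<omega>. X (?T n \<omega> + u) \<omega>) \<omega> \<in> B} \<in> sets Finf" if "B \<in> sets paths" for n B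
      by (rule Finf_preimage[OF measurable_path[OF YFinf] that])
    have E: "?E B \<in> sets Finf" if B: "B \<in> sets paths" for B
    proof -
      have "?E B = (\<Union>n. ?S n \<inter> {\<omega>\<in>\<Omega>. path I (\<lambda>u \<omega>. X (?T n \<omega> + u) \<omega>) \<omega> \<in> B})" (is "_ = ?U")
      proof (rule set_eqI)
        fix \<omega>
        have "\<omega> \<in> ?E B \<longleftrightarrow> (\<exists>n. \<omega> \<in> ?S n \<and> \<omega> \<in> ?E B)" using finite_S by blast
        also have "\<dots> \<longleftrightarrow> (\<exists>n. \<omega> \<in> ?S n \<and> path I (\<lambda>u \<omega>. X (?T n \<omega> + u) \<omega>) \<omega> \<in> B)"
          by (intro ex_cong1 conj_cong refl EB_S)
        also have "\<dots> \<longleftrightarrow> \<omega> \<in> ?U" by blast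
        finally show "\<omega> \<in> ?E B \<longleftrightarrow> \<omega> \<in> ?U" .
      qed
      then show ?thesis using stop_le_Finf[OF stop] pT[OF B] by auto
    qed
    have SG: "{\<omega>\<in>\<Omega>. \<tau> \<omega> < \<infinity>} \<in> sets ?G"
    proof -
      have "{\<omega>\<in>\<Omega>. \<tau> \<omega> < \<infinity>} \<inter> {\<omega>\<in>\<Omega>. \<tau> \<omega> \<le> ereal t} = {\<omega>\<in>\<Omega>. \<tau> \<omega> \<le> ereal t}" for t
        by (auto simp: le_less_trans[OF _ ereal_infty_less(1)[THEN iffD2]])
      moreover have "{\<omega>\<in>\<Omega>. \<tau> \<omega> < \<infinity>} \<in> sets Finf"
        unfolding stop_finite_eq[OF stop] using stop_le_Finf[OF stop] by (intro sets.countable_UN) auto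
      ultimately show ?thesis
        using stop_sets[OF stop] unfolding sets_Fstop[OF stop] by (simp del: ereal_infty_less)
    qed
    define g where "g R B \<omega> = (if \<tau> \<omega> < \<infinity> then measure (R (X (real_of_ereal (\<tau> \<omega>)) \<omega>)) {\<omega>'\<in>\<Omega>. path I X \<omega>' \<in> B} else 0)"
      for R :: "'e \<Rightarrow> 'w measure" and B \<omega>
    have gG: "g R B \<in> borel_measurable ?G" if R: "R \<in> borel \<rightarrow>\<^sub>M prob_algebra Finf" and B: "B \<in> sets paths" for R B
    proof (rule measurable_FstopI[OF stop])
      fix t assume t: "t \<in> I"
      have m: "(\<lambda>y. measure (R y) {\<omega>'\<in>\<Omega>. path I X \<omega>' \<in> B}) \<in> borel_measurable borel"
        by (rule measurable_compose[OF kernel_subprob[OF R]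
              measurable_measure_subprob_algebra[OF Finf_preimage[OF path_Finf B]]])
      have "(\<lambda>\<omega>. indicator {\<omega>\<in>\<Omega>. \<tau> \<omega> \<le> ereal t} \<omega> * measure (R (X (stop_min \<tau> t \<omega>) \<omega>)) {\<omega>'\<in>\<Omega>. path I X \<omega>' \<in> B}) \<in> borel_measurable (F t)"
        by (intro borel_measurable_times borel_measurable_indicator stop_sets[OF stop t]
            measurable_compose[OF compose_stop_min[OF stop t X_joint[OF prog t]] m])
      then show "(\<lambda>\<omega>. if \<tau> \<omega> \<le> ereal t then g R B \<omega> else 0) \<in> borel_measurable (F t)"
        by (rule measurable_cong[THEN iffD1, rotated]) (use t in \<open>auto simp: indicator_def g_def T_eq\<close>)
    qed (simp add: g_def)
    have regen: "(\<integral>\<^sup>+\<omega>. indicator (A \<inter> ?S n) \<omega> * indicator (?E B) \<omega> \<partial>Q x) =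
        (\<integral>\<^sup>+\<omega>. indicator (A \<inter> ?S n) \<omega> * ennreal (g Q B \<omega>) \<partial>Q x)"
      if A: "A \<in> sets ?G" for A n
    proof -
      have AF: "A \<inter> {\<omega>\<in>\<Omega>. \<tau> \<omega> \<le> ereal t} \<in> sets (F t)" if "t \<in> I" for t
        using A that by (simp add: sets_Fstop[OF stop])
      let ?V = "\<lambda>\<omega>. indicator (A \<inter> ?S n) \<omega> * ennreal (exp (l0 * ?T n \<omega>) * Z X (?T n \<omega>) \<omega>)"
      have VG: "?V \<in> borel_measurable ?G"
      proof (rule measurable_FstopI[OF stop])
        fix t assume t: "t \<in> I"
        let ?m = "min t (real n)"
        have m: "?m \<in> I" "?m \<le> t" using t by auto
        have "(\<lambda>\<omega>. indicator (A \<inter> {\<omega>\<in>\<Omega>. \<tau> \<omega> \<le> ereal ?m}) \<omega> * ennreal (exp (l0 * stop_min \<tau> ?m \<omega>) * Z X (stop_min \<tau> ?m \<omega>) \<omega>)) \<in> borel_measurable (F ?m)"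
          using AF[OF m(1)] compose_stop_min[OF stop m(1) Z_joint[OF m(1)]] T(1)[OF m(1)] by measurable
        then have "(\<lambda>\<omega>. indicator (A \<inter> {\<omega>\<in>\<Omega>. \<tau> \<omega> \<le> ereal ?m}) \<omega> * ennreal (exp (l0 * stop_min \<tau> ?m \<omega>) * Z X (stop_min \<tau> ?m \<omega>) \<omega>)) \<in> borel_measurable (F t)"
          by (rule measurable_F_mono) (use m t in auto)
        then show "(\<lambda>\<omega>. if \<tau> \<omega> \<le> ereal t then ?V \<omega> else 0) \<in> borel_measurable (F t)"
        proof (rule measurable_cong[THEN iffD1, rotated])
          fix \<omega>
          have "\<tau> \<omega> \<le> ereal ?m \<longleftrightarrow> \<tau> \<omega> \<le> ereal t \<and> \<tau> \<omega> \<le> ereal (real n)" by (auto simp: min_def intro: order.trans)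
          then show "indicator (A \<inter> {\<omega>\<in>\<Omega>. \<tau> \<omega> \<le> ereal ?m}) \<omega> * ennreal (exp (l0 * stop_min \<tau> ?m \<omega>) * Z X (stop_min \<tau> ?m \<omega>) \<omega>) =
              (if \<tau> \<omega> \<le> ereal t then ?V \<omega> else 0)"
            using T_eq[of \<omega> ?m] T_eq[of \<omega> "real n"] by (auto simp: indicator_def)
        qed
      qed (simp add: indicator_def)
      have "(\<integral>\<^sup>+\<omega>. indicator (A \<inter> ?S n) \<omega> * indicator {\<omega>\<in>\<Omega>. path I (\<lambda>u \<omega>. X (?T n \<omega> + u) \<omega>) \<omega> \<in> B} \<omega> \<partial>Q x) =
          (\<integral>\<^sup>+\<omega>. indicator (A \<inter> ?S n) \<omega> * emeasure (Q (X (?T n \<omega>) \<omega>)) {\<omega>'\<in>\<Omega>. path I X \<omega>' \<in> B} \<partial>Q x)"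
      proof (rule Q_regeneration[OF prog time_real T(1)[OF time_real] T(2)[OF time_real] T(3) AF[OF time_real] _ B])
        fix B assume B: "B \<in> sets paths"
        have gP: "g P B \<in> borel_measurable ?G" by (rule gG[OF P_kernel B])
        have ce: "AE \<omega> in P x. \<omega> \<in> {\<omega>\<in>\<Omega>. \<tau> \<omega> < \<infinity>} \<longrightarrow> real_cond_exp (P x) ?G (indicator (?E B)) \<omega> = g P B \<omega>"
        proof -
          have "AE \<omega> in P x. \<tau> \<omega> < \<infinity> \<longrightarrow> real_cond_exp (P x) ?G (indicator (?E B)) \<omega> =
              measure (P (X (real_of_ereal (\<tau> \<omega>)) \<omega>)) {\<omega>'\<in>\<Omega>. path I X \<omega>' \<in> B}"
            using strong stop B unfolding strong_markov_process_def by blast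
          then show ?thesis by eventually_elim (simp add: g_def)
        qed
        have "(\<integral>\<^sup>+\<omega>. ?V \<omega> * indicator (?E B) \<omega> \<partial>P x) = (\<integral>\<^sup>+\<omega>. ?V \<omega> * ennreal (g P B \<omega>) \<partial>P x)"
        proof (rule nn_integral_weight_cond_exp_indicator[OF prob_P subalgebra_Fstop[OF stop sets_P] _ SG _ _ ce VG])
          show "?E B \<in> sets (P x)" using E[OF B] by simp
          show "g P B \<in> borel_measurable (P x)"
            by (rule measurable_from_subalg[OF subalgebra_Fstop[OF stop sets_P] gP])
        qed (auto simp: g_def indicator_def)
        moreover have "(\<integral>\<^sup>+\<omega>. ?V \<omega> * indicator (?E B) \<omega> \<partial>P x) =
            (\<integral>\<^sup>+\<omega>. ?V \<omega> * indicator {\<omega>\<in>\<Omega>. path I (\<lambda>u \<omega>. X (?T n \<omega> + u) \<omega>) \<omega> \<in> B} \<omega> \<partial>P x)"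
          by (intro nn_integral_cong) (simp only: mult.assoc ind_E)
        moreover have "(\<integral>\<^sup>+\<omega>. ?V \<omega> * ennreal (g P B \<omega>) \<partial>P x) =
            (\<integral>\<^sup>+\<omega>. ?V \<omega> * emeasure (P (X (?T n \<omega>) \<omega>)) {\<omega>'\<in>\<Omega>. path I X \<omega>' \<in> B} \<partial>P x)"
          using finite_S
          by (intro nn_integral_cong)
            (auto simp: indicator_def g_def T_eq finite_measure.emeasure_eq_measure[OF prob_space.finite_measure[OF prob_P]])
        ultimately show "(\<integral>\<^sup>+\<omega>. ?V \<omega> * indicator {\<omega>\<in>\<Omega>. path I (\<lambda>u \<omega>. X (?T n \<omega> + u) \<omega>) \<omega> \<in> B} \<omega> \<partial>P x) =
            (\<integral>\<^sup>+\<omega>. ?V \<omega> * emeasure (P (X (?T n \<omega>) \<omega>)) {\<omega>'\<in>\<Omega>. path I X \<omega>' \<in> B} \<partial>P x)" by simp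
      qed
      moreover have "(\<integral>\<^sup>+\<omega>. indicator (A \<inter> ?S n) \<omega> * indicator {\<omega>\<in>\<Omega>. path I (\<lambda>u \<omega>. X (?T n \<omega> + u) \<omega>) \<omega> \<in> B} \<omega> \<partial>Q x) =
          (\<integral>\<^sup>+\<omega>. indicator (A \<inter> ?S n) \<omega> * indicator (?E B) \<omega> \<partial>Q x)"
        using ind_E[of A n _ 1 B] by (intro nn_integral_cong) (simp only: mult_1_left)
      moreover have "(\<integral>\<^sup>+\<omega>. indicator (A \<inter> ?S n) \<omega> * emeasure (Q (X (?T n \<omega>) \<omega>)) {\<omega>'\<in>\<Omega>. path I X \<omega>' \<in> B} \<partial>Q x) =
          (\<integral>\<^sup>+\<omega>. indicator (A \<inter> ?S n) \<omega> * ennreal (g Q B \<omega>) \<partial>Q x)"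
        using finite_S
        by (intro nn_integral_cong)
          (auto simp: indicator_def g_def T_eq finite_measure.emeasure_eq_measure[OF prob_space.finite_measure[OF prob_Q]])
      ultimately show ?thesis by simp
    qed
    have lim: "(\<integral>\<^sup>+\<omega>. indicator A \<omega> * f \<omega> \<partial>Q x) = (SUP n. (\<integral>\<^sup>+\<omega>. indicator (A \<inter> ?S n) \<omega> * f \<omega> \<partial>Q x))"
      if A: "A \<in> sets Finf" and f: "f \<in> borel_measurable Finf" and f0: "\<And>\<omega>. \<omega> \<in> \<Omega> \<Longrightarrow> \<tau> \<omega> = \<infinity> \<Longrightarrow> f \<omega> = 0" for A f
    proof -
      have "(\<integral>\<^sup>+\<omega>. indicator A \<omega> * f \<omega> \<partial>Q x) = (\<integral>\<^sup>+\<omega>. (SUP n. indicator (A \<inter> ?S n) \<omega> * f \<omega>) \<partial>Q x)"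
      proof (rule nn_integral_cong)
        fix \<omega> assume "\<omega> \<in> space (Q x)"
        then have \<omega>: "\<omega> \<in> \<Omega>" by simp
        show "indicator A \<omega> * f \<omega> = (SUP n. indicator (A \<inter> ?S n) \<omega> * f \<omega>)"
        proof (cases "\<tau> \<omega> < \<infinity>")
          case True
          then obtain n where n: "\<omega> \<in> ?S n" using finite_S[OF \<omega>] by blast
          show ?thesis
          proof (rule antisym)
            have "indicator A \<omega> * f \<omega> = indicator (A \<inter> ?S n) \<omega> * f \<omega>" using n by (simp add: indicator_def)
            then show "indicator A \<omega> * f \<omega> \<le> (SUP n. indicator (A \<inter> ?S n) \<omega> * f \<omega>)"
              by (intro SUP_upper2[of n]) auto
          qed (auto intro!: SUP_least simp: indicator_def)
        qed (use f0[OF \<omega>] in simp)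
      qed
      also have "\<dots> = (SUP n. (\<integral>\<^sup>+\<omega>. indicator (A \<inter> ?S n) \<omega> * f \<omega> \<partial>Q x))"
      proof (rule nn_integral_monotone_convergence_SUP)
        show "incseq (\<lambda>n \<omega>. indicator (A \<inter> ?S n) \<omega> * f \<omega>)"
        proof (rule incseq_SucI, rule le_funI, rule mult_right_mono)
          fix n \<omega>
          show "indicator (A \<inter> ?S n) \<omega> \<le> (indicator (A \<inter> ?S (Suc n)) \<omega> :: ennreal)"
            by (auto simp: indicator_def intro: order.trans)
        qed simp
        show "(\<lambda>\<omega>. indicator (A \<inter> ?S n) \<omega> * f \<omega>) \<in> borel_measurable (Q x)" for n
          using f by (intro borel_measurable_times_ennreal borel_measurable_indicator)
            (use A stop_le_Finf[OF stop] in auto)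
      qed
      finally show ?thesis .
    qed
    have "AE \<omega> in Q x. real_cond_exp (Q x) ?G (indicator (?E B)) \<omega> = g Q B \<omega>"
    proof (rule real_cond_exp_indicator_eqI[OF prob_Q subalgebra_Fstop[OF stop sets_Q] _ gG[OF Q_kernel B]])
      show "?E B \<in> sets (Q x)" using E[OF B] by simp
      fix A assume A: "A \<in> sets ?G"
      then have AM: "A \<in> sets Finf" by (simp add: sets_Fstop[OF stop])
      have gm: "(\<lambda>\<omega>. ennreal (g Q B \<omega>)) \<in> borel_measurable Finf"
        using measurable_from_subalg[OF subalgebra_Fstop[OF stop refl] gG[OF Q_kernel B]] by measurable
      show "(\<integral>\<^sup>+\<omega>. indicator A \<omega> * indicator (?E B) \<omega> \<partial>Q x) = (\<integral>\<^sup>+\<omega>. indicator A \<omega> * ennreal (g Q B \<omega>) \<partial>Q x)"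
        by (subst (1 2) lim[OF AM]) (use gm E[OF B] regen[OF A] in \<open>auto simp: g_def\<close>)
    qed (auto simp: g_def prob_space.prob_le_1[OF prob_Q])
    then show ?thesis by eventually_elim (simp add: g_def)
  qed
  then show ?thesis
    using Q_markov prog unfolding strong_markov_process_def by blast
qed

end

section \<open>Coupling two laws through their common part\<close>

text \<open>The common part of the densities transports \<open>U\<close> to \<open>V\<close> along \<open>M\<close>. The residual densities \<open>g1 - min g1 g2\<close>
  and \<open>g2 - min g1 g2\<close> have the same mass and are coupled independently; there the cost is only bounded by \<open>b\<close>.\<close>

lemma overlap_coupling:
  fixes U V :: "'a \<Rightarrow> 'e::second_countable_topology" and g1 g2 :: "'a \<Rightarrow> real"
  assumes M: "prob_space M" and U[measurable]: "U \<in> M \<rightarrow>\<^sub>M borel" and V[measurable]: "V \<in> M \<rightarrow>\<^sub>M borel"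
    and g[measurable]: "g1 \<in> borel_measurable M" "g2 \<in> borel_measurable M"
    and g0: "\<And>\<omega>. 0 \<le> g1 \<omega>" "\<And>\<omega>. 0 \<le> g2 \<omega>"
    and g1_mass: "(\<integral>\<^sup>+\<omega>. ennreal (g1 \<omega>) \<partial>M) = 1" and g2_mass: "(\<integral>\<^sup>+\<omega>. ennreal (g2 \<omega>) \<partial>M) = 1"
  obtains \<pi> where "\<pi> \<in> couplings (distr (density M (\<lambda>\<omega>. ennreal (g1 \<omega>))) borel U) (distr (density M (\<lambda>\<omega>. ennreal (g2 \<omega>))) borel V)"
    and "\<And>(c :: 'e \<times> 'e \<Rightarrow> ennreal) b. c \<in> borel_measurable (borel \<Otimes>\<^sub>M borel) \<Longrightarrow> (\<And>z. c z \<le> b) \<Longrightarrow>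
      (\<integral>\<^sup>+z. c z \<partial>\<pi>) \<le> (\<integral>\<^sup>+\<omega>. ennreal (min (g1 \<omega>) (g2 \<omega>)) * c (U \<omega>, V \<omega>) \<partial>M) +
        b * (1 - (\<integral>\<^sup>+\<omega>. ennreal (min (g1 \<omega>) (g2 \<omega>)) \<partial>M))"
proof -
  interpret M: prob_space M by fact
  interpret MM: pair_sigma_finite M M ..
  define h where "h \<omega> = min (g1 \<omega>) (g2 \<omega>)" for \<omega>
  define r1 where "r1 \<omega> = g1 \<omega> - h \<omega>" for \<omega>
  define r2 where "r2 \<omega> = g2 \<omega> - h \<omega>" for \<omega>
  have [measurable]: "h \<in> borel_measurable M" "r1 \<in> borel_measurable M" "r2 \<in> borel_measurable M"
    unfolding h_def r1_def r2_def by measurable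
  have nn: "0 \<le> h \<omega>" "0 \<le> r1 \<omega>" "0 \<le> r2 \<omega>" for \<omega>
    using g0 by (auto simp: h_def r1_def r2_def)
  have split1: "ennreal (g1 \<omega>) = ennreal (h \<omega>) + ennreal (r1 \<omega>)"
    and split2: "ennreal (g2 \<omega>) = ennreal (h \<omega>) + ennreal (r2 \<omega>)" for \<omega>
    using nn by (simp_all add: ennreal_plus[symmetric] r1_def r2_def del: ennreal_plus)
  define r where "r = 1 - (\<integral>\<^sup>+\<omega>. ennreal (h \<omega>) \<partial>M)"
  have hle: "(\<integral>\<^sup>+\<omega>. ennreal (h \<omega>) \<partial>M) \<le> 1"
    unfolding g1_mass[symmetric] by (intro nn_integral_mono ennreal_leI) (simp add: h_def)
  have top: "(\<integral>\<^sup>+\<omega>. ennreal (h \<omega>) \<partial>M) \<noteq> top" using hle by (rule neq_top_trans[rotated]) simp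
  have rest: "(\<integral>\<^sup>+\<omega>. ennreal (r1 \<omega>) \<partial>M) = r" "(\<integral>\<^sup>+\<omega>. ennreal (r2 \<omega>) \<partial>M) = r"
  proof -
    have "1 = (\<integral>\<^sup>+\<omega>. ennreal (h \<omega>) \<partial>M) + (\<integral>\<^sup>+\<omega>. ennreal (r1 \<omega>) \<partial>M)"
      unfolding g1_mass[symmetric] split1 by (intro nn_integral_add) measurable
    then show "(\<integral>\<^sup>+\<omega>. ennreal (r1 \<omega>) \<partial>M) = r"
      using ennreal_add_diff_cancel_left[OF top, of "\<integral>\<^sup>+\<omega>. ennreal (r1 \<omega>) \<partial>M"] by (simp add: r_def)
    have "1 = (\<integral>\<^sup>+\<omega>. ennreal (h \<omega>) \<partial>M) + (\<integral>\<^sup>+\<omega>. ennreal (r2 \<omega>) \<partial>M)"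
      unfolding g2_mass[symmetric] split2 by (intro nn_integral_add) measurable
    then show "(\<integral>\<^sup>+\<omega>. ennreal (r2 \<omega>) \<partial>M) = r"
      using ennreal_add_diff_cancel_left[OF top, of "\<integral>\<^sup>+\<omega>. ennreal (r2 \<omega>) \<partial>M"] by (simp add: r_def)
  qed
  have r1: "r \<le> 1" unfolding r_def by simp
  then have r_fin: "r < \<infinity>" by (simp add: order.strict_trans1)
  \<comment> \<open>The boolean selects the common part, where both coordinates are read off the same point, or
    the independent residuals.\<close>
  define N where "N = density ((M \<Otimes>\<^sub>M M) \<Otimes>\<^sub>M count_space (UNIV :: bool set))
    (\<lambda>(p, s). if s then ennreal (h (fst p)) else ennreal (r1 (fst p)) * (ennreal (r2 (snd p)) / r))"
  define \<phi> where "\<phi> q = (U (fst (fst q)), if snd q then V (fst (fst q)) else V (snd (fst q)))"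
    for q :: "('a \<times> 'a) \<times> bool"
  have dens[measurable]: "(\<lambda>(p, s). if s then ennreal (h (fst p)) else ennreal (r1 (fst p)) * (ennreal (r2 (snd p)) / r))
      \<in> borel_measurable ((M \<Otimes>\<^sub>M M) \<Otimes>\<^sub>M count_space (UNIV :: bool set))"
    unfolding case_prod_beta' by measurable
  have \<phi>[measurable]: "\<phi> \<in> (M \<Otimes>\<^sub>M M) \<Otimes>\<^sub>M count_space (UNIV :: bool set) \<rightarrow>\<^sub>M borel \<Otimes>\<^sub>M borel"
    unfolding \<phi>_def[abs_def] by measurable
  define \<pi> where "\<pi> = distr N (borel \<Otimes>\<^sub>M borel) \<phi>"
  have sN[measurable_cong]: "sets N = sets ((M \<Otimes>\<^sub>M M) \<Otimes>\<^sub>M count_space (UNIV :: bool set))"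
    by (simp add: N_def)
  interpret C: sigma_finite_measure "count_space (UNIV :: bool set)"
    by (rule sigma_finite_measure_count_space_finite) simp
  have int: "(\<integral>\<^sup>+z. f z \<partial>\<pi>) = (\<integral>\<^sup>+\<omega>. ennreal (h \<omega>) * f (U \<omega>, V \<omega>) \<partial>M) +
      (\<integral>\<^sup>+\<omega>. (\<integral>\<^sup>+\<omega>'. ennreal (r1 \<omega>) * (ennreal (r2 \<omega>') / r) * f (U \<omega>, V \<omega>') \<partial>M) \<partial>M)"
    if f[measurable]: "f \<in> borel_measurable (borel \<Otimes>\<^sub>M borel)" for f :: "'e \<times> 'e \<Rightarrow> ennreal"
  proof -
    let ?k = "\<lambda>p s. (if s then ennreal (h (fst p)) else ennreal (r1 (fst p)) * (ennreal (r2 (snd p)) / r)) * f (\<phi> (p, s))"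
    have m: "(\<lambda>q. ?k (fst q) (snd q)) \<in> borel_measurable ((M \<Otimes>\<^sub>M M) \<Otimes>\<^sub>M count_space (UNIV :: bool set))"
      using borel_measurable_times_ennreal[OF dens measurable_compose[OF \<phi> f]] by (simp add: case_prod_beta')
    have "(\<integral>\<^sup>+z. f z \<partial>\<pi>) = (\<integral>\<^sup>+q. ?k (fst q) (snd q) \<partial>((M \<Otimes>\<^sub>M M) \<Otimes>\<^sub>M count_space (UNIV :: bool set)))"
      unfolding \<pi>_def by (subst nn_integral_distr) (auto simp: N_def nn_integral_density case_prod_beta')
    also have "\<dots> = (\<integral>\<^sup>+p. (\<integral>\<^sup>+s. ?k p s \<partial>count_space UNIV) \<partial>(M \<Otimes>\<^sub>M M))"
      using C.nn_integral_fst[OF m, symmetric] by (simp only: fst_conv snd_conv prod.collapse)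
    also have "\<dots> = (\<integral>\<^sup>+p. ennreal (h (fst p)) * f (U (fst p), V (fst p)) +
        ennreal (r1 (fst p)) * (ennreal (r2 (snd p)) / r) * f (U (fst p), V (snd p)) \<partial>(M \<Otimes>\<^sub>M M))"
      by (simp add: nn_integral_count_space_finite UNIV_bool \<phi>_def add.commute)
    also have "\<dots> = (\<integral>\<^sup>+p. ennreal (h (fst p)) * f (U (fst p), V (fst p)) \<partial>(M \<Otimes>\<^sub>M M)) +
        (\<integral>\<^sup>+p. ennreal (r1 (fst p)) * (ennreal (r2 (snd p)) / r) * f (U (fst p), V (snd p)) \<partial>(M \<Otimes>\<^sub>M M))"
      by (intro nn_integral_add) measurable
    also have "(\<integral>\<^sup>+p. ennreal (h (fst p)) * f (U (fst p), V (fst p)) \<partial>(M \<Otimes>\<^sub>M M)) =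
        (\<integral>\<^sup>+\<omega>. ennreal (h \<omega>) * f (U \<omega>, V \<omega>) \<partial>M)"
      by (subst M.nn_integral_fst[symmetric]) (auto simp: M.emeasure_space_1)
    also have "(\<integral>\<^sup>+p. ennreal (r1 (fst p)) * (ennreal (r2 (snd p)) / r) * f (U (fst p), V (snd p)) \<partial>(M \<Otimes>\<^sub>M M)) =
        (\<integral>\<^sup>+\<omega>. (\<integral>\<^sup>+\<omega>'. ennreal (r1 \<omega>) * (ennreal (r2 \<omega>') / r) * f (U \<omega>, V \<omega>') \<partial>M) \<partial>M)"
      by (subst M.nn_integral_fst[symmetric]) auto
    finally show ?thesis .
  qed
  have null: "AE \<omega> in M. r1 \<omega> = 0" "AE \<omega> in M. r2 \<omega> = 0" if "r = 0"
    using rest that nn by (auto simp: nn_integral_0_iff_AE antisym)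
  have quot1: "r * (a / r) = a" if "r \<noteq> 0" for a :: ennreal
    using that r_fin by (simp add: ennreal_times_divide mult_divide_eq_ennreal mult.commute[of r])
  have cancel1: "(\<integral>\<^sup>+\<omega>. (\<integral>\<^sup>+\<omega>'. ennreal (r1 \<omega>) * (ennreal (r2 \<omega>') / r) * k \<omega> \<partial>M) \<partial>M) = (\<integral>\<^sup>+\<omega>. ennreal (r1 \<omega>) * k \<omega> \<partial>M)"
    if k[measurable]: "k \<in> borel_measurable M" for k :: "'a \<Rightarrow> ennreal"
  proof (cases "r = 0")
    case True
    have "(\<integral>\<^sup>+\<omega>. (\<integral>\<^sup>+\<omega>'. ennreal (r1 \<omega>) * (ennreal (r2 \<omega>') / r) * k \<omega> \<partial>M) \<partial>M) = (\<integral>\<^sup>+\<omega>. 0 \<partial>M)"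
      by (rule nn_integral_cong_AE) (use null(1)[OF True] in eventually_elim, simp)
    moreover have "(\<integral>\<^sup>+\<omega>. ennreal (r1 \<omega>) * k \<omega> \<partial>M) = (\<integral>\<^sup>+\<omega>. 0 \<partial>M)"
      by (rule nn_integral_cong_AE) (use null(1)[OF True] in eventually_elim, simp)
    ultimately show ?thesis by simp
  next
    case False
    have "(\<integral>\<^sup>+\<omega>'. ennreal (r1 \<omega>) * (ennreal (r2 \<omega>') / r) * k \<omega> \<partial>M) = ennreal (r1 \<omega>) * k \<omega>" for \<omega>
    proof -
      have "(\<integral>\<^sup>+\<omega>'. ennreal (r1 \<omega>) * (ennreal (r2 \<omega>') / r) * k \<omega> \<partial>M) = (\<integral>\<^sup>+\<omega>'. (ennreal (r1 \<omega>) * k \<omega>) * (ennreal (r2 \<omega>') / r) \<partial>M)"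
        by (simp add: ac_simps)
      also have "\<dots> = (ennreal (r1 \<omega>) * k \<omega>) * (r / r)"
        by (subst nn_integral_cmult) (simp_all add: nn_integral_divide rest)
      also have "r / r = 1" using False r_fin by (simp add: ennreal_divide_self less_top)
      finally show ?thesis by simp
    qed
    then show ?thesis by simp
  qed
  have cancel2: "(\<integral>\<^sup>+\<omega>. (\<integral>\<^sup>+\<omega>'. ennreal (r1 \<omega>) * (ennreal (r2 \<omega>') / r) * k \<omega>' \<partial>M) \<partial>M) = (\<integral>\<^sup>+\<omega>. ennreal (r2 \<omega>) * k \<omega> \<partial>M)"
    if k[measurable]: "k \<in> borel_measurable M" for k :: "'a \<Rightarrow> ennreal"
  proof (cases "r = 0")
    case True
    have "(\<integral>\<^sup>+\<omega>. (\<integral>\<^sup>+\<omega>'. ennreal (r1 \<omega>) * (ennreal (r2 \<omega>') / r) * k \<omega>' \<partial>M) \<partial>M) = (\<integral>\<^sup>+\<omega>. 0 \<partial>M)"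
      by (rule nn_integral_cong_AE) (use null(1)[OF True] in eventually_elim, simp)
    moreover have "(\<integral>\<^sup>+\<omega>. ennreal (r2 \<omega>) * k \<omega> \<partial>M) = (\<integral>\<^sup>+\<omega>. 0 \<partial>M)"
      by (rule nn_integral_cong_AE) (use null(2)[OF True] in eventually_elim, simp)
    ultimately show ?thesis by simp
  next
    case False
    have "(\<integral>\<^sup>+\<omega>. (\<integral>\<^sup>+\<omega>'. ennreal (r1 \<omega>) * (ennreal (r2 \<omega>') / r) * k \<omega>' \<partial>M) \<partial>M) =
        (\<integral>\<^sup>+\<omega>. ennreal (r1 \<omega>) * (\<integral>\<^sup>+\<omega>'. (ennreal (r2 \<omega>') / r) * k \<omega>' \<partial>M) \<partial>M)"
      by (intro nn_integral_cong, subst nn_integral_cmult[symmetric]) (auto simp: mult.assoc)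
    also have "\<dots> = r * (\<integral>\<^sup>+\<omega>'. (ennreal (r2 \<omega>') / r) * k \<omega>' \<partial>M)"
      by (subst nn_integral_multc) (simp_all add: rest)
    also have "\<dots> = (\<integral>\<^sup>+\<omega>'. r * ((ennreal (r2 \<omega>') / r) * k \<omega>') \<partial>M)"
      by (rule nn_integral_cmult[symmetric]) measurable
    also have "\<dots> = (\<integral>\<^sup>+\<omega>. ennreal (r2 \<omega>) * k \<omega> \<partial>M)"
      by (simp only: mult.assoc[symmetric] quot1[OF False])
    finally show ?thesis .
  qed
  have s\<pi>[measurable_cong]: "sets \<pi> = sets (borel \<Otimes>\<^sub>M borel)" by (simp add: \<pi>_def)
  have marg1: "distr \<pi> borel fst = distr (density M (\<lambda>\<omega>. ennreal (g1 \<omega>))) borel U"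
  proof (rule measure_eqI)
    fix B assume "B \<in> sets (distr \<pi> borel fst)"
    then have B[measurable]: "B \<in> sets borel" by simp
    have "emeasure (distr \<pi> borel fst) B = (\<integral>\<^sup>+z. indicator B z \<partial>distr \<pi> borel fst)" by simp
    also have "\<dots> = (\<integral>\<^sup>+z. indicator B (fst z) \<partial>\<pi>)" by (rule nn_integral_distr) measurable
    also have "\<dots> = (\<integral>\<^sup>+\<omega>. ennreal (h \<omega>) * indicator B (U \<omega>) \<partial>M) + (\<integral>\<^sup>+\<omega>. ennreal (r1 \<omega>) * indicator B (U \<omega>) \<partial>M)"
      using cancel1[of "\<lambda>\<omega>. indicator B (U \<omega>)"] by (subst int) auto
    also have "\<dots> = (\<integral>\<^sup>+\<omega>. ennreal (g1 \<omega>) * indicator B (U \<omega>) \<partial>M)"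
      unfolding split1 distrib_right by (rule nn_integral_add[symmetric]) measurable
    also have "\<dots> = (\<integral>\<^sup>+z. indicator B z \<partial>distr (density M (\<lambda>\<omega>. ennreal (g1 \<omega>))) borel U)"
      by (subst nn_integral_distr) (auto simp: nn_integral_density)
    finally show "emeasure (distr \<pi> borel fst) B = emeasure (distr (density M (\<lambda>\<omega>. ennreal (g1 \<omega>))) borel U) B" by simp
  qed simp
  have marg2: "distr \<pi> borel snd = distr (density M (\<lambda>\<omega>. ennreal (g2 \<omega>))) borel V"
  proof (rule measure_eqI)
    fix B assume "B \<in> sets (distr \<pi> borel snd)"
    then have B[measurable]: "B \<in> sets borel" by simp
    have "emeasure (distr \<pi> borel snd) B = (\<integral>\<^sup>+z. indicator B z \<partial>distr \<pi> borel snd)" by simp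
    also have "\<dots> = (\<integral>\<^sup>+z. indicator B (snd z) \<partial>\<pi>)" by (rule nn_integral_distr) measurable
    also have "\<dots> = (\<integral>\<^sup>+\<omega>. ennreal (h \<omega>) * indicator B (V \<omega>) \<partial>M) + (\<integral>\<^sup>+\<omega>. ennreal (r2 \<omega>) * indicator B (V \<omega>) \<partial>M)"
      using cancel2[of "\<lambda>\<omega>. indicator B (V \<omega>)"] by (subst int) auto
    also have "\<dots> = (\<integral>\<^sup>+\<omega>. ennreal (g2 \<omega>) * indicator B (V \<omega>) \<partial>M)"
      unfolding split2 distrib_right by (rule nn_integral_add[symmetric]) measurable
    also have "\<dots> = (\<integral>\<^sup>+z. indicator B z \<partial>distr (density M (\<lambda>\<omega>. ennreal (g2 \<omega>))) borel V)"
      by (subst nn_integral_distr) (auto simp: nn_integral_density)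
    finally show "emeasure (distr \<pi> borel snd) B = emeasure (distr (density M (\<lambda>\<omega>. ennreal (g2 \<omega>))) borel V) B" by simp
  qed simp
  show thesis
  proof (rule that)
    show "\<pi> \<in> couplings (distr (density M (\<lambda>\<omega>. ennreal (g1 \<omega>))) borel U) (distr (density M (\<lambda>\<omega>. ennreal (g2 \<omega>))) borel V)"
      using s\<pi> marg1 marg2 by (simp add: couplings_def)
    fix c :: "'e \<times> 'e \<Rightarrow> ennreal" and b :: ennreal assume c[measurable]: "c \<in> borel_measurable (borel \<Otimes>\<^sub>M borel)" and cb: "\<And>z. c z \<le> b"
    have "(\<integral>\<^sup>+\<omega>. (\<integral>\<^sup>+\<omega>'. ennreal (r1 \<omega>) * (ennreal (r2 \<omega>') / r) * c (U \<omega>, V \<omega>') \<partial>M) \<partial>M) \<le>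
        (\<integral>\<^sup>+\<omega>. (\<integral>\<^sup>+\<omega>'. ennreal (r1 \<omega>) * (ennreal (r2 \<omega>') / r) * b \<partial>M) \<partial>M)"
      by (intro nn_integral_mono mult_left_mono cb) auto
    also have "\<dots> = b * r"
    proof -
      have "(\<integral>\<^sup>+\<omega>. ennreal (r1 \<omega>) * b \<partial>M) = r * b" by (subst nn_integral_multc) (simp_all add: rest)
      then show ?thesis using cancel1[of "\<lambda>_. b"] by (simp only: mult.commute[of r b]) simp
    qed
    finally show "(\<integral>\<^sup>+z. c z \<partial>\<pi>) \<le> (\<integral>\<^sup>+\<omega>. ennreal (min (g1 \<omega>) (g2 \<omega>)) * c (U \<omega>, V \<omega>) \<partial>M) +
        b * (1 - (\<integral>\<^sup>+\<omega>. ennreal (min (g1 \<omega>) (g2 \<omega>)) \<partial>M))"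
      unfolding int[OF c] r_def[symmetric] h_def[symmetric] by (intro add_left_mono)
  qed
qed

section \<open>Estimates on the penalization from the coupling\<close>

context penalized_markov
begin

abbreviation EZ :: "real \<Rightarrow> 'e \<Rightarrow> real" where "EZ t x \<equiv> penal_mean I \<rho> X P t x"

lemma Z_integrable: "t \<in> I \<Longrightarrow> integrable (P x) (Z X t)"
proof -
  assume t: "t \<in> I"
  interpret prob_space "P x" by simp
  show ?thesis using t by (intro integrable_const_bound[where B = 1]) auto
qed

lemma EZ_nn_integral: "t \<in> I \<Longrightarrow> (\<integral>\<^sup>+\<omega>. ennreal (Z X t \<omega>) \<partial>P x) = ennreal (EZ t x)"
  unfolding penal_mean_def by (intro nn_integral_eq_integral Z_integrable) auto

lemma EZ_pos:
  assumes t: "t \<in> I" shows "0 < EZ t x"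
proof -
  interpret prob_space "P x" by simp
  have "0 \<le> EZ t x" unfolding penal_mean_def using t by (intro integral_nonneg_AE) auto
  moreover have "EZ t x \<noteq> 0"
  proof
    assume "EZ t x = 0"
    then have "AE \<omega> in P x. Z X t \<omega> = 0"
      using t integral_nonneg_eq_0_iff_AE[OF Z_integrable[OF t, of x]] by (simp add: penal_mean_def)
    moreover have "Z X t \<omega> \<noteq> 0" for \<omega> using penal_pos[OF t, of X \<omega>] by linarith
    ultimately show False using AE_False by auto
  qed
  ultimately show ?thesis by simp
qed

lemma EZ_nonneg [simp]: "t \<in> I \<Longrightarrow> 0 \<le> EZ t x"
  by (rule less_imp_le) (rule EZ_pos)

lemma EZ_le_one: "t \<in> I \<Longrightarrow> EZ t x \<le> 1"
proof -
  assume t: "t \<in> I"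
  interpret prob_space "P x" by simp
  have "EZ t x \<le> (\<integral>\<omega>. 1 \<partial>P x)"
    unfolding penal_mean_def using t by (intro integral_mono Z_integrable) auto
  then show ?thesis by (simp add: prob_space[simplified])
qed

lemma EZ_measurable: "t \<in> I \<Longrightarrow> EZ t \<in> borel_measurable borel"
proof -
  assume t: "t \<in> I"
  have "(\<lambda>x. enn2real (\<integral>\<^sup>+\<omega>. ennreal (Z X t \<omega>) \<partial>P x)) \<in> borel_measurable borel"
    using t by (intro borel_measurable_enn2real kernel_nn_integral_measurable[OF P_kernel]) measurable
  then show ?thesis using t by (simp add: EZ_nn_integral enn2real_ennreal)
qed

lemma EZ_markov:
  assumes s: "s \<in> I" and u: "u \<in> I" and A: "A \<in> sets (F s)"
  shows "(\<integral>\<^sup>+\<omega>. indicator A \<omega> * ennreal (Z X (s + u) \<omega>) \<partial>P x) =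
    (\<integral>\<^sup>+\<omega>. indicator A \<omega> * (ennreal (Z X s \<omega>) * ennreal (EZ u (X s \<omega>))) \<partial>P x)"
proof -
  interpret prob_space "P x" by simp
  have "A \<in> sets Finf" using A sets_F_Finf[OF s] by auto
  then have fin: "(\<integral>\<^sup>+\<omega>. indicator A \<omega> \<partial>P x) < \<infinity>" by (simp add: less_top[symmetric])
  show ?thesis
    using penalized_markov[OF s u borel_measurable_indicator[OF A] fin, of "\<lambda>_. 1"] u
    by (simp add: EZ_nn_integral)
qed

end

locale penalized_coupling = penalized_markov I \<rho> K \<Omega> F X P
  for I and \<rho> :: "'e::polish_space \<Rightarrow> real" and K \<Omega> F and X :: "real \<Rightarrow> 'w \<Rightarrow> 'e" and P +
  fixes D CA gA CB CC :: real
    and \<Omega>' :: "'v set" and X' Y' :: "real \<Rightarrow> 'v \<Rightarrow> 'e" and PP :: "'e \<times> 'e \<Rightarrow> 'v measure"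
  assumes dist_le: "\<And>x y :: 'e. dist x y \<le> D"
    and coupling: "markovian_coupling I X P \<Omega>' X' Y' PP"
    and progressive_X': "progressively_measurable I (natural_filtration I \<Omega>' (\<lambda>t \<omega>. (X' t \<omega>, Y' t \<omega>))) (\<lambda>t \<omega>. \<rho> (X' t \<omega>))"
    and progressive_Y': "progressively_measurable I (natural_filtration I \<Omega>' (\<lambda>t \<omega>. (X' t \<omega>, Y' t \<omega>))) (\<lambda>t \<omega>. \<rho> (Y' t \<omega>))"
    and CA_pos: "0 < CA" and CB_pos: "0 < CB" and CC_gt: "1 < CC" and gA_pos: "0 < gA"
    and condition_A: "\<And>x y t. t \<in> I \<Longrightarrow>
      (\<integral>\<omega>. penal I \<rho> X' t \<omega> / penal_mean I \<rho> X P t x * dist (X' t \<omega>) (Y' t \<omega>) \<partial>PP (x, y)) \<le> CA * exp (- gA * t) * dist x y"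
    and CB_bound: "\<And>x y t. t \<in> I \<Longrightarrow>
      (\<integral>\<omega>. \<bar>penal I \<rho> X' t \<omega> - penal I \<rho> Y' t \<omega>\<bar> \<partial>PP (x, y)) \<le> CB * dist x y * penal_mean I \<rho> X P t x"
    and CC_bound: "\<And>x y t. t \<in> I \<Longrightarrow>
      (\<integral>\<omega>. min (penal I \<rho> X' t \<omega> / penal_mean I \<rho> X P t x) (penal I \<rho> Y' t \<omega> / penal_mean I \<rho> X P t y) \<partial>PP (x, y)) \<ge> 1 / CC"
begin

abbreviation F' :: "real \<Rightarrow> 'v measure" where "F' \<equiv> natural_filtration I \<Omega>' (\<lambda>t \<omega>. (X' t \<omega>, Y' t \<omega>))"

lemma D_nonneg [simp]: "0 \<le> D"
  using dist_le[of undefined undefined] by simp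

lemma borel_fst: "fst \<in> borel_measurable (borel :: ('e \<times> 'e) measure)"
  and borel_snd: "snd \<in> borel_measurable (borel :: ('e \<times> 'e) measure)"
  by (simp_all add: borel_prod[symmetric])

sublocale CX: penalized_markov I "\<lambda>z. \<rho> (fst z)" K \<Omega>' F' "\<lambda>t \<omega>. (X' t \<omega>, Y' t \<omega>)" PP
  using coupling progressive_X' rho_le measurable_compose[OF borel_fst rho_measurable]
  by unfold_locales (simp_all add: markovian_coupling_def)

sublocale CY: penalized_markov I "\<lambda>z. \<rho> (snd z)" K \<Omega>' F' "\<lambda>t \<omega>. (X' t \<omega>, Y' t \<omega>)" PP
  using coupling progressive_Y' rho_le measurable_compose[OF borel_snd rho_measurable]
  by unfold_locales (simp_all add: markovian_coupling_def)

abbreviation Finf' :: "'v measure" where "Finf' \<equiv> filtration_sup I \<Omega>' F'"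

lemma penal_fst: "penal I (\<lambda>z. \<rho> (fst z)) (\<lambda>t \<omega>. (X' t \<omega>, Y' t \<omega>)) = penal I \<rho> X'"
  and penal_snd: "penal I (\<lambda>z. \<rho> (snd z)) (\<lambda>t \<omega>. (X' t \<omega>, Y' t \<omega>)) = penal I \<rho> Y'"
  by (simp_all add: penal_def fun_eq_iff)

lemma ZX_F': "t \<in> I \<Longrightarrow> Z X' t \<in> borel_measurable (F' t)"
  and ZY_F': "t \<in> I \<Longrightarrow> Z Y' t \<in> borel_measurable (F' t)"
  using CX.Z_F[of t] CY.Z_F[of t] by (simp_all add: penal_fst penal_snd)

lemma X'_F': "t \<in> I \<Longrightarrow> X' t \<in> F' t \<rightarrow>\<^sub>M borel"
  and Y'_F': "t \<in> I \<Longrightarrow> Y' t \<in> F' t \<rightarrow>\<^sub>M borel"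
  using measurable_compose[OF CX.X_F borel_fst] measurable_compose[OF CX.X_F borel_snd] by simp_all

lemma ZX_Finf' [measurable]: "t \<in> I \<Longrightarrow> Z X' t \<in> borel_measurable Finf'"
  and ZY_Finf' [measurable]: "t \<in> I \<Longrightarrow> Z Y' t \<in> borel_measurable Finf'"
  and X'_Finf' [measurable]: "t \<in> I \<Longrightarrow> X' t \<in> Finf' \<rightarrow>\<^sub>M borel"
  and Y'_Finf' [measurable]: "t \<in> I \<Longrightarrow> Y' t \<in> Finf' \<rightarrow>\<^sub>M borel"
  by (auto intro: CX.measurable_F_Finf ZX_F' ZY_F' X'_F' Y'_F')

lemma dist_F': "t \<in> I \<Longrightarrow> (\<lambda>\<omega>. dist (X' t \<omega>) (Y' t \<omega>)) \<in> borel_measurable (F' t)"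
  by (intro borel_measurable_dist X'_F' Y'_F')

lemma dist_Finf' [measurable]: "t \<in> I \<Longrightarrow> (\<lambda>\<omega>. dist (X' t \<omega>) (Y' t \<omega>)) \<in> borel_measurable Finf'"
  by (rule CX.measurable_F_Finf[OF dist_F'])

lemma start_PP: "AE \<omega> in PP (x, y). X' 0 \<omega> = x \<and> Y' 0 \<omega> = y"
  using CX.X_zero[of "(x, y)"] by simp

lemma penalized_marginal_X:
  assumes t: "t \<in> I" and h: "h \<in> borel_measurable paths"
  shows "(\<integral>\<^sup>+\<omega>. ennreal (Z X' t \<omega>) * h (path I X' \<omega>) \<partial>PP (x, y)) = (\<integral>\<^sup>+\<omega>. ennreal (Z X t \<omega>) * h (path I X \<omega>) \<partial>P x)"
proof (rule penalized_path_law_eq[OF t _ _ _ _ _ _ _ h])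
  show "finite_measure (PP (x, y))" "finite_measure (P x)"
    by (rule prob_space.finite_measure, simp)+
  show "\<forall>u\<in>I. X' u \<in> PP (x, y) \<rightarrow>\<^sub>M borel" "\<forall>u\<in>I. X u \<in> P x \<rightarrow>\<^sub>M borel" by simp_all
  show "penalizable (PP (x, y)) X' t"
    using penalizable_mono_sets[of X' t Finf' "PP (x, y)"] CX.penalizable_Finf[OF t] by simp
  show "penalizable (P x) X t"
    by (rule penalizable_mono_sets[OF penalizable_Finf[OF t]]) auto
  show "distr (PP (x, y)) paths (path I X') = distr (P x) paths (path I X)"
    using coupling by (simp add: markovian_coupling_def)
qed

lemma penalized_marginal_Y:
  assumes t: "t \<in> I" and h: "h \<in> borel_measurable paths"
  shows "(\<integral>\<^sup>+\<omega>. ennreal (Z Y' t \<omega>) * h (path I Y' \<omega>) \<partial>PP (x, y)) = (\<integral>\<^sup>+\<omega>. ennreal (Z X t \<omega>) * h (path I X \<omega>) \<partial>P y)"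
proof (rule penalized_path_law_eq[OF t _ _ _ _ _ _ _ h])
  show "finite_measure (PP (x, y))" "finite_measure (P y)"
    by (rule prob_space.finite_measure, simp)+
  show "\<forall>u\<in>I. Y' u \<in> PP (x, y) \<rightarrow>\<^sub>M borel" "\<forall>u\<in>I. X u \<in> P y \<rightarrow>\<^sub>M borel" by simp_all
  show "penalizable (PP (x, y)) Y' t"
    using penalizable_mono_sets[of Y' t Finf' "PP (x, y)"] CY.penalizable_Finf[OF t] by simp
  show "penalizable (P y) X t"
    by (rule penalizable_mono_sets[OF penalizable_Finf[OF t]]) auto
  show "distr (PP (x, y)) paths (path I Y') = distr (P y) paths (path I X)"
    using coupling by (simp add: markovian_coupling_def)
qed

lemma EZ_X': "t \<in> I \<Longrightarrow> (\<integral>\<omega>. Z X' t \<omega> \<partial>PP (x, y)) = EZ t x"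
  and EZ_Y': "t \<in> I \<Longrightarrow> (\<integral>\<omega>. Z Y' t \<omega> \<partial>PP (x, y)) = EZ t y"
  using penalized_marginal_X[of t "\<lambda>_. 1" x y] penalized_marginal_Y[of t "\<lambda>_. 1" x y]
  by (simp_all add: EZ_nn_integral integral_eq_nn_integral)

lemma EZ_CX: "t \<in> I \<Longrightarrow> CX.EZ t z = EZ t (fst z)"
  and EZ_CY: "t \<in> I \<Longrightarrow> CY.EZ t z = EZ t (snd z)"
  using EZ_X'[of t "fst z" "snd z"] EZ_Y'[of t "fst z" "snd z"]
  by (simp_all add: penal_mean_def penal_fst penal_snd)

lemma PP_integrable:
  "f \<in> borel_measurable Finf' \<Longrightarrow> (\<And>\<omega>. \<bar>f \<omega>\<bar> \<le> b) \<Longrightarrow> integrable (PP z) (f :: 'v \<Rightarrow> real)"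
  using prob_space.finite_measure[OF CX.prob_P, of z]
  by (intro finite_measure.integrable_const_bound[where B = b]) auto

lemma EZ_lipschitz:
  assumes t: "t \<in> I" shows "\<bar>EZ t x - EZ t y\<bar> \<le> CB * dist x y * EZ t x"
proof -
  have i: "integrable (PP (x, y)) (Z X' t)" "integrable (PP (x, y)) (Z Y' t)"
    using t by (auto intro!: PP_integrable[where b = 1])
  have "\<bar>EZ t x - EZ t y\<bar> = \<bar>\<integral>\<omega>. Z X' t \<omega> - Z Y' t \<omega> \<partial>PP (x, y)\<bar>"
    using t i by (simp add: EZ_X' EZ_Y')
  also have "\<dots> \<le> (\<integral>\<omega>. \<bar>Z X' t \<omega> - Z Y' t \<omega>\<bar> \<partial>PP (x, y))" by (rule integral_abs_bound)
  finally show ?thesis using CB_bound[OF t, of x y] by linarith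
qed

definition ratio :: real where "ratio = 1 + CB * D"

lemma ratio_ge_one: "1 \<le> ratio" and ratio_pos [simp]: "0 < ratio"
proof -
  have "0 \<le> CB * D" using CB_pos by simp
  then show "1 \<le> ratio" "0 < ratio" by (simp_all add: ratio_def)
qed

lemma EZ_ratio: "t \<in> I \<Longrightarrow> EZ t y \<le> ratio * EZ t x"
proof -
  assume t: "t \<in> I"
  have "CB * dist x y * EZ t x \<le> CB * D * EZ t x"
    using CB_pos t by (intro mult_right_mono mult_left_mono dist_le) auto
  then show ?thesis using EZ_lipschitz[OF t, of x y] by (simp add: ratio_def algebra_simps)
qed

text \<open>The minimum is half of the sum minus the distance of the two densities, and the mean of that distance is at
  most twice \<open>CB d(x, y)\<close>: once from the difference of \<open>Z\<^sub>t\<close> along the two paths, once from the normalizations.\<close>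

lemma overlap_close:
  assumes t: "t \<in> I"
  shows "1 - CB * dist x y \<le> (\<integral>\<omega>. min (Z X' t \<omega> / EZ t x) (Z Y' t \<omega> / EZ t y) \<partial>PP (x, y))"
proof -
  have ex: "0 < EZ t x" and ey: "0 < EZ t y" using EZ_pos[OF t] by auto
  have i: "integrable (PP (x, y)) (Z X' t)" "integrable (PP (x, y)) (Z Y' t)"
    "integrable (PP (x, y)) (\<lambda>\<omega>. \<bar>Z X' t \<omega> - Z Y' t \<omega>\<bar>)"
    using t by (auto intro!: PP_integrable[where b = 1] integrable_abs Bochner_Integration.integrable_diff)
  have point: "(Z X' t \<omega> / EZ t x + Z Y' t \<omega> / EZ t y) - (\<bar>Z X' t \<omega> - Z Y' t \<omega>\<bar> / EZ t x + Z Y' t \<omega> * (\<bar>EZ t x - EZ t y\<bar> / (EZ t x * EZ t y)))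
      \<le> 2 * min (Z X' t \<omega> / EZ t x) (Z Y' t \<omega> / EZ t y)" for \<omega>
  proof -
    have "Z X' t \<omega> / EZ t x - Z Y' t \<omega> / EZ t y = (Z X' t \<omega> - Z Y' t \<omega>) / EZ t x + Z Y' t \<omega> * ((EZ t y - EZ t x) / (EZ t x * EZ t y))"
      using ex ey by (simp add: field_simps)
    then have "\<bar>Z X' t \<omega> / EZ t x - Z Y' t \<omega> / EZ t y\<bar> \<le> \<bar>(Z X' t \<omega> - Z Y' t \<omega>) / EZ t x\<bar> + \<bar>Z Y' t \<omega> * ((EZ t y - EZ t x) / (EZ t x * EZ t y))\<bar>"
      by (simp only: abs_triangle_ineq)
    also have "\<dots> = \<bar>Z X' t \<omega> - Z Y' t \<omega>\<bar> / EZ t x + Z Y' t \<omega> * (\<bar>EZ t x - EZ t y\<bar> / (EZ t x * EZ t y))"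
      using ex ey t by (simp add: abs_mult abs_divide abs_minus_commute)
    finally show ?thesis by (simp add: min_def abs_if split: if_splits)
  qed
  have "2 - (CB * dist x y + CB * dist x y) \<le>
      2 - ((\<integral>\<omega>. \<bar>Z X' t \<omega> - Z Y' t \<omega>\<bar> \<partial>PP (x, y)) / EZ t x + EZ t y * (\<bar>EZ t x - EZ t y\<bar> / (EZ t x * EZ t y)))"
    using CB_bound[OF t, of x y] EZ_lipschitz[OF t, of x y] ex ey
    by (intro diff_left_mono add_mono) (simp_all add: divide_simps mult.commute)
  also have "\<dots> = (\<integral>\<omega>. (Z X' t \<omega> / EZ t x + Z Y' t \<omega> / EZ t y) -
      (\<bar>Z X' t \<omega> - Z Y' t \<omega>\<bar> / EZ t x + Z Y' t \<omega> * (\<bar>EZ t x - EZ t y\<bar> / (EZ t x * EZ t y))) \<partial>PP (x, y))"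
    using i t ex ey by (simp add: EZ_X' EZ_Y')
  also have "\<dots> \<le> (\<integral>\<omega>. 2 * min (Z X' t \<omega> / EZ t x) (Z Y' t \<omega> / EZ t y) \<partial>PP (x, y))"
    by (rule integral_mono[OF _ _ point]) (use i in \<open>auto intro!: integrable_min\<close>)
  finally show ?thesis by simp
qed

definition overlap_bound :: "'e \<Rightarrow> 'e \<Rightarrow> real" where
  "overlap_bound x y = max (1 / CC) (1 - CB * dist x y)"

text \<open>The densities at the horizon \<open>t + u\<close> have been replaced by their conditional expectations given the past up to
  \<open>t\<close>. The conditional expectation of a minimum is at most the minimum of the conditional expectations.\<close>

lemma overlap_projected:
  assumes t: "t \<in> I" and u: "u \<in> I"
  shows "overlap_bound x y \<le>
    (\<integral>\<omega>. min (Z X' t \<omega> * EZ u (X' t \<omega>) / EZ (t + u) x) (Z Y' t \<omega> * EZ u (Y' t \<omega>) / EZ (t + u) y) \<partial>PP (x, y))"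
proof -
  have tu: "t + u \<in> I" using t u by simp
  have ex: "0 < EZ (t + u) x" and ey: "0 < EZ (t + u) y" using EZ_pos[OF tu] by auto
  let ?a = "\<lambda>\<omega>. Z X' t \<omega> * EZ u (X' t \<omega>) / EZ (t + u) x" and ?b = "\<lambda>\<omega>. Z Y' t \<omega> * EZ u (Y' t \<omega>) / EZ (t + u) y"
  let ?A = "\<lambda>\<omega>. Z X' (t + u) \<omega> / EZ (t + u) x" and ?B = "\<lambda>\<omega>. Z Y' (t + u) \<omega> / EZ (t + u) y"
  define S where "S = {\<omega>\<in>space (F' t). ?a \<omega> \<le> ?b \<omega>}"
  have [measurable]: "(\<lambda>\<omega>. EZ u (X' t \<omega>)) \<in> borel_measurable (F' t)" "(\<lambda>\<omega>. EZ u (Y' t \<omega>)) \<in> borel_measurable (F' t)"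
    using measurable_compose[OF X'_F'[OF t] EZ_measurable[OF u]] measurable_compose[OF Y'_F'[OF t] EZ_measurable[OF u]] by auto
  note [measurable] = ZX_F'[OF t] ZY_F'[OF t]
  have S: "S \<in> sets (F' t)" unfolding S_def by measurable
  have S_iff: "\<omega> \<in> S \<longleftrightarrow> ?a \<omega> \<le> ?b \<omega>" if "\<omega> \<in> \<Omega>'" for \<omega> using that t by (simp add: S_def)
  have Sc: "\<Omega>' - S \<in> sets (F' t)" using sets.compl_sets[OF S] t by simp
  have am: "?a \<in> borel_measurable Finf'" and bm: "?b \<in> borel_measurable Finf'"
    by (rule CX.measurable_F_Finf[OF _ t], measurable)+
  have SM: "S \<in> sets Finf'" "\<Omega>' - S \<in> sets Finf'" using S Sc CX.sets_F_Finf[OF t] by auto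
  have mono: "overlap_bound x y \<le> (\<integral>\<omega>. min (?A \<omega>) (?B \<omega>) \<partial>PP (x, y))"
    unfolding overlap_bound_def using CC_bound[OF tu] overlap_close[OF tu] by simp
  have nonneg: "0 \<le> ?a \<omega>" "0 \<le> ?b \<omega>" "0 \<le> ?A \<omega>" "0 \<le> ?B \<omega>" for \<omega>
    using t u tu by simp_all
  have gen: "(\<integral>\<^sup>+\<omega>. indicator R \<omega> * ennreal (f \<omega> / c) \<partial>PP (x, y)) =
      (\<integral>\<^sup>+\<omega>. indicator R \<omega> * ennreal (f \<omega>) \<partial>PP (x, y)) / ennreal c"
    if S: "R \<in> sets (F' t)" and f[measurable]: "f \<in> borel_measurable Finf'" and f0: "\<And>\<omega>. 0 \<le> f \<omega>" and c: "0 < c" for R f c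
  proof -
    have [measurable]: "R \<in> sets Finf'" using S CX.sets_F_Finf[OF t] by auto
    have "(\<integral>\<^sup>+\<omega>. indicator R \<omega> * ennreal (f \<omega>) \<partial>PP (x, y)) / ennreal c =
        (\<integral>\<^sup>+\<omega>. (indicator R \<omega> * ennreal (f \<omega>)) / ennreal c \<partial>PP (x, y))"
      by (rule nn_integral_divide[symmetric]) measurable
    also have "\<dots> = (\<integral>\<^sup>+\<omega>. indicator R \<omega> * ennreal (f \<omega> / c) \<partial>PP (x, y))"
      by (simp only: divide_ennreal[OF f0 c, symmetric] ennreal_times_divide)
    finally show ?thesis ..
  qed
  have MX: "(\<integral>\<^sup>+\<omega>. indicator R \<omega> * ennreal (?A \<omega>) \<partial>PP (x, y)) = (\<integral>\<^sup>+\<omega>. indicator R \<omega> * ennreal (?a \<omega>) \<partial>PP (x, y))"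
    if S: "R \<in> sets (F' t)" for R
  proof -
    have "(\<integral>\<^sup>+\<omega>. indicator R \<omega> * ennreal (Z X' (t + u) \<omega>) \<partial>PP (x, y)) =
        (\<integral>\<^sup>+\<omega>. indicator R \<omega> * ennreal (Z X' t \<omega> * EZ u (X' t \<omega>)) \<partial>PP (x, y))"
      using CX.EZ_markov[OF t u S, of "(x, y)"] t u by (simp add: penal_fst EZ_CX ennreal_mult)
    moreover have "(\<lambda>\<omega>. Z X' t \<omega> * EZ u (X' t \<omega>)) \<in> borel_measurable Finf'"
      by (rule CX.measurable_F_Finf[OF _ t]) measurable
    ultimately show ?thesis using t u tu ex by (simp add: gen[OF S])
  qed
  have MY: "(\<integral>\<^sup>+\<omega>. indicator R \<omega> * ennreal (?B \<omega>) \<partial>PP (x, y)) = (\<integral>\<^sup>+\<omega>. indicator R \<omega> * ennreal (?b \<omega>) \<partial>PP (x, y))"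
    if S: "R \<in> sets (F' t)" for R
  proof -
    have "(\<integral>\<^sup>+\<omega>. indicator R \<omega> * ennreal (Z Y' (t + u) \<omega>) \<partial>PP (x, y)) =
        (\<integral>\<^sup>+\<omega>. indicator R \<omega> * ennreal (Z Y' t \<omega> * EZ u (Y' t \<omega>)) \<partial>PP (x, y))"
      using CY.EZ_markov[OF t u S, of "(x, y)"] t u by (simp add: penal_snd EZ_CY ennreal_mult)
    moreover have "(\<lambda>\<omega>. Z Y' t \<omega> * EZ u (Y' t \<omega>)) \<in> borel_measurable Finf'"
      by (rule CX.measurable_F_Finf[OF _ t]) measurable
    ultimately show ?thesis using t u tu ey by (simp add: gen[OF S])
  qed
  have im: "(\<lambda>\<omega>. indicator R \<omega> * ennreal (f \<omega>)) \<in> borel_measurable (PP (x, y))"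
    if [measurable]: "R \<in> sets Finf'" "f \<in> borel_measurable Finf'" for R f
    by measurable
  have "(\<integral>\<^sup>+\<omega>. ennreal (min (?A \<omega>) (?B \<omega>)) \<partial>PP (x, y)) \<le>
      (\<integral>\<^sup>+\<omega>. indicator S \<omega> * ennreal (?A \<omega>) + indicator (\<Omega>' - S) \<omega> * ennreal (?B \<omega>) \<partial>PP (x, y))"
    by (intro nn_integral_mono) (auto simp: indicator_def ennreal_leI)
  also have "\<dots> = (\<integral>\<^sup>+\<omega>. indicator S \<omega> * ennreal (?A \<omega>) \<partial>PP (x, y)) + (\<integral>\<^sup>+\<omega>. indicator (\<Omega>' - S) \<omega> * ennreal (?B \<omega>) \<partial>PP (x, y))"
    using SM tu by (intro nn_integral_add im) simp_all
  also have "\<dots> = (\<integral>\<^sup>+\<omega>. indicator S \<omega> * ennreal (?a \<omega>) \<partial>PP (x, y)) + (\<integral>\<^sup>+\<omega>. indicator (\<Omega>' - S) \<omega> * ennreal (?b \<omega>) \<partial>PP (x, y))"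
    by (simp only: MX[OF S] MY[OF Sc])
  also have "\<dots> = (\<integral>\<^sup>+\<omega>. indicator S \<omega> * ennreal (?a \<omega>) + indicator (\<Omega>' - S) \<omega> * ennreal (?b \<omega>) \<partial>PP (x, y))"
    using SM am bm by (intro nn_integral_add[symmetric] im) simp_all
  also have "\<dots> = (\<integral>\<^sup>+\<omega>. ennreal (min (?a \<omega>) (?b \<omega>)) \<partial>PP (x, y))"
    using S_iff by (intro nn_integral_cong) (auto simp: indicator_def min_def)
  finally have le: "(\<integral>\<^sup>+\<omega>. ennreal (min (?A \<omega>) (?B \<omega>)) \<partial>PP (x, y)) \<le> (\<integral>\<^sup>+\<omega>. ennreal (min (?a \<omega>) (?b \<omega>)) \<partial>PP (x, y))" .
  have bA: "?A \<omega> \<le> 1 / EZ (t + u) x" "?a \<omega> \<le> 1 / EZ (t + u) x" for \<omega>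
    using ex tu t u by (auto intro!: divide_right_mono mult_le_one EZ_le_one)
  have i: "integrable (PP (x, y)) (\<lambda>\<omega>. min (?A \<omega>) (?B \<omega>))" "integrable (PP (x, y)) (\<lambda>\<omega>. min (?a \<omega>) (?b \<omega>))"
    using nonneg bA tu am bm
    by (auto intro!: PP_integrable[where b = "1 / EZ (t + u) x"] simp: abs_of_nonneg min_le_iff_disj)
  have "(\<integral>\<omega>. min (?A \<omega>) (?B \<omega>) \<partial>PP (x, y)) \<le> (\<integral>\<omega>. min (?a \<omega>) (?b \<omega>) \<partial>PP (x, y))"
    using le nonneg i by (simp add: nn_integral_eq_integral integral_nonneg_AE)
  with mono show ?thesis by linarith
qed

end

section \<open>The eigenfunction and the coupling of the h-transforms\<close>

locale penalized_coupling_qsd = penalized_coupling I \<rho> K \<Omega> F X P D CA gA CB CC \<Omega>' X' Y' PP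
  for I and \<rho> :: "'e::polish_space \<Rightarrow> real" and K \<Omega> F and X :: "real \<Rightarrow> 'w \<Rightarrow> 'e" and P
    and D CA gA CB CC and \<Omega>' :: "'v set" and X' Y' PP +
  fixes \<nu>QS :: "'e measure" and l0 :: real and \<eta> :: "'e \<Rightarrow> real"
  assumes projective: "projective_limits_exist I \<Omega> F"
    and nu: "prob_on_borel \<nu>QS"
    and absorption: "absorption_rate I \<rho> X P \<nu>QS l0"
    and eta_limit: "\<And>x. ((\<lambda>t. exp (l0 * t) * penal_mean I \<rho> X P t x) \<longlongrightarrow> \<eta> x) (inf at_top (principal I))"
begin

lemma nu_prob: "prob_space \<nu>QS" and sets_nu [simp, measurable_cong]: "sets \<nu>QS = sets borel"
  using nu by (auto simp: prob_on_borel_def)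

lemma space_nu [simp]: "space \<nu>QS = UNIV"
  using sets_eq_imp_space_eq[OF sets_nu] by simp

lemma nu_integrable:
  assumes "f \<in> borel_measurable borel" "\<And>x. \<bar>f x\<bar> \<le> b" shows "integrable \<nu>QS (f :: 'e \<Rightarrow> real)"
proof -
  interpret prob_space \<nu>QS by (rule nu_prob)
  show ?thesis using assms by (intro integrable_const_bound[where B = b]) auto
qed

lemma nu_absorption:
  "t \<in> I \<Longrightarrow> bounded_measurable f \<Longrightarrow> (\<integral>x. penal_semigroup I \<rho> X P t f x \<partial>\<nu>QS) = exp (- l0 * t) * (\<integral>x. f x \<partial>\<nu>QS)"
  using absorption by (simp add: absorption_rate_def)

lemma nu_EZ: "t \<in> I \<Longrightarrow> (\<integral>x. EZ t x \<partial>\<nu>QS) = exp (- l0 * t)"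
  using nu_absorption[of t "\<lambda>_. 1"] prob_space.prob_space[OF nu_prob]
  by (simp add: bounded_measurable_def penal_semigroup_def penal_mean_def)

text \<open>The mean of \<open>exp (l0 t) E\<^sub>x Z\<^sub>t\<close> under the quasi-stationary distribution is one.\<close>

lemma EZ_scaled_bounds:
  assumes t: "t \<in> I" shows "1 / ratio \<le> exp (l0 * t) * EZ t x" "exp (l0 * t) * EZ t x \<le> ratio"
proof -
  interpret prob_space \<nu>QS by (rule nu_prob)
  have i: "integrable \<nu>QS (EZ t)"
    using t EZ_le_one by (intro nu_integrable[where b = 1] EZ_measurable) (auto simp: abs_of_nonneg)
  have one: "exp (l0 * t) * exp (- l0 * t) = 1" by (simp add: exp_add[symmetric])
  have "(\<integral>y. EZ t y \<partial>\<nu>QS) \<le> (\<integral>y. ratio * EZ t x \<partial>\<nu>QS)"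
    using i t by (intro integral_mono EZ_ratio) auto
  then have "exp (- l0 * t) \<le> ratio * EZ t x" using prob_space t by (simp add: nu_EZ)
  then have "exp (l0 * t) * exp (- l0 * t) \<le> exp (l0 * t) * (ratio * EZ t x)" by (rule mult_left_mono) simp
  then show "1 / ratio \<le> exp (l0 * t) * EZ t x"
    unfolding one by (simp add: divide_le_eq ac_simps)
  have "(\<integral>y. EZ t x \<partial>\<nu>QS) \<le> (\<integral>y. ratio * EZ t y \<partial>\<nu>QS)"
    using i t by (intro integral_mono EZ_ratio) auto
  then have "EZ t x \<le> ratio * exp (- l0 * t)" using prob_space t by (simp add: nu_EZ)
  then have "exp (l0 * t) * EZ t x \<le> exp (l0 * t) * (ratio * exp (- l0 * t))" by (rule mult_left_mono) simp
  also have "\<dots> = ratio" using one by (simp add: ac_simps)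
  finally show "exp (l0 * t) * EZ t x \<le> ratio" .
qed

lemma EZ_scaled_seq:
  assumes t: "t \<in> I" shows "(\<lambda>n. exp (l0 * (t + real n)) * EZ (t + real n) x) \<longlonglongrightarrow> \<eta> x"
proof -
  have "filterlim (\<lambda>n. t + real n) at_top sequentially"
    by (rule filterlim_tendsto_add_at_top[OF tendsto_const filterlim_real_sequentially])
  then have "filterlim (\<lambda>n. t + real n) (inf at_top (principal I)) sequentially"
    using t by (simp add: filterlim_inf filterlim_principal)
  from filterlim_compose[OF eta_limit this] show ?thesis .
qed

lemma EZ_scaled_seq0: "(\<lambda>n. exp (l0 * real n) * EZ (real n) x) \<longlonglongrightarrow> \<eta> x"
  using EZ_scaled_seq[OF zero_in_time] by simp

lemma eta_ge: "1 / ratio \<le> \<eta> x"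
  by (rule LIMSEQ_le_const[OF EZ_scaled_seq0]) (use EZ_scaled_bounds(1)[OF time_real] in blast)

lemma eta_le: "\<eta> x \<le> ratio"
  by (rule LIMSEQ_le_const2[OF EZ_scaled_seq0]) (use EZ_scaled_bounds(2)[OF time_real] in blast)

lemma eta_gt: "0 < \<eta> x"
  by (rule less_le_trans[OF _ eta_ge]) simp

lemma eta_ratio: "\<eta> y \<le> ratio * \<eta> x"
proof (rule LIMSEQ_le[OF EZ_scaled_seq0 tendsto_mult_left[OF EZ_scaled_seq0]])
  show "\<exists>N. \<forall>n\<ge>N. exp (l0 * real n) * EZ (real n) y \<le> ratio * (exp (l0 * real n) * EZ (real n) x)"
    using mult_left_mono[OF EZ_ratio[OF time_real], of "exp (l0 * real _)"] by (auto simp: ac_simps)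
qed

lemma eta_lipschitz: "\<bar>\<eta> x - \<eta> y\<bar> \<le> CB * dist x y * \<eta> x"
proof (rule LIMSEQ_le[OF tendsto_rabs[OF tendsto_diff[OF EZ_scaled_seq0 EZ_scaled_seq0]] tendsto_mult_left[OF EZ_scaled_seq0]])
  show "\<exists>N. \<forall>n\<ge>N. \<bar>exp (l0 * real n) * EZ (real n) x - exp (l0 * real n) * EZ (real n) y\<bar> \<le> CB * dist x y * (exp (l0 * real n) * EZ (real n) x)"
  proof (intro exI[of _ 0] allI impI)
    fix n
    have "\<bar>exp (l0 * real n) * EZ (real n) x - exp (l0 * real n) * EZ (real n) y\<bar> = exp (l0 * real n) * \<bar>EZ (real n) x - EZ (real n) y\<bar>"
      by (simp add: abs_mult right_diff_distrib[symmetric])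
    also have "\<dots> \<le> exp (l0 * real n) * (CB * dist x y * EZ (real n) x)"
      by (intro mult_left_mono EZ_lipschitz) auto
    finally show "\<bar>exp (l0 * real n) * EZ (real n) x - exp (l0 * real n) * EZ (real n) y\<bar> \<le> CB * dist x y * (exp (l0 * real n) * EZ (real n) x)"
      by (simp add: ac_simps)
  qed
qed

lemma eta_borel: "\<eta> \<in> borel_measurable borel"
  by (rule borel_measurable_LIMSEQ_real[OF EZ_scaled_seq0])
    (intro borel_measurable_times borel_measurable_const EZ_measurable time_real)

lemma P_integrable:
  "f \<in> borel_measurable Finf \<Longrightarrow> (\<And>\<omega>. \<bar>f \<omega>\<bar> \<le> b) \<Longrightarrow> integrable (P x) (f :: 'w \<Rightarrow> real)"
  using prob_space.finite_measure[OF prob_P, of x]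
  by (intro finite_measure.integrable_const_bound[where B = b]) auto

lemma EZ_chapman:
  assumes t: "t \<in> I" and u: "u \<in> I" shows "EZ (t + u) x = (\<integral>\<omega>. Z X t \<omega> * EZ u (X t \<omega>) \<partial>P x)"
proof -
  have m: "(\<lambda>\<omega>. Z X t \<omega> * EZ u (X t \<omega>)) \<in> borel_measurable Finf"
    using Z_Finf[OF t] measurable_compose[OF X_Finf[OF t] EZ_measurable[OF u]] by measurable
  have "ennreal (EZ (t + u) x) = (\<integral>\<^sup>+\<omega>. ennreal (Z X (t + u) \<omega>) \<partial>P x)"
    using t u by (simp add: EZ_nn_integral)
  also have "\<dots> = (\<integral>\<^sup>+\<omega>. ennreal (Z X t \<omega> * EZ u (X t \<omega>)) \<partial>P x)"
  proof -
    have "(\<integral>\<^sup>+\<omega>. indicator \<Omega> \<omega> * f \<omega> \<partial>P x) = (\<integral>\<^sup>+\<omega>. f \<omega> \<partial>P x)" for f :: "'w \<Rightarrow> ennreal"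
      by (intro nn_integral_cong) (simp add: indicator_def)
    then show ?thesis using EZ_markov[OF t u sets.top, of x] t u by (simp add: ennreal_mult)
  qed
  also have "\<dots> = ennreal (\<integral>\<omega>. Z X t \<omega> * EZ u (X t \<omega>) \<partial>P x)"
    using t u m EZ_le_one[OF u]
    by (intro nn_integral_eq_integral P_integrable[where b = 1]) (auto intro!: mult_le_one simp: abs_mult)
  finally show ?thesis
    using t u by (subst (asm) ennreal_inj) (auto intro!: integral_nonneg_AE)
qed

lemma eta_eigen_real:
  assumes t: "t \<in> I" shows "(\<integral>\<omega>. Z X t \<omega> * \<eta> (X t \<omega>) \<partial>P x) = exp (- l0 * t) * \<eta> x"
proof (rule LIMSEQ_unique)
  show "(\<lambda>n. \<integral>\<omega>. Z X t \<omega> * (exp (l0 * real n) * EZ (real n) (X t \<omega>)) \<partial>P x) \<longlonglongrightarrow> (\<integral>\<omega>. Z X t \<omega> * \<eta> (X t \<omega>) \<partial>P x)"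
  proof (rule integral_dominated_convergence[where w = "\<lambda>_. ratio"])
    show "(\<lambda>\<omega>. Z X t \<omega> * \<eta> (X t \<omega>)) \<in> borel_measurable (P x)"
      using measurable_compose[OF X_Finf[OF t] eta_borel] Z_Finf[OF t] by measurable
    show "(\<lambda>\<omega>. Z X t \<omega> * (exp (l0 * real n) * EZ (real n) (X t \<omega>))) \<in> borel_measurable (P x)" for n
      using measurable_compose[OF X_Finf[OF t] EZ_measurable[OF time_real]] Z_Finf[OF t] by measurable
    show "integrable (P x) (\<lambda>_. ratio)" by (rule P_integrable[where b = ratio]) (auto simp: less_imp_le)
    show "AE \<omega> in P x. (\<lambda>n. Z X t \<omega> * (exp (l0 * real n) * EZ (real n) (X t \<omega>))) \<longlonglongrightarrow> Z X t \<omega> * \<eta> (X t \<omega>)"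
      by (intro AE_I2 tendsto_mult_left EZ_scaled_seq0)
    show "AE \<omega> in P x. norm (Z X t \<omega> * (exp (l0 * real n) * EZ (real n) (X t \<omega>))) \<le> ratio" for n
    proof (rule AE_I2)
      fix \<omega>
      have "Z X t \<omega> * (exp (l0 * real n) * EZ (real n) (X t \<omega>)) \<le> 1 * ratio"
        using t EZ_scaled_bounds(2)[OF time_real] by (intro mult_mono) auto
      then show "norm (Z X t \<omega> * (exp (l0 * real n) * EZ (real n) (X t \<omega>))) \<le> ratio"
        using t by (simp add: abs_mult)
    qed
  qed
  have "(\<lambda>n. exp (- l0 * t) * (exp (l0 * (t + real n)) * EZ (t + real n) x)) \<longlonglongrightarrow> exp (- l0 * t) * \<eta> x"
    by (intro tendsto_mult_left EZ_scaled_seq t)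
  moreover have "exp (- l0 * t) * (exp (l0 * (t + real n)) * EZ (t + real n) x) =
      (\<integral>\<omega>. Z X t \<omega> * (exp (l0 * real n) * EZ (real n) (X t \<omega>)) \<partial>P x)" for n
  proof -
    have "exp (- l0 * t) * (exp (l0 * (t + real n)) * EZ (t + real n) x) = exp (l0 * real n) * EZ (t + real n) x"
      by (simp add: mult.assoc[symmetric] exp_add[symmetric] algebra_simps)
    also have "\<dots> = (\<integral>\<omega>. exp (l0 * real n) * (Z X t \<omega> * EZ (real n) (X t \<omega>)) \<partial>P x)"
      using t by (simp add: EZ_chapman)
    finally show ?thesis by (simp add: ac_simps)
  qed
  ultimately show "(\<lambda>n. \<integral>\<omega>. Z X t \<omega> * (exp (l0 * real n) * EZ (real n) (X t \<omega>)) \<partial>P x) \<longlonglongrightarrow> exp (- l0 * t) * \<eta> x"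
    by (simp only:)
qed

lemma Z_eta_measurable [measurable]: "t \<in> I \<Longrightarrow> (\<lambda>\<omega>. Z X t \<omega> * \<eta> (X t \<omega>)) \<in> borel_measurable Finf"
  using measurable_compose[OF X_Finf eta_borel] Z_Finf by measurable

lemma Z_eta_integrable: "t \<in> I \<Longrightarrow> integrable (P x) (\<lambda>\<omega>. Z X t \<omega> * \<eta> (X t \<omega>))"
proof (rule P_integrable[where b = ratio])
  fix \<omega> assume t: "t \<in> I"
  have "Z X t \<omega> * \<eta> (X t \<omega>) \<le> 1 * ratio" using t eta_le less_imp_le[OF eta_gt] by (intro mult_mono) auto
  then show "\<bar>Z X t \<omega> * \<eta> (X t \<omega>)\<bar> \<le> ratio" using t less_imp_le[OF eta_gt] by (simp add: abs_mult)
qed (rule Z_eta_measurable)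

lemma nu_eta: "(\<integral>x. \<eta> x \<partial>\<nu>QS) = 1"
proof (rule LIMSEQ_unique)
  show "(\<lambda>n. \<integral>x. exp (l0 * real n) * EZ (real n) x \<partial>\<nu>QS) \<longlonglongrightarrow> (\<integral>x. \<eta> x \<partial>\<nu>QS)"
  proof (rule integral_dominated_convergence[where w = "\<lambda>_. ratio"])
    show "integrable \<nu>QS (\<lambda>_. ratio)" by (rule nu_integrable[where b = ratio]) (auto simp: less_imp_le)
    show "AE x in \<nu>QS. norm (exp (l0 * real n) * EZ (real n) x) \<le> ratio" for n
      using EZ_scaled_bounds(2)[OF time_real] by (intro AE_I2) (simp add: abs_mult)
  qed (use eta_borel EZ_measurable[OF time_real] EZ_scaled_seq0 in auto)
  have "(\<integral>x. exp (l0 * real n) * EZ (real n) x \<partial>\<nu>QS) = 1" for n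
    by (simp add: nu_EZ exp_add[symmetric])
  then show "(\<lambda>n. \<integral>x. exp (l0 * real n) * EZ (real n) x \<partial>\<nu>QS) \<longlonglongrightarrow> 1" by simp
qed

sublocale penalized_h_transform I \<rho> K \<Omega> F X P \<eta> l0
proof
  show "(\<integral>\<^sup>+\<omega>. ennreal (Z X t \<omega>) * ennreal (\<eta> (X t \<omega>)) \<partial>P x) = ennreal (exp (- l0 * t) * \<eta> x)" if t: "t \<in> I" for t x
  proof -
    have "(\<integral>\<^sup>+\<omega>. ennreal (Z X t \<omega>) * ennreal (\<eta> (X t \<omega>)) \<partial>P x) = (\<integral>\<^sup>+\<omega>. ennreal (Z X t \<omega> * \<eta> (X t \<omega>)) \<partial>P x)"
      using t less_imp_le[OF eta_gt] by (simp add: ennreal_mult)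
    also have "\<dots> = ennreal (\<integral>\<omega>. Z X t \<omega> * \<eta> (X t \<omega>) \<partial>P x)"
      using t less_imp_le[OF eta_gt] by (intro nn_integral_eq_integral Z_eta_integrable) auto
    finally show ?thesis by (simp only: eta_eigen_real[OF t])
  qed
qed (simp_all add: eta_borel eta_gt projective)

text \<open>The densities of \<open>Q\<close> carried to the coupling, with the starting point read off from the path.\<close>

definition GX :: "real \<Rightarrow> 'v \<Rightarrow> real" where
  "GX t \<omega> = exp (l0 * t) * Z X' t \<omega> * \<eta> (X' t \<omega>) / \<eta> (X' 0 \<omega>)"
definition GY :: "real \<Rightarrow> 'v \<Rightarrow> real" where
  "GY t \<omega> = exp (l0 * t) * Z Y' t \<omega> * \<eta> (Y' t \<omega>) / \<eta> (Y' 0 \<omega>)"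

lemma GX_nonneg [simp]: "t \<in> I \<Longrightarrow> 0 \<le> GX t \<omega>" and GY_nonneg [simp]: "t \<in> I \<Longrightarrow> 0 \<le> GY t \<omega>"
  by (simp_all add: GX_def GY_def)

lemma GX_measurable [measurable]: "t \<in> I \<Longrightarrow> GX t \<in> borel_measurable Finf'"
  and GY_measurable [measurable]: "t \<in> I \<Longrightarrow> GY t \<in> borel_measurable Finf'"
  unfolding GX_def[abs_def] GY_def[abs_def]
  using ZX_Finf'[of t] ZY_Finf'[of t] X'_Finf'[of t] Y'_Finf'[of t] X'_Finf'[OF zero_in_time] Y'_Finf'[OF zero_in_time]
  by measurable

lemma G_start: "AE \<omega> in PP (x, y). GX t \<omega> = exp (l0 * t) * Z X' t \<omega> * \<eta> (X' t \<omega>) / \<eta> x \<and>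
    GY t \<omega> = exp (l0 * t) * Z Y' t \<omega> * \<eta> (Y' t \<omega>) / \<eta> y"
  using start_PP[of x y] by eventually_elim (simp add: GX_def GY_def)

lemma Q_density_eq:
  assumes t: "t \<in> I" and f[measurable]: "f \<in> borel_measurable borel"
  shows "(\<integral>\<^sup>+\<omega>. ennreal (Z X t \<omega>) * (ennreal (exp (l0 * t) * \<eta> (X t \<omega>) / \<eta> x) * f (X t \<omega>)) \<partial>P x) = (\<integral>\<^sup>+\<omega>. f (X t \<omega>) \<partial>Q x)"
proof -
  have m: "(\<lambda>\<omega>. f (X t \<omega>)) \<in> borel_measurable (F t)" by (rule measurable_compose[OF X_F[OF t] f])
  have "ennreal (\<eta> x) * (\<integral>\<^sup>+\<omega>. ennreal (Z X t \<omega>) * (ennreal (exp (l0 * t) * \<eta> (X t \<omega>) / \<eta> x) * f (X t \<omega>)) \<partial>P x) =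
      (\<integral>\<^sup>+\<omega>. ennreal (\<eta> x) * (ennreal (Z X t \<omega>) * (ennreal (exp (l0 * t) * \<eta> (X t \<omega>) / \<eta> x) * f (X t \<omega>))) \<partial>P x)"
    using t by (intro nn_integral_cmult[symmetric]) measurable
  also have "\<dots> = (\<integral>\<^sup>+\<omega>. f (X t \<omega>) * mart t \<omega> \<partial>P x)"
  proof (rule nn_integral_cong)
    fix \<omega>
    have "ennreal (\<eta> x) * ennreal (exp (l0 * t) * \<eta> (X t \<omega>) / \<eta> x) = ennreal (exp (l0 * t) * \<eta> (X t \<omega>))"
      using eta_gt[of x] by (simp add: ennreal_mult[symmetric] del: eta_pos)
    then show "ennreal (\<eta> x) * (ennreal (Z X t \<omega>) * (ennreal (exp (l0 * t) * \<eta> (X t \<omega>) / \<eta> x) * f (X t \<omega>))) = f (X t \<omega>) * mart t \<omega>"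
      unfolding mart_def by (simp add: ennreal_mult) (metis mult.assoc mult.commute)
  qed
  also have "\<dots> = ennreal (\<eta> x) * (\<integral>\<^sup>+\<omega>. f (X t \<omega>) \<partial>Q x)" by (rule nn_integral_Q[OF t m, symmetric])
  finally show ?thesis by (simp only: eta_cancel)
qed

lemma GX_law:
  assumes t: "t \<in> I" and f[measurable]: "f \<in> borel_measurable borel"
  shows "(\<integral>\<^sup>+\<omega>. ennreal (GX t \<omega>) * f (X' t \<omega>) \<partial>PP (x, y)) = (\<integral>\<^sup>+\<omega>. f (X t \<omega>) \<partial>Q x)"
proof -
  have "(\<integral>\<^sup>+\<omega>. ennreal (GX t \<omega>) * f (X' t \<omega>) \<partial>PP (x, y)) =
      (\<integral>\<^sup>+\<omega>. ennreal (Z X' t \<omega>) * (ennreal (exp (l0 * t) * \<eta> (path I X' \<omega> t) / \<eta> x) * f (path I X' \<omega> t)) \<partial>PP (x, y))"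
  proof (intro nn_integral_cong_AE eventually_mono[OF G_start[of t x y]])
    fix \<omega> assume "GX t \<omega> = exp (l0 * t) * Z X' t \<omega> * \<eta> (X' t \<omega>) / \<eta> x \<and> GY t \<omega> = exp (l0 * t) * Z Y' t \<omega> * \<eta> (Y' t \<omega>) / \<eta> y"
    then have "GX t \<omega> = Z X' t \<omega> * (exp (l0 * t) * \<eta> (X' t \<omega>) / \<eta> x)" by simp
    moreover have "0 \<le> exp (l0 * t) * \<eta> (X' t \<omega>) / \<eta> x" by simp
    ultimately have "ennreal (GX t \<omega>) = ennreal (Z X' t \<omega>) * ennreal (exp (l0 * t) * \<eta> (X' t \<omega>) / \<eta> x)"
      using t by (simp only: ennreal_mult penal_nonneg)
    then show "ennreal (GX t \<omega>) * f (X' t \<omega>) =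
        ennreal (Z X' t \<omega>) * (ennreal (exp (l0 * t) * \<eta> (path I X' \<omega> t) / \<eta> x) * f (path I X' \<omega> t))"
      using t by (simp only: mult.assoc restrict_apply if_True)
  qed
  also have "\<dots> = (\<integral>\<^sup>+\<omega>. ennreal (Z X t \<omega>) * (ennreal (exp (l0 * t) * \<eta> (path I X \<omega> t) / \<eta> x) * f (path I X \<omega> t)) \<partial>P x)"
    using t by (intro penalized_marginal_X[where h = "\<lambda>p. ennreal (exp (l0 * t) * \<eta> (p t) / \<eta> x) * f (p t)"]) measurable
  also have "\<dots> = (\<integral>\<^sup>+\<omega>. f (X t \<omega>) \<partial>Q x)" using Q_density_eq[OF t f] t by simp
  finally show ?thesis .
qed

lemma GY_law:
  assumes t: "t \<in> I" and f[measurable]: "f \<in> borel_measurable borel"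
  shows "(\<integral>\<^sup>+\<omega>. ennreal (GY t \<omega>) * f (Y' t \<omega>) \<partial>PP (x, y)) = (\<integral>\<^sup>+\<omega>. f (X t \<omega>) \<partial>Q y)"
proof -
  have "(\<integral>\<^sup>+\<omega>. ennreal (GY t \<omega>) * f (Y' t \<omega>) \<partial>PP (x, y)) =
      (\<integral>\<^sup>+\<omega>. ennreal (Z Y' t \<omega>) * (ennreal (exp (l0 * t) * \<eta> (path I Y' \<omega> t) / \<eta> y) * f (path I Y' \<omega> t)) \<partial>PP (x, y))"
  proof (intro nn_integral_cong_AE eventually_mono[OF G_start[of t x y]])
    fix \<omega> assume "GX t \<omega> = exp (l0 * t) * Z X' t \<omega> * \<eta> (X' t \<omega>) / \<eta> x \<and> GY t \<omega> = exp (l0 * t) * Z Y' t \<omega> * \<eta> (Y' t \<omega>) / \<eta> y"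
    then have "GY t \<omega> = Z Y' t \<omega> * (exp (l0 * t) * \<eta> (Y' t \<omega>) / \<eta> y)" by simp
    moreover have "0 \<le> exp (l0 * t) * \<eta> (Y' t \<omega>) / \<eta> y" by simp
    ultimately have "ennreal (GY t \<omega>) = ennreal (Z Y' t \<omega>) * ennreal (exp (l0 * t) * \<eta> (Y' t \<omega>) / \<eta> y)"
      using t by (simp only: ennreal_mult penal_nonneg)
    then show "ennreal (GY t \<omega>) * f (Y' t \<omega>) =
        ennreal (Z Y' t \<omega>) * (ennreal (exp (l0 * t) * \<eta> (path I Y' \<omega> t) / \<eta> y) * f (path I Y' \<omega> t))"
      using t by (simp only: mult.assoc restrict_apply if_True)
  qed
  also have "\<dots> = (\<integral>\<^sup>+\<omega>. ennreal (Z X t \<omega>) * (ennreal (exp (l0 * t) * \<eta> (path I X \<omega> t) / \<eta> y) * f (path I X \<omega> t)) \<partial>P y)"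
    using t by (intro penalized_marginal_Y[where h = "\<lambda>p. ennreal (exp (l0 * t) * \<eta> (p t) / \<eta> y) * f (p t)"]) measurable
  also have "\<dots> = (\<integral>\<^sup>+\<omega>. f (X t \<omega>) \<partial>Q y)" using Q_density_eq[OF t f] t by simp
  finally show ?thesis .
qed

text \<open>Dominated convergence, as the horizon \<open>t + u\<close> of \<open>overlap_projected\<close> tends to infinity.\<close>

lemma overlap_limit:
  assumes t: "t \<in> I"
  shows "ennreal (overlap_bound x y) \<le> (\<integral>\<^sup>+\<omega>. ennreal (min (GX t \<omega>) (GY t \<omega>)) \<partial>PP (x, y))"
proof -
  let ?a = "\<lambda>n \<omega>. Z X' t \<omega> * EZ (real n) (X' t \<omega>) / EZ (t + real n) x"
  let ?b = "\<lambda>n \<omega>. Z Y' t \<omega> * EZ (real n) (Y' t \<omega>) / EZ (t + real n) y"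
  let ?gX = "\<lambda>\<omega>. exp (l0 * t) * Z X' t \<omega> * \<eta> (X' t \<omega>) / \<eta> x" and ?gY = "\<lambda>\<omega>. exp (l0 * t) * Z Y' t \<omega> * \<eta> (Y' t \<omega>) / \<eta> y"
  have scaled: "z * EZ (real n) w / EZ (t + real n) v =
      exp (l0 * t) * z * (exp (l0 * real n) * EZ (real n) w) / (exp (l0 * (t + real n)) * EZ (t + real n) v)" for z n w v
    by (simp add: distrib_left exp_add)
  have lim: "(\<lambda>n. z * EZ (real n) w / EZ (t + real n) v) \<longlonglongrightarrow> exp (l0 * t) * z * \<eta> w / \<eta> v" for z w v
    unfolding scaled
    by (intro tendsto_divide tendsto_mult_left EZ_scaled_seq0 EZ_scaled_seq t less_imp_neq[OF eta_gt, symmetric])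
  have bound: "z * EZ (real n) w / EZ (t + real n) v \<le> exp (l0 * t) * ratio * ratio" if z: "0 \<le> z" "z \<le> 1" for z n w v
  proof -
    have "exp (l0 * t) * z * (exp (l0 * real n) * EZ (real n) w) / (exp (l0 * (t + real n)) * EZ (t + real n) v) \<le>
        exp (l0 * t) * 1 * ratio / (1 / ratio)"
      using z t EZ_scaled_bounds(2)[OF time_real, of n w] EZ_scaled_bounds(1)[of "t + real n" v]
      by (intro frac_le mult_mono) (auto intro!: mult_nonneg_nonneg simp: less_imp_le[OF ratio_pos])
    then show ?thesis unfolding scaled by simp
  qed
  have [measurable]: "(\<lambda>\<omega>. EZ (real n) (X' t \<omega>)) \<in> borel_measurable Finf'" "(\<lambda>\<omega>. EZ (real n) (Y' t \<omega>)) \<in> borel_measurable Finf'" for n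
    using measurable_compose[OF X'_Finf'[OF t] EZ_measurable[OF time_real]] measurable_compose[OF Y'_Finf'[OF t] EZ_measurable[OF time_real]] by auto
  note [measurable] = ZX_Finf'[OF t] ZY_Finf'[OF t] X'_Finf'[OF t] Y'_Finf'[OF t]
  have nn: "0 \<le> z * EZ (real n) w / EZ (t + real n) v" if "0 \<le> z" for z n w v
    using that t by simp
  have "(\<lambda>n. \<integral>\<omega>. min (?a n \<omega>) (?b n \<omega>) \<partial>PP (x, y)) \<longlonglongrightarrow> (\<integral>\<omega>. min (?gX \<omega>) (?gY \<omega>) \<partial>PP (x, y))"
  proof (rule integral_dominated_convergence[where w = "\<lambda>_. exp (l0 * t) * ratio * ratio"])
    show "integrable (PP (x, y)) (\<lambda>_. exp (l0 * t) * ratio * ratio)"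
      by (rule PP_integrable[where b = "exp (l0 * t) * ratio * ratio"]) (auto simp: abs_mult)
    show "AE \<omega> in PP (x, y). (\<lambda>n. min (?a n \<omega>) (?b n \<omega>)) \<longlonglongrightarrow> min (?gX \<omega>) (?gY \<omega>)"
      by (intro AE_I2 tendsto_min lim)
    show "AE \<omega> in PP (x, y). norm (min (?a n \<omega>) (?b n \<omega>)) \<le> exp (l0 * t) * ratio * ratio" for n
    proof (rule AE_I2)
      fix \<omega>
      have "min (?a n \<omega>) (?b n \<omega>) \<le> exp (l0 * t) * ratio * ratio"
        using bound[of "Z X' t \<omega>" n "X' t \<omega>" x] t by (simp add: min_le_iff_disj)
      moreover have "0 \<le> min (?a n \<omega>) (?b n \<omega>)" using nn t by simp
      ultimately show "norm (min (?a n \<omega>) (?b n \<omega>)) \<le> exp (l0 * t) * ratio * ratio" by simp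
    qed
  qed measurable
  then have le: "overlap_bound x y \<le> (\<integral>\<omega>. min (?gX \<omega>) (?gY \<omega>) \<partial>PP (x, y))"
    by (rule LIMSEQ_le_const) (use overlap_projected[OF t time_real] in blast)
  have ub: "?gX \<omega> \<le> exp (l0 * t) * ratio * ratio" for \<omega>
    by (rule LIMSEQ_le_const2[OF lim]) (use bound[of "Z X' t \<omega>" _ "X' t \<omega>" x] t in auto)
  have nng: "0 \<le> ?gX \<omega>" "0 \<le> ?gY \<omega>" for \<omega> using t by simp_all
  have "ennreal (overlap_bound x y) \<le> ennreal (\<integral>\<omega>. min (?gX \<omega>) (?gY \<omega>) \<partial>PP (x, y))"
    by (rule ennreal_leI[OF le])
  also have "\<dots> = (\<integral>\<^sup>+\<omega>. ennreal (min (?gX \<omega>) (?gY \<omega>)) \<partial>PP (x, y))"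
  proof (rule nn_integral_eq_integral[symmetric])
    have "\<bar>min (?gX \<omega>) (?gY \<omega>)\<bar> \<le> exp (l0 * t) * ratio * ratio" for \<omega>
      using ub[of \<omega>] nng[of \<omega>] by (simp add: min_le_iff_disj)
    then show "integrable (PP (x, y)) (\<lambda>\<omega>. min (?gX \<omega>) (?gY \<omega>))"
      by (intro PP_integrable) measurable
  qed (use nng in auto)
  also have "\<dots> = (\<integral>\<^sup>+\<omega>. ennreal (min (GX t \<omega>) (GY t \<omega>)) \<partial>PP (x, y))"
    by (intro nn_integral_cong_AE eventually_mono[OF G_start[of t x y]]) simp
  finally show ?thesis .
qed

text \<open>The density of \<open>Q x\<close> and the density \<open>Z\<^sub>t / E\<^sub>x Z\<^sub>t\<close> of condition (A) differ by a factor that is at most \<open>ratio\<close>.\<close>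

lemma GX_cost:
  assumes t: "t \<in> I"
  shows "(\<integral>\<^sup>+\<omega>. ennreal (GX t \<omega>) * ennreal (dist (X' t \<omega>) (Y' t \<omega>)) \<partial>PP (x, y)) \<le>
    ennreal (ratio * (CA * exp (- gA * t)) * dist x y)"
proof -
  have ex: "0 < EZ t x" by (rule EZ_pos[OF t])
  have g: "exp (l0 * t) * \<eta> z / \<eta> x \<le> ratio / EZ t x" for z
  proof -
    have "EZ t x * \<eta> z = (\<integral>\<omega>. Z X t \<omega> * \<eta> z \<partial>P x)"
      by (simp add: penal_mean_def)
    also have "\<dots> \<le> (\<integral>\<omega>. Z X t \<omega> * (ratio * \<eta> (X t \<omega>)) \<partial>P x)"
      using Z_integrable[OF t] Z_eta_integrable[OF t] t
      by (intro integral_mono mult_left_mono eta_ratio) (auto simp: mult.left_commute[of _ ratio])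
    also have "\<dots> = ratio * (exp (- l0 * t) * \<eta> x)"
      by (simp add: mult.left_commute[of _ ratio] eta_eigen_real[OF t])
    finally have "exp (l0 * t) * (EZ t x * \<eta> z) \<le> exp (l0 * t) * (ratio * (exp (- l0 * t) * \<eta> x))"
      by (rule mult_left_mono) simp
    also have "\<dots> = ratio * \<eta> x * (exp (l0 * t) * exp (- l0 * t))" by (simp only: ac_simps)
    also have "\<dots> = ratio * \<eta> x" by (simp add: exp_add[symmetric])
    finally show ?thesis using ex eta_gt[of x] by (simp add: divide_simps ac_simps del: eta_pos)
  qed
  note [measurable] = ZX_Finf'[OF t] dist_Finf'[OF t]
  have i: "integrable (PP (x, y)) (\<lambda>\<omega>. Z X' t \<omega> / EZ t x * dist (X' t \<omega>) (Y' t \<omega>))"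
  proof (rule PP_integrable[where b = "1 / EZ t x * D"])
    fix \<omega>
    have "Z X' t \<omega> / EZ t x * dist (X' t \<omega>) (Y' t \<omega>) \<le> 1 / EZ t x * D"
      using t ex dist_le by (intro mult_mono divide_right_mono) auto
    then show "\<bar>Z X' t \<omega> / EZ t x * dist (X' t \<omega>) (Y' t \<omega>)\<bar> \<le> 1 / EZ t x * D" using t by (simp add: abs_mult)
  qed measurable
  have "(\<integral>\<^sup>+\<omega>. ennreal (GX t \<omega>) * ennreal (dist (X' t \<omega>) (Y' t \<omega>)) \<partial>PP (x, y)) \<le>
      (\<integral>\<^sup>+\<omega>. ennreal (ratio * (Z X' t \<omega> / EZ t x * dist (X' t \<omega>) (Y' t \<omega>))) \<partial>PP (x, y))"
  proof (intro nn_integral_mono_AE eventually_mono[OF G_start[of t x y]])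
    fix \<omega> assume G: "GX t \<omega> = exp (l0 * t) * Z X' t \<omega> * \<eta> (X' t \<omega>) / \<eta> x \<and> GY t \<omega> = exp (l0 * t) * Z Y' t \<omega> * \<eta> (Y' t \<omega>) / \<eta> y"
    have "GX t \<omega> = Z X' t \<omega> * (exp (l0 * t) * \<eta> (X' t \<omega>) / \<eta> x)" using G by simp
    also have "\<dots> \<le> Z X' t \<omega> * (ratio / EZ t x)" using t by (intro mult_left_mono g) auto
    finally have "GX t \<omega> * dist (X' t \<omega>) (Y' t \<omega>) \<le> Z X' t \<omega> * (ratio / EZ t x) * dist (X' t \<omega>) (Y' t \<omega>)"
      by (rule mult_right_mono) simp
    then show "ennreal (GX t \<omega>) * ennreal (dist (X' t \<omega>) (Y' t \<omega>)) \<le> ennreal (ratio * (Z X' t \<omega> / EZ t x * dist (X' t \<omega>) (Y' t \<omega>)))"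
      using t by (subst ennreal_mult[symmetric]) (auto intro!: ennreal_leI simp: ac_simps)
  qed
  also have "\<dots> = ennreal (ratio * (\<integral>\<omega>. Z X' t \<omega> / EZ t x * dist (X' t \<omega>) (Y' t \<omega>) \<partial>PP (x, y)))"
    using t less_imp_le[OF ratio_pos]
    by (subst nn_integral_eq_integral[OF integrable_mult_right[OF i]]) (auto intro!: AE_I2)
  also have "\<dots> \<le> ennreal (ratio * (CA * exp (- gA * t) * dist x y))"
    by (intro ennreal_leI mult_left_mono condition_A t less_imp_le[OF ratio_pos])
  finally show ?thesis by (simp only: mult.assoc)
qed

end

context penalized_coupling_qsd
begin

lemma prob_on_borel_space: "prob_on_borel \<mu> \<Longrightarrow> space (\<mu> :: 'e measure) = UNIV"
  using sets_eq_imp_space_eq[of \<mu> borel] by (simp add: prob_on_borel_def)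

lemma Q_subprob: "prob_on_borel \<mu> \<Longrightarrow> Q \<in> \<mu> \<rightarrow>\<^sub>M subprob_algebra Finf"
  using kernel_subprob[OF Q_kernel] by (simp add: prob_on_borel_def cong: measurable_cong_sets)

lemma sets_bind_Q: "prob_on_borel \<mu> \<Longrightarrow> sets (\<mu> \<bind> Q) = sets Finf"
  by (rule sets_bind) (auto simp: prob_on_borel_space)

lemma sets_law_at [simp]: "sets (law_at X Q \<mu> t) = sets borel"
  by (simp add: law_at_def)

lemma Q_fun_measurable:
  assumes "t \<in> I" "f \<in> borel_measurable borel"
  shows "(\<lambda>x. \<integral>\<^sup>+\<omega>. f (X t \<omega>) \<partial>Q x) \<in> borel_measurable borel"
  by (rule kernel_nn_integral_measurable[OF Q_kernel measurable_compose[OF X_Finf[OF assms(1)] assms(2)]])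

lemma nn_integral_law_at:
  assumes \<mu>: "prob_on_borel \<mu>" and t: "t \<in> I" and f: "f \<in> borel_measurable borel"
  shows "(\<integral>\<^sup>+y. f y \<partial>law_at X Q \<mu> t) = (\<integral>\<^sup>+x. (\<integral>\<^sup>+\<omega>. f (X t \<omega>) \<partial>Q x) \<partial>\<mu>)"
proof -
  have m: "X t \<in> (\<mu> \<bind> Q) \<rightarrow>\<^sub>M borel"
    using X_Finf[OF t] by (simp add: measurable_cong_sets[OF sets_bind_Q[OF \<mu>] refl])
  show ?thesis
    unfolding law_at_def
    using nn_integral_distr[OF m, of f] f
    by (simp add: nn_integral_bind[OF measurable_compose[OF X_Finf[OF t] f] Q_subprob[OF \<mu>]])
qed

lemma law_at_prob:
  assumes \<mu>: "prob_on_borel \<mu>" and t: "t \<in> I" shows "prob_on_borel (law_at X Q \<mu> t)"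
proof -
  have "emeasure (law_at X Q \<mu> t) UNIV = (\<integral>\<^sup>+y. 1 \<partial>law_at X Q \<mu> t)"
    using sets_eq_imp_space_eq[OF sets_law_at] by simp
  also have "\<dots> = (\<integral>\<^sup>+x. 1 \<partial>\<mu>)"
    by (subst nn_integral_law_at[OF \<mu> t]) (simp_all add: prob_space.emeasure_space_1[OF prob_Q, simplified])
  also have "\<dots> = 1" using \<mu> prob_space.emeasure_space_1[of \<mu>] by (simp add: prob_on_borel_def)
  finally show ?thesis
    unfolding prob_on_borel_def using sets_eq_imp_space_eq[OF sets_law_at] by (auto intro!: prob_spaceI)
qed

lemma law_at_eqI:
  assumes N: "sets N = sets borel" and \<mu>: "prob_on_borel \<mu>" and t: "t \<in> I"
    and eq: "\<And>B. B \<in> sets borel \<Longrightarrow> emeasure N B = (\<integral>\<^sup>+x. (\<integral>\<^sup>+\<omega>. indicator B (X t \<omega>) \<partial>Q x) \<partial>\<mu>)"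
  shows "N = law_at X Q \<mu> t"
proof (rule measure_eqI)
  fix B assume "B \<in> sets N"
  then have B: "B \<in> sets borel" using N by simp
  have "emeasure (law_at X Q \<mu> t) B = (\<integral>\<^sup>+y. indicator B y \<partial>law_at X Q \<mu> t)" using B by simp
  also have "\<dots> = emeasure N B" using B by (subst nn_integral_law_at[OF \<mu> t]) (simp_all add: eq)
  finally show "emeasure N B = emeasure (law_at X Q \<mu> t) B" ..
qed (simp add: N)

lemma law_at_zero:
  assumes \<mu>: "prob_on_borel \<mu>" shows "law_at X Q \<mu> 0 = \<mu>"
proof (rule law_at_eqI[OF _ \<mu> zero_in_time, symmetric])
  show s: "sets \<mu> = sets borel" using \<mu> by (simp add: prob_on_borel_def)
  fix B :: "'e set" assume B: "B \<in> sets borel"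
  have "(\<integral>\<^sup>+\<omega>. indicator B (X 0 \<omega>) \<partial>Q x) = indicator B x" for x
  proof -
    have "(\<integral>\<^sup>+\<omega>. indicator B (X 0 \<omega>) \<partial>Q x) = (\<integral>\<^sup>+\<omega>. indicator B x \<partial>Q x)"
      using Q_X_zero[of x] by (intro nn_integral_cong_AE) (auto elim!: eventually_mono)
    then show ?thesis by (simp add: prob_space.emeasure_space_1[OF prob_Q, simplified])
  qed
  then show "emeasure \<mu> B = (\<integral>\<^sup>+x. (\<integral>\<^sup>+\<omega>. indicator B (X 0 \<omega>) \<partial>Q x) \<partial>\<mu>)"
    using B s by simp
qed

lemma Q_chapman:
  assumes s: "s \<in> I" and t: "t \<in> I" and f[measurable]: "f \<in> borel_measurable borel"
  shows "(\<integral>\<^sup>+\<omega>. f (X (s + t) \<omega>) \<partial>Q x) = (\<integral>\<^sup>+\<omega>. (\<integral>\<^sup>+\<omega>'. f (X t \<omega>') \<partial>Q (X s \<omega>)) \<partial>Q x)"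
proof -
  have h: "(\<lambda>p. f (p t)) \<in> borel_measurable paths" using t by measurable
  have h1: "(\<lambda>\<omega>. f (path I X \<omega> t)) \<in> borel_measurable (F t)"
    using measurable_compose[OF X_F[OF t] f] t by simp
  have h2: "(\<lambda>\<omega>. f (path I (\<lambda>r \<omega>. X (s + r) \<omega>) \<omega> t)) \<in> borel_measurable (F (s + t))"
    using measurable_compose[OF X_F[OF time_add[OF s t]] f] t by simp
  have ind: "(\<integral>\<^sup>+\<omega>. indicator \<Omega> \<omega> * g \<omega> \<partial>Q x) = (\<integral>\<^sup>+\<omega>. g \<omega> \<partial>Q x)" for g
    by (intro nn_integral_cong) (simp add: indicator_def)
  have "\<Omega> \<in> sets (F s)" using sets.top[of "F s"] s by simp
  from Q_markov_cylinder[OF s t this h h1 h2, of x] show ?thesis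
    unfolding ind using t by simp
qed

lemma law_at_add:
  assumes \<mu>: "prob_on_borel \<mu>" and s: "s \<in> I" and t: "t \<in> I"
  shows "law_at X Q (law_at X Q \<mu> s) t = law_at X Q \<mu> (s + t)"
proof (rule law_at_eqI[OF _ \<mu> time_add[OF s t]])
  fix B :: "'e set" assume B[measurable]: "B \<in> sets borel"
  have m: "(\<lambda>x. \<integral>\<^sup>+\<omega>. indicator B (X t \<omega>) \<partial>Q x) \<in> borel_measurable borel"
    by (rule Q_fun_measurable[OF t]) simp
  have "emeasure (law_at X Q (law_at X Q \<mu> s) t) B = (\<integral>\<^sup>+y. indicator B y \<partial>law_at X Q (law_at X Q \<mu> s) t)" by simp
  also have "\<dots> = (\<integral>\<^sup>+x. (\<integral>\<^sup>+\<omega>. indicator B (X t \<omega>) \<partial>Q x) \<partial>law_at X Q \<mu> s)"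
    by (rule nn_integral_law_at[OF law_at_prob[OF \<mu> s] t]) simp
  also have "\<dots> = (\<integral>\<^sup>+x. (\<integral>\<^sup>+\<omega>. (\<integral>\<^sup>+\<omega>'. indicator B (X t \<omega>') \<partial>Q (X s \<omega>)) \<partial>Q x) \<partial>\<mu>)"
    by (rule nn_integral_law_at[OF \<mu> s m])
  also have "\<dots> = (\<integral>\<^sup>+x. (\<integral>\<^sup>+\<omega>. indicator B (X (s + t) \<omega>) \<partial>Q x) \<partial>\<mu>)"
    by (intro nn_integral_cong Q_chapman[OF s t, symmetric]) simp
  finally show "emeasure (law_at X Q (law_at X Q \<mu> s) t) B = (\<integral>\<^sup>+x. (\<integral>\<^sup>+\<omega>. indicator B (X (s + t) \<omega>) \<partial>Q x) \<partial>\<mu>)" .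
qed simp

lemma coupling_sets: "\<pi> \<in> couplings \<mu> \<nu> \<Longrightarrow> sets \<pi> = sets (borel :: ('e \<times> 'e) measure)"
  unfolding couplings_def borel_prod[symmetric] by simp

lemma coupling_prob:
  assumes \<pi>: "\<pi> \<in> couplings \<mu> \<nu>" and \<mu>: "prob_on_borel (\<mu> :: 'e measure)" shows "prob_space \<pi>"
proof (rule prob_space_distrD)
  show "fst \<in> \<pi> \<rightarrow>\<^sub>M borel" using borel_fst by (simp add: measurable_cong_sets[OF coupling_sets[OF \<pi>] refl])
  show "prob_space (distr \<pi> borel fst)" using \<pi> \<mu> by (simp add: couplings_def prob_on_borel_def)
qed

lemma coupling_fst:
  assumes \<pi>: "\<pi> \<in> couplings \<mu> \<nu>" and f: "f \<in> borel_measurable borel"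
  shows "(\<integral>\<^sup>+z. f (fst z) \<partial>\<pi>) = (\<integral>\<^sup>+x. f x \<partial>(\<mu> :: 'e measure))"
proof -
  have "fst \<in> \<pi> \<rightarrow>\<^sub>M borel" using borel_fst by (simp add: measurable_cong_sets[OF coupling_sets[OF \<pi>] refl])
  from nn_integral_distr[OF this, of f] show ?thesis using \<pi> f by (simp add: couplings_def)
qed

lemma coupling_snd:
  assumes \<pi>: "\<pi> \<in> couplings \<mu> \<nu>" and f: "f \<in> borel_measurable borel"
  shows "(\<integral>\<^sup>+z. f (snd z) \<partial>\<pi>) = (\<integral>\<^sup>+x. f x \<partial>(\<nu> :: 'e measure))"
proof -
  have "snd \<in> \<pi> \<rightarrow>\<^sub>M borel" using borel_snd by (simp add: measurable_cong_sets[OF coupling_sets[OF \<pi>] refl])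
  from nn_integral_distr[OF this, of f] show ?thesis using \<pi> f by (simp add: couplings_def)
qed

lemma coupling_integrable:
  assumes "\<pi> \<in> couplings \<mu> \<nu>" "prob_on_borel (\<mu> :: 'e measure)"
    and "f \<in> borel_measurable borel" "\<And>z. \<bar>f z\<bar> \<le> b"
  shows "integrable \<pi> (f :: 'e \<times> 'e \<Rightarrow> real)"
  using assms prob_space.finite_measure[OF coupling_prob[OF assms(1,2)]]
  by (intro finite_measure.integrable_const_bound[where B = b])
    (auto simp: measurable_cong_sets[OF coupling_sets refl])

lemma borel_dist: "(\<lambda>z. dist (fst z) (snd z)) \<in> borel_measurable (borel :: ('e \<times> 'e) measure)"
  by (intro borel_measurable_dist borel_fst borel_snd)

lemma overlap_bound_range: "0 \<le> overlap_bound x y" "overlap_bound x y \<le> 1"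
  using CC_gt CB_pos by (auto simp: overlap_bound_def le_max_iff_disj divide_le_eq intro!: mult_nonneg_nonneg)

lemma overlap_bound_borel: "(\<lambda>z. overlap_bound (fst z) (snd z)) \<in> borel_measurable (borel :: ('e \<times> 'e) measure)"
  unfolding overlap_bound_def using borel_dist by measurable

text \<open>For a cost \<open>c\<close> that is at most \<open>b\<close> and at most \<open>k\<close> times the distance, the first term comes from the
  common part of the densities and condition (A), the second one from the residual masses.\<close>

definition cost_control :: "real \<Rightarrow> ('e \<times> 'e) measure \<Rightarrow> ('e \<times> 'e) measure \<Rightarrow> bool" where
  "cost_control t \<pi> \<pi>' \<longleftrightarrow> (\<forall>c b k. c \<in> borel_measurable borel \<longrightarrow> (\<forall>z. 0 \<le> c z) \<longrightarrow> (\<forall>z. c z \<le> b) \<longrightarrow> 0 \<le> k \<longrightarrow>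
      (\<forall>z. c z \<le> k * dist (fst z) (snd z)) \<longrightarrow>
      (\<integral>z. c z \<partial>\<pi>') \<le> (\<integral>z. k * (ratio * (CA * exp (- gA * t)) * dist (fst z) (snd z)) + b * (1 - overlap_bound (fst z) (snd z)) \<partial>\<pi>))"

text \<open>The coupling over a time \<open>t\<close>: run the given coupling of the penalized process, keep the common part of
  the two densities of the h-transforms, and couple the remaining masses independently.\<close>

lemma coupling_step:
  assumes t: "t \<in> I" and \<mu>: "prob_on_borel \<mu>" and \<nu>: "prob_on_borel \<nu>" and \<pi>: "\<pi> \<in> couplings \<mu> \<nu>"
  obtains \<pi>' where "\<pi>' \<in> couplings (law_at X Q \<mu> t) (law_at X Q \<nu> t)" and "cost_control t \<pi> \<pi>'"
proof -
  note s\<pi> = coupling_sets[OF \<pi>]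
  interpret p: prob_space \<pi> by (rule coupling_prob[OF \<pi> \<mu>])
  have sp\<pi>: "space \<pi> = UNIV" using sets_eq_imp_space_eq[OF s\<pi>] by simp
  define MM where "MM = \<pi> \<bind> PP"
  have kern: "PP \<in> \<pi> \<rightarrow>\<^sub>M subprob_algebra Finf'"
    using CX.kernel_subprob[OF CX.P_kernel] by (simp add: measurable_cong_sets[OF s\<pi> refl])
  have sets_MM [measurable_cong]: "sets MM = sets Finf'"
    unfolding MM_def by (rule sets_bind) (auto simp: sp\<pi>)
  have nn_MM: "(\<integral>\<^sup>+\<omega>. f \<omega> \<partial>MM) = (\<integral>\<^sup>+z. (\<integral>\<^sup>+\<omega>. f \<omega> \<partial>PP z) \<partial>\<pi>)" if "f \<in> borel_measurable Finf'" for f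
    unfolding MM_def by (rule nn_integral_bind[OF that kern])
  have prob_MM: "prob_space MM"
  proof (rule prob_spaceI)
    have "emeasure MM (space MM) = (\<integral>\<^sup>+\<omega>. 1 \<partial>MM)" by simp
    also have "\<dots> = 1"
      by (subst nn_MM) (auto simp: prob_space.emeasure_space_1[OF CX.prob_P, simplified] p.emeasure_space_1)
    finally show "emeasure MM (space MM) = 1" .
  qed
  note [measurable] = X'_Finf'[OF t] Y'_Finf'[OF t] GX_measurable[OF t] GY_measurable[OF t] dist_Finf'[OF t]
  have lawX: "(\<integral>\<^sup>+\<omega>. ennreal (GX t \<omega>) * f (X' t \<omega>) \<partial>MM) = (\<integral>\<^sup>+x. (\<integral>\<^sup>+\<omega>. f (X t \<omega>) \<partial>Q x) \<partial>\<mu>)"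
    if f[measurable]: "f \<in> borel_measurable borel" for f
  proof -
    have m: "(\<lambda>x. \<integral>\<^sup>+\<omega>. f (X t \<omega>) \<partial>Q x) \<in> borel_measurable borel"
      by (rule Q_fun_measurable[OF t f])
    have "(\<integral>\<^sup>+\<omega>. ennreal (GX t \<omega>) * f (X' t \<omega>) \<partial>MM) = (\<integral>\<^sup>+z. (\<integral>\<^sup>+\<omega>. ennreal (GX t \<omega>) * f (X' t \<omega>) \<partial>PP z) \<partial>\<pi>)"
      by (rule nn_MM) measurable
    also have "\<dots> = (\<integral>\<^sup>+z. (\<integral>\<^sup>+\<omega>. f (X t \<omega>) \<partial>Q (fst z)) \<partial>\<pi>)"
    proof (rule nn_integral_cong)
      fix z :: "'e \<times> 'e"
      show "(\<integral>\<^sup>+\<omega>. ennreal (GX t \<omega>) * f (X' t \<omega>) \<partial>PP z) = (\<integral>\<^sup>+\<omega>. f (X t \<omega>) \<partial>Q (fst z))"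
        using GX_law[OF t f, of "fst z" "snd z"] by simp
    qed
    also have "\<dots> = (\<integral>\<^sup>+x. (\<integral>\<^sup>+\<omega>. f (X t \<omega>) \<partial>Q x) \<partial>\<mu>)" by (rule coupling_fst[OF \<pi> m])
    finally show ?thesis .
  qed
  have lawY: "(\<integral>\<^sup>+\<omega>. ennreal (GY t \<omega>) * f (Y' t \<omega>) \<partial>MM) = (\<integral>\<^sup>+x. (\<integral>\<^sup>+\<omega>. f (X t \<omega>) \<partial>Q x) \<partial>\<nu>)"
    if f[measurable]: "f \<in> borel_measurable borel" for f
  proof -
    have m: "(\<lambda>x. \<integral>\<^sup>+\<omega>. f (X t \<omega>) \<partial>Q x) \<in> borel_measurable borel"
      by (rule Q_fun_measurable[OF t f])
    have "(\<integral>\<^sup>+\<omega>. ennreal (GY t \<omega>) * f (Y' t \<omega>) \<partial>MM) = (\<integral>\<^sup>+z. (\<integral>\<^sup>+\<omega>. ennreal (GY t \<omega>) * f (Y' t \<omega>) \<partial>PP z) \<partial>\<pi>)"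
      by (rule nn_MM) measurable
    also have "\<dots> = (\<integral>\<^sup>+z. (\<integral>\<^sup>+\<omega>. f (X t \<omega>) \<partial>Q (snd z)) \<partial>\<pi>)"
    proof (rule nn_integral_cong)
      fix z :: "'e \<times> 'e"
      show "(\<integral>\<^sup>+\<omega>. ennreal (GY t \<omega>) * f (Y' t \<omega>) \<partial>PP z) = (\<integral>\<^sup>+\<omega>. f (X t \<omega>) \<partial>Q (snd z))"
        using GY_law[OF t f, of "fst z" "snd z"] by simp
    qed
    also have "\<dots> = (\<integral>\<^sup>+x. (\<integral>\<^sup>+\<omega>. f (X t \<omega>) \<partial>Q x) \<partial>\<nu>)" by (rule coupling_snd[OF \<pi> m])
    finally show ?thesis .
  qed
  have mass: "(\<integral>\<^sup>+\<omega>. ennreal (GX t \<omega>) \<partial>MM) = 1" "(\<integral>\<^sup>+\<omega>. ennreal (GY t \<omega>) \<partial>MM) = 1"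
    using lawX[of "\<lambda>_. 1"] lawY[of "\<lambda>_. 1"] prob_space.emeasure_space_1[of \<mu>] prob_space.emeasure_space_1[of \<nu>] \<mu> \<nu>
    by (simp_all add: prob_space.emeasure_space_1[OF prob_Q, simplified] prob_on_borel_def)
  have UV: "X' t \<in> MM \<rightarrow>\<^sub>M borel" "Y' t \<in> MM \<rightarrow>\<^sub>M borel" "GX t \<in> borel_measurable MM" "GY t \<in> borel_measurable MM"
    by measurable
  obtain \<pi>' where \<pi>': "\<pi>' \<in> couplings (distr (density MM (\<lambda>\<omega>. ennreal (GX t \<omega>))) borel (X' t)) (distr (density MM (\<lambda>\<omega>. ennreal (GY t \<omega>))) borel (Y' t))"
    and cost: "\<And>(c :: 'e \<times> 'e \<Rightarrow> ennreal) b. c \<in> borel_measurable (borel \<Otimes>\<^sub>M borel) \<Longrightarrow> (\<And>z. c z \<le> b) \<Longrightarrow>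
      (\<integral>\<^sup>+z. c z \<partial>\<pi>') \<le> (\<integral>\<^sup>+\<omega>. ennreal (min (GX t \<omega>) (GY t \<omega>)) * c (X' t \<omega>, Y' t \<omega>) \<partial>MM) +
        b * (1 - (\<integral>\<^sup>+\<omega>. ennreal (min (GX t \<omega>) (GY t \<omega>)) \<partial>MM))"
    using overlap_coupling[OF prob_MM UV GX_nonneg[OF t] GY_nonneg[OF t] mass] by blast
  have eqX: "distr (density MM (\<lambda>\<omega>. ennreal (GX t \<omega>))) borel (X' t) = law_at X Q \<mu> t"
  proof (rule law_at_eqI[OF _ \<mu> t])
    fix B :: "'e set" assume B[measurable]: "B \<in> sets borel"
    have "emeasure (distr (density MM (\<lambda>\<omega>. ennreal (GX t \<omega>))) borel (X' t)) B =
        (\<integral>\<^sup>+y. indicator B y \<partial>distr (density MM (\<lambda>\<omega>. ennreal (GX t \<omega>))) borel (X' t))" by simp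
    also have "\<dots> = (\<integral>\<^sup>+\<omega>. ennreal (GX t \<omega>) * indicator B (X' t \<omega>) \<partial>MM)"
      by (subst nn_integral_distr) (auto simp: nn_integral_density)
    also have "\<dots> = (\<integral>\<^sup>+x. (\<integral>\<^sup>+\<omega>. indicator B (X t \<omega>) \<partial>Q x) \<partial>\<mu>)" by (rule lawX) simp
    finally show "emeasure (distr (density MM (\<lambda>\<omega>. ennreal (GX t \<omega>))) borel (X' t)) B = (\<integral>\<^sup>+x. (\<integral>\<^sup>+\<omega>. indicator B (X t \<omega>) \<partial>Q x) \<partial>\<mu>)" .
  qed simp
  have eqY: "distr (density MM (\<lambda>\<omega>. ennreal (GY t \<omega>))) borel (Y' t) = law_at X Q \<nu> t"
  proof (rule law_at_eqI[OF _ \<nu> t])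
    fix B :: "'e set" assume B[measurable]: "B \<in> sets borel"
    have "emeasure (distr (density MM (\<lambda>\<omega>. ennreal (GY t \<omega>))) borel (Y' t)) B =
        (\<integral>\<^sup>+y. indicator B y \<partial>distr (density MM (\<lambda>\<omega>. ennreal (GY t \<omega>))) borel (Y' t))" by simp
    also have "\<dots> = (\<integral>\<^sup>+\<omega>. ennreal (GY t \<omega>) * indicator B (Y' t \<omega>) \<partial>MM)"
      by (subst nn_integral_distr) (auto simp: nn_integral_density)
    also have "\<dots> = (\<integral>\<^sup>+x. (\<integral>\<^sup>+\<omega>. indicator B (X t \<omega>) \<partial>Q x) \<partial>\<nu>)" by (rule lawY) simp
    finally show "emeasure (distr (density MM (\<lambda>\<omega>. ennreal (GY t \<omega>))) borel (Y' t)) B = (\<integral>\<^sup>+x. (\<integral>\<^sup>+\<omega>. indicator B (X t \<omega>) \<partial>Q x) \<partial>\<nu>)" .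
  qed simp
  have \<pi>'c: "\<pi>' \<in> couplings (law_at X Q \<mu> t) (law_at X Q \<nu> t)" using \<pi>' unfolding eqX eqY .
  show thesis
  proof (rule that[OF \<pi>'c], unfold cost_control_def, intro allI impI)
    fix c :: "'e \<times> 'e \<Rightarrow> real" and b k
    assume c: "c \<in> borel_measurable borel" and "\<forall>z. 0 \<le> c z" "\<forall>z. c z \<le> b" and k: "0 \<le> k"
      and "\<forall>z. c z \<le> k * dist (fst z) (snd z)"
    then have c0: "\<And>z. 0 \<le> c z" and cb: "\<And>z. c z \<le> b" and ck: "\<And>z. c z \<le> k * dist (fst z) (snd z)"
      by blast+
    let ?d = "\<lambda>z :: 'e \<times> 'e. dist (fst z) (snd z)" and ?o = "\<lambda>z :: 'e \<times> 'e. overlap_bound (fst z) (snd z)"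
    let ?g = "ratio * (CA * exp (- gA * t))"
    have g0: "0 \<le> ?g" using CA_pos less_imp_le[OF ratio_pos] by simp
    have b0: "0 \<le> b" using c0[of undefined] cb[of undefined] by linarith
    have int_o: "integrable \<pi> ?o"
      by (rule coupling_integrable[OF \<pi> \<mu> overlap_bound_borel, where b = 1]) (use overlap_bound_range in \<open>auto simp: abs_of_nonneg\<close>)
    have int_d: "integrable \<pi> ?d"
      by (rule coupling_integrable[OF \<pi> \<mu> borel_dist, where b = D]) (use dist_le in auto)
    have ec: "(\<lambda>z. ennreal (c z)) \<in> borel_measurable (borel \<Otimes>\<^sub>M borel)"
      using c unfolding borel_prod[symmetric] by simp
    have dm: "(\<lambda>\<omega>. ennreal (GX t \<omega>) * ennreal (dist (X' t \<omega>) (Y' t \<omega>))) \<in> borel_measurable Finf'" by measurable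
    have "(\<integral>\<^sup>+\<omega>. ennreal (min (GX t \<omega>) (GY t \<omega>)) * ennreal (c (X' t \<omega>, Y' t \<omega>)) \<partial>MM) \<le>
        (\<integral>\<^sup>+\<omega>. ennreal k * (ennreal (GX t \<omega>) * ennreal (dist (X' t \<omega>) (Y' t \<omega>))) \<partial>MM)"
    proof (rule nn_integral_mono)
      fix \<omega>
      have "min (GX t \<omega>) (GY t \<omega>) * c (X' t \<omega>, Y' t \<omega>) \<le> GX t \<omega> * (k * dist (X' t \<omega>) (Y' t \<omega>))"
        using ck[of "(X' t \<omega>, Y' t \<omega>)"] c0 t by (intro mult_mono) auto
      then have "ennreal (min (GX t \<omega>) (GY t \<omega>) * c (X' t \<omega>, Y' t \<omega>)) \<le> ennreal (k * (GX t \<omega> * dist (X' t \<omega>) (Y' t \<omega>)))"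
        by (intro ennreal_leI) (simp add: ac_simps)
      then show "ennreal (min (GX t \<omega>) (GY t \<omega>)) * ennreal (c (X' t \<omega>, Y' t \<omega>)) \<le> ennreal k * (ennreal (GX t \<omega>) * ennreal (dist (X' t \<omega>) (Y' t \<omega>)))"
        using t k c0 by (simp add: ennreal_mult)
    qed
    also have "\<dots> = ennreal k * (\<integral>\<^sup>+\<omega>. ennreal (GX t \<omega>) * ennreal (dist (X' t \<omega>) (Y' t \<omega>)) \<partial>MM)"
      by (rule nn_integral_cmult) (use dm in simp)
    also have "\<dots> \<le> ennreal k * (\<integral>\<^sup>+z. ennreal (?g * ?d z) \<partial>\<pi>)"
    proof (rule mult_left_mono)
      show "(\<integral>\<^sup>+\<omega>. ennreal (GX t \<omega>) * ennreal (dist (X' t \<omega>) (Y' t \<omega>)) \<partial>MM) \<le> (\<integral>\<^sup>+z. ennreal (?g * ?d z) \<partial>\<pi>)"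
        unfolding nn_MM[OF dm]
      proof (rule nn_integral_mono)
        fix z :: "'e \<times> 'e"
        show "(\<integral>\<^sup>+\<omega>. ennreal (GX t \<omega>) * ennreal (dist (X' t \<omega>) (Y' t \<omega>)) \<partial>PP z) \<le> ennreal (?g * ?d z)"
          using GX_cost[OF t, of "fst z" "snd z"] by simp
      qed
    qed simp
    also have "\<dots> = ennreal (k * (?g * (\<integral>z. ?d z \<partial>\<pi>)))"
    proof -
      have "(\<integral>\<^sup>+z. ennreal (?g * ?d z) \<partial>\<pi>) = ennreal (\<integral>z. ?g * ?d z \<partial>\<pi>)"
        using g0 by (intro nn_integral_eq_integral integrable_mult_right int_d) (auto intro!: AE_I2)
      also have "(\<integral>z. ?g * ?d z \<partial>\<pi>) = ?g * (\<integral>z. ?d z \<partial>\<pi>)" by simp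
      finally show ?thesis using k g0 by (simp add: ennreal_mult)
    qed
    finally have first: "(\<integral>\<^sup>+\<omega>. ennreal (min (GX t \<omega>) (GY t \<omega>)) * ennreal (c (X' t \<omega>, Y' t \<omega>)) \<partial>MM) \<le> ennreal (k * (?g * (\<integral>z. ?d z \<partial>\<pi>)))" .
    have "ennreal (\<integral>z. ?o z \<partial>\<pi>) = (\<integral>\<^sup>+z. ennreal (?o z) \<partial>\<pi>)"
      using overlap_bound_range by (intro nn_integral_eq_integral[symmetric] int_o) auto
    also have "\<dots> \<le> (\<integral>\<^sup>+z. (\<integral>\<^sup>+\<omega>. ennreal (min (GX t \<omega>) (GY t \<omega>)) \<partial>PP z) \<partial>\<pi>)"
    proof (rule nn_integral_mono)
      fix z :: "'e \<times> 'e"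
      show "ennreal (?o z) \<le> (\<integral>\<^sup>+\<omega>. ennreal (min (GX t \<omega>) (GY t \<omega>)) \<partial>PP z)"
        using overlap_limit[OF t, of "fst z" "snd z"] by simp
    qed
    also have "\<dots> = (\<integral>\<^sup>+\<omega>. ennreal (min (GX t \<omega>) (GY t \<omega>)) \<partial>MM)"
      by (rule nn_MM[symmetric]) measurable
    finally have "1 - (\<integral>\<^sup>+\<omega>. ennreal (min (GX t \<omega>) (GY t \<omega>)) \<partial>MM) \<le> 1 - ennreal (\<integral>z. ?o z \<partial>\<pi>)"
      by (rule ennreal_minus_mono[OF order.refl])
    also have "\<dots> = ennreal (1 - (\<integral>z. ?o z \<partial>\<pi>))"
      using overlap_bound_range by (simp add: ennreal_minus integral_nonneg_AE flip: ennreal_1)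
    finally have second: "ennreal b * (1 - (\<integral>\<^sup>+\<omega>. ennreal (min (GX t \<omega>) (GY t \<omega>)) \<partial>MM)) \<le> ennreal b * ennreal (1 - (\<integral>z. ?o z \<partial>\<pi>))"
      by (rule mult_left_mono) simp
    have o1: "(\<integral>z. ?o z \<partial>\<pi>) \<le> 1"
    proof -
      have "(\<integral>z. ?o z \<partial>\<pi>) \<le> (\<integral>z. 1 \<partial>\<pi>)" by (intro integral_mono int_o overlap_bound_range) simp
      then show ?thesis by (simp add: p.prob_space)
    qed
    have d0: "0 \<le> (\<integral>z. ?d z \<partial>\<pi>)" by (intro integral_nonneg_AE) simp
    have "(\<integral>\<^sup>+z. ennreal (c z) \<partial>\<pi>') \<le> ennreal (k * (?g * (\<integral>z. ?d z \<partial>\<pi>))) + ennreal b * ennreal (1 - (\<integral>z. ?o z \<partial>\<pi>))"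
      by (rule order.trans[OF cost[OF ec ennreal_leI[OF cb]] add_mono[OF first second]])
    also have "\<dots> = ennreal (k * (?g * (\<integral>z. ?d z \<partial>\<pi>)) + b * (1 - (\<integral>z. ?o z \<partial>\<pi>)))"
      using b0 o1 k g0 d0 by (simp add: ennreal_mult'[symmetric] ennreal_plus[symmetric] del: ennreal_plus)
    finally have le: "(\<integral>\<^sup>+z. ennreal (c z) \<partial>\<pi>') \<le> ennreal (k * (?g * (\<integral>z. ?d z \<partial>\<pi>)) + b * (1 - (\<integral>z. ?o z \<partial>\<pi>)))" .
    have "(\<integral>z. c z \<partial>\<pi>') \<le> k * (?g * (\<integral>z. ?d z \<partial>\<pi>)) + b * (1 - (\<integral>z. ?o z \<partial>\<pi>))"
    proof (rule integral_real_bounded)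
      show "0 \<le> k * (?g * (\<integral>z. ?d z \<partial>\<pi>)) + b * (1 - (\<integral>z. ?o z \<partial>\<pi>))"
        using mult_nonneg_nonneg[OF k mult_nonneg_nonneg[OF g0 d0]] mult_nonneg_nonneg[OF b0, of "1 - (\<integral>z. ?o z \<partial>\<pi>)"] o1
        by (intro add_nonneg_nonneg) auto
    qed (rule le)
    also have "\<dots> = (\<integral>z. k * (?g * ?d z) + b * (1 - ?o z) \<partial>\<pi>)"
      using int_o int_d by (simp add: p.prob_space)
    finally show "(\<integral>z. c z \<partial>\<pi>') \<le> (\<integral>z. k * (?g * ?d z) + b * (1 - ?o z) \<partial>\<pi>)" .
  qed
qed

end

section \<open>The constants\<close>

lemma ln_div_exp_decay:
  assumes "0 < CA" "0 < gA" "0 < c"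
  shows "decay CA gA t \<le> c \<longleftrightarrow> ln (CA / c) / gA \<le> t"
proof -
  have "decay CA gA t \<le> c \<longleftrightarrow> CA / c \<le> exp (gA * t)"
    using assms by (simp add: decay_def exp_minus divide_simps mult.commute)
  also have "\<dots> \<longleftrightarrow> ln (CA / c) \<le> gA * t" using assms ln_le_cancel_iff[of "CA / c" "exp (gA * t)"] by simp
  also have "\<dots> \<longleftrightarrow> ln (CA / c) / gA \<le> t" using assms by (simp add: divide_le_eq mult.commute)
  finally show ?thesis .
qed

context time_set
begin

lemma time_ceiling: obtains s where "s \<in> I" "c \<le> s" "\<And>t. t \<in> I \<Longrightarrow> c \<le> t \<Longrightarrow> s \<le> t"
proof (cases rule: time_cases)
  case continuous
  then show ?thesis by (intro that[of "max 0 c"]) auto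
next
  case discrete
  show ?thesis
  proof (rule that[OF time_real])
    show "c \<le> real (nat \<lceil>c\<rceil>)" by (rule real_nat_ceiling_ge)
    fix t assume "t \<in> I" "c \<le> t"
    then obtain n where "t = real n" using discrete by (auto simp: Nats_def)
    with \<open>c \<le> t\<close> show "real (nat \<lceil>c\<rceil>) \<le> t" by (simp add: nat_le_iff ceiling_le_iff)
  qed
qed

lemma first_time_below_decay:
  assumes "0 < CA" "0 < gA" "0 < c"
  shows "first_time_below I (decay CA gA) c \<in> I"
    and "t \<in> I \<Longrightarrow> first_time_below I (decay CA gA) c \<le> t \<Longrightarrow> decay CA gA t \<le> c"
proof -
  obtain s where s: "s \<in> I" "ln (CA / c) / gA \<le> s" "\<And>t. t \<in> I \<Longrightarrow> ln (CA / c) / gA \<le> t \<Longrightarrow> s \<le> t"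
    using time_ceiling by blast
  have "first_time_below I (decay CA gA) c = s"
    unfolding first_time_below_def ln_div_exp_decay[OF assms]
    using s by (intro Least_equality) auto
  then show "first_time_below I (decay CA gA) c \<in> I"
    and "t \<in> I \<Longrightarrow> first_time_below I (decay CA gA) c \<le> t \<Longrightarrow> decay CA gA t \<le> c"
    using s ln_div_exp_decay[OF assms, of t] by auto
qed

end

section \<open>Contraction of the h-transform in Wasserstein distance\<close>

context penalized_coupling_qsd
begin

abbreviation "\<alpha> \<equiv> const_alpha I D CA gA CB CC"
abbreviation "\<beta> \<equiv> const_beta CC"
abbreviation "\<kappa> \<equiv> const_kappa CB CC"
abbreviation "C0 \<equiv> const_C0 D CA CB CC"
abbreviation "t0 \<equiv> const_t0 I D CA gA CB CC"
abbreviation "rate \<equiv> C0 * max 1 (\<kappa> * D) / \<beta>"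

lemma beta_range: "1 / 2 < \<beta>" "\<beta> < 1" "0 < \<beta>"
  using CC_gt by (auto simp: const_beta_def field_simps)

lemma kappa_pos: "0 < \<kappa>"
  using CB_pos beta_range by (simp add: const_kappa_def)

lemma kappa_eq: "\<kappa> * (\<beta> - 1 / 2) = CB"
  using beta_range by (simp add: const_kappa_def)

lemma C0_nonneg: "0 \<le> C0"
proof -
  have "0 \<le> 1 / 2 * (1 - 1 / CC) + (1 + CB * D) * CA"
    using CC_gt CA_pos CB_pos by (intro add_nonneg_nonneg mult_nonneg_nonneg) auto
  then show ?thesis by (simp add: const_C0_def le_max_iff_disj)
qed

lemma rate_nonneg: "0 \<le> rate"
  using C0_nonneg beta_range by simp

text \<open>Condition (A) at time zero.\<close>

lemma CA_ge_one:
  assumes xy: "x \<noteq> (y :: 'e)" shows "1 \<le> CA"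
proof -
  interpret prob_space "PP (x, y)" by simp
  have "(\<integral>\<omega>. Z X' 0 \<omega> / EZ 0 x * dist (X' 0 \<omega>) (Y' 0 \<omega>) \<partial>PP (x, y)) = (\<integral>\<omega>. dist x y \<partial>PP (x, y))"
  proof (rule integral_cong_AE)
    show "AE \<omega> in PP (x, y). Z X' 0 \<omega> / EZ 0 x * dist (X' 0 \<omega>) (Y' 0 \<omega>) = dist x y"
      using start_PP[of x y] by eventually_elim (simp add: penal_mean_def prob_space.prob_space[OF prob_P, simplified])
  qed (use dist_Finf'[OF zero_in_time] in simp_all)
  also have "\<dots> = dist x y" using prob_space by simp
  finally have "dist x y \<le> CA * dist x y" using condition_A[OF zero_in_time, of x y] by simp
  then show ?thesis using xy by simp
qed

lemma D_pos: "x \<noteq> (y :: 'e) \<Longrightarrow> 0 < D"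
  using dist_le[of x y] zero_less_dist_iff[of x y] by linarith

text \<open>With \<open>q = 1 - 1 / CC\<close> and \<open>b = CB D\<close>, the first expression in \<open>C0\<close> suffices if \<open>b \<le> q / 2\<close> and
  the second one otherwise.\<close>

lemma one_step_constant_le_C0:
  assumes CA: "1 \<le> CA" shows "ratio * CA + CB * D \<le> C0"
proof -
  define q b where "q = 1 - 1 / CC" and "b = CB * D"
  have q: "0 < q" "q \<le> 1" and b: "0 \<le> b" using CC_gt CB_pos by (auto simp: q_def b_def)
  show ?thesis
  proof (cases "b \<le> q / 2")
    case True
    then show ?thesis by (simp add: const_C0_def ratio_def q_def[symmetric] b_def[symmetric] le_max_iff_disj)
  next
    case False
    have m: "1 \<le> (1 + b) * CA" using b CA mult_mono[of 1 "1 + b" 1 CA] by simp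
    define s where "s = 2 * b / q"
    have s: "1 \<le> s" "b = s * q / 2" using False q by (auto simp: s_def le_divide_eq)
    define w where "w = (1 + b) * CA"
    have "(s - 1) * (q / 2) \<le> (s - 1) * w"
      using s q m by (intro mult_left_mono) (auto simp: w_def[symmetric])
    moreover have "(s - 1) * (q / 2) = s * q / 2 - q / 2" "(s - 1) * w = s * w - w"
      by (simp_all add: left_diff_distrib)
    ultimately have "(1 + b) * CA + b \<le> q + s * ((1 + b) * CA)"
      using s(2) q unfolding w_def[symmetric] by linarith
    also have "q + s * ((1 + b) * CA) = q + 2 * b * (1 + b) / q * CA" by (simp add: s_def)
    finally have "(1 + b) * CA + b \<le> q + 2 * b * (1 + b) / q * CA" .
    then show ?thesis
      by (simp add: const_C0_def ratio_def q_def[symmetric] b_def[symmetric] le_max_iff_disj mult.assoc)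
  qed
qed

lemma overlap_defect: "1 - overlap_bound x y \<le> CB * dist x y" "1 - overlap_bound x y \<le> 1 - 1 / CC"
  by (auto simp: overlap_bound_def)

lemma bounded_step:
  assumes t: "t \<in> I" and \<mu>: "prob_on_borel \<mu>" and \<nu>: "prob_on_borel \<nu>" and \<pi>: "\<pi> \<in> couplings \<mu> \<nu>"
    and xy: "x \<noteq> (y :: 'e)"
  obtains \<pi>' where "\<pi>' \<in> couplings (law_at X Q \<mu> t) (law_at X Q \<nu> t)"
    and "(\<integral>z. dist (fst z) (snd z) \<partial>\<pi>') \<le> C0 * (\<integral>z. dist (fst z) (snd z) \<partial>\<pi>)"
proof -
  obtain \<pi>' where \<pi>': "\<pi>' \<in> couplings (law_at X Q \<mu> t) (law_at X Q \<nu> t)"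
    and c: "cost_control t \<pi> \<pi>'"
    by (rule coupling_step[OF t \<mu> \<nu> \<pi>])
  let ?d = "\<lambda>z :: 'e \<times> 'e. dist (fst z) (snd z)" and ?o = "\<lambda>z :: 'e \<times> 'e. overlap_bound (fst z) (snd z)"
  have int_o: "integrable \<pi> ?o"
    by (rule coupling_integrable[OF \<pi> \<mu> overlap_bound_borel, where b = 1]) (use overlap_bound_range in \<open>auto simp: abs_of_nonneg\<close>)
  have int_d: "integrable \<pi> ?d"
    by (rule coupling_integrable[OF \<pi> \<mu> borel_dist, where b = D]) (use dist_le in auto)
  interpret prob_space \<pi> by (rule coupling_prob[OF \<pi> \<mu>])
  have "(\<integral>z. ?d z \<partial>\<pi>') \<le> (\<integral>z. 1 * (ratio * (CA * exp (- gA * t)) * ?d z) + D * (1 - ?o z) \<partial>\<pi>)"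
    by (rule c[unfolded cost_control_def, rule_format, OF borel_dist]) (auto simp: dist_le)
  also have "\<dots> \<le> (\<integral>z. C0 * ?d z \<partial>\<pi>)"
  proof (rule integral_mono)
    fix z :: "'e \<times> 'e"
    have "exp (- gA * t) \<le> 1" using gA_pos time_nonneg[OF t] by simp
    then have "ratio * (CA * exp (- gA * t)) \<le> ratio * (CA * 1)"
      using CA_pos by (intro mult_left_mono less_imp_le[OF ratio_pos]) auto
    then have "ratio * (CA * exp (- gA * t)) * ?d z \<le> ratio * CA * ?d z" by (intro mult_right_mono) auto
    moreover have "D * (1 - ?o z) \<le> D * (CB * ?d z)" by (intro mult_left_mono overlap_defect) simp
    moreover have "(ratio * CA + CB * D) * ?d z \<le> C0 * ?d z"
      by (intro mult_right_mono one_step_constant_le_C0 CA_ge_one[OF xy]) simp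
    ultimately show "1 * (ratio * (CA * exp (- gA * t)) * ?d z) + D * (1 - ?o z) \<le> C0 * ?d z"
      by (simp add: algebra_simps)
  qed (use int_o int_d in auto)
  finally show thesis using \<pi>' by (intro that[of \<pi>']) simp_all
qed

definition truncated :: "'e \<times> 'e \<Rightarrow> real" where "truncated z = min 1 (\<kappa> * dist (fst z) (snd z))"

lemma truncated_borel: "truncated \<in> borel_measurable borel"
  unfolding truncated_def[abs_def] using borel_dist by measurable

lemma truncated_range: "0 \<le> truncated z" "truncated z \<le> 1" "truncated z \<le> \<kappa> * dist (fst z) (snd z)"
  using kappa_pos by (auto simp: truncated_def)

lemma t0_facts:
  assumes xy: "x \<noteq> (y :: 'e)"
  shows "t0 \<in> I" "0 < t0" "ratio * (CA * exp (- gA * t0)) \<le> 1 / 2"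
    "\<kappa> * (ratio * (CA * exp (- gA * t0))) * D \<le> 1 / (2 * CC)"
proof -
  let ?c1 = "1 / (2 * (1 + CB * D))" and ?c2 = "1 / (2 * \<kappa> * (1 + CB * D) * D * CC)"
  have r: "0 < 1 + CB * D" using ratio_pos by (simp add: ratio_def)
  have c: "0 < ?c1" "0 < ?c2" using r kappa_pos D_pos[OF xy] CC_gt by simp_all
  note f1 = first_time_below_decay[OF CA_pos gA_pos c(1)] and f2 = first_time_below_decay[OF CA_pos gA_pos c(2)]
  show t0: "t0 \<in> I" unfolding const_t0_def using f1(1) f2(1) by simp
  have "decay CA gA t0 \<le> ?c1" by (rule f1(2)[OF t0]) (simp add: const_t0_def)
  then have d1: "ratio * decay CA gA t0 \<le> 1 / 2"
    using r by (simp add: ratio_def field_simps)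
  then show "ratio * (CA * exp (- gA * t0)) \<le> 1 / 2" by (simp add: decay_def)
  have "decay CA gA t0 \<le> ?c2" by (rule f2(2)[OF t0]) (simp add: const_t0_def)
  then have "(\<kappa> * ratio * D) * decay CA gA t0 \<le> (\<kappa> * ratio * D) * ?c2"
    using kappa_pos D_pos[OF xy] less_imp_le[OF ratio_pos] by (intro mult_left_mono) auto
  also have "(\<kappa> * ratio * D) * ?c2 = 1 / (2 * CC)"
  proof -
    define R where "R = 1 + CB * D"
    have "0 < R" using r by (simp add: R_def)
    then show ?thesis
      using kappa_pos D_pos[OF xy] CC_gt unfolding ratio_def R_def[symmetric] by (simp add: divide_simps)
  qed
  finally show "\<kappa> * (ratio * (CA * exp (- gA * t0))) * D \<le> 1 / (2 * CC)"
    by (simp add: decay_def ac_simps)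
  have "t0 \<noteq> 0"
  proof
    assume z: "t0 = 0"
    have "1 * 1 \<le> ratio * CA" by (rule mult_mono) (use ratio_ge_one CA_ge_one[OF xy] in auto)
    then show False using d1 unfolding z by (simp add: decay_def)
  qed
  then show "0 < t0" using time_nonneg[OF t0] by simp
qed

text \<open>Two points with \<open>\<kappa> d \<le> 1\<close> pay \<open>\<kappa> d / 2\<close> for the common part and \<open>CB d = (\<beta> - 1 / 2) \<kappa> d\<close> for the residual
  masses. Other points pay at most \<open>1 / (2 CC)\<close> and \<open>1 - 1 / CC\<close>, in total \<open>\<beta>\<close>. The constants
  \<open>\<kappa>\<close>, \<open>\<beta>\<close> and \<open>t0\<close> are chosen for these two sums.\<close>

lemma contracting_step:
  assumes \<mu>: "prob_on_borel \<mu>" and \<nu>: "prob_on_borel \<nu>" and \<pi>: "\<pi> \<in> couplings \<mu> \<nu>" and xy: "x \<noteq> (y :: 'e)"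
  obtains \<pi>' where "\<pi>' \<in> couplings (law_at X Q \<mu> t0) (law_at X Q \<nu> t0)"
    and "(\<integral>z. truncated z \<partial>\<pi>') \<le> \<beta> * (\<integral>z. truncated z \<partial>\<pi>)"
proof -
  note t0 = t0_facts[OF xy]
  obtain \<pi>' where \<pi>': "\<pi>' \<in> couplings (law_at X Q \<mu> t0) (law_at X Q \<nu> t0)"
    and c: "cost_control t0 \<pi> \<pi>'"
    by (rule coupling_step[OF t0(1) \<mu> \<nu> \<pi>])
  let ?d = "\<lambda>z :: 'e \<times> 'e. dist (fst z) (snd z)" and ?o = "\<lambda>z :: 'e \<times> 'e. overlap_bound (fst z) (snd z)"
  let ?g = "ratio * (CA * exp (- gA * t0))"
  have int_o: "integrable \<pi> ?o"
    by (rule coupling_integrable[OF \<pi> \<mu> overlap_bound_borel, where b = 1]) (use overlap_bound_range in \<open>auto simp: abs_of_nonneg\<close>)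
  have int_d: "integrable \<pi> ?d"
    by (rule coupling_integrable[OF \<pi> \<mu> borel_dist, where b = D]) (use dist_le in auto)
  have int_t: "integrable \<pi> truncated"
    by (rule coupling_integrable[OF \<pi> \<mu> truncated_borel, where b = 1]) (use truncated_range in \<open>auto simp: abs_of_nonneg\<close>)
  interpret prob_space \<pi> by (rule coupling_prob[OF \<pi> \<mu>])
  have "(\<integral>z. truncated z \<partial>\<pi>') \<le> (\<integral>z. \<kappa> * (?g * ?d z) + 1 * (1 - ?o z) \<partial>\<pi>)"
    by (rule c[unfolded cost_control_def, rule_format, OF truncated_borel]) (use truncated_range kappa_pos in auto)
  also have "\<dots> \<le> (\<integral>z. \<beta> * truncated z \<partial>\<pi>)"
  proof (rule integral_mono)
    fix z :: "'e \<times> 'e"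
    have k0: "0 \<le> \<kappa> * ?d z" using kappa_pos by simp
    show "\<kappa> * (?g * ?d z) + 1 * (1 - ?o z) \<le> \<beta> * truncated z"
    proof (cases "\<kappa> * ?d z \<le> 1")
      case True
      have "?g * (\<kappa> * ?d z) \<le> 1 / 2 * (\<kappa> * ?d z)" by (rule mult_right_mono[OF t0(3) k0])
      moreover have "1 - ?o z \<le> (\<kappa> * (\<beta> - 1 / 2)) * ?d z" unfolding kappa_eq by (rule overlap_defect)
      ultimately show ?thesis using True by (simp add: truncated_def min_absorb2 algebra_simps)
    next
      case False
      have "0 \<le> \<kappa> * ?g" using kappa_pos less_imp_le[OF ratio_pos] CA_pos by simp
      then have "\<kappa> * ?g * ?d z \<le> \<kappa> * ?g * D" by (intro mult_left_mono dist_le)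
      also note t0(4)
      finally have "\<kappa> * ?g * ?d z + (1 - ?o z) \<le> 1 / (2 * CC) + (1 - 1 / CC)"
        using overlap_defect(2)[of "fst z" "snd z"] by linarith
      also have "\<dots> = \<beta>" using CC_gt by (simp add: const_beta_def field_simps)
      finally show ?thesis using False by (simp add: truncated_def mult.assoc)
    qed
  qed (use int_o int_d int_t in auto)
  finally show thesis using \<pi>' by (intro that[of \<pi>']) simp_all
qed

lemma contracting_steps:
  assumes \<mu>: "prob_on_borel \<mu>" and \<nu>: "prob_on_borel \<nu>" and \<pi>: "\<pi> \<in> couplings \<mu> \<nu>" and xy: "x \<noteq> (y :: 'e)"
  shows "\<exists>\<pi>'\<in>couplings (law_at X Q \<mu> (real n * t0)) (law_at X Q \<nu> (real n * t0)).
    (\<integral>z. truncated z \<partial>\<pi>') \<le> \<beta> ^ n * (\<integral>z. truncated z \<partial>\<pi>)"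
proof (induction n)
  case 0
  show ?case using \<pi> by (auto simp: law_at_zero[OF \<mu>] law_at_zero[OF \<nu>])
next
  case (Suc n)
  note t0 = t0_facts(1)[OF xy]
  have nt: "real n * t0 \<in> I" using t0 by simp
  obtain \<pi>1 where \<pi>1: "\<pi>1 \<in> couplings (law_at X Q \<mu> (real n * t0)) (law_at X Q \<nu> (real n * t0))"
      "(\<integral>z. truncated z \<partial>\<pi>1) \<le> \<beta> ^ n * (\<integral>z. truncated z \<partial>\<pi>)" using Suc.IH by blast
  obtain \<pi>' where \<pi>': "\<pi>' \<in> couplings (law_at X Q (law_at X Q \<mu> (real n * t0)) t0) (law_at X Q (law_at X Q \<nu> (real n * t0)) t0)"
      "(\<integral>z. truncated z \<partial>\<pi>') \<le> \<beta> * (\<integral>z. truncated z \<partial>\<pi>1)"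
    by (rule contracting_step[OF law_at_prob[OF \<mu> nt] law_at_prob[OF \<nu> nt] \<pi>1(1) xy])
  have "\<beta> * (\<integral>z. truncated z \<partial>\<pi>1) \<le> \<beta> * (\<beta> ^ n * (\<integral>z. truncated z \<partial>\<pi>))"
    using \<pi>1(2) beta_range by (intro mult_left_mono) auto
  then have "(\<integral>z. truncated z \<partial>\<pi>') \<le> \<beta> ^ Suc n * (\<integral>z. truncated z \<partial>\<pi>)" using \<pi>'(2) by simp
  moreover have "real n * t0 + t0 = real (Suc n) * t0" by (simp add: algebra_simps)
  ultimately show ?case
    using \<pi>'(1) unfolding law_at_add[OF \<mu> nt t0] law_at_add[OF \<nu> nt t0] by auto
qed

lemma dist_le_truncated:
  assumes xy: "x \<noteq> (y :: 'e)"
  shows "\<kappa> * dist (fst z) (snd z) \<le> max 1 (\<kappa> * D) * truncated (z :: 'e \<times> 'e)"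
proof (cases "\<kappa> * dist (fst z) (snd z) \<le> 1")
  case True
  then have "truncated z = \<kappa> * dist (fst z) (snd z)" by (simp add: truncated_def)
  then show ?thesis using mult_right_mono[of 1 "max 1 (\<kappa> * D)", OF _ truncated_range(1)[of z]] by simp
next
  case False
  then have "truncated z = 1" by (simp add: truncated_def)
  moreover have "\<kappa> * dist (fst z) (snd z) \<le> \<kappa> * D" using kappa_pos dist_le by (intro mult_left_mono) auto
  ultimately show ?thesis by simp
qed

text \<open>If \<open>E\<close> is a single point all distances vanish. Otherwise a time \<open>t = r + n t0\<close> is spent in one step that
  is merely bounded and in \<open>n\<close> contracting steps for the truncated distance.\<close>

lemma wasserstein_contraction:
  assumes t: "t \<in> I" and \<mu>: "prob_on_borel \<mu>" and \<nu>: "prob_on_borel \<nu>" and \<pi>: "\<pi> \<in> couplings \<mu> \<nu>"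
  shows "\<exists>\<pi>'\<in>couplings (law_at X Q \<mu> t) (law_at X Q \<nu> t).
    (\<integral>z. dist (fst z) (snd z) \<partial>\<pi>') \<le> rate * exp (- \<alpha> * t) * (\<integral>z. dist (fst z) (snd z) \<partial>\<pi>)"
proof (cases "\<exists>x y :: 'e. x \<noteq> y")
  case False
  then have zero: "(\<lambda>z :: 'e \<times> 'e. dist (fst z) (snd z)) = (\<lambda>_. 0)" by (intro ext) simp
  obtain \<pi>' where "\<pi>' \<in> couplings (law_at X Q \<mu> t) (law_at X Q \<nu> t)"
    by (rule coupling_step[OF t \<mu> \<nu> \<pi>]) (rule that)
  then show ?thesis unfolding zero by (intro bexI[of _ \<pi>']) simp_all
next
  case True
  then obtain x y :: 'e where xy: "x \<noteq> y" by blast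
  note t0 = t0_facts[OF xy]
  define n where "n = nat \<lfloor>t / t0\<rfloor>"
  define r where "r = t - real n * t0"
  have tt: "0 \<le> t / t0" using time_nonneg[OF t] t0 by simp
  have "real n \<le> t / t0" unfolding n_def using tt by simp
  then have n1: "real n * t0 \<le> t" using t0 by (simp add: le_divide_eq)
  have "t / t0 < real n + 1" unfolding n_def using tt by linarith
  then have n2: "t - t0 < real n * t0" using t0 by (simp add: divide_less_eq algebra_simps)
  have nI: "real n * t0 \<in> I" using t0 by simp
  have rI: "r \<in> I" unfolding r_def using nI t n1 by simp
  obtain \<pi>1 where \<pi>1: "\<pi>1 \<in> couplings (law_at X Q \<mu> r) (law_at X Q \<nu> r)"
      "(\<integral>z. dist (fst z) (snd z) \<partial>\<pi>1) \<le> C0 * (\<integral>z. dist (fst z) (snd z) \<partial>\<pi>)"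
    by (rule bounded_step[OF rI \<mu> \<nu> \<pi> xy])
  note \<mu>r = law_at_prob[OF \<mu> rI] and \<nu>r = law_at_prob[OF \<nu> rI]
  obtain \<pi>2 where \<pi>2: "\<pi>2 \<in> couplings (law_at X Q (law_at X Q \<mu> r) (real n * t0)) (law_at X Q (law_at X Q \<nu> r) (real n * t0))"
      "(\<integral>z. truncated z \<partial>\<pi>2) \<le> \<beta> ^ n * (\<integral>z. truncated z \<partial>\<pi>1)"
    using contracting_steps[OF \<mu>r \<nu>r \<pi>1(1) xy, of n] by blast
  have sum: "r + real n * t0 = t" by (simp add: r_def)
  have \<pi>2c: "\<pi>2 \<in> couplings (law_at X Q \<mu> t) (law_at X Q \<nu> t)"
    using \<pi>2(1) unfolding law_at_add[OF \<mu> rI nI] law_at_add[OF \<nu> rI nI] sum .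
  let ?d = "\<lambda>z :: 'e \<times> 'e. dist (fst z) (snd z)" and ?m = "max 1 (\<kappa> * D)"
  have int: "integrable \<pi>2 ?d" "integrable \<pi>2 truncated" "integrable \<pi>1 ?d" "integrable \<pi>1 truncated"
    using dist_le truncated_range
    by (auto intro!: coupling_integrable[OF \<pi>2c law_at_prob[OF \<mu> t] borel_dist, where b = D]
        coupling_integrable[OF \<pi>2c law_at_prob[OF \<mu> t] truncated_borel, where b = 1]
        coupling_integrable[OF \<pi>1(1) \<mu>r borel_dist, where b = D]
        coupling_integrable[OF \<pi>1(1) \<mu>r truncated_borel, where b = 1] simp: abs_of_nonneg)
  have m0: "0 \<le> ?m" by simp
  have "\<kappa> * (\<integral>z. ?d z \<partial>\<pi>2) = (\<integral>z. \<kappa> * ?d z \<partial>\<pi>2)" by simp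
  also have "\<dots> \<le> (\<integral>z. ?m * truncated z \<partial>\<pi>2)"
    using int by (intro integral_mono dist_le_truncated[OF xy]) auto
  also have "\<dots> = ?m * (\<integral>z. truncated z \<partial>\<pi>2)" by simp
  also have "\<dots> \<le> ?m * (\<beta> ^ n * (\<integral>z. truncated z \<partial>\<pi>1))" by (rule mult_left_mono[OF \<pi>2(2) m0])
  also have "\<dots> \<le> ?m * (\<beta> ^ n * (\<kappa> * (C0 * (\<integral>z. ?d z \<partial>\<pi>))))"
  proof (intro mult_left_mono m0)
    have "(\<integral>z. truncated z \<partial>\<pi>1) \<le> (\<integral>z. \<kappa> * ?d z \<partial>\<pi>1)"
      using int truncated_range by (intro integral_mono) auto
    also have "\<dots> = \<kappa> * (\<integral>z. ?d z \<partial>\<pi>1)" by simp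
    also have "\<dots> \<le> \<kappa> * (C0 * (\<integral>z. ?d z \<partial>\<pi>))" using \<pi>1(2) kappa_pos by (intro mult_left_mono) auto
    finally show "(\<integral>z. truncated z \<partial>\<pi>1) \<le> \<kappa> * (C0 * (\<integral>z. ?d z \<partial>\<pi>))" .
  qed (use beta_range in simp)
  finally have "\<kappa> * (\<integral>z. ?d z \<partial>\<pi>2) \<le> \<kappa> * (?m * \<beta> ^ n * C0 * (\<integral>z. ?d z \<partial>\<pi>))" by (simp only: ac_simps)
  then have 1: "(\<integral>z. ?d z \<partial>\<pi>2) \<le> \<beta> ^ n * (?m * C0 * (\<integral>z. ?d z \<partial>\<pi>))"
    using kappa_pos by (simp add: ac_simps)
  have "\<beta> ^ n \<le> exp (- \<alpha> * t) / \<beta>"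
  proof -
    have l: "ln \<beta> = - (\<alpha> * t0)" using t0(2) beta_range by (simp add: const_alpha_def ln_div)
    have lneg: "ln \<beta> \<le> 0" using beta_range by simp
    have a0: "0 \<le> \<alpha>" using l lneg t0(2) by (simp add: zero_le_mult_iff)
    have "\<beta> ^ n = exp (real n * ln \<beta>)" using beta_range by (simp add: exp_of_nat_mult)
    also have "real n * ln \<beta> = - \<alpha> * (real n * t0)" by (simp add: l)
    also have "exp (- \<alpha> * (real n * t0)) \<le> exp (- \<alpha> * (t - t0))"
      using a0 n2 by (simp add: mult_left_mono)
    also have "\<dots> = exp (- \<alpha> * t) * exp (\<alpha> * t0)" by (simp add: exp_add[symmetric] algebra_simps)
    also have "exp (\<alpha> * t0) = 1 / \<beta>"
    proof -
      have "exp (\<alpha> * t0) = exp (- ln \<beta>)" by (simp add: l)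
      then show ?thesis by (simp only: exp_minus exp_ln[OF beta_range(3)] inverse_eq_divide)
    qed
    finally show ?thesis by simp
  qed
  then have "\<beta> ^ n * (?m * C0 * (\<integral>z. ?d z \<partial>\<pi>)) \<le> exp (- \<alpha> * t) / \<beta> * (?m * C0 * (\<integral>z. ?d z \<partial>\<pi>))"
    using C0_nonneg by (intro mult_right_mono mult_nonneg_nonneg m0 integral_nonneg_AE) auto
  then have "(\<integral>z. ?d z \<partial>\<pi>2) \<le> rate * exp (- \<alpha> * t) * (\<integral>z. ?d z \<partial>\<pi>)"
    using 1 by (simp add: ac_simps)
  then show ?thesis using \<pi>2c by blast
qed

end

context penalized_coupling_qsd
begin

section \<open>The transition semigroup\<close>

lemma ratio_neq_0 [simp]: "ratio \<noteq> 0"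
  by (rule less_imp_neq[OF ratio_pos, symmetric])

text \<open>The change of measure for signed integrands.\<close>

lemma Q_bochner:
  assumes t: "t \<in> I" and f[measurable]: "f \<in> borel_measurable (F t)"
  shows "(\<integral>\<omega>. f \<omega> \<partial>Q x) = (\<integral>\<omega>. exp (l0 * t) / \<eta> x * (Z X t \<omega> * \<eta> (X t \<omega>)) * f \<omega> \<partial>P x)"
proof -
  let ?k = "\<lambda>\<omega>. exp (l0 * t) / \<eta> x * (Z X t \<omega> * \<eta> (X t \<omega>))"
  have k0: "0 \<le> ?k \<omega>" for \<omega> using t by simp
  have kF[measurable]: "?k \<in> borel_measurable (F t)"
    using Z_F[OF t] measurable_compose[OF X_F[OF t] eta_borel] by measurable
  have kFinf: "?k \<in> borel_measurable Finf" by (rule measurable_F_Finf[OF kF t])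
  have fFinf: "f \<in> borel_measurable Finf" by (rule measurable_F_Finf[OF f t])
  note subP = subalgebra_F[OF sets_P t] and subQ = subalgebra_F[OF sets_Q t]
  have mart_k: "mart t \<omega> = ennreal (\<eta> x) * ennreal (?k \<omega>)" for \<omega>
    using t less_imp_neq[OF eta_gt, of x, symmetric] by (simp add: mart_def ennreal_mult[symmetric])
  have nn: "(\<integral>\<^sup>+\<omega>. ennreal (g \<omega>) \<partial>Q x) = (\<integral>\<^sup>+\<omega>. ennreal (?k \<omega> * g \<omega>) \<partial>P x)"
    if g: "g \<in> borel_measurable (F t)" for g
  proof -
    have gm: "(\<lambda>\<omega>. ennreal (g \<omega>)) \<in> borel_measurable (F t)" using g by measurable
    have "ennreal (\<eta> x) * (\<integral>\<^sup>+\<omega>. ennreal (g \<omega>) \<partial>Q x) = (\<integral>\<^sup>+\<omega>. ennreal (g \<omega>) * mart t \<omega> \<partial>P x)"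
      by (rule nn_integral_Q[OF t gm])
    also have "\<dots> = (\<integral>\<^sup>+\<omega>. ennreal (\<eta> x) * ennreal (?k \<omega> * g \<omega>) \<partial>P x)"
    proof (rule nn_integral_cong)
      fix \<omega>
      have "ennreal (?k \<omega> * g \<omega>) = ennreal (?k \<omega>) * ennreal (g \<omega>)" by (rule ennreal_mult'[OF k0])
      then show "ennreal (g \<omega>) * mart t \<omega> = ennreal (\<eta> x) * ennreal (?k \<omega> * g \<omega>)"
        unfolding mart_k by (simp only: mult.commute mult.left_commute)
    qed
    also have "\<dots> = ennreal (\<eta> x) * (\<integral>\<^sup>+\<omega>. ennreal (?k \<omega> * g \<omega>) \<partial>P x)"
      by (rule nn_integral_cmult) (use kFinf measurable_F_Finf[OF g t] in measurable)
    finally show ?thesis by (simp only: eta_cancel)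
  qed
  let ?i = "\<lambda>\<omega>. ?k \<omega> * f \<omega>"
  have im: "?i \<in> borel_measurable Finf" using kFinf fFinf by measurable
  have eqI: "integrable (Q x) f \<longleftrightarrow> integrable (P x) ?i"
    unfolding integrable_iff_bounded using nn[of "\<lambda>\<omega>. \<bar>f \<omega>\<bar>"] fFinf im t
    by (simp add: abs_mult)
  show ?thesis
  proof (cases "integrable (Q x) f")
    case True
    have iP: "integrable (P x) ?i" using True unfolding eqI .
    have "(\<integral>\<^sup>+\<omega>. ennreal (- f \<omega>) \<partial>Q x) = (\<integral>\<^sup>+\<omega>. ennreal (- ?i \<omega>) \<partial>P x)"
      using nn[of "\<lambda>\<omega>. - f \<omega>"] f by simp
    then show ?thesis
      unfolding real_lebesgue_integral_def[OF True] real_lebesgue_integral_def[OF iP] using nn[OF f] by simp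
  next
    case False
    have nP: "\<not> integrable (P x) ?i" using False unfolding eqI .
    show ?thesis
      by (rule trans[OF not_integrable_integral_eq[OF False] not_integrable_integral_eq[OF nP, symmetric]])
  qed
qed

lemma Q_semigroup:
  assumes t: "t \<in> I" and \<phi>: "bounded_measurable \<phi>"
  shows "(\<integral>\<omega>. \<phi> (X t \<omega>) \<partial>Q x) = exp (l0 * t) / \<eta> x * penal_semigroup I \<rho> X P t (\<lambda>y. \<eta> y * \<phi> y) x"
proof -
  have "(\<lambda>\<omega>. \<phi> (X t \<omega>)) \<in> borel_measurable (F t)"
    using measurable_compose[OF X_F[OF t], of \<phi> borel] \<phi> by (simp add: bounded_measurable_def)
  from Q_bochner[OF t this, of x] show ?thesis
    unfolding penal_semigroup_def integral_mult_right_zero[symmetric] by (simp add: mult.assoc)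
qed

text \<open>Kantorovich duality in the easy direction, applied to the two laws started from points.\<close>

lemma Q_lipschitz:
  assumes t: "t \<in> I" and f: "f \<in> borel_measurable borel" and fb: "\<And>z. \<bar>f z\<bar> \<le> b"
    and lip: "\<And>u v. \<bar>f u - f v\<bar> \<le> L * dist u v" and L: "0 \<le> L"
  shows "\<bar>(\<integral>\<omega>. f (X t \<omega>) \<partial>Q x) - (\<integral>\<omega>. f (X t \<omega>) \<partial>Q y)\<bar> \<le> L * rate * D * exp (- \<alpha> * t)"
proof -
  let ?\<pi> = "return (borel \<Otimes>\<^sub>M borel) (x, y)"
  have pr: "prob_on_borel (return borel z)" for z :: 'e by (simp add: prob_on_borel_def prob_space_return)
  have "?\<pi> \<in> couplings (return borel x) (return borel y)"
    by (simp add: couplings_def distr_return space_pair_measure)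
  from wasserstein_contraction[OF t pr pr this] obtain \<pi>' where
    \<pi>': "\<pi>' \<in> couplings (law_at X Q (return borel x) t) (law_at X Q (return borel y) t)"
    and c: "(\<integral>z. dist (fst z) (snd z) \<partial>\<pi>') \<le> rate * exp (- \<alpha> * t) * (\<integral>z. dist (fst z) (snd z) \<partial>?\<pi>)"
    by blast
  have law: "law_at X Q (return borel z) t = distr (Q z) borel (X t)" for z
    unfolding law_at_def by (subst bind_return[OF kernel_subprob[OF Q_kernel]]) simp_all
  have sp: "sets \<pi>' = sets (borel \<Otimes>\<^sub>M borel)" and f1: "distr \<pi>' borel fst = distr (Q x) borel (X t)"
    and f2: "distr \<pi>' borel snd = distr (Q y) borel (X t)"
    using \<pi>' by (auto simp: couplings_def law)
  have m: "fst \<in> \<pi>' \<rightarrow>\<^sub>M borel" "snd \<in> \<pi>' \<rightarrow>\<^sub>M borel"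
    by (simp_all add: measurable_cong_sets[OF sp refl])
  have Xm: "X t \<in> Q z \<rightarrow>\<^sub>M borel" for z using X_Finf[OF t] by simp
  have e1: "(\<integral>\<omega>. f (X t \<omega>) \<partial>Q x) = (\<integral>z. f (fst z) \<partial>\<pi>')"
    using integral_distr[OF Xm f, of x] integral_distr[OF m(1) f] by (simp add: f1)
  have e2: "(\<integral>\<omega>. f (X t \<omega>) \<partial>Q y) = (\<integral>z. f (snd z) \<partial>\<pi>')"
    using integral_distr[OF Xm f, of y] integral_distr[OF m(2) f] by (simp add: f2)
  note pl = law_at_prob[OF pr t, of x]
  have i: "integrable \<pi>' (\<lambda>z. f (fst z))" "integrable \<pi>' (\<lambda>z. f (snd z))" "integrable \<pi>' (\<lambda>z. dist (fst z) (snd z))"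
    using fb dist_le
    by (auto intro!: coupling_integrable[OF \<pi>' pl, where b = b] coupling_integrable[OF \<pi>' pl borel_dist, where b = D]
        measurable_compose[OF borel_fst f] measurable_compose[OF borel_snd f])
  have "\<bar>(\<integral>\<omega>. f (X t \<omega>) \<partial>Q x) - (\<integral>\<omega>. f (X t \<omega>) \<partial>Q y)\<bar> = \<bar>\<integral>z. f (fst z) - f (snd z) \<partial>\<pi>'\<bar>"
    using i by (simp add: e1 e2)
  also have "\<dots> \<le> (\<integral>z. \<bar>f (fst z) - f (snd z)\<bar> \<partial>\<pi>')" by (rule integral_abs_bound)
  also have "\<dots> \<le> (\<integral>z. L * dist (fst z) (snd z) \<partial>\<pi>')"
    using i by (intro integral_mono lip) auto
  also have "\<dots> = L * (\<integral>z. dist (fst z) (snd z) \<partial>\<pi>')" by simp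
  also have "\<dots> \<le> L * (rate * exp (- \<alpha> * t) * D)"
  proof (rule mult_left_mono[OF _ L])
    have "(\<integral>z. dist (fst z) (snd z) \<partial>?\<pi>) = dist x y"
    proof (subst integral_return)
      show "(\<lambda>z. dist (fst z) (snd z)) \<in> borel_measurable (borel \<Otimes>\<^sub>M borel :: ('e \<times> 'e) measure)"
        unfolding borel_prod by (rule borel_dist)
    qed (simp_all add: space_pair_measure)
    then have "(\<integral>z. dist (fst z) (snd z) \<partial>?\<pi>) \<le> D" using dist_le by simp
    then have "rate * exp (- \<alpha> * t) * (\<integral>z. dist (fst z) (snd z) \<partial>?\<pi>) \<le> rate * exp (- \<alpha> * t) * D"
      using rate_nonneg by (intro mult_left_mono mult_nonneg_nonneg) auto
    with c show "(\<integral>z. dist (fst z) (snd z) \<partial>\<pi>') \<le> rate * exp (- \<alpha> * t) * D" by linarith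
  qed
  finally show ?thesis by (simp only: ac_simps)
qed

section \<open>Convergence of the conditioned laws\<close>

text \<open>Let \<open>h\<close> be the image of \<open>1 / \<eta>\<close> under the semigroup of \<open>Q\<close> at time \<open>u = t - s\<close>. The conditioned
  probability of \<open>A\<close> is the ratio of the integrals of \<open>h (X s)\<close> over \<open>A\<close> and over the whole space under \<open>Q x\<close>, and
  \<open>h\<close> is nearly constant.\<close>

lemma conditioned_law_convergence:
  assumes s: "s \<in> I" and t: "t \<in> I" and st: "s \<le> t" and A: "A \<in> sets (F s)"
  shows "\<bar>(\<integral>\<omega>. indicator A \<omega> * Z X t \<omega> \<partial>P x) / EZ t x - measure (Q x) A\<bar> \<le>
    ratio ^ 2 * (CB * ratio * rate * D) * exp (- \<alpha> * (t - s))"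
proof -
  define u where "u = t - s"
  have u: "u \<in> I" and su: "s + u = t" using s t st by (auto simp: u_def)
  define h where "h y = exp (l0 * u) * EZ u y / \<eta> y" for y
  let ?\<delta> = "CB * ratio * rate * D * exp (- \<alpha> * u)"
  have AM: "A \<in> sets Finf" using A sets_F_Finf[OF s] by auto
  interpret Qx: prob_space "Q x" by simp
  have inv_eta: "(\<lambda>y. 1 / \<eta> y) \<in> borel_measurable borel" using eta_borel by measurable
  have inv_b: "\<bar>1 / \<eta> y\<bar> \<le> ratio" for y
    using eta_ge[of y] eta_gt[of y] ratio_pos by (simp add: divide_simps mult.commute del: eta_pos ratio_pos)
  have inv_lip: "\<bar>1 / \<eta> v - 1 / \<eta> w\<bar> \<le> (CB * ratio) * dist v w" for v w
  proof -
    have "\<bar>1 / \<eta> v - 1 / \<eta> w\<bar> = \<bar>\<eta> v - \<eta> w\<bar> * \<bar>1 / \<eta> w\<bar> / \<eta> v"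
      using eta_gt[of v] eta_gt[of w] less_imp_neq[OF eta_gt, symmetric]
      by (simp add: diff_frac_eq abs_divide abs_mult abs_minus_commute mult.commute)
    also have "\<dots> \<le> (CB * dist v w * \<eta> v) * ratio / \<eta> v"
      using CB_pos by (intro divide_right_mono mult_mono eta_lipschitz inv_b) auto
    also have "\<dots> = (CB * ratio) * dist v w" using less_imp_neq[OF eta_gt, of v, symmetric] by simp
    finally show ?thesis .
  qed
  have h_Q: "h y = (\<integral>\<omega>. 1 / \<eta> (X u \<omega>) \<partial>Q y)" for y
  proof -
    have "bounded_measurable (\<lambda>y. 1 / \<eta> y)"
      using inv_eta inv_b by (auto simp: bounded_measurable_def bounded_iff)
    from Q_semigroup[OF u this, of y] show ?thesis
      using less_imp_neq[OF eta_gt, symmetric] by (simp add: h_def penal_semigroup_def penal_mean_def)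
  qed
  have osc: "\<bar>h v - h w\<bar> \<le> ?\<delta>" for v w
    unfolding h_Q using Q_lipschitz[OF u inv_eta inv_b inv_lip, of v w] CB_pos less_imp_le[OF ratio_pos] by simp
  have h_borel: "h \<in> borel_measurable borel"
    unfolding h_def[abs_def] using EZ_measurable[OF u] eta_borel by measurable
  have h_le: "\<bar>h y\<bar> \<le> ratio * ratio" for y
  proof -
    have "\<bar>h y\<bar> = exp (l0 * u) * EZ u y * \<bar>1 / \<eta> y\<bar>" using u by (simp add: h_def abs_mult abs_divide)
    also have "\<dots> \<le> ratio * ratio"
      using EZ_scaled_bounds(2)[OF u, of y] u less_imp_le[OF ratio_pos] by (intro mult_mono inv_b) auto
    finally show ?thesis .
  qed
  have hX: "(\<lambda>\<omega>. h (X s \<omega>)) \<in> borel_measurable (F s)" by (rule measurable_compose[OF X_F[OF s] h_borel])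
  have hXM: "(\<lambda>\<omega>. h (X s \<omega>)) \<in> borel_measurable Finf" by (rule measurable_F_Finf[OF hX s])
  have num: "exp (l0 * t) / \<eta> x * (\<integral>\<omega>. indicator B \<omega> * Z X t \<omega> \<partial>P x) = (\<integral>\<omega>. indicator B \<omega> * h (X s \<omega>) \<partial>Q x)"
    if B: "B \<in> sets (F s)" for B
  proof -
    have BM: "B \<in> sets Finf" using B sets_F_Finf[OF s] by auto
    have "(\<lambda>\<omega>. indicator B \<omega> * h (X s \<omega>)) \<in> borel_measurable (F s)" using B hX by measurable
    have ex: "exp (l0 * t) = exp (l0 * s) * exp (l0 * u)"
      unfolding su[symmetric] distrib_left by (rule exp_add)
    have swap: "e1 / n * (z * k) * (i * (e2 * w / k)) = e1 * e2 / n * (i * (z * w))" if "k \<noteq> 0"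
      for e1 e2 n z k i w :: real using that by simp
    from Q_bochner[OF s \<open>(\<lambda>\<omega>. indicator B \<omega> * h (X s \<omega>)) \<in> borel_measurable (F s)\<close>, of x]
    have "(\<integral>\<omega>. indicator B \<omega> * h (X s \<omega>) \<partial>Q x) =
        (\<integral>\<omega>. exp (l0 * t) / \<eta> x * (indicator B \<omega> * (Z X s \<omega> * EZ u (X s \<omega>))) \<partial>P x)"
      unfolding h_def swap[OF less_imp_neq[OF eta_gt, symmetric]] ex .
    also have "\<dots> = exp (l0 * t) / \<eta> x * (\<integral>\<omega>. indicator B \<omega> * (Z X s \<omega> * EZ u (X s \<omega>)) \<partial>P x)"
      by (rule integral_mult_right_zero)
    also have "(\<integral>\<omega>. indicator B \<omega> * (Z X s \<omega> * EZ u (X s \<omega>)) \<partial>P x) = (\<integral>\<omega>. indicator B \<omega> * Z X t \<omega> \<partial>P x)"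
    proof -
      have m: "(\<lambda>\<omega>. indicator B \<omega> * (Z X s \<omega> * EZ u (X s \<omega>))) \<in> borel_measurable (P x)"
        "(\<lambda>\<omega>. indicator B \<omega> * Z X t \<omega>) \<in> borel_measurable (P x)"
        using BM Z_Finf[OF s] Z_Finf[OF t] measurable_compose[OF X_Finf[OF s] EZ_measurable[OF u]] by measurable
      have e: "ennreal (indicator B \<omega> * a) = indicator B \<omega> * ennreal a" for \<omega> a
        by (simp add: indicator_def)
      show ?thesis
        using EZ_markov[OF s u B, of x] s t u m
        by (simp add: integral_eq_nn_integral e su ennreal_mult)
    qed
    finally show ?thesis ..
  qed
  define H where "H = exp (l0 * t) * EZ t x / \<eta> x"
  have i_h: "integrable (Q x) (\<lambda>\<omega>. h (X s \<omega>))"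
    using h_le hXM by (intro Qx.integrable_const_bound[where B = "ratio * ratio"]) auto
  have i_Ah: "integrable (Q x) (\<lambda>\<omega>. indicator A \<omega> * h (X s \<omega>))"
    using integrable_mult_indicator[OF _ i_h, of A] AM by simp
  have i_A: "integrable (Q x) (\<lambda>\<omega>. indicator A \<omega> :: real)"
    using AM Qx.emeasure_finite[of A] by (intro integrable_real_indicator) (auto simp: less_top[symmetric])
  have H_int: "H = (\<integral>\<omega>. h (X s \<omega>) \<partial>Q x)"
  proof -
    have "\<Omega> \<in> sets (F s)" using sets.top[of "F s"] s by simp
    from num[OF this] have "exp (l0 * t) / \<eta> x * (\<integral>\<omega>. indicator \<Omega> \<omega> * Z X t \<omega> \<partial>P x) = (\<integral>\<omega>. indicator \<Omega> \<omega> * h (X s \<omega>) \<partial>Q x)" .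
    moreover have "(\<integral>\<omega>. indicator \<Omega> \<omega> * Z X t \<omega> \<partial>P x) = EZ t x"
      unfolding penal_mean_def by (rule Bochner_Integration.integral_cong) simp_all
    moreover have "(\<integral>\<omega>. indicator \<Omega> \<omega> * h (X s \<omega>) \<partial>Q x) = (\<integral>\<omega>. h (X s \<omega>) \<partial>Q x)"
      by (rule Bochner_Integration.integral_cong) simp_all
    ultimately show ?thesis by (simp add: H_def)
  qed
  have H_lower: "1 / ratio ^ 2 \<le> H"
  proof -
    have "1 / ratio ^ 2 = (1 / ratio) * (1 / ratio)" by (simp add: power2_eq_square)
    also have "\<dots> \<le> (exp (l0 * t) * EZ t x) * (1 / \<eta> x)"
      using EZ_scaled_bounds(1)[OF t, of x] eta_le[of x] eta_gt[of x] less_imp_le[OF ratio_pos] t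
      by (intro mult_mono frac_le) auto
    finally show ?thesis by (simp add: H_def)
  qed
  then have H0: "0 < H" using ratio_pos by (intro less_le_trans[of 0 "1 / ratio ^ 2" H]) simp_all
  have close: "\<bar>h (X s \<omega>) - H\<bar> \<le> ?\<delta>" for \<omega>
  proof -
    have "h (X s \<omega>) - H = (\<integral>\<omega>'. h (X s \<omega>) - h (X s \<omega>') \<partial>Q x)"
      using i_h Qx.prob_space by (simp add: H_int)
    also have "\<bar>\<dots>\<bar> \<le> (\<integral>\<omega>'. \<bar>h (X s \<omega>) - h (X s \<omega>')\<bar> \<partial>Q x)" by (rule integral_abs_bound)
    also have "\<dots> \<le> (\<integral>\<omega>'. ?\<delta> \<partial>Q x)"
      using i_h by (intro integral_mono osc) auto
    also have "\<dots> = ?\<delta>" using Qx.prob_space by simp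
    finally show ?thesis .
  qed
  have "(\<integral>\<omega>. indicator A \<omega> * Z X t \<omega> \<partial>P x) / EZ t x = (\<integral>\<omega>. indicator A \<omega> * h (X s \<omega>) \<partial>Q x) / H"
    unfolding num[OF A, symmetric] H_def using EZ_pos[OF t, of x] less_imp_neq[OF eta_gt, of x, symmetric]
    by simp
  moreover have "measure (Q x) A = (\<integral>\<omega>. indicator A \<omega> * H \<partial>Q x) / H"
  proof -
    have "A \<inter> \<Omega> = A" using sets.sets_into_space[OF A] s by auto
    then show ?thesis using H0 AM by simp
  qed
  ultimately have "(\<integral>\<omega>. indicator A \<omega> * Z X t \<omega> \<partial>P x) / EZ t x - measure (Q x) A =
      (\<integral>\<omega>. indicator A \<omega> * (h (X s \<omega>) - H) \<partial>Q x) / H"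
    using i_Ah i_A by (simp add: right_diff_distrib diff_divide_distrib)
  also have "\<bar>\<dots>\<bar> \<le> ?\<delta> / (1 / ratio ^ 2)"
  proof -
    have "\<bar>\<integral>\<omega>. indicator A \<omega> * (h (X s \<omega>) - H) \<partial>Q x\<bar> \<le> (\<integral>\<omega>. \<bar>indicator A \<omega> * (h (X s \<omega>) - H)\<bar> \<partial>Q x)"
      by (rule integral_abs_bound)
    also have "\<dots> \<le> (\<integral>\<omega>. ?\<delta> \<partial>Q x)"
    proof (rule integral_mono)
      show "integrable (Q x) (\<lambda>\<omega>. \<bar>indicator A \<omega> * (h (X s \<omega>) - H)\<bar>)"
        using i_Ah i_A by (intro integrable_abs) (simp add: right_diff_distrib)
      show "\<bar>indicator A \<omega> * (h (X s \<omega>) - H)\<bar> \<le> ?\<delta>" for \<omega>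
        using close[of \<omega>] by (auto simp: indicator_def)
    qed simp
    also have "\<dots> = ?\<delta>" using Qx.prob_space by simp
    finally have "\<bar>\<integral>\<omega>. indicator A \<omega> * (h (X s \<omega>) - H) \<partial>Q x\<bar> \<le> ?\<delta>" .
    moreover have "0 < 1 / ratio ^ 2" using ratio_pos by simp
    ultimately have "\<bar>\<integral>\<omega>. indicator A \<omega> * (h (X s \<omega>) - H) \<partial>Q x\<bar> / H \<le> ?\<delta> / (1 / ratio ^ 2)"
      using H_lower by (intro frac_le) auto
    then show ?thesis using H0 by (simp add: abs_divide)
  qed
  finally show ?thesis by (simp add: u_def ac_simps)
qed

section \<open>The invariant distribution\<close>

definition \<nu>Q :: "'e measure" where "\<nu>Q = density \<nu>QS (\<lambda>x. ennreal (\<eta> x))"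

lemma nuQ_prob: "prob_on_borel \<nu>Q"
proof -
  have "(\<integral>\<^sup>+x. ennreal (\<eta> x) \<partial>\<nu>QS) = ennreal (\<integral>x. \<eta> x \<partial>\<nu>QS)"
    by (intro nn_integral_eq_integral nu_integrable[where b = ratio] eta_borel) (auto simp: eta_le)
  then have "emeasure \<nu>Q UNIV = 1"
    unfolding \<nu>Q_def using eta_borel by (simp add: emeasure_density nu_eta)
  then show ?thesis unfolding prob_on_borel_def by (auto intro!: prob_spaceI simp: \<nu>Q_def)
qed

text \<open>The density \<open>\<eta>\<close> cancels the normalization of \<open>Q\<close>, which leaves the absorption rate of the quasi-stationary
  distribution.\<close>

lemma nuQ_invariant: "invariant_distribution I X Q \<nu>Q"
proof -
  have "law_at X Q \<nu>Q t = \<nu>Q" if t: "t \<in> I" for t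
  proof (rule law_at_eqI[OF _ nuQ_prob t, symmetric])
    show "sets \<nu>Q = sets borel" by (simp add: \<nu>Q_def)
    fix B :: "'e set" assume B[measurable]: "B \<in> sets borel"
    let ?f = "\<lambda>y. \<eta> y * indicator B y"
    have fm: "?f \<in> borel_measurable borel" using eta_borel B by measurable
    have f_le: "\<bar>?f y\<bar> \<le> ratio" for y using eta_le[of y] less_imp_le[OF ratio_pos] by (auto simp: indicator_def)
    have fbm: "bounded_measurable ?f" using fm f_le by (auto simp: bounded_measurable_def bounded_iff)
    have Zf: "(\<lambda>\<omega>. Z X t \<omega> * ?f (X t \<omega>)) \<in> borel_measurable Finf"
      using Z_Finf[OF t] measurable_compose[OF X_Finf[OF t] fm] by measurable
    have Zf_le: "\<bar>Z X t \<omega> * ?f (X t \<omega>)\<bar> \<le> ratio" for \<omega>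
    proof -
      have "\<bar>Z X t \<omega>\<bar> * \<bar>?f (X t \<omega>)\<bar> \<le> 1 * ratio" using t by (intro mult_mono f_le) auto
      then show ?thesis by (simp add: abs_mult)
    qed
    have Pf: "(\<integral>\<^sup>+\<omega>. ennreal (Z X t \<omega> * ?f (X t \<omega>)) \<partial>P x) = ennreal (penal_semigroup I \<rho> X P t ?f x)" for x
      unfolding penal_semigroup_def using t
      by (intro nn_integral_eq_integral P_integrable[OF Zf Zf_le]) (auto intro!: AE_I2)
    have Pf0: "0 \<le> penal_semigroup I \<rho> X P t ?f x" for x
      unfolding penal_semigroup_def using t by (intro integral_nonneg_AE) (auto intro!: AE_I2)
    have Pfm: "penal_semigroup I \<rho> X P t ?f \<in> borel_measurable borel"
    proof -
      have "(\<lambda>x. enn2real (\<integral>\<^sup>+\<omega>. ennreal (Z X t \<omega> * ?f (X t \<omega>)) \<partial>P x)) \<in> borel_measurable borel"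
        by (intro borel_measurable_enn2real kernel_nn_integral_measurable[OF P_kernel] measurable_compose[OF Zf measurable_ennreal])
      then show ?thesis unfolding Pf using Pf0 by simp
    qed
    have Pf_le: "\<bar>penal_semigroup I \<rho> X P t ?f x\<bar> \<le> ratio" for x
    proof -
      interpret prob_space "P x" by simp
      have "penal_semigroup I \<rho> X P t ?f x \<le> (\<integral>\<omega>. ratio \<partial>P x)"
        unfolding penal_semigroup_def
        by (intro integral_mono P_integrable[OF Zf Zf_le] order.trans[OF abs_ge_self Zf_le]) simp
      then show ?thesis using Pf0[of x] prob_space by simp
    qed
    have one: "ennreal (\<eta> x) * (\<integral>\<^sup>+\<omega>. indicator B (X t \<omega>) \<partial>Q x) = ennreal (exp (l0 * t)) * ennreal (penal_semigroup I \<rho> X P t ?f x)" for x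
    proof -
      have "(\<lambda>\<omega>. indicator B (X t \<omega>) :: ennreal) \<in> borel_measurable (F t)"
        by (rule measurable_compose[OF X_F[OF t] borel_measurable_indicator[OF B]])
      have "ennreal (\<eta> x) * (\<integral>\<^sup>+\<omega>. indicator B (X t \<omega>) \<partial>Q x) =
          (\<integral>\<^sup>+\<omega>. indicator B (X t \<omega>) * mart t \<omega> \<partial>P x)"
        by (rule nn_integral_Q[OF t \<open>(\<lambda>\<omega>. indicator B (X t \<omega>) :: ennreal) \<in> borel_measurable (F t)\<close>])
      also have "(\<lambda>\<omega>. indicator B (X t \<omega>) * mart t \<omega>) =
          (\<lambda>\<omega>. ennreal (exp (l0 * t)) * ennreal (Z X t \<omega> * ?f (X t \<omega>)))"
      proof
        fix \<omega>
        show "indicator B (X t \<omega>) * mart t \<omega> = ennreal (exp (l0 * t)) * ennreal (Z X t \<omega> * ?f (X t \<omega>))"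
        proof (cases "X t \<omega> \<in> B")
          case True
          then show ?thesis using t by (simp add: mart_def ennreal_mult mult.assoc)
        qed simp
      qed
      also have "(\<integral>\<^sup>+\<omega>. ennreal (exp (l0 * t)) * ennreal (Z X t \<omega> * ?f (X t \<omega>)) \<partial>P x) = ennreal (exp (l0 * t)) * (\<integral>\<^sup>+\<omega>. ennreal (Z X t \<omega> * ?f (X t \<omega>)) \<partial>P x)"
        by (rule nn_integral_cmult) (use measurable_compose[OF Zf measurable_ennreal] in simp)
      finally show ?thesis by (simp only: Pf)
    qed
    have "(\<integral>\<^sup>+x. (\<integral>\<^sup>+\<omega>. indicator B (X t \<omega>) \<partial>Q x) \<partial>\<nu>Q) = (\<integral>\<^sup>+x. ennreal (\<eta> x) * (\<integral>\<^sup>+\<omega>. indicator B (X t \<omega>) \<partial>Q x) \<partial>\<nu>QS)"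
      unfolding \<nu>Q_def using eta_borel Q_fun_measurable[OF t, of "indicator B"] B by (subst nn_integral_density) auto
    also have "\<dots> = ennreal (exp (l0 * t)) * (\<integral>\<^sup>+x. ennreal (penal_semigroup I \<rho> X P t ?f x) \<partial>\<nu>QS)"
      unfolding one by (rule nn_integral_cmult) (use measurable_compose[OF Pfm measurable_ennreal] in simp)
    also have "(\<integral>\<^sup>+x. ennreal (penal_semigroup I \<rho> X P t ?f x) \<partial>\<nu>QS) = ennreal (\<integral>x. penal_semigroup I \<rho> X P t ?f x \<partial>\<nu>QS)"
      using Pf0 by (intro nn_integral_eq_integral nu_integrable[OF Pfm Pf_le]) auto
    also have "\<dots> = ennreal (exp (- l0 * t) * (\<integral>x. ?f x \<partial>\<nu>QS))" by (simp only: nu_absorption[OF t fbm])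
    also have "ennreal (exp (l0 * t)) * \<dots> = ennreal (\<integral>x. ?f x \<partial>\<nu>QS)"
      by (subst ennreal_mult'[symmetric]) (simp_all add: mult.assoc[symmetric] exp_add[symmetric])
    also have "\<dots> = (\<integral>\<^sup>+x. ennreal (?f x) \<partial>\<nu>QS)"
      by (intro nn_integral_eq_integral[symmetric] nu_integrable[OF fm f_le]) auto
    also have "\<dots> = emeasure \<nu>Q B"
      unfolding \<nu>Q_def using eta_borel B
      by (subst emeasure_density) (auto intro!: nn_integral_cong simp: indicator_def)
    finally show "emeasure \<nu>Q B = (\<integral>\<^sup>+x. (\<integral>\<^sup>+\<omega>. indicator B (X t \<omega>) \<partial>Q x) \<partial>\<nu>Q)" ..
  qed
  then show ?thesis using nuQ_prob by (simp add: invariant_distribution_def)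
qed

text \<open>The integral of a bounded Lipschitz function under an invariant distribution does not depend on
  that distribution, because the oscillation of its image under the semigroup tends to zero.\<close>

lemma invariant_lipschitz_eq:
  assumes \<mu>: "invariant_distribution I X Q \<mu>" and \<nu>: "invariant_distribution I X Q \<nu>" and xy: "x \<noteq> (y :: 'e)"
    and f: "f \<in> borel_measurable borel" and fb: "\<And>z. \<bar>f z\<bar> \<le> b"
    and lip: "\<And>u v. \<bar>f u - f v\<bar> \<le> L * dist u v" and L: "0 \<le> L"
  shows "(\<integral>z. f z \<partial>\<mu>) = (\<integral>z. f z \<partial>\<nu>)"
proof -
  have near: "\<bar>(\<integral>z. f z \<partial>\<mu>) - (\<integral>\<omega>. f (X t \<omega>) \<partial>Q x)\<bar> \<le> L * rate * D * exp (- \<alpha> * t)"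
    if \<mu>: "invariant_distribution I X Q \<mu>" and t: "t \<in> I" for \<mu> t
  proof -
    have pb: "prob_on_borel \<mu>" and inv: "law_at X Q \<mu> t = \<mu>" using \<mu> t by (auto simp: invariant_distribution_def)
    interpret prob_space \<mu> using pb by (simp add: prob_on_borel_def)
    have s\<mu>: "sets \<mu> = sets borel" using pb by (simp add: prob_on_borel_def)
    have nn: "(\<integral>\<^sup>+z. ennreal (f z + b) \<partial>\<mu>) = (\<integral>\<^sup>+z. (\<integral>\<^sup>+\<omega>. ennreal (f (X t \<omega>) + b) \<partial>Q z) \<partial>\<mu>)"
      using nn_integral_law_at[OF pb t, of "\<lambda>z. ennreal (f z + b)"] f unfolding inv by simp
    have f0: "0 \<le> f z + b" and fb2: "\<bar>f z + b\<bar> \<le> 2 * b" for z using fb[of z] by auto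
    have fX: "(\<lambda>\<omega>. f (X t \<omega>)) \<in> borel_measurable Finf" by (rule measurable_compose[OF X_Finf[OF t] f])
    have iQ: "integrable (Q z) (\<lambda>\<omega>. f (X t \<omega>))" for z
      using fb fX prob_space.finite_measure[OF prob_Q, of z]
      by (intro finite_measure.integrable_const_bound[where B = b]) auto
    have inner: "(\<integral>\<^sup>+\<omega>. ennreal (f (X t \<omega>) + b) \<partial>Q z) = ennreal ((\<integral>\<omega>. f (X t \<omega>) \<partial>Q z) + b)" for z
    proof -
      interpret Qz: prob_space "Q z" by simp
      have "(\<integral>\<^sup>+\<omega>. ennreal (f (X t \<omega>) + b) \<partial>Q z) = ennreal (\<integral>\<omega>. f (X t \<omega>) + b \<partial>Q z)"
        using f0 iQ by (intro nn_integral_eq_integral) auto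
      then show ?thesis using iQ Qz.prob_space by simp
    qed
    let ?g = "\<lambda>z. \<integral>\<omega>. f (X t \<omega>) \<partial>Q z"
    have g0: "0 \<le> ?g z + b" for z
    proof -
      interpret Qz: prob_space "Q z" by simp
      have "0 \<le> (\<integral>\<omega>. f (X t \<omega>) + b \<partial>Q z)" using f0 by (intro integral_nonneg_AE) auto
      then show ?thesis using iQ Qz.prob_space by simp
    qed
    have gm: "(\<lambda>z. ?g z + b) \<in> borel_measurable borel"
    proof -
      have fbm: "(\<lambda>z. ennreal (f z + b)) \<in> borel_measurable borel"
        by (intro measurable_compose[OF _ measurable_ennreal] borel_measurable_add f borel_measurable_const)
      have "(\<lambda>z. enn2real (\<integral>\<^sup>+\<omega>. ennreal (f (X t \<omega>) + b) \<partial>Q z)) \<in> borel_measurable borel"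
        by (intro borel_measurable_enn2real Q_fun_measurable[OF t fbm])
      then show ?thesis unfolding inner using g0 by simp
    qed
    have gb: "\<bar>?g z - ?g x\<bar> \<le> L * rate * D * exp (- \<alpha> * t)" for z
      by (rule Q_lipschitz[OF t f fb lip L])
    have gm': "(\<lambda>z. ?g z + b) \<in> borel_measurable \<mu>" using gm by (simp add: measurable_cong_sets[OF s\<mu> refl])
    have ig: "integrable \<mu> (\<lambda>z. ?g z + b)"
    proof (rule integrable_const_bound[where B = "\<bar>?g x + b\<bar> + L * rate * D * exp (- \<alpha> * t)"])
      have "norm (?g z + b) \<le> \<bar>?g x + b\<bar> + L * rate * D * exp (- \<alpha> * t)" for z using gb[of z] by simp
      then show "AE z in \<mu>. norm (?g z + b) \<le> \<bar>?g x + b\<bar> + L * rate * D * exp (- \<alpha> * t)" by simp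
    qed (rule gm')
    have if_: "integrable \<mu> (\<lambda>z. f z + b)"
      using fb2 f by (intro integrable_const_bound[where B = "2 * b"]) (auto simp: measurable_cong_sets[OF s\<mu> refl])
    have "ennreal (\<integral>z. f z + b \<partial>\<mu>) = ennreal (\<integral>z. ?g z + b \<partial>\<mu>)"
      using nn unfolding inner using f0 g0 if_ ig by (simp add: nn_integral_eq_integral)
    then have e: "(\<integral>z. f z + b \<partial>\<mu>) = (\<integral>z. ?g z + b \<partial>\<mu>)"
      using f0 g0 by (subst (asm) ennreal_inj) (auto intro!: integral_nonneg_AE)
    have if2: "integrable \<mu> f"
      using fb f by (intro integrable_const_bound[where B = b]) (auto simp: measurable_cong_sets[OF s\<mu> refl])
    have ig2: "integrable \<mu> ?g" using Bochner_Integration.integrable_diff[OF ig, of "\<lambda>_. b"] by simp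
    have fg: "(\<integral>z. f z \<partial>\<mu>) = (\<integral>z. ?g z \<partial>\<mu>)" using e if2 ig2 by simp
    define G where "G z = ?g z - ?g x" for z
    have iG: "integrable \<mu> G"
      unfolding G_def[abs_def] by (rule Bochner_Integration.integrable_diff[OF ig2 integrable_const])
    have "(\<integral>z. ?g z - ?g x \<partial>\<mu>) = (\<integral>z. ?g z \<partial>\<mu>) - (\<integral>z. ?g x \<partial>\<mu>)"
      by (rule Bochner_Integration.integral_diff[OF ig2 integrable_const])
    then have G_int: "(\<integral>z. G z \<partial>\<mu>) = (\<integral>z. f z \<partial>\<mu>) - ?g x"
      unfolding G_def fg using prob_space by simp
    have G_le: "\<bar>G z\<bar> \<le> L * rate * D * exp (- \<alpha> * t)" for z unfolding G_def by (rule gb)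
    have G_abs: "\<bar>\<integral>z. G z \<partial>\<mu>\<bar> \<le> (\<integral>z. \<bar>G z\<bar> \<partial>\<mu>)" by (rule integral_abs_bound)
    have G_mono: "(\<integral>z. \<bar>G z\<bar> \<partial>\<mu>) \<le> (\<integral>z. L * rate * D * exp (- \<alpha> * t) \<partial>\<mu>)"
      by (rule integral_mono[OF integrable_abs[OF iG] integrable_const G_le])
    have "(\<integral>z. L * rate * D * exp (- \<alpha> * t) \<partial>\<mu>) = L * rate * D * exp (- \<alpha> * t)"
      using prob_space by simp
    with G_abs G_mono show ?thesis unfolding G_int by linarith
  qed
  have a: "0 < \<alpha>"
    using t0_facts(2)[OF xy] beta_range by (simp add: const_alpha_def)
  have bound: "\<bar>(\<integral>z. f z \<partial>\<mu>) - (\<integral>z. f z \<partial>\<nu>)\<bar> \<le> 2 * (L * rate * D) * exp (- \<alpha> * real n)" for n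
    using near[OF \<mu> time_real, of n] near[OF \<nu> time_real, of n] by linarith
  have "(\<lambda>n. 2 * (L * rate * D) * exp (- \<alpha>) ^ n) \<longlonglongrightarrow> 2 * (L * rate * D) * 0"
    using a by (intro tendsto_mult_left LIMSEQ_power_zero) simp
  then have "(\<lambda>n. 2 * (L * rate * D) * exp (- \<alpha> * real n)) \<longlonglongrightarrow> 0"
    by (simp add: exp_of_nat_mult[symmetric] mult.commute)
  then have "\<bar>(\<integral>z. f z \<partial>\<mu>) - (\<integral>z. f z \<partial>\<nu>)\<bar> \<le> 0"
  proof (rule LIMSEQ_le_const)
    show "\<exists>N. \<forall>n\<ge>N. \<bar>(\<integral>z. f z \<partial>\<mu>) - (\<integral>z. f z \<partial>\<nu>)\<bar> \<le> 2 * (L * rate * D) * exp (- \<alpha> * real n)"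
      by (intro exI allI impI) (rule bound)
  qed
  then show ?thesis by (simp only: abs_le_zero_iff right_minus_eq)
qed

lemma invariant_unique:
  assumes \<mu>: "invariant_distribution I X Q \<mu>" and \<nu>: "invariant_distribution I X Q \<nu>" shows "\<mu> = \<nu>"
proof -
  have p\<mu>: "prob_space \<mu>" "sets \<mu> = sets borel" and p\<nu>: "prob_space \<nu>" "sets \<nu> = sets borel"
    using \<mu> \<nu> by (auto simp: invariant_distribution_def prob_on_borel_def)
  interpret m: prob_space \<mu> by fact
  interpret n: prob_space \<nu> by fact
  have sp: "space \<mu> = UNIV" "space \<nu> = UNIV"
    using sets_eq_imp_space_eq[OF p\<mu>(2)] sets_eq_imp_space_eq[OF p\<nu>(2)] by auto
  show ?thesis
  proof (rule measure_eqI_generator_eq[where E = "Collect closed" and \<Omega> = UNIV and A = "\<lambda>_. UNIV"])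
    show "Int_stable (Collect closed :: 'e set set)" by (auto simp: Int_stable_def)
    show "sets \<mu> = sigma_sets UNIV (Collect closed)" "sets \<nu> = sigma_sets UNIV (Collect closed)"
      using p\<mu>(2) p\<nu>(2) by (simp_all add: borel_eq_closed)
    fix C :: "'e set" assume "C \<in> Collect closed"
    then have C: "closed C" by simp
    show "emeasure \<mu> C = emeasure \<nu> C"
    proof (cases "C = {} \<or> C = UNIV")
      case True
      then show ?thesis using m.emeasure_space_1 n.emeasure_space_1 sp by auto
    next
      case False
      then obtain x y where xy: "x \<in> C" "y \<notin> C" by auto
      then have ne: "x \<noteq> y" by auto
      (* Lipschitz approximations from above of the indicator of a closed set, which determine the measure. *)
      define f where "f k z = max 0 (1 - real k * infdist z C)" for k z
      have f_cont: "continuous_on UNIV (f k)" for k unfolding f_def by (intro continuous_intros)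
      then have fm: "f k \<in> borel_measurable borel" for k by (rule borel_measurable_continuous_onI)
      have f_le: "\<bar>f k z\<bar> \<le> 1" for k z using infdist_nonneg[of z C] by (simp add: f_def)
      have f_lip: "\<bar>f k u - f k v\<bar> \<le> real k * dist u v" for k u v
      proof -
        have "\<bar>f k u - f k v\<bar> \<le> \<bar>real k * infdist u C - real k * infdist v C\<bar>"
          unfolding f_def by linarith
        also have "\<dots> = real k * \<bar>infdist u C - infdist v C\<bar>" by (simp add: right_diff_distrib[symmetric] abs_mult)
        also have "\<dots> \<le> real k * dist u v"
          using infdist_triangle[of u C v] infdist_triangle[of v C u] by (intro mult_left_mono) (auto simp: dist_commute abs_le_iff)
        finally show ?thesis .
      qed
      have f_lim: "(\<lambda>k. f k z) \<longlonglongrightarrow> indicator C z" for z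
      proof (cases "z \<in> C")
        case True
        then show ?thesis by (simp add: f_def)
      next
        case False
        then have p: "0 < infdist z C"
          using in_closed_iff_infdist_zero[OF C, of z] xy(1) infdist_nonneg[of z C]
          by (cases "infdist z C = 0") auto
        obtain k0 :: nat where k0: "1 < real k0 * infdist z C" using reals_Archimedean3[OF p] by auto
        have "f k z = 0" if "k0 \<le> k" for k
        proof -
          have "real k0 * infdist z C \<le> real k * infdist z C" using that p by (intro mult_right_mono) auto
          then show ?thesis using k0 by (simp add: f_def)
        qed
        then have "eventually (\<lambda>k. f k z = 0) sequentially" by (auto simp: eventually_sequentially)
        then show ?thesis using False by (simp add: tendsto_eventually)
      qed
      have CB: "C \<in> sets borel" using C by simp
      have lim: "(\<lambda>k. \<integral>z. f k z \<partial>N) \<longlonglongrightarrow> measure N C" if N: "prob_space N" "sets N = sets borel" for N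
      proof -
        interpret N: prob_space N by fact
        have "(\<lambda>k. \<integral>z. f k z \<partial>N) \<longlonglongrightarrow> (\<integral>z. indicator C z \<partial>N)"
          by (rule integral_dominated_convergence[where w = "\<lambda>_. 1"])
            (use f_lim f_le fm CB in \<open>auto simp: measurable_cong_sets[OF N(2) refl]\<close>)
        then show ?thesis using sets_eq_imp_space_eq[OF N(2)] by simp
      qed
      have eq: "(\<integral>z. f k z \<partial>\<mu>) = (\<integral>z. f k z \<partial>\<nu>)" for k
        by (rule invariant_lipschitz_eq[OF \<mu> \<nu> ne fm f_le f_lip of_nat_0_le_iff])
      have "measure \<mu> C = measure \<nu> C"
        by (rule LIMSEQ_unique[OF lim[OF p\<mu>, unfolded eq] lim[OF p\<nu>]])
      then show ?thesis by (simp only: m.emeasure_eq_measure n.emeasure_eq_measure)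
    qed
  qed (auto simp: m.emeasure_finite)
qed

lemma wasserstein_law_at:
  assumes t: "t \<in> I" and \<mu>: "prob_on_borel \<mu>" and \<nu>: "prob_on_borel \<nu>"
  shows "wasserstein (law_at X Q \<mu> t) (law_at X Q \<nu> t) \<le> rate * exp (- \<alpha> * t) * wasserstein \<mu> \<nu>"
proof -
  let ?c = "\<lambda>\<pi>. \<integral>z. dist (fst z) (snd z) \<partial>(\<pi> :: ('e \<times> 'e) measure)"
  let ?r = "rate * exp (- \<alpha> * t)"
  have r0: "0 \<le> ?r" by (rule mult_nonneg_nonneg[OF rate_nonneg exp_ge_zero])
  have c0: "0 \<le> ?c \<pi>" for \<pi> by (intro integral_nonneg_AE) simp
  have bdd: "bdd_below (?c ` S)" for S using c0 by (auto intro!: bdd_belowI[of _ 0])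
  have le: "wasserstein (law_at X Q \<mu> t) (law_at X Q \<nu> t) \<le> ?r * ?c \<pi>" if \<pi>: "\<pi> \<in> couplings \<mu> \<nu>" for \<pi>
  proof -
    obtain \<pi>' where \<pi>': "\<pi>' \<in> couplings (law_at X Q \<mu> t) (law_at X Q \<nu> t)" "?c \<pi>' \<le> ?r * ?c \<pi>"
      using wasserstein_contraction[OF t \<mu> \<nu> \<pi>] by blast
    have "wasserstein (law_at X Q \<mu> t) (law_at X Q \<nu> t) \<le> ?c \<pi>'"
      unfolding wasserstein_def by (rule cINF_lower[OF bdd \<pi>'(1)])
    with \<pi>'(2) show ?thesis by linarith
  qed
  have ne: "couplings \<mu> \<nu> \<noteq> {}"
  proof -
    interpret m: prob_space \<mu> using \<mu> by (simp add: prob_on_borel_def)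
    interpret n: prob_space \<nu> using \<nu> by (simp add: prob_on_borel_def)
    interpret pair_prob_space \<mu> \<nu> ..
    have s: "sets \<mu> = sets borel" "sets \<nu> = sets borel" using \<mu> \<nu> by (auto simp: prob_on_borel_def)
    have e: "distr (\<mu> \<Otimes>\<^sub>M \<nu>) borel fst = distr (\<mu> \<Otimes>\<^sub>M \<nu>) \<mu> fst" "distr (\<mu> \<Otimes>\<^sub>M \<nu>) borel snd = distr (\<mu> \<Otimes>\<^sub>M \<nu>) \<nu> snd"
      using s by (auto intro!: distr_cong)
    have m1: "distr (\<mu> \<Otimes>\<^sub>M \<nu>) \<mu> fst = \<mu>" by (rule n.distr_pair_fst)
    have m2: "distr (\<mu> \<Otimes>\<^sub>M \<nu>) \<nu> snd = \<nu>"
    proof (rule measure_eqI)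
      fix B assume "B \<in> sets (distr (\<mu> \<Otimes>\<^sub>M \<nu>) \<nu> snd)"
      then have B: "B \<in> sets \<nu>" by simp
      have "snd -` B \<inter> space (\<mu> \<Otimes>\<^sub>M \<nu>) = space \<mu> \<times> B"
        using sets.sets_into_space[OF B] by (auto simp: space_pair_measure)
      then show "emeasure (distr (\<mu> \<Otimes>\<^sub>M \<nu>) \<nu> snd) B = emeasure \<nu> B"
        using B by (simp add: emeasure_distr n.emeasure_pair_measure_Times m.emeasure_space_1)
    qed simp
    have "\<mu> \<Otimes>\<^sub>M \<nu> \<in> couplings \<mu> \<nu>"
      unfolding couplings_def
      by (intro CollectI conjI sets_pair_measure_cong s trans[OF e(1) m1] trans[OF e(2) m2])
    then show ?thesis by (rule ex_in_conv[THEN iffD1, OF exI])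
  qed
  show ?thesis
  proof (cases "?r = 0")
    case True
    obtain \<pi> where "\<pi> \<in> couplings \<mu> \<nu>" using ne by auto
    from le[OF this] show ?thesis unfolding True by simp
  next
    case False
    then have r: "0 < ?r" using r0 by linarith
    have "wasserstein (law_at X Q \<mu> t) (law_at X Q \<nu> t) / ?r \<le> wasserstein \<mu> \<nu>"
      unfolding wasserstein_def[of \<mu> \<nu>]
    proof (rule cINF_greatest[OF ne])
      fix \<pi> assume "\<pi> \<in> couplings \<mu> \<nu>"
      from le[OF this] show "wasserstein (law_at X Q \<mu> t) (law_at X Q \<nu> t) / ?r \<le> ?c \<pi>"
        unfolding pos_divide_le_eq[OF r] by (simp only: mult.commute)
    qed
    then show ?thesis unfolding pos_divide_le_eq[OF r] by (simp only: mult.commute)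
  qed
qed

end

section \<open>The Q-process\<close>

context penalized_coupling_qsd
begin

lemma Q_process_summary:
  "\<exists>Q :: 'e \<Rightarrow> 'w measure.
     (\<forall>x. prob_space (Q x) \<and> sets (Q x) = sets (filtration_sup I \<Omega> F)) \<and>
     (\<exists>C. \<forall>x. \<forall>s\<in>I. \<forall>t\<in>I. s \<le> t \<longrightarrow> (\<forall>A\<in>sets (F s).
        \<bar>(\<integral>\<omega>. indicator A \<omega> * penal I \<rho> X t \<omega> \<partial>P x) / penal_mean I \<rho> X P t x - measure (Q x) A\<bar> \<le> C * exp (- \<alpha> * (t - s)))) \<and>
     markov_process I \<Omega> F X Q \<and>
     (strong_markov_process I \<Omega> F X P \<longrightarrow> strong_markov_process I \<Omega> F X Q) \<and>
     (\<forall>\<phi> x. \<forall>t\<in>I. bounded_measurable \<phi> \<longrightarrow>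
        (\<integral>\<omega>. \<phi> (X t \<omega>) \<partial>Q x) =
        exp (l0 * t) / \<eta> x * penal_semigroup I \<rho> X P t (\<lambda>y. \<eta> y * \<phi> y) x) \<and>
     invariant_distribution I X Q (density \<nu>QS (\<lambda>x. ennreal (\<eta> x))) \<and>
     (\<forall>\<mu>. invariant_distribution I X Q \<mu> \<longrightarrow> \<mu> = density \<nu>QS (\<lambda>x. ennreal (\<eta> x))) \<and>
     (\<forall>\<mu> \<nu>. \<forall>t\<in>I. prob_on_borel \<mu> \<longrightarrow> prob_on_borel \<nu> \<longrightarrow>
        wasserstein (law_at X Q \<mu> t) (law_at X Q \<nu> t)
          \<le> C0 * max 1 (\<kappa> * D) / \<beta> * exp (- \<alpha> * t) * wasserstein \<mu> \<nu>)"
proof (intro exI[of _ Q] conjI)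
  show "\<forall>x. prob_space (Q x) \<and> sets (Q x) = sets (filtration_sup I \<Omega> F)" by (simp add: sets_Q)
  show "\<exists>C. \<forall>x. \<forall>s\<in>I. \<forall>t\<in>I. s \<le> t \<longrightarrow> (\<forall>A\<in>sets (F s).
        \<bar>(\<integral>\<omega>. indicator A \<omega> * penal I \<rho> X t \<omega> \<partial>P x) / penal_mean I \<rho> X P t x - measure (Q x) A\<bar> \<le> C * exp (- \<alpha> * (t - s)))"
    by (intro exI[of _ "ratio ^ 2 * (CB * ratio * rate * D)"] allI ballI impI conditioned_law_convergence)
  show "markov_process I \<Omega> F X Q" by (rule Q_markov)
  show "strong_markov_process I \<Omega> F X P \<longrightarrow> strong_markov_process I \<Omega> F X Q"
    by (intro impI Q_strong_markov)
  show "\<forall>\<phi> x. \<forall>t\<in>I. bounded_measurable \<phi> \<longrightarrow> (\<integral>\<omega>. \<phi> (X t \<omega>) \<partial>Q x) =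
        exp (l0 * t) / \<eta> x * penal_semigroup I \<rho> X P t (\<lambda>y. \<eta> y * \<phi> y) x"
    by (intro allI ballI impI Q_semigroup)
  show "invariant_distribution I X Q (density \<nu>QS (\<lambda>x. ennreal (\<eta> x)))"
    unfolding \<nu>Q_def[symmetric] by (rule nuQ_invariant)
  show "\<forall>\<mu>. invariant_distribution I X Q \<mu> \<longrightarrow> \<mu> = density \<nu>QS (\<lambda>x. ennreal (\<eta> x))"
    unfolding \<nu>Q_def[symmetric] by (intro allI impI invariant_unique nuQ_invariant)
  show "\<forall>\<mu> \<nu>. \<forall>t\<in>I. prob_on_borel \<mu> \<longrightarrow> prob_on_borel \<nu> \<longrightarrow>
        wasserstein (law_at X Q \<mu> t) (law_at X Q \<nu> t) \<le> C0 * max 1 (\<kappa> * D) / \<beta> * exp (- \<alpha> * t) * wasserstein \<mu> \<nu>"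
    by (intro allI ballI impI wasserstein_law_at)
qed

end

theorem theorem2p4:
  fixes I :: "real set"
    and \<Omega> :: "'w set" and F :: "real \<Rightarrow> 'w measure"
    and X :: "real \<Rightarrow> 'w \<Rightarrow> 'e::polish_space" and P :: "'e \<Rightarrow> 'w measure"
    and \<rho> :: "'e \<Rightarrow> real" and D :: real
    and \<Omega>' :: "'v set" and X' Y' :: "real \<Rightarrow> 'v \<Rightarrow> 'e" and PP :: "'e \<times> 'e \<Rightarrow> 'v measure"
    and CA gA CB CC :: real
    and \<nu>QS :: "'e measure" and l0 :: real and \<eta> :: "'e \<Rightarrow> real"
  defines "Z \<equiv> penal I \<rho> X" and "ZX \<equiv> penal I \<rho> X'" and "ZY \<equiv> penal I \<rho> Y'"
    and "EZ \<equiv> penal_mean I \<rho> X P"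
    and "\<alpha> \<equiv> const_alpha I D CA gA CB CC"
    and "\<beta> \<equiv> const_beta CC" and "\<kappa> \<equiv> const_kappa CB CC" and "C0 \<equiv> const_C0 D CA CB CC"
    and "\<nu>Q \<equiv> density \<nu>QS (\<lambda>x. ennreal (\<eta> x))"
  assumes time: "I = {0..} \<or> I = \<nat>"
    and bounded_dist: "\<forall>x y :: 'e. dist x y \<le> D"
    and rho_nonneg: "\<forall>x. 0 \<le> \<rho> x"
    and rho_lipschitz: "\<exists>L. L-lipschitz_on UNIV \<rho>"
    and markov: "markov_process I \<Omega> F X P"
    and proj_limits: "projective_limits_exist I \<Omega> F"
    and Z_well_defined: "progressively_measurable I F (\<lambda>t \<omega>. \<rho> (X t \<omega>))"
    and coupling: "markovian_coupling I X P \<Omega>' X' Y' PP"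
    and ZX_well_defined:
      "progressively_measurable I (natural_filtration I \<Omega>' (\<lambda>t \<omega>. (X' t \<omega>, Y' t \<omega>)))
         (\<lambda>t \<omega>. \<rho> (X' t \<omega>))"
    and ZY_well_defined:
      "progressively_measurable I (natural_filtration I \<Omega>' (\<lambda>t \<omega>. (X' t \<omega>, Y' t \<omega>)))
         (\<lambda>t \<omega>. \<rho> (Y' t \<omega>))"
    and CA: "CA > 0" and gA: "gA > 0"
    and condition_A:
      "\<forall>x y. \<forall>t\<in>I. (\<integral>\<omega>. ZX t \<omega> / EZ t x * dist (X' t \<omega>) (Y' t \<omega>) \<partial>PP (x, y))
                    \<le> CA * exp (- gA * t) * dist x y"
    and CB: "CB > 0"
    and CB_bound:
      "\<forall>x y. \<forall>t\<in>I. (\<integral>\<omega>. \<bar>ZX t \<omega> - ZY t \<omega>\<bar> \<partial>PP (x, y)) \<le> CB * dist x y * EZ t x"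
    and CC: "CC > 1"
    and CC_bound:
      "\<forall>x y. \<forall>t\<in>I. (\<integral>\<omega>. min (ZX t \<omega> / EZ t x) (ZY t \<omega> / EZ t y) \<partial>PP (x, y)) \<ge> 1 / CC"
    and nuQS: "quasi_stationary I \<rho> X P \<nu>QS"
    and lambda0: "absorption_rate I \<rho> X P \<nu>QS l0"
    and eta: "\<forall>x. ((\<lambda>t. exp (l0 * t) * EZ t x) \<longlongrightarrow> \<eta> x) (inf at_top (principal I))"
  shows "\<exists>Q :: 'e \<Rightarrow> 'w measure.
     (\<forall>x. prob_space (Q x) \<and> sets (Q x) = sets (filtration_sup I \<Omega> F)) \<and>
     (\<exists>C. \<forall>x. \<forall>s\<in>I. \<forall>t\<in>I. s \<le> t \<longrightarrow> (\<forall>A\<in>sets (F s).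
        \<bar>(\<integral>\<omega>. indicator A \<omega> * Z t \<omega> \<partial>P x) / EZ t x - measure (Q x) A\<bar> \<le> C * exp (- \<alpha> * (t - s)))) \<and>
     markov_process I \<Omega> F X Q \<and>
     (strong_markov_process I \<Omega> F X P \<longrightarrow> strong_markov_process I \<Omega> F X Q) \<and>
     (\<forall>\<phi> x. \<forall>t\<in>I. bounded_measurable \<phi> \<longrightarrow>
        (\<integral>\<omega>. \<phi> (X t \<omega>) \<partial>Q x) =
        exp (l0 * t) / \<eta> x * penal_semigroup I \<rho> X P t (\<lambda>y. \<eta> y * \<phi> y) x) \<and>
     invariant_distribution I X Q \<nu>Q \<and>
     (\<forall>\<mu>. invariant_distribution I X Q \<mu> \<longrightarrow> \<mu> = \<nu>Q) \<and>
     (\<forall>\<mu> \<nu>. \<forall>t\<in>I. prob_on_borel \<mu> \<longrightarrow> prob_on_borel \<nu> \<longrightarrow>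
        wasserstein (law_at X Q \<mu> t) (law_at X Q \<nu> t)
          \<le> C0 * max 1 (\<kappa> * D) / \<beta> * exp (- \<alpha> * t) * wasserstein \<mu> \<nu>)"
proof -
  obtain L where L: "L-lipschitz_on UNIV \<rho>" using rho_lipschitz by blast
  have rho_measurable: "\<rho> \<in> borel_measurable borel"
    by (rule borel_measurable_continuous_onI[OF lipschitz_on_continuous_on[OF L]])
  define K where "K = \<rho> undefined + L * D"
  have rho_le: "\<rho> x \<le> K" for x
  proof -
    have "\<rho> x - \<rho> undefined \<le> dist (\<rho> x) (\<rho> undefined)" by (simp add: dist_real_def)
    also have "\<dots> \<le> L * dist x undefined" by (rule lipschitz_onD[OF L]) auto
    also have "\<dots> \<le> L * D" using bounded_dist lipschitz_on_nonneg[OF L] by (intro mult_left_mono) auto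
    finally show ?thesis by (simp add: K_def)
  qed
  have rho_nonneg': "0 \<le> \<rho> x" for x using rho_nonneg by blast
  have dist_bound: "dist x y \<le> D" for x y :: 'e using bounded_dist by blast
  have A: "(\<integral>\<omega>. penal I \<rho> X' t \<omega> / penal_mean I \<rho> X P t x * dist (X' t \<omega>) (Y' t \<omega>) \<partial>PP (x, y)) \<le> CA * exp (- gA * t) * dist x y"
    if "t \<in> I" for x y t using condition_A that unfolding ZX_def EZ_def by blast
  have B: "(\<integral>\<omega>. \<bar>penal I \<rho> X' t \<omega> - penal I \<rho> Y' t \<omega>\<bar> \<partial>PP (x, y)) \<le> CB * dist x y * penal_mean I \<rho> X P t x"
    if "t \<in> I" for x y t using CB_bound that unfolding ZX_def ZY_def EZ_def by blast
  have C: "1 / CC \<le> (\<integral>\<omega>. min (penal I \<rho> X' t \<omega> / penal_mean I \<rho> X P t x) (penal I \<rho> Y' t \<omega> / penal_mean I \<rho> X P t y) \<partial>PP (x, y))"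
    if "t \<in> I" for x y t using CC_bound that unfolding ZX_def ZY_def EZ_def by blast
  have nu_prob: "prob_on_borel \<nu>QS" using nuQS by (simp add: quasi_stationary_def)
  have eta': "((\<lambda>t. exp (l0 * t) * penal_mean I \<rho> X P t x) \<longlongrightarrow> \<eta> x) (inf at_top (principal I))" for x
    using eta unfolding EZ_def by blast
  have "penalized_coupling_qsd I \<rho> K \<Omega> F X P D CA gA CB CC \<Omega>' X' Y' PP \<nu>QS l0 \<eta>"
    by (unfold_locales; fact)
  from penalized_coupling_qsd.Q_process_summary[OF this] show ?thesis
    unfolding Z_def EZ_def \<alpha>_def \<beta>_def \<kappa>_def C0_def \<nu>Q_def .
qed

end
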